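(* Let $(\varphi,g)$ be a $G_2$-structure on a $7$-manifold with full torsion tensor $T_{ab}$ with components $\tau_1,\tau_7,\tau_{14},\tau_{27}$. Let $v$ be a vector field, $M=|v|_g^2$, and let $v_1,v_7,v_{14},v_{27}$ be the components of $\nabla v$. Then the deformation $\varphi_{bcd}\to\tilde\varphi_{bcd}=\varphi_{bcd}+v_e\psi_{bcd}{}^e$, which lies in $\Lambda^3_7$, results in a new $G_2$-structure $\tilde\varphi$ with torsion tensor $\tilde T_{an}$ given by $$\begin{aligned}\tilde T_{an}=\;&(1+M)^{-\frac43}\Big(v_1\big(v_av_n-(1+M)g_{an}\big)-\tfrac43(1+M)v_1\varphi_{anm}v^m-\big(1+\tfrac43M\big)\varphi_{anm}v_7^m\\&-\tfrac13\psi_{anmp}v^mv_7^p+\tfrac53v_a\varphi_{nmp}v^mv_7^p+\tfrac43v_n\varphi_{amp}v^mv_7^p+\tfrac13v_7^mv_m\varphi^p{}_{an}v_p\\&+\tfrac13v_n(v_7)_a+\tfrac83v_a(v_7)_n-(1+M)(v_{14})_{an}-2v_m(v_{14})^m{}_{[a}v_{n]}+\tfrac13\varphi_{anm}v_{14}^{mp}v_p\\&+\tfrac13\psi_{anmp}v_qv^mv_{14}^{pq}-(1+M)(v_{27})_{an}+v_m(v_{27})^m{}_av_n-(1+M)\varphi^{mp}{}_a(v_{27})_{pn}v_m\\&-\tfrac13\varphi_{anm}v_{27}^{mp}v_p+\tfrac13\psi_{anmp}v^mv_{27}^{pq}v_q+v_a\varphi_{nmp}v^mv_{27}^{pq}v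_q-\tfrac13\varphi_{an}{}^mv_mv_{27}^{pq}v_pv_q\Big)\\&+(1+M)^{-\frac13}\Big(\tau_1g_{an}+\tau_1\varphi^m{}_{an}v_m+\varphi_{anm}\tau_7^m+v_a(\tau_7)_n-g_{an}\tau_7^mv_m+\psi_{anmp}\tau_7^mv^p\\&+(\tau_{14})_{an}-\varphi_{nmp}v^m(\tau_{14})^p{}_a+(\tau_{27})_{an}+\varphi_{nmp}v^m(\tau_{27})^p{}_a\Big).\end{aligned}$$
   Context: A $3$-form on a $7$-manifold is positive if at each point it lies in the $GL(7,\mathbb R)$-orbit of $\varphi_0=e^{123}+e^{145}+e^{167}+e^{246}-e^{257}-e^{347}-e^{356}$. A positive $3$-form $\varphi$ determines a Riemannian metric $g$ and volume form by $g(u,w)\,\mathrm{vol}=\frac16(u\lrcorner\varphi)\wedge(w\lrcorner\varphi)\wedge\varphi$; the pair $(\varphi,g)$ is a $G_2$-structure. $\psi=*\varphi$; with these conventions $\varphi_{abc}\varphi_{mn}{}^{c}=g_{am}g_{bn}-g_{an}g_{bm}+\psi_{abmn}$. $\nabla$ is the Levi-Civita connection of $g$. The full torsion tensor $T_{ab}$ is defined by $\nabla_a\varphi_{bcd}=T_a{}^e\psi_{ebcd}$. It decomposes as $T_{ab}=\tau_1g_{ab}+\tau_7^c\varphi_{cab}+(\tau_{14})_{ab}+(\tau_{27})_{ab}$ with $\tau_1$ a function, $\tau_7$ a $1$-form, $\tau_{14}\in\Lambda^2_{14}=\{\omega\in\Lambda^2:\omega^{ab}\varphi_{abc}=0\}$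 and $\tau_{27}$ a traceless symmetric tensor. In the same way $\nabla_av_b=v_1g_{ab}+v_7^c\varphi_{cab}+(v_{14})_{ab}+(v_{27})_{ab}$ with $v_1$ a function, $v_7$ a vector field, $v_{14}\in\Lambda^2_{14}$, $v_{27}$ traceless symmetric. $\Lambda^3_7=\{\alpha\lrcorner\psi\}$ for $1$-forms $\alpha$. For any $v$ the form $\tilde\varphi$ is positive and defines a $G_2$-structure $(\tilde\varphi,\tilde g)$; its torsion $\tilde T_{ab}$ is defined by $\tilde\nabla_a\tilde\varphi_{bcd}=\tilde T_{an}\tilde g^{ne}\tilde\psi_{ebcd}$ with $\tilde\psi=\tilde*\tilde\varphi$ and $\tilde\nabla$ the Levi-Civita connection of $\tilde g$. All indices in the formula are raised and lowered with $g$; square brackets denote antisymmetrization with unit weight.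
   Formalization: Two terms of the printed formula for T̃_an are false and are corrected: +(1/3)φ_{anm}v14^{mp}v_p becomes −(1/3)φ_{anm}v14^{mp}v_p, and −(1+M)φ^{mp}_a(v27)_{pn}v_m becomes −(1+M)φ^{mp}_n(v27)_{pa}v_m. *)

theory Defs
  imports "HOL-Analysis.Analysis"
begin

section \<open>Smooth functions and smooth manifolds\<close>

definition partial_deriv :: "'n \<Rightarrow> (real^'n \<Rightarrow> real) \<Rightarrow> real^'n \<Rightarrow> real"
  where "partial_deriv i f x = frechet_derivative f (at x) (axis i 1)"

primrec Ck_on :: "nat \<Rightarrow> (real^'n) set \<Rightarrow> (real^'n \<Rightarrow> real) \<Rightarrow> bool" where
  "Ck_on 0 S f \<longleftrightarrow> continuous_on S f"
| "Ck_on (Suc k) S f \<longleftrightarrow>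
     (\<forall>x\<in>S. f differentiable (at x)) \<and> (\<forall>i. Ck_on k S (partial_deriv i f))"

text \<open>Only used for open sets.\<close>
definition smooth_on :: "(real^'n) set \<Rightarrow> (real^'n \<Rightarrow> real) \<Rightarrow> bool"
  where "smooth_on S f \<longleftrightarrow> (\<forall>k. Ck_on k S f)"

text \<open>A chart is a pair of its domain and its coordinate map; only the values of the
  coordinate map on the domain matter.\<close>
type_synonym ('a, 'n) chart = "'a set \<times> ('a \<Rightarrow> real^'n)"

definition chart_inv :: "('a, 'n::finite) chart \<Rightarrow> real^'n \<Rightarrow> 'a"
  where "chart_inv c = inv_into (fst c) (snd c)"

definition smooth_manifold :: "'a topology \<Rightarrow> ('a, 'n::finite) chart set \<Rightarrow> bool"
  where "smooth_manifold X \<A> \<longleftrightarrow>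
     Hausdorff_space X \<and> second_countable X \<and> (\<Union>c\<in>\<A>. fst c) = topspace X \<and>
     (\<forall>c\<in>\<A>. openin X (fst c) \<and> open (snd c ` fst c) \<and>
        homeomorphic_map (subtopology X (fst c)) (top_of_set (snd c ` fst c)) (snd c)) \<and>
     (\<forall>c\<in>\<A>. \<forall>d\<in>\<A>. \<forall>i.
        smooth_on (snd c ` (fst c \<inter> fst d)) (\<lambda>x. snd d (chart_inv c x) $ i))"

definition coord_deriv :: "('a, 'n::finite) chart \<Rightarrow> 'n \<Rightarrow> ('a \<Rightarrow> real) \<Rightarrow> 'a \<Rightarrow> real"
  where "coord_deriv c i f p = partial_deriv i (\<lambda>x. f (chart_inv c x)) (snd c p)"

text \<open>The Jacobian of the transition from \<open>c\<close> to \<open>d\<close>; row index: coordinate of \<open>d\<close>.\<close>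
definition jacobian :: "('a, 'n::finite) chart \<Rightarrow> ('a, 'n) chart \<Rightarrow> 'a \<Rightarrow> real^'n^'n"
  where "jacobian c d p = (\<chi> i j. coord_deriv c j (\<lambda>q. snd d q $ i) p)"


section \<open>Tensors in components\<close>

text \<open>A covariant \<open>k\<close>-tensor is given by its components: \<open>T [a\<^sub>1, \<dots>, a\<^sub>k]\<close> is
  \<open>T\<close> evaluated on the basis vectors with these indices.  Values at index lists of length other
  than \<open>k\<close> carry no meaning.\<close>
type_synonym 'n tensor = "'n list \<Rightarrow> real"

definition pullback :: "real^'n^'n \<Rightarrow> 'n::finite tensor \<Rightarrow> 'n tensor"
  where "pullback P T I =
     (\<Sum>J | length J = length I. (\<Prod>m<length I. P $ (J ! m) $ (I ! m)) * T J)"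

definition alternating :: "nat \<Rightarrow> 'n tensor \<Rightarrow> bool"
  where "alternating k \<omega> \<longleftrightarrow>
     (\<forall>I \<sigma>. length I = k \<longrightarrow> \<sigma> permutes {..<k} \<longrightarrow>
        \<omega> (map (\<lambda>m. I ! \<sigma> m) [0..<k]) = of_int (sign \<sigma>) * \<omega> I)"

text \<open>The form \<open>e\<^bsup>j\<^sub>1\<dots>j\<^sub>k\<^esup>\<close>, normalised by \<open>e\<^bsup>j\<^sub>1\<dots>j\<^sub>k\<^esup>(e\<^bsub>j\<^sub>1\<^esub>, \<dots>, e\<^bsub>j\<^sub>k\<^esub>) = 1\<close>.\<close>
definition basis_form :: "'n list \<Rightarrow> 'n tensor"
  where "basis_form J I =
     (\<Sum>\<sigma> | \<sigma> permutes {..<length J}.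
        if I = map (\<lambda>m. J ! \<sigma> m) [0..<length J] then of_int (sign \<sigma>) else 0)"

text \<open>The wedge product of a \<open>k\<close>-form and an \<open>l\<close>-form.\<close>
definition wedge :: "nat \<Rightarrow> nat \<Rightarrow> 'n tensor \<Rightarrow> 'n tensor \<Rightarrow> 'n tensor"
  where "wedge k l \<alpha> \<beta> I =
     (\<Sum>\<sigma> | \<sigma> permutes {..<k + l}.
        of_int (sign \<sigma>) * \<alpha> (map (\<lambda>m. I ! \<sigma> m) [0..<k]) * \<beta> (map (\<lambda>m. I ! \<sigma> m) [k..<k + l]))
     / (fact k * fact l)"

definition interior_prod :: "real^'n \<Rightarrow> 'n::finite tensor \<Rightarrow> 'n tensor"
  where "interior_prod u \<omega> I = (\<Sum>i\<in>UNIV. u $ i * \<omega> (i # I))"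

text \<open>Raising the index in position \<open>m\<close> (counted from 0) with the metric \<open>g\<close>.\<close>
definition raise :: "real^'n^'n \<Rightarrow> nat \<Rightarrow> 'n::finite tensor \<Rightarrow> 'n tensor"
  where "raise g m T I = (\<Sum>j\<in>UNIV. matrix_inv g $ (I ! m) $ j * T (I[m := j]))"

definition flat :: "real^'n^'n \<Rightarrow> real^'n \<Rightarrow> 'n::finite tensor"
  where "flat g u I = (g *v u) $ (hd I)"

definition sharp :: "real^'n^'n \<Rightarrow> 'n::finite tensor \<Rightarrow> real^'n"
  where "sharp g \<alpha> = (\<chi> i. raise g 0 \<alpha> [i])"

text \<open>The Hodge dual of a \<open>k\<close>-form, for the metric \<open>g\<close> and volume form \<open>vol\<close>:
  \<open>(*\<alpha>)\<^bsub>b\<^sub>1\<dots>\<^esub> = (1/k!) \<alpha>\<^bsup>a\<^sub>1\<dots>a\<^sub>k\<^esup> vol\<^bsub>a\<^sub>1\<dots>a\<^sub>kb\<^sub>1\<dots>\<^esub>\<close>,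
  so that \<open>\<alpha> \<and> *\<beta> = \<langle>\<alpha>, \<beta>\<rangle> vol\<close>.\<close>
definition hodge :: "real^'n^'n \<Rightarrow> 'n::finite tensor \<Rightarrow> nat \<Rightarrow> 'n tensor \<Rightarrow> 'n tensor"
  where "hodge g vol k \<alpha> I =
     (\<Sum>J | length J = k. fold (raise g) [0..<k] \<alpha> J * vol (J @ I)) / fact k"


section \<open>Tensor fields and the Levi-Civita connection\<close>

text \<open>A covariant tensor field assigns to every chart of the atlas and every point of the
  domain of that chart the components with respect to the coordinate frame.\<close>
type_synonym ('a, 'n) tensor_field = "('a, 'n) chart \<Rightarrow> 'a \<Rightarrow> 'n tensor"

type_synonym ('a, 'n) vector_field = "('a, 'n) chart \<Rightarrow> 'a \<Rightarrow> real^'n"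

definition smooth_tensor_field ::
    "('a, 'n::finite) chart set \<Rightarrow> nat \<Rightarrow> ('a, 'n) tensor_field \<Rightarrow> bool"
  where "smooth_tensor_field \<A> k T \<longleftrightarrow>
     (\<forall>c\<in>\<A>. \<forall>I. length I = k \<longrightarrow> smooth_on (snd c ` fst c) (\<lambda>x. T c (chart_inv c x) I)) \<and>
     (\<forall>c\<in>\<A>. \<forall>d\<in>\<A>. \<forall>p\<in>fst c \<inter> fst d. \<forall>I. length I = k \<longrightarrow>
        T c p I = pullback (jacobian c d p) (T d p) I)"

definition smooth_vector_field ::
    "('a, 'n::finite) chart set \<Rightarrow> ('a, 'n) vector_field \<Rightarrow> bool"
  where "smooth_vector_field \<A> v \<longleftrightarrow>
     (\<forall>c\<in>\<A>. \<forall>i. smooth_on (snd c ` fst c) (\<lambda>x. v c (chart_inv c x) $ i)) \<and>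
     (\<forall>c\<in>\<A>. \<forall>d\<in>\<A>. \<forall>p\<in>fst c \<inter> fst d. v d p = jacobian c d p *v v c p)"

text \<open>\<open>christoffel c g p k i j\<close> is \<open>\<Gamma>\<^bsup>k\<^esup>\<^bsub>ij\<^esub>\<close> at \<open>p\<close>; \<open>g\<close> is the matrix
  of the metric in the chart \<open>c\<close>.\<close>
definition christoffel ::
    "('a, 'n::finite) chart \<Rightarrow> ('a \<Rightarrow> real^'n^'n) \<Rightarrow> 'a \<Rightarrow> 'n \<Rightarrow> 'n \<Rightarrow> 'n \<Rightarrow> real"
  where "christoffel c g p k i j =
     (\<Sum>l\<in>UNIV. matrix_inv (g p) $ k $ l *
        (coord_deriv c i (\<lambda>q. g q $ j $ l) p + coord_deriv c j (\<lambda>q. g q $ i $ l) p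
         - coord_deriv c l (\<lambda>q. g q $ i $ j) p)) / 2"

text \<open>The covariant derivative in the chart \<open>c\<close>; the first index is the direction of
  differentiation, \<open>cov_deriv c g T p [a, b\<^sub>1, \<dots>, b\<^sub>k] = \<nabla>\<^sub>a T\<^bsub>b\<^sub>1\<dots>b\<^sub>k\<^esub>\<close>.\<close>
definition cov_deriv ::
    "('a, 'n::finite) chart \<Rightarrow> ('a \<Rightarrow> real^'n^'n) \<Rightarrow> ('a \<Rightarrow> 'n tensor) \<Rightarrow> 'a \<Rightarrow> 'n tensor"
  where "cov_deriv c g T p I =
     coord_deriv c (hd I) (\<lambda>q. T q (tl I)) p
     - (\<Sum>m<length (tl I). \<Sum>e\<in>UNIV.
          christoffel c g p e (hd I) (tl I ! m) * T p ((tl I)[m := e]))"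


section \<open>Positive 3-forms in dimension 7\<close>

text \<open>The indices \<open>1, \<dots>, 7\<close> are the elements of the type \<open>7\<close>, in which \<open>7 = 0\<close>.\<close>
definition phi0 :: "7 tensor"
  where "phi0 I =
     basis_form [1,2,3] I + basis_form [1,4,5] I + basis_form [1,6,7] I + basis_form [2,4,6] I
     - basis_form [2,5,7] I - basis_form [3,4,7] I - basis_form [3,5,6] I"

definition positive_form :: "7 tensor \<Rightarrow> bool"
  where "positive_form \<omega> \<longleftrightarrow>
     (\<exists>P. invertible P \<and> (\<forall>I. length I = 3 \<longrightarrow> \<omega> I = pullback P phi0 I))"

text \<open>The metric \<open>g\<close> has the volume form \<open>\<mu> e\<^bsup>1234567\<^esup>\<close>, and the two are related to \<open>\<omega>\<close> by
  \<open>g(u,w) vol = (1/6) (u \<lrcorner> \<omega>) \<and> (w \<lrcorner> \<omega>) \<and> \<omega>\<close>.\<close>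
definition metric_volume :: "7 tensor \<Rightarrow> real^7^7 \<Rightarrow> real \<Rightarrow> bool"
  where "metric_volume \<omega> g \<mu> \<longleftrightarrow>
     transpose g = g \<and> (\<forall>u. u \<noteq> 0 \<longrightarrow> u \<bullet> (g *v u) > 0) \<and> \<mu>\<^sup>2 = det g \<and>
     (\<forall>u w. (u \<bullet> (g *v w)) * \<mu> =
        wedge 4 3 (wedge 2 2 (interior_prod u \<omega>) (interior_prod w \<omega>)) \<omega> [1,2,3,4,5,6,7] / 6)"

definition g2_metric :: "7 tensor \<Rightarrow> real^7^7"
  where "g2_metric \<omega> = (THE g. \<exists>\<mu>. metric_volume \<omega> g \<mu>)"

definition g2_vol :: "7 tensor \<Rightarrow> 7 tensor"
  where "g2_vol \<omega> I = (THE \<mu>. \<exists>g. metric_volume \<omega> g \<mu>) * basis_form [1,2,3,4,5,6,7] I"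

definition g2_psi :: "7 tensor \<Rightarrow> 7 tensor"
  where "g2_psi \<omega> = hodge (g2_metric \<omega>) (g2_vol \<omega>) 3 \<omega>"

definition Lambda2_14 :: "7 tensor \<Rightarrow> 7 tensor set"
  where "Lambda2_14 \<omega> = {\<beta>. alternating 2 \<beta> \<and>
     (\<forall>c. (\<Sum>a\<in>UNIV. \<Sum>b\<in>UNIV.
        raise (g2_metric \<omega>) 0 (raise (g2_metric \<omega>) 1 \<beta>) [a, b] * \<omega> [a, b, c]) = 0)}"

definition Lambda3_7 :: "7 tensor \<Rightarrow> 7 tensor set"
  where "Lambda3_7 \<omega> = {\<beta>. \<exists>\<alpha>. \<forall>b c d.
     \<beta> [b, c, d] = interior_prod (sharp (g2_metric \<omega>) \<alpha>) (g2_psi \<omega>) [b, c, d]}"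

definition traceless_symmetric :: "7 tensor \<Rightarrow> 7 tensor set"
  where "traceless_symmetric \<omega> = {h. (\<forall>a b. h [a, b] = h [b, a]) \<and>
     (\<Sum>a\<in>UNIV. raise (g2_metric \<omega>) 0 h [a, a]) = 0}"

text \<open>\<open>S\<^bsub>ab\<^esub> = s\<^sub>1 g\<^bsub>ab\<^esub> + s\<^sub>7\<^sup>c \<omega>\<^bsub>cab\<^esub> + (s\<^bsub>14\<^esub>)\<^bsub>ab\<^esub> + (s\<^bsub>27\<^esub>)\<^bsub>ab\<^esub>\<close>;
  the components are determined by \<open>S\<close>.\<close>
definition g2_components ::
    "7 tensor \<Rightarrow> 7 tensor \<Rightarrow> real \<Rightarrow> real^7 \<Rightarrow> 7 tensor \<Rightarrow> 7 tensor \<Rightarrow> bool"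
  where "g2_components \<omega> S s1 s7 s14 s27 \<longleftrightarrow>
     s14 \<in> Lambda2_14 \<omega> \<and> s27 \<in> traceless_symmetric \<omega> \<and>
     (\<forall>a b. S [a, b] = s1 * g2_metric \<omega> $ a $ b + (\<Sum>c\<in>UNIV. s7 $ c * \<omega> [c, a, b])
        + s14 [a, b] + s27 [a, b])"


section \<open>$G_2$-structures, torsion, and the deformation\<close>

definition g2_structure :: "('a, 7) chart set \<Rightarrow> ('a, 7) tensor_field \<Rightarrow> bool"
  where "g2_structure \<A> \<phi> \<longleftrightarrow>
     smooth_tensor_field \<A> 3 \<phi> \<and>
     (\<forall>c\<in>\<A>. \<forall>p\<in>fst c. alternating 3 (\<phi> c p) \<and> positive_form (\<phi> c p))"

definition g2_nabla ::
    "('a, 7) tensor_field \<Rightarrow> ('a, 7) chart \<Rightarrow> ('a \<Rightarrow> 7 tensor) \<Rightarrow> 'a \<Rightarrow> 7 tensor"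
  where "g2_nabla \<phi> c = cov_deriv c (\<lambda>q. g2_metric (\<phi> c q))"

text \<open>\<open>\<nabla>\<^sub>a \<phi>\<^bsub>bcd\<^esub> = T\<^sub>a\<^sup>e \<psi>\<^bsub>ebcd\<^esub>\<close>, all operations being those of the \<open>G\<^sub>2\<close>-structure \<open>\<phi>\<close>.\<close>
definition full_torsion ::
    "('a, 7) chart set \<Rightarrow> ('a, 7) tensor_field \<Rightarrow> ('a, 7) tensor_field \<Rightarrow> bool"
  where "full_torsion \<A> \<phi> T \<longleftrightarrow>
     (\<forall>ch\<in>\<A>. \<forall>p\<in>fst ch. \<forall>a b c d.
        g2_nabla \<phi> ch (\<phi> ch) p [a, b, c, d] =
        (\<Sum>e\<in>UNIV. raise (g2_metric (\<phi> ch p)) 1 (T ch p) [a, e] * g2_psi (\<phi> ch p) [e, b, c, d]))"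

text \<open>\<open>\<omega>\<^bsub>bcd\<^esub> + u\<^sub>e \<psi>\<^bsub>bcd\<^esub>\<^sup>e\<close>\<close>
definition deform :: "7 tensor \<Rightarrow> real^7 \<Rightarrow> 7 tensor"
  where "deform \<omega> u I = \<omega> I +
     (\<Sum>e\<in>UNIV. flat (g2_metric \<omega>) u [e] * raise (g2_metric \<omega>) 3 (g2_psi \<omega>) (I @ [e]))"

text \<open>The torsion of the deformed structure at a point.  Here \<open>u\<close> is the deforming vector with
  components \<open>u1\<close>, \<open>u7\<close>, \<open>u14\<close>, \<open>u27\<close> of its covariant derivative (\<open>u7\<close> a vector) and
  \<open>t1\<close>, \<open>t7\<close>, \<open>t14\<close>, \<open>t27\<close> are the components of the original torsion (\<open>t7\<close> a covector).
  \<open>uf\<close>, \<open>u7f\<close> are the covectors of \<open>u\<close>, \<open>u7\<close>, and \<open>t7s\<close> is the vector of \<open>t7\<close>.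

  Two of the summands deviate from the published formula, which fails for these two terms as printed: the sign
  of \<open>(1/3) \<phi>\<^bsub>anm\<^esub> v\<^bsub>14\<^esub>\<^bsup>mp\<^esup> v\<^sub>p\<close> is \<open>-\<close> instead of \<open>+\<close>, and the free indices in
  \<open>\<phi>\<^bsup>mp\<^esup>\<^sub>a (v\<^bsub>27\<^esub>)\<^bsub>pn\<^esub> v\<^sub>m\<close> are interchanged to \<open>\<phi>\<^bsup>mp\<^esup>\<^sub>n (v\<^bsub>27\<^esub>)\<^bsub>pa\<^esub> v\<^sub>m\<close>.\<close>
definition deformed_torsion ::
    "7 tensor \<Rightarrow> real^7 \<Rightarrow> real \<Rightarrow> real^7 \<Rightarrow> 7 tensor \<Rightarrow> 7 tensor \<Rightarrow>
     real \<Rightarrow> 7 tensor \<Rightarrow> 7 tensor \<Rightarrow> 7 tensor \<Rightarrow> 7 \<Rightarrow> 7 \<Rightarrow> real"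
  where "deformed_torsion \<omega> u u1 u7 u14 u27 t1 t7 t14 t27 a n =
    (let g = g2_metric \<omega>;
         \<psi> = g2_psi \<omega>;
         up = raise g;
         uf = flat g u;
         u7f = flat g u7;
         t7s = sharp g t7;
         M = u \<bullet> (g *v u)
     in
      (1 + M) powr (-4/3) *
       (u1 * (uf [a] * uf [n] - (1 + M) * g $ a $ n)
        - 4/3 * (1 + M) * u1 * (\<Sum>m\<in>UNIV. \<omega> [a, n, m] * u $ m)
        - (1 + 4/3 * M) * (\<Sum>m\<in>UNIV. \<omega> [a, n, m] * u7 $ m)
        - 1/3 * (\<Sum>m\<in>UNIV. \<Sum>p\<in>UNIV. \<psi> [a, n, m, p] * u $ m * u7 $ p)
        + 5/3 * uf [a] * (\<Sum>m\<in>UNIV. \<Sum>p\<in>UNIV. \<omega> [n, m, p] * u $ m * u7 $ p)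
        + 4/3 * uf [n] * (\<Sum>m\<in>UNIV. \<Sum>p\<in>UNIV. \<omega> [a, m, p] * u $ m * u7 $ p)
        + 1/3 * (\<Sum>m\<in>UNIV. u7 $ m * uf [m]) * (\<Sum>p\<in>UNIV. up 0 \<omega> [p, a, n] * uf [p])
        + 1/3 * uf [n] * u7f [a]
        + 8/3 * uf [a] * u7f [n]
        - (1 + M) * u14 [a, n]
        - 2 * (((\<Sum>m\<in>UNIV. uf [m] * up 0 u14 [m, a]) * uf [n]
                - (\<Sum>m\<in>UNIV. uf [m] * up 0 u14 [m, n]) * uf [a]) / 2)
        - 1/3 * (\<Sum>m\<in>UNIV. \<Sum>p\<in>UNIV. \<omega> [a, n, m] * up 0 (up 1 u14) [m, p] * uf [p])
        + 1/3 * (\<Sum>m\<in>UNIV. \<Sum>p\<in>UNIV. \<Sum>q\<in>UNIV.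
                   \<psi> [a, n, m, p] * uf [q] * u $ m * up 0 (up 1 u14) [p, q])
        - (1 + M) * u27 [a, n]
        + (\<Sum>m\<in>UNIV. uf [m] * up 0 u27 [m, a]) * uf [n]
        - (1 + M) * (\<Sum>m\<in>UNIV. \<Sum>p\<in>UNIV. up 0 (up 1 \<omega>) [m, p, n] * u27 [p, a] * uf [m])
        - 1/3 * (\<Sum>m\<in>UNIV. \<Sum>p\<in>UNIV. \<omega> [a, n, m] * up 0 (up 1 u27) [m, p] * uf [p])
        + 1/3 * (\<Sum>m\<in>UNIV. \<Sum>p\<in>UNIV. \<Sum>q\<in>UNIV.
                   \<psi> [a, n, m, p] * u $ m * up 0 (up 1 u27) [p, q] * uf [q])
        + uf [a] * (\<Sum>m\<in>UNIV. \<Sum>p\<in>UNIV. \<Sum>q\<in>UNIV.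
                   \<omega> [n, m, p] * u $ m * up 0 (up 1 u27) [p, q] * uf [q])
        - 1/3 * (\<Sum>m\<in>UNIV. up 2 \<omega> [a, n, m] * uf [m])
              * (\<Sum>p\<in>UNIV. \<Sum>q\<in>UNIV. up 0 (up 1 u27) [p, q] * uf [p] * uf [q]))
      + (1 + M) powr (-1/3) *
       (t1 * g $ a $ n
        + t1 * (\<Sum>m\<in>UNIV. up 0 \<omega> [m, a, n] * uf [m])
        + (\<Sum>m\<in>UNIV. \<omega> [a, n, m] * t7s $ m)
        + uf [a] * t7 [n]
        - g $ a $ n * (\<Sum>m\<in>UNIV. t7s $ m * uf [m])
        + (\<Sum>m\<in>UNIV. \<Sum>p\<in>UNIV. \<psi> [a, n, m, p] * t7s $ m * u $ p)
        + t14 [a, n]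
        - (\<Sum>m\<in>UNIV. \<Sum>p\<in>UNIV. \<omega> [n, m, p] * u $ m * up 0 t14 [p, a])
        + t27 [a, n]
        + (\<Sum>m\<in>UNIV. \<Sum>p\<in>UNIV. \<omega> [n, m, p] * u $ m * up 0 t27 [p, a])))"

end

(* The group of linear maps preserving phi0 is transitive on the unit sphere, so at each point there is a
   frame in which the form is phi0 and the vector field is r e_1.  The complement of e_1 is C^3 with
   phi0 = e^1 /\ omega + Re Omega, and the deformation turns Re Omega into Re ((1 - i r) Omega).  Hence the
   deformed form is the pullback of phi0 by multiplication with a cube root z of 1 - i r on C^3 and with
   1/|z|^2 on e_1.  This gives its positivity, its metric (1+M)^(-2/3) ((1+M) g - v (x) v) and its dual.

   The covariant derivatives of the deformed form and metric with respect to g are computed in a frame that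
   is parallel to first order along a curve.  The derivative of the metric determines the difference of the
   two Levi-Civita connections.  In the adapted frame, the equation between the covariant derivative of the
   deformed form and the proposed torsion then becomes an identity that is polynomial in r and linear in the
   components of the covariant derivative of v and of T, and it is compared coefficient by coefficient.
   The torsion is unique because u -> u _| psi is injective. *)

theory Submission
  imports Defs
begin

section \<open>Pullbacks\<close>

text \<open>The adapted frame is chosen at a single point and not smoothly, so nothing expressed in
  it can be differentiated. Metric and dual form are therefore first brought into frame-free shape:
  \<open>deform_metric\<close> for the deformed metric, and \<open>psi_identity\<close>, which
  writes \<psi> through the form and the metric alone. These are differentiated along a curve whose
  frame agrees with the adapted one only at time 0; as the metric components are stationary there,
  only the form and the covector contribute. The metric is a definite description. It becomes
  accessible through \<mu> g = B with B cubic in the form: taking determinants gives \<mu>^9 = det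
  B, hence g = B / root 9 (det B). The odd root keeps the sign of \<mu>, so charts of either
  orientation are treated alike. The fractional powers of 1 + M disappear in k = |z|^2, for which
  k^3 = 1 + M: the exponents -4/3, -2/3 and -1/3 become 1/k^4, 1/k^2 and 1/k. What remains is
  rational in r and k, and k enters the final comparison only through k^3 = 1 + r^2.\<close>

lemma finite_lists_length [simp]: "finite {J::'n::finite list. length J = n}"
  using finite_lists_length_eq[of "UNIV::'n set" n] by simp

lemma sum_lists_Suc:
  "(\<Sum>J | length J = Suc n. f J) = (\<Sum>j\<in>UNIV. \<Sum>J | length J = n. f (j # J))"
  for f :: "'n::finite list \<Rightarrow> 'b::comm_monoid_add"
proof -
  have "{J::'n list. length J = Suc n} = (\<lambda>(j, J). j # J) ` (UNIV \<times> {J. length J = n})"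
    by (auto simp: length_Suc_conv image_iff)
  moreover have "inj_on (\<lambda>(j, J). j # J) (UNIV \<times> {J::'n list. length J = n})"
    by (auto simp: inj_on_def)
  ultimately show ?thesis
    by (simp add: sum.reindex sum.cartesian_product case_prod_unfold)
qed

lemma pullback_Nil [simp]: "pullback P T [] = T []"
  by (simp add: pullback_def)

text \<open>Splitting off the first slot turns the sum over multi-indices into nested sums.
  Inductions on the index list and explicit evaluations in low degree both go through this
  rule.\<close>

lemma pullback_Cons:
  "pullback P T (i # I) = (\<Sum>j\<in>UNIV. P $ j $ i * pullback P (\<lambda>J. T (j # J)) I)"
  unfolding pullback_def
  by (simp del: prod.lessThan_Suc add: sum_lists_Suc prod.lessThan_Suc_shift sum_distrib_left mult.assoc)

lemma pullback_cong:
  assumes "\<And>J. length J = length I \<Longrightarrow> T J = T' J"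
  shows "pullback P T I = pullback P T' I"
  unfolding pullback_def by (rule sum.cong) (auto simp: assms)

lemma pullback_add: "pullback P (\<lambda>J. S J + T J) I = pullback P S I + pullback P T I"
  by (simp add: pullback_def algebra_simps sum.distrib)

lemma pullback_diff: "pullback P (\<lambda>J. S J - T J) I = pullback P S I - pullback P T I"
  by (simp add: pullback_def algebra_simps sum_subtractf)

lemma pullback_scale: "pullback P (\<lambda>J. c * T J) I = c * pullback P T I"
  by (simp add: pullback_def sum_distrib_left mult.left_commute)

lemma pullback_scale_right: "pullback P (\<lambda>J. T J * c) I = pullback P T I * c"
  using pullback_scale[of P c T I] by (simp add: mult.commute)

lemma pullback_divide: "pullback P (\<lambda>J. T J / c) I = pullback P T I / c"
  using pullback_scale_right[of P T "inverse c" I] by (simp add: divide_inverse)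

lemma pullback_sum: "pullback P (\<lambda>J. \<Sum>x\<in>A. T x J) I = (\<Sum>x\<in>A. pullback P (T x) I)"
  unfolding pullback_def by (subst sum.swap) (simp add: sum_distrib_left)

lemma pullback_zero [simp]: "pullback P (\<lambda>J. 0) I = 0"
  by (simp add: pullback_def)

lemma pullback_pullback: "pullback A (pullback B T) I = pullback (B ** A) T I"
proof (induction I arbitrary: T)
  case (Cons i I)
  have "pullback A (pullback B T) (i # I) =
      (\<Sum>j\<in>UNIV. A $ j $ i * (\<Sum>k\<in>UNIV. B $ k $ j * pullback A (pullback B (\<lambda>J. T (k # J))) I))"
    by (simp add: pullback_Cons pullback_sum pullback_scale)
  also have "\<dots> = (\<Sum>k\<in>UNIV. (\<Sum>j\<in>UNIV. B $ k $ j * A $ j $ i) * pullback (B ** A) (\<lambda>J. T (k # J)) I)"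
    unfolding Cons sum_distrib_left sum_distrib_right
    by (subst sum.swap) (simp add: algebra_simps)
  finally show ?case
    by (simp add: pullback_Cons matrix_matrix_mult_def)
qed simp

lemma pullback_id [simp]: "pullback (mat 1) T I = T I"
  by (induction I arbitrary: T) (simp_all add: pullback_Cons mat_def if_distrib if_distribR cong: if_cong)

lemma interior_prod_pullback:
  "interior_prod u (pullback P T) I = pullback P (interior_prod (P *v u) T) I"
proof -
  have "interior_prod u (pullback P T) I =
      (\<Sum>i\<in>UNIV. \<Sum>j\<in>UNIV. P $ j $ i * u $ i * pullback P (\<lambda>J. T (j # J)) I)"
    by (simp add: interior_prod_def pullback_Cons sum_distrib_left algebra_simps)
  also have "\<dots> = (\<Sum>j\<in>UNIV. (\<Sum>i\<in>UNIV. P $ j $ i * u $ i) * pullback P (\<lambda>J. T (j # J)) I)"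
    by (subst sum.swap) (simp add: sum_distrib_right)
  also have "\<dots> = pullback P (interior_prod (P *v u) T) I"
    by (simp add: interior_prod_def[abs_def] pullback_sum pullback_scale matrix_vector_mult_def)
  finally show ?thesis .
qed

lemma pullback_append:
  "pullback P T (I @ I') = pullback P (\<lambda>J. pullback P (\<lambda>K. T (J @ K)) I') I"
  by (induction I arbitrary: T) (simp_all add: pullback_Cons)

lemma pullback_mult:
  "pullback P \<alpha> I * pullback P \<beta> I' =
     pullback P (\<lambda>L. \<alpha> (take (length I) L) * \<beta> (drop (length I) L)) (I @ I')"
proof -
  have "pullback P (\<lambda>L. \<alpha> (take (length I) L) * \<beta> (drop (length I) L)) (I @ I') =
      pullback P (\<lambda>J. \<alpha> J * pullback P \<beta> I') I"
    unfolding pullback_append pullback_scale[symmetric] by (rule pullback_cong) simp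
  then show ?thesis by (simp add: pullback_scale_right)
qed

text \<open>The hypothesis makes \<open>A\<close> the inverse transpose of \<open>B\<close>, so
  \<open>R\<close> transforms contravariantly and \<open>S\<close> covariantly; a full contraction
  of the two is invariant.\<close>

lemma pullback_contract:
  assumes "B ** transpose A = mat 1"
  shows "(\<Sum>J | length J = n. pullback A R J * pullback B S J) = (\<Sum>J | length J = n. R J * S J)"
proof (induction n arbitrary: R S)
  case 0
  have "{J::'a list. length J = 0} = {[]}" by auto
  then show ?case by simp
next
  case (Suc n)
  have *: "(\<Sum>i\<in>UNIV. A $ j $ i * B $ k $ i) = (if j = k then 1 else 0)" for j k
    using arg_cong[OF assms, of "\<lambda>M. M $ k $ j"]
    by (simp add: matrix_matrix_mult_def transpose_def mat_def mult.commute eq_commute)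
  have "(\<Sum>J | length J = Suc n. pullback A R J * pullback B S J) =
      (\<Sum>i\<in>UNIV. \<Sum>J | length J = n. \<Sum>j\<in>UNIV. \<Sum>k\<in>UNIV. (A $ j $ i * B $ k $ i) *
        (pullback A (\<lambda>J. R (j # J)) J * pullback B (\<lambda>J. S (k # J)) J))"
    by (simp add: sum_lists_Suc pullback_Cons sum_product algebra_simps)
  also have "\<dots> = (\<Sum>i\<in>UNIV. \<Sum>j\<in>UNIV. \<Sum>k\<in>UNIV. (A $ j $ i * B $ k $ i) * (\<Sum>J | length J = n.
        pullback A (\<lambda>J. R (j # J)) J * pullback B (\<lambda>J. S (k # J)) J))"
    unfolding sum_distrib_left
    by (intro sum.cong refl, subst sum.swap, rule sum.cong[OF refl], rule sum.swap)
  also have "\<dots> = (\<Sum>j\<in>UNIV. \<Sum>k\<in>UNIV. \<Sum>i\<in>UNIV. (A $ j $ i * B $ k $ i) * (\<Sum>J | length J = n.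
        pullback A (\<lambda>J. R (j # J)) J * pullback B (\<lambda>J. S (k # J)) J))"
    by (subst sum.swap, rule sum.cong[OF refl], rule sum.swap)
  also have "\<dots> = (\<Sum>j\<in>UNIV. \<Sum>J | length J = n. R (j # J) * S (j # J))"
    unfolding Suc sum_distrib_right[symmetric] *
    by (simp add: if_distrib if_distribR cong: if_cong)
  finally show ?case by (simp add: sum_lists_Suc)
qed

lemma pullback_permute:
  \<comment> \<open>The same matrix acts on every slot, so permuting the positions of
    \<open>I\<close> and of the summation index together leaves the product of matrix entries
    unchanged.\<close>
  assumes \<sigma>: "\<sigma> permutes {..<length I}"
  shows "pullback P T (permute_list \<sigma> I) = pullback P (\<lambda>J. T (permute_list \<sigma> J)) I"
proof -
  let ?n = "length I"
  have inv: "inv \<sigma> permutes {..<?n}" by (rule permutes_inv[OF \<sigma>])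
  have prod: "(\<Prod>m<?n. P $ (J ! \<sigma> m) $ (I ! \<sigma> m)) = (\<Prod>m<?n. P $ (J ! m) $ (I ! m))" for J
    using prod.permute[OF \<sigma>, of "\<lambda>m. P $ (J ! m) $ (I ! m)"] by (simp add: o_def)
  have "pullback P (\<lambda>J. T (permute_list \<sigma> J)) I =
      (\<Sum>J | length J = ?n. (\<Prod>m<?n. P $ (permute_list \<sigma> J ! m) $ (permute_list \<sigma> I ! m)) * T (permute_list \<sigma> J))"
    unfolding pullback_def prod[symmetric]
    by (rule sum.cong) (auto simp: permute_list_nth \<sigma> intro!: prod.cong)
  also have "\<dots> = (\<Sum>J | length J = ?n. (\<Prod>m<?n. P $ (J ! m) $ (permute_list \<sigma> I ! m)) * T J)"
  proof (rule sum.reindex_bij_witness[where i = "permute_list (inv \<sigma>)" and j = "permute_list \<sigma>"])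
    fix J :: "'a list" assume "J \<in> {J. length J = ?n}"
    then have [simp]: "length J = ?n" by simp
    show "permute_list (inv \<sigma>) (permute_list \<sigma> J) = J" "permute_list \<sigma> (permute_list (inv \<sigma>) J) = J"
      using \<sigma> inv by (simp_all add: permute_list_compose[symmetric] permutes_inv_o)
  qed auto
  finally show ?thesis by (simp add: pullback_def)
qed

section \<open>Alternating sums\<close>

text \<open>Antisymmetrisation without the factor 1/n!. Both \<open>basis_form\<close> and
  \<open>wedge\<close> are instances, so compatibility with pullback and the recursion on the degree
  are proved only once.\<close>

definition alt_sum :: "nat \<Rightarrow> ('n list \<Rightarrow> real) \<Rightarrow> 'n list \<Rightarrow> real"
  where "alt_sum n f I =
    (\<Sum>\<sigma> | \<sigma> permutes {..<n}. of_int (sign \<sigma>) * f (map (\<lambda>m. I ! \<sigma> m) [0..<n]))"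

lemma basis_form_alt_sum: "basis_form J I = alt_sum (length J) (\<lambda>L. if I = L then 1 else 0) J"
  by (simp add: basis_form_def alt_sum_def if_distrib cong: if_cong)

lemma wedge_alt_sum:
  "wedge k l \<alpha> \<beta> I = alt_sum (k + l) (\<lambda>L. \<alpha> (take k L) * \<beta> (drop k L)) I / (fact k * fact l)"
  by (simp add: wedge_def alt_sum_def take_map drop_map take_upt mult.assoc)

lemma map_nth_permute_list: "length I = n \<Longrightarrow> map (\<lambda>m. I ! \<sigma> m) [0..<n] = permute_list \<sigma> I"
  by (simp add: permute_list_def)

lemma pullback_alt_sum:
  assumes "length I = n"
  shows "pullback P (alt_sum n f) I = alt_sum n (pullback P f) I"
proof -
  have "pullback P (alt_sum n f) I =
      pullback P (\<lambda>J. \<Sum>\<sigma> | \<sigma> permutes {..<n}. of_int (sign \<sigma>) * f (permute_list \<sigma> J)) I"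
    by (rule pullback_cong) (simp add: alt_sum_def assms map_nth_permute_list)
  also have "\<dots> = (\<Sum>\<sigma> | \<sigma> permutes {..<n}. of_int (sign \<sigma>) * pullback P f (permute_list \<sigma> I))"
    by (simp add: pullback_sum pullback_scale pullback_permute assms)
  finally show ?thesis by (simp add: alt_sum_def assms map_nth_permute_list)
qed

lemma alt_sum_cong:
  assumes "\<And>L. length L = n \<Longrightarrow> f L = g L"
  shows "alt_sum n f I = alt_sum n g I"
  unfolding alt_sum_def by (rule sum.cong) (simp_all add: assms)

lemma pullback_wedge:
  assumes "length I = k + l"
  shows "wedge k l (pullback P \<alpha>) (pullback P \<beta>) I = pullback P (wedge k l \<alpha> \<beta>) I"
proof -
  have "alt_sum (k + l) (\<lambda>L. pullback P \<alpha> (take k L) * pullback P \<beta> (drop k L)) I =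
      alt_sum (k + l) (pullback P (\<lambda>L. \<alpha> (take k L) * \<beta> (drop k L))) I"
    by (rule alt_sum_cong) (simp add: pullback_mult)
  then show ?thesis
    unfolding wedge_alt_sum pullback_divide pullback_alt_sum[OF assms] by simp
qed

lemma wedge_cong:
  assumes "\<And>L. length L = k \<Longrightarrow> \<alpha> L = \<alpha>' L" "\<And>L. length L = l \<Longrightarrow> \<beta> L = \<beta>' L"
  shows "wedge k l \<alpha> \<beta> I = wedge k l \<alpha>' \<beta>' I"
  unfolding wedge_def using assms by simp

text \<open>Permuting the indices by \<tau> replaces \<sigma> by its composite with \<tau> in every
  summand; reindexing the sum leaves the factor sign \<tau>.\<close>

lemma alternating_alt_sum: "alternating n (alt_sum n f)"
  unfolding alternating_def
proof (intro allI impI)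
  fix I :: "'a list" and \<tau> assume len: "length I = n" and \<tau>: "\<tau> permutes {..<n}"
  let ?J = "map (\<lambda>m. I ! \<tau> m) [0..<n]"
  have *: "(of_int (sign \<tau>) :: real) * of_int (sign \<tau>) = 1"
    by (metis of_int_1 of_int_mult sign_idempotent)
  then have **: "of_int (sign \<tau>) * (of_int (sign \<tau>) * z) = z" for z :: real
    by (metis mult.assoc mult_1)
  have nth: "map (\<lambda>m. ?J ! \<sigma> m) [0..<n] = map (\<lambda>m. I ! (\<tau> \<circ> \<sigma>) m) [0..<n]"
    if "\<sigma> permutes {..<n}" for \<sigma>
    using permutes_in_image[OF that] by auto
  have sgn: "sign (\<tau> \<circ> \<sigma>) = sign \<tau> * sign \<sigma>" if "\<sigma> permutes {..<n}" for \<sigma>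
    by (intro sign_compose permutes_imp_permutation[of "{..<n}"]) (use that \<tau> in auto)
  have "of_int (sign \<tau>) * alt_sum n f I = of_int (sign \<tau>) *
      (\<Sum>\<sigma> | \<sigma> permutes {..<n}. of_int (sign (\<tau> \<circ> \<sigma>)) * f (map (\<lambda>m. I ! (\<tau> \<circ> \<sigma>) m) [0..<n]))"
    unfolding alt_sum_def by (subst setum_permutations_compose_left[OF \<tau>]) simp
  also have "\<dots> = (\<Sum>\<sigma> | \<sigma> permutes {..<n}. of_int (sign \<sigma>) * f (map (\<lambda>m. ?J ! \<sigma> m) [0..<n]))"
    unfolding sum_distrib_left
    by (rule sum.cong) (simp_all only: nth sgn mem_Collect_eq of_int_mult mult.assoc **)
  finally show "alt_sum n f ?J = of_int (sign \<tau>) * alt_sum n f I"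
    by (simp only: alt_sum_def)
qed

lemma alternatingD:
  "alternating n F \<Longrightarrow> length I = n \<Longrightarrow> \<sigma> permutes {..<n} \<Longrightarrow>
     F (permute_list \<sigma> I) = of_int (sign \<sigma>) * F I"
  unfolding alternating_def by (metis map_nth_permute_list)

lemma alternating_not_distinct:
  assumes F: "alternating n F" and len: "length I = n" and I: "\<not> distinct I"
  shows "F I = 0"
proof -
  obtain i j where ij: "i < n" "j < n" "i \<noteq> j" "I ! i = I ! j"
    using I len by (auto simp: distinct_conv_nth)
  have perm: "Transposition.transpose i j permutes {..<n}"
    by (rule permutes_swap_id) (use ij in auto)
  have "permute_list (Transposition.transpose i j) I = I"
    by (rule nth_equalityI) (use ij perm len in \<open>auto simp: permute_list_nth Transposition.transpose_def\<close>)
  then show ?thesis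
    using alternatingD[OF F len perm] ij by (simp add: sign_swap_id)
qed

text \<open>In \<open>basis_form L I\<close> the permutations act on \<open>L\<close>, while
  antisymmetry is claimed in \<open>I\<close>, so \<open>alternating_alt_sum\<close> does not apply.
  A permutation of \<open>I\<close> is moved over to \<open>L\<close>, where it becomes composition
  on the right.\<close>

lemma alternating_basis_form:
  assumes "length L = n"
  shows "alternating n (basis_form L)"
  unfolding alternating_def
proof (intro allI impI)
  fix I :: "'a list" and \<tau> assume len: "length I = n" and \<tau>: "\<tau> permutes {..<n}"
  have eq: "permute_list \<tau> I = permute_list (\<sigma> \<circ> \<tau>) L \<longleftrightarrow> I = permute_list \<sigma> L"
    if "\<sigma> permutes {..<n}" for \<sigma>
  proof -
    have "permute_list (inv \<tau>) (permute_list \<tau> K) = K" if "length K = n" for K :: "'a list"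
      using \<tau> that permutes_inv[OF \<tau>] by (simp add: permute_list_compose[symmetric] permutes_inv_o)
    then have "permute_list \<tau> I = permute_list \<tau> (permute_list \<sigma> L) \<longleftrightarrow> I = permute_list \<sigma> L"
      using len assms by (metis length_permute_list)
    then show ?thesis using \<tau> assms by (simp add: permute_list_compose)
  qed
  have sgn: "sign (\<sigma> \<circ> \<tau>) = sign \<sigma> * sign \<tau>" if "\<sigma> permutes {..<n}" for \<sigma>
    by (intro sign_compose permutes_imp_permutation[of "{..<n}"]) (use that \<tau> in auto)
  have "basis_form L (permute_list \<tau> I) =
      (\<Sum>\<sigma> | \<sigma> permutes {..<n}. if permute_list \<tau> I = permute_list \<sigma> L then of_int (sign \<sigma>) else 0)"
    by (simp add: basis_form_def assms map_nth_permute_list)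
  also have "\<dots> = (\<Sum>\<sigma> | \<sigma> permutes {..<n}.
      if permute_list \<tau> I = permute_list (\<sigma> \<circ> \<tau>) L then of_int (sign (\<sigma> \<circ> \<tau>)) else 0)"
    by (rule sum_permutations_compose_right[OF \<tau>])
  also have "\<dots> = of_int (sign \<tau>) *
      (\<Sum>\<sigma> | \<sigma> permutes {..<n}. if I = permute_list \<sigma> L then of_int (sign \<sigma>) else 0)"
    unfolding sum_distrib_left by (rule sum.cong) (auto simp: eq sgn)
  finally show "basis_form L (map (\<lambda>m. I ! \<tau> m) [0..<n]) = of_int (sign \<tau>) * basis_form L I"
    by (simp add: basis_form_def assms len map_nth_permute_list)
qed

lemma permute_list_distinct_inj:
  assumes "distinct L" "\<sigma> permutes {..<length L}" "\<tau> permutes {..<length L}"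
    "permute_list \<sigma> L = permute_list \<tau> L"
  shows "\<sigma> = \<tau>"
proof
  fix m
  show "\<sigma> m = \<tau> m"
  proof (cases "m < length L")
    case True
    then have "L ! \<sigma> m = L ! \<tau> m"
      using assms by (metis permute_list_nth)
    then show ?thesis
      using True assms permutes_in_image[of _ "{..<length L}" m]
      by (metis lessThan_iff nth_eq_iff_index_eq)
  next
    case False
    then show ?thesis using assms by (metis lessThan_iff permutes_not_in)
  qed
qed

lemma basis_form_self:
  assumes "distinct L"
  shows "basis_form L L = 1"
proof -
  have "(if L = permute_list \<sigma> L then of_int (sign \<sigma>) else 0) = (if \<sigma> = id then 1 else (0::real))"
    if "\<sigma> permutes {..<length L}" for \<sigma>
    using permute_list_distinct_inj[OF assms that permutes_id] by auto
  then have "basis_form L L = (\<Sum>\<sigma> | \<sigma> permutes {..<length L}. if \<sigma> = id then 1 else 0)"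
    unfolding basis_form_def by (intro sum.cong) (auto simp: map_nth_permute_list)
  then show ?thesis by (simp add: permutes_id finite_permutations)
qed

lemma distinct_permute_of:
  fixes L I :: "'n::finite list"
  assumes "distinct L" "distinct I" "length L = CARD('n)" "length I = CARD('n)"
  obtains \<sigma> where "\<sigma> permutes {..<length L}" "permute_list \<sigma> L = I"
proof -
  have "set L = UNIV" "set I = UNIV"
    using assms by (metis card_eq_UNIV_imp_eq_UNIV distinct_card finite_class.finite_UNIV)+
  then have "mset I = mset L"
    using assms by (metis set_eq_iff_mset_eq_distinct)
  then show ?thesis using that by (rule mset_eq_permutation)
qed

section \<open>Forms of top degree and the determinant\<close>

lemma alternating_top:
  fixes L :: "'n::finite list"
  assumes F: "alternating (length L) F" and L: "distinct L" "length L = CARD('n)"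
    and I: "length I = length L"
  shows "F I = F L * basis_form L I"
proof (cases "distinct I")
  case True
  then obtain \<sigma> where \<sigma>: "\<sigma> permutes {..<length L}" "permute_list \<sigma> L = I"
    using distinct_permute_of[OF L(1) True] L I by metis
  then show ?thesis
    using alternatingD[OF F refl \<sigma>(1)] alternatingD[OF alternating_basis_form refl \<sigma>(1), of L]
    by (simp add: basis_form_self[OF L(1)])
next
  case False
  then show ?thesis
    using alternating_not_distinct[OF F I False]
      alternating_not_distinct[OF alternating_basis_form I False] by simp
qed

text \<open>This is the Leibniz formula. Permutations of list positions are carried to permutations
  of the index type along the bijection from positions to entries of \<open>L\<close>, which
  preserves signs.\<close>

lemma pullback_basis_form_self:
  fixes L :: "'n::finite list"
  assumes L: "distinct L" "length L = CARD('n)"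
  shows "pullback P (basis_form L) L = det P"
proof -
  let ?N = "{..<length L}" and ?f = "(!) L"
  have UN: "set L = UNIV"
    using assms by (metis card_eq_UNIV_imp_eq_UNIV distinct_card finite_class.finite_UNIV)
  have bij: "bij_betw ?f ?N UNIV"
    using bij_betw_nth[OF L(1) refl UN[symmetric]] .
  then have inj: "inj_on ?f ?N" and img: "?f ` ?N = UNIV" by (auto simp: bij_betw_def)
  have "pullback P (basis_form L) L =
      (\<Sum>\<sigma> | \<sigma> permutes ?N. \<Sum>J | length J = length L. if J = permute_list \<sigma> L then
        of_int (sign \<sigma>) * (\<Prod>m<length L. P $ (J ! m) $ (L ! m)) else 0)"
    unfolding pullback_def basis_form_def sum_distrib_left
    by (subst sum.swap) (auto intro!: sum.cong simp: map_nth_permute_list mult.commute)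
  also have "\<dots> = (\<Sum>\<sigma> | \<sigma> permutes ?N. of_int (sign \<sigma>) * (\<Prod>m<length L. P $ (L ! \<sigma> m) $ (L ! m)))"
    by (intro sum.cong refl) (simp add: permute_list_nth)
  also have "\<dots> = (\<Sum>\<sigma> | \<sigma> permutes ?N. of_int (sign (map_permutation ?N ?f \<sigma>)) *
      (\<Prod>i\<in>UNIV. P $ (map_permutation ?N ?f \<sigma> i) $ i))"
  proof (intro sum.cong refl)
    fix \<sigma> assume "\<sigma> \<in> {\<sigma>. \<sigma> permutes ?N}"
    then have \<sigma>: "\<sigma> permutes ?N" by simp
    have "(\<Prod>i\<in>UNIV. P $ (map_permutation ?N ?f \<sigma> i) $ i) =
        (\<Prod>m<length L. P $ (map_permutation ?N ?f \<sigma> (L ! m)) $ (L ! m))"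
      using prod.reindex_bij_betw[OF bij, of "\<lambda>i. P $ (map_permutation ?N ?f \<sigma> i) $ i"] by simp
    also have "\<dots> = (\<Prod>m<length L. P $ (L ! \<sigma> m) $ (L ! m))"
      by (intro prod.cong refl) (simp add: map_permutation_def restrict_id_def inv_into_f_f[OF inj])
    finally show "of_int (sign \<sigma>) * (\<Prod>m<length L. P $ (L ! \<sigma> m) $ (L ! m)) =
        of_int (sign (map_permutation ?N ?f \<sigma>)) * (\<Prod>i\<in>UNIV. P $ (map_permutation ?N ?f \<sigma> i) $ i)"
      by (simp add: sign_map_permutation[OF inj \<sigma>])
  qed
  also have "\<dots> = (\<Sum>p | p permutes UNIV. of_int (sign p) * (\<Prod>i\<in>UNIV. P $ (p i) $ i))"
  proof (rule sum.reindex_bij_betw)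
    show "bij_betw (map_permutation ?N ?f) {\<sigma>. \<sigma> permutes ?N} {p. p permutes UNIV}"
      using bij_betw_permutations[OF bij] img
      by (simp add: map_permutation_def[abs_def] restrict_id_def[abs_def])
  qed
  also have "\<dots> = det (transpose P)"
    by (simp add: det_def transpose_def)
  finally show ?thesis by simp
qed

lemma pullback_top:
  fixes L :: "'n::finite list"
  assumes F: "alternating (length L) F" and L: "distinct L" "length L = CARD('n)"
  shows "pullback P F L = det P * F L"
proof -
  have "pullback P F L = pullback P (\<lambda>J. F L * basis_form L J) L"
    by (rule pullback_cong) (rule alternating_top[OF F L])
  then show ?thesis by (simp add: pullback_scale pullback_basis_form_self[OF L])
qed

lemma pullback_basis_form_top:
  fixes L :: "'n::finite list"
  assumes L: "distinct L" "length L = CARD('n)" and I: "length I = length L"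
  shows "pullback P (basis_form L) I = det P * basis_form L I"
proof -
  have "alternating (length L) (pullback P (basis_form L))"
    unfolding alternating_def
  proof (intro allI impI)
    fix K :: "'n list" and \<sigma> assume K: "length K = length L" and \<sigma>: "\<sigma> permutes {..<length L}"
    have "pullback P (basis_form L) (permute_list \<sigma> K) =
        pullback P (\<lambda>J. of_int (sign \<sigma>) * basis_form L J) K"
      using \<sigma> K by (subst pullback_permute)
        (auto intro!: pullback_cong alternatingD[OF alternating_basis_form])
    then show "pullback P (basis_form L) (map (\<lambda>m. K ! \<sigma> m) [0..<length L]) =
        of_int (sign \<sigma>) * pullback P (basis_form L) K"
      by (simp add: pullback_scale map_nth_permute_list K)
  qed
  from alternating_top[OF this L I] show ?thesis
    by (simp add: pullback_basis_form_self[OF L])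
qed

lemma alt_sum_0 [simp]: "alt_sum 0 f I = f []"
  by (simp add: alt_sum_def)

text \<open>Every permutation of Suc n positions is a transposition of n with some b, composed with
  a permutation of the first n. It sends \<open>I ! b\<close> to the last slot and puts
  \<open>I ! n\<close> in place b; the sign is -1 unless b = n. The list may be longer than Suc n,
  because the recursion lowers the degree without shortening it.\<close>

lemma alt_sum_Suc:
  assumes len: "Suc n \<le> length I"
  shows "alt_sum (Suc n) f I = alt_sum n (\<lambda>L. f (L @ [I ! n])) I
    - (\<Sum>b<n. alt_sum n (\<lambda>L. f (L @ [I ! b])) (I[b := I ! n]))"
proof -
  have ins: "{..<Suc n} = insert n {..<n}" by auto
  let ?g = "\<lambda>\<sigma>. of_int (sign \<sigma>) * f (map (\<lambda>m. I ! \<sigma> m) [0..<Suc n])"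
  have sgn: "sign (Transposition.transpose n b \<circ> q) = (if n = b then 1 else - 1) * sign q"
    if "q permutes {..<n}" for b q
    using that by (subst sign_compose) (auto simp: permutation_swap_id sign_swap_id
        intro: permutes_imp_permutation[of "{..<n}"])
  have map1: "map (\<lambda>m. I ! (Transposition.transpose n b \<circ> q) m) [0..<Suc n] =
      map (\<lambda>m. I[b := I ! n] ! q m) [0..<n] @ [I ! b]" if "q permutes {..<n}" "b < n" for b q
  proof -
    have "q m < n" if "m < n" for m
      using permutes_in_image[OF \<open>q permutes {..<n}\<close>, of m] that by simp
    moreover have "q n = n" using permutes_not_in[OF \<open>q permutes {..<n}\<close>] by simp
    ultimately show ?thesis
      using len \<open>b < n\<close>
      by (auto simp: nth_list_update Transposition.transpose_def) (metis less_irrefl)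
  qed
  have map0: "map (\<lambda>m. I ! (Transposition.transpose n n \<circ> q) m) [0..<Suc n] =
      map (\<lambda>m. I ! q m) [0..<n] @ [I ! n]" if "q permutes {..<n}" for q
    using permutes_not_in[OF that, of n] by simp
  have "alt_sum (Suc n) f I = (\<Sum>b\<in>insert n {..<n}. \<Sum>q | q permutes {..<n}.
      ?g (Transposition.transpose n b \<circ> q))"
    unfolding alt_sum_def ins by (rule sum_over_permutations_insert) auto
  also have "\<dots> = (\<Sum>q | q permutes {..<n}. ?g (Transposition.transpose n n \<circ> q)) +
      (\<Sum>b<n. \<Sum>q | q permutes {..<n}. ?g (Transposition.transpose n b \<circ> q))"
    by (subst sum.insert) auto
  also have "(\<Sum>q | q permutes {..<n}. ?g (Transposition.transpose n n \<circ> q)) =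
      alt_sum n (\<lambda>L. f (L @ [I ! n])) I"
    unfolding alt_sum_def
    by (intro sum.cong refl, simp only: mem_Collect_eq map0 sgn) simp
  also have "(\<Sum>b<n. \<Sum>q | q permutes {..<n}. ?g (Transposition.transpose n b \<circ> q)) =
      - (\<Sum>b<n. alt_sum n (\<lambda>L. f (L @ [I ! b])) (I[b := I ! n]))"
    unfolding alt_sum_def sum_negf[symmetric]
    by (intro sum.cong refl, simp only: mem_Collect_eq lessThan_iff map1 sgn) simp
  finally show ?thesis by simp
qed

lemma alt_sum_3: "alt_sum 3 f [a, b, c] =
    f [a, b, c] - f [b, a, c] - f [a, c, b] + f [c, a, b] - f [c, b, a] + f [b, c, a]"
  by (simp add: numeral_eq_Suc alt_sum_Suc)

lemma alt_sum_4: "alt_sum 4 f [a, b, c, d] =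
    f [a, b, c, d] - f [b, a, c, d] - f [a, c, b, d] + f [c, a, b, d] - f [c, b, a, d] + f [b, c, a, d]
  - f [a, b, d, c] + f [b, a, d, c] + f [a, d, b, c] - f [d, a, b, c] + f [d, b, a, c] - f [b, d, a, c]
  + f [a, c, d, b] - f [c, a, d, b] - f [a, d, c, b] + f [d, a, c, b] - f [d, c, a, b] + f [c, d, a, b]
  - f [b, c, d, a] + f [c, b, d, a] + f [b, d, c, a] - f [d, b, c, a] + f [d, c, b, a] - f [c, d, b, a]"
  by (simp add: numeral_eq_Suc alt_sum_Suc)

section \<open>Rules for alternating tensors\<close>

lemma alternating_swap:
  assumes F: "alternating n F" and len: "length (xs @ b # a # ys) = n"
  shows "F (xs @ b # a # ys) = - F (xs @ a # b # ys)"
proof -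
  let ?m = "length xs"
  let ?t = "Transposition.transpose ?m (Suc ?m)"
  have perm: "?t permutes {..<n}"
    by (rule permutes_swap_id) (use len in auto)
  have "permute_list ?t (xs @ a # b # ys) = xs @ b # a # ys"
  proof (rule nth_equalityI)
    fix i assume "i < length (permute_list ?t (xs @ a # b # ys))"
    then show "permute_list ?t (xs @ a # b # ys) ! i = (xs @ b # a # ys) ! i"
      using len perm
      by (auto simp: permute_list_nth nth_append nth_Cons' Transposition.transpose_def)
  qed simp
  then show ?thesis
    using alternatingD[OF F _ perm, of "xs @ a # b # ys"] len by (simp add: sign_swap_id)
qed

lemma alternating_diff:
  "alternating n F \<Longrightarrow> alternating n G \<Longrightarrow> alternating n (\<lambda>I. F I - G I)"
  by (simp add: alternating_def right_diff_distrib)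

lemma alternating_add:
  "alternating n F \<Longrightarrow> alternating n G \<Longrightarrow> alternating n (\<lambda>I. F I + G I)"
  by (simp add: alternating_def distrib_left)

lemma alternating_scale:
  "alternating n F \<Longrightarrow> alternating n (\<lambda>I. c * F I)"
  by (simp add: alternating_def mult.left_commute)

lemma alternating_divide:
  "alternating n F \<Longrightarrow> alternating n (\<lambda>I. F I / c)"
  by (simp add: alternating_def)

lemma alternating_sum:
  "(\<And>x. x \<in> A \<Longrightarrow> alternating n (F x)) \<Longrightarrow> alternating n (\<lambda>I. \<Sum>x\<in>A. F x I)"
  by (simp add: alternating_def sum_distrib_left cong: sum.cong)

text \<open>A permutation of the last n slots is a permutation of all m + n slots after shifting
  positions by m, and the shift keeps its sign.\<close>

lemma alternating_append:
  assumes F: "alternating (m + n) F" and J: "length J = m"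
  shows "alternating n (\<lambda>I. F (J @ I))"
  unfolding alternating_def
proof (intro allI impI)
  fix I :: "'a list" and \<sigma> assume I: "length I = n" and \<sigma>: "\<sigma> permutes {..<n}"
  let ?f = "\<lambda>i. i + m"
  let ?p = "map_permutation {..<n} ?f \<sigma>"
  have inj: "inj_on ?f {..<n}" by (simp add: inj_on_def)
  have "bij_betw ?f {..<n} {m..<m + n}"
    by (rule bij_betw_byWitness[where f' = "\<lambda>i. i - m"]) auto
  then have p: "?p permutes {m..<m + n}"
    using bij_betw_permutations[of ?f "{..<n}" "{m..<m + n}"] \<sigma>
    by (auto simp: map_permutation_def[abs_def] restrict_id_def[abs_def] bij_betw_def)
  then have p': "?p permutes {..<m + n}"
    by (rule permutes_subset) auto
  have val: "?p (i + m) = \<sigma> i + m" if "i < n" for i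
    using that inv_into_f_f[OF inj, of i] by (simp add: map_permutation_def restrict_id_def)
  have "permute_list ?p (J @ I) = J @ permute_list \<sigma> I"
  proof (rule nth_equalityI)
    fix i assume "i < length (permute_list ?p (J @ I))"
    then have i: "i < m + n" using I J by simp
    have "permute_list ?p (J @ I) ! i = (J @ I) ! ?p i"
      using i I J p' by (simp add: permute_list_nth)
    also have "\<dots> = (J @ permute_list \<sigma> I) ! i"
    proof (cases "i < m")
      case True
      then have "?p i = i" using permutes_not_in[OF p] by simp
      then show ?thesis using True J by (simp add: nth_append)
    next
      case False
      then obtain k where k: "i = k + m" "k < n" using i by (metis add.commute le_add_diff_inverse nat_add_left_cancel_less not_less)
      then show ?thesis using J I \<sigma> val[OF k(2)] by (simp add: nth_append permute_list_nth)
    qed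
    finally show "permute_list ?p (J @ I) ! i = (J @ permute_list \<sigma> I) ! i" .
  qed simp
  then show "F (J @ map (\<lambda>m. I ! \<sigma> m) [0..<n]) = of_int (sign \<sigma>) * F (J @ I)"
    using alternatingD[OF F _ p', of "J @ I"] sign_map_permutation[OF inj \<sigma>]
    by (simp add: map_nth_permute_list I J)
qed

text \<open>Both forms vanish on repeated indices, and every list of distinct indices is a
  permutation of a sublist of \<open>L\<close>. In dimension 7 this leaves 35 values to compare, in
  degree 3 as well as in degree 4; all the large componentwise identities are reduced in this
  way.\<close>

lemma alternating_ext:
  assumes F: "alternating k F" and G: "alternating k G" and L: "distinct L" "set L = UNIV"
    and eq: "\<And>N. N \<in> set (filter (\<lambda>N. length N = k) (subseqs L)) \<Longrightarrow> F N = G N"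
    and I: "length I = k"
  shows "F I = G I"
proof (cases "distinct I")
  case True
  have "set I \<in> set ` set (subseqs L)" using L by (simp add: subseqs_powset)
  then obtain N where N: "N \<in> set (subseqs L)" "set N = set I" by auto
  then have "distinct N" using subseqs_distinctD L by blast
  then have m: "mset I = mset N" using N True by (metis set_eq_iff_mset_eq_distinct)
  then obtain p where p: "p permutes {..<length N}" "permute_list p N = I"
    by (rule mset_eq_permutation)
  have len: "length N = k" using m I by (metis mset_eq_length)
  then show ?thesis
    using eq[of N] N p alternatingD[OF F len, of p] alternatingD[OF G len, of p] by simp
next
  case False
  then show ?thesis using alternating_not_distinct F G I by metis
qed

section \<open>The model form\<close>

lemma UNIV_7: "(UNIV::7 set) = {1, 2, 3, 4, 5, 6, 7}"
proof -
  have "card {1, 2, 3, 4, 5, 6, 7::7} = CARD(7)" by simp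
  then show ?thesis by (metis card_eq_UNIV_imp_eq_UNIV finite_class.finite_UNIV)
qed

lemma sum_7: "sum f (UNIV::7 set) = f 1 + f 2 + f 3 + f 4 + f 5 + f 6 + f 7"
  unfolding UNIV_7 by (simp add: ac_simps)

lemma forall_7: "(\<forall>i::7. P i) \<longleftrightarrow> P 1 \<and> P 2 \<and> P 3 \<and> P 4 \<and> P 5 \<and> P 6 \<and> P 7"
proof -
  have "(\<forall>i::7. P i) \<longleftrightarrow> (\<forall>i\<in>UNIV. P i)" by simp
  then show ?thesis unfolding UNIV_7 by simp
qed

text \<open>The position of an index in \<open>1, \<dots>, 7\<close>; the order of the type \<open>7\<close> starts with \<open>7 = 0\<close>.\<close>
definition rank7 :: "7 \<Rightarrow> nat"
  where "rank7 i = (if i = 1 then 1 else if i = 2 then 2 else if i = 3 then 3 else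
    if i = 4 then 4 else if i = 5 then 5 else if i = 6 then 6 else 7)"

lemma rank7_simps [simp]:
  "rank7 1 = 1" "rank7 2 = 2" "rank7 3 = 3" "rank7 4 = 4" "rank7 5 = 5" "rank7 6 = 6" "rank7 7 = 7"
  by (simp_all add: rank7_def)

lemma list7: "distinct [1, 2, 3, 4, 5, 6, 7::7]" "length [1, 2, 3, 4, 5, 6, 7::7] = CARD(7)"
    "set [1, 2, 3, 4, 5, 6, 7::7] = UNIV" "length [1, 2, 3, 4, 5, 6, 7::7] = 7"
  by (simp, simp, simp only: list.set UNIV_7, simp)

lemmas alternating_7_ext = alternating_ext[OF _ _ list7(1,3)]

text \<open>As conditional rewrite rules these sort the indices by adjacent swaps. The condition on
  \<open>rank7\<close> lets a rule fire only at an inversion, so rewriting terminates at the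
  increasing list.\<close>

lemma alternating_sort_4:
  assumes "alternating 4 F"
  shows "rank7 b < rank7 a \<Longrightarrow> F [a, b, c, d] = - F [b, a, c, d]"
    and "rank7 c < rank7 b \<Longrightarrow> F [a, b, c, d] = - F [a, c, b, d]"
    and "rank7 d < rank7 c \<Longrightarrow> F [a, b, c, d] = - F [a, b, d, c]"
  using alternating_swap[OF assms, of "[]" a b "[c, d]"]
    alternating_swap[OF assms, of "[a]" b c "[d]"] alternating_swap[OF assms, of "[a, b]" c d "[]"]
  by simp_all

lemma alternating_sort_7:
  assumes "alternating 7 F"
  shows "rank7 b < rank7 a \<Longrightarrow> F [a, b, c, d, e, f, g] = - F [b, a, c, d, e, f, g]"
    and "rank7 c < rank7 b \<Longrightarrow> F [a, b, c, d, e, f, g] = - F [a, c, b, d, e, f, g]"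
    and "rank7 d < rank7 c \<Longrightarrow> F [a, b, c, d, e, f, g] = - F [a, b, d, c, e, f, g]"
    and "rank7 e < rank7 d \<Longrightarrow> F [a, b, c, d, e, f, g] = - F [a, b, c, e, d, f, g]"
    and "rank7 f < rank7 e \<Longrightarrow> F [a, b, c, d, e, f, g] = - F [a, b, c, d, f, e, g]"
    and "rank7 g < rank7 f \<Longrightarrow> F [a, b, c, d, e, f, g] = - F [a, b, c, d, e, g, f]"
  using alternating_swap[OF assms, of "[]" a b "[c, d, e, f, g]"]
    alternating_swap[OF assms, of "[a]" b c "[d, e, f, g]"]
    alternating_swap[OF assms, of "[a, b]" c d "[e, f, g]"]
    alternating_swap[OF assms, of "[a, b, c]" d e "[f, g]"]
    alternating_swap[OF assms, of "[a, b, c, d]" e f "[g]"]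
    alternating_swap[OF assms, of "[a, b, c, d, e]" f g "[]"]
  by simp_all

lemma basis_form_3: "basis_form [i, j, k] [a, b, c] =
    (if a = i \<and> b = j \<and> c = k then 1 else 0) - (if a = j \<and> b = i \<and> c = k then 1 else 0)
  - (if a = i \<and> b = k \<and> c = j then 1 else 0) + (if a = k \<and> b = i \<and> c = j then 1 else 0)
  - (if a = k \<and> b = j \<and> c = i then 1 else 0) + (if a = j \<and> b = k \<and> c = i then 1 else 0)"
proof -
  have "length [i, j, k] = 3" by simp
  then show ?thesis unfolding basis_form_alt_sum \<open>length [i, j, k] = 3\<close> alt_sum_3 by (simp only: list.inject simp_thms)
qed

text \<open>For given a and b at most one c has a nonzero entry: this is the cross product of
  imaginary octonions. The last index therefore stays symbolic, and a sum over it collapses to a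
  single term.\<close>

lemma phi0_rows:
    "phi0 [1, 1, c] = 0"
    "phi0 [1, 2, c] = (if c = 3 then 1 else 0)"
    "phi0 [1, 3, c] = (if c = 2 then - 1 else 0)"
    "phi0 [1, 4, c] = (if c = 5 then 1 else 0)"
    "phi0 [1, 5, c] = (if c = 4 then - 1 else 0)"
    "phi0 [1, 6, c] = (if c = 7 then 1 else 0)"
    "phi0 [1, 7, c] = (if c = 6 then - 1 else 0)"
    "phi0 [2, 1, c] = (if c = 3 then - 1 else 0)"
    "phi0 [2, 2, c] = 0"
    "phi0 [2, 3, c] = (if c = 1 then 1 else 0)"
    "phi0 [2, 4, c] = (if c = 6 then 1 else 0)"
    "phi0 [2, 5, c] = (if c = 7 then - 1 else 0)"
    "phi0 [2, 6, c] = (if c = 4 then - 1 else 0)"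
    "phi0 [2, 7, c] = (if c = 5 then 1 else 0)"
    "phi0 [3, 1, c] = (if c = 2 then 1 else 0)"
    "phi0 [3, 2, c] = (if c = 1 then - 1 else 0)"
    "phi0 [3, 3, c] = 0"
    "phi0 [3, 4, c] = (if c = 7 then - 1 else 0)"
    "phi0 [3, 5, c] = (if c = 6 then - 1 else 0)"
    "phi0 [3, 6, c] = (if c = 5 then 1 else 0)"
    "phi0 [3, 7, c] = (if c = 4 then 1 else 0)"
    "phi0 [4, 1, c] = (if c = 5 then - 1 else 0)"
    "phi0 [4, 2, c] = (if c = 6 then - 1 else 0)"
    "phi0 [4, 3, c] = (if c = 7 then 1 else 0)"
    "phi0 [4, 4, c] = 0"
    "phi0 [4, 5, c] = (if c = 1 then 1 else 0)"
    "phi0 [4, 6, c] = (if c = 2 then 1 else 0)"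
    "phi0 [4, 7, c] = (if c = 3 then - 1 else 0)"
    "phi0 [5, 1, c] = (if c = 4 then 1 else 0)"
    "phi0 [5, 2, c] = (if c = 7 then 1 else 0)"
    "phi0 [5, 3, c] = (if c = 6 then 1 else 0)"
    "phi0 [5, 4, c] = (if c = 1 then - 1 else 0)"
    "phi0 [5, 5, c] = 0"
    "phi0 [5, 6, c] = (if c = 3 then - 1 else 0)"
    "phi0 [5, 7, c] = (if c = 2 then - 1 else 0)"
    "phi0 [6, 1, c] = (if c = 7 then - 1 else 0)"
    "phi0 [6, 2, c] = (if c = 4 then 1 else 0)"
    "phi0 [6, 3, c] = (if c = 5 then - 1 else 0)"
    "phi0 [6, 4, c] = (if c = 2 then - 1 else 0)"
    "phi0 [6, 5, c] = (if c = 3 then 1 else 0)"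
    "phi0 [6, 6, c] = 0"
    "phi0 [6, 7, c] = (if c = 1 then 1 else 0)"
    "phi0 [7, 1, c] = (if c = 6 then 1 else 0)"
    "phi0 [7, 2, c] = (if c = 5 then - 1 else 0)"
    "phi0 [7, 3, c] = (if c = 4 then - 1 else 0)"
    "phi0 [7, 4, c] = (if c = 3 then 1 else 0)"
    "phi0 [7, 5, c] = (if c = 2 then 1 else 0)"
    "phi0 [7, 6, c] = (if c = 1 then - 1 else 0)"
    "phi0 [7, 7, c] = 0"
  by (simp_all add: phi0_def basis_form_3 cong: if_cong)

lemma alternating_phi0: "alternating 3 phi0"
  unfolding phi0_def[abs_def]
  by (intro alternating_add alternating_diff alternating_basis_form) simp_all

lemma phi0_cyclic: "phi0 [a, b, c] = phi0 [b, c, a]"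
  using alternating_swap[OF alternating_phi0, of "[]" a b "[c]"]
    alternating_swap[OF alternating_phi0, of "[b]" a c "[]"] by simp

lemma interior_prod_phi0_sum:
  "interior_prod u phi0 [a, b] = (\<Sum>i\<in>UNIV. u $ i * phi0 [a, b, i])"
  by (simp add: interior_prod_def phi0_cyclic[of _ a b])

lemma interior_prod_phi0:
    "interior_prod u phi0 [1, 1] = 0"
    "interior_prod u phi0 [1, 2] = u $ 3"
    "interior_prod u phi0 [1, 3] = - u $ 2"
    "interior_prod u phi0 [1, 4] = u $ 5"
    "interior_prod u phi0 [1, 5] = - u $ 4"
    "interior_prod u phi0 [1, 6] = u $ 7"
    "interior_prod u phi0 [1, 7] = - u $ 6"
    "interior_prod u phi0 [2, 1] = - u $ 3"
    "interior_prod u phi0 [2, 2] = 0"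
    "interior_prod u phi0 [2, 3] = u $ 1"
    "interior_prod u phi0 [2, 4] = u $ 6"
    "interior_prod u phi0 [2, 5] = - u $ 7"
    "interior_prod u phi0 [2, 6] = - u $ 4"
    "interior_prod u phi0 [2, 7] = u $ 5"
    "interior_prod u phi0 [3, 1] = u $ 2"
    "interior_prod u phi0 [3, 2] = - u $ 1"
    "interior_prod u phi0 [3, 3] = 0"
    "interior_prod u phi0 [3, 4] = - u $ 7"
    "interior_prod u phi0 [3, 5] = - u $ 6"
    "interior_prod u phi0 [3, 6] = u $ 5"
    "interior_prod u phi0 [3, 7] = u $ 4"
    "interior_prod u phi0 [4, 1] = - u $ 5"
    "interior_prod u phi0 [4, 2] = - u $ 6"
    "interior_prod u phi0 [4, 3] = u $ 7"
    "interior_prod u phi0 [4, 4] = 0"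
    "interior_prod u phi0 [4, 5] = u $ 1"
    "interior_prod u phi0 [4, 6] = u $ 2"
    "interior_prod u phi0 [4, 7] = - u $ 3"
    "interior_prod u phi0 [5, 1] = u $ 4"
    "interior_prod u phi0 [5, 2] = u $ 7"
    "interior_prod u phi0 [5, 3] = u $ 6"
    "interior_prod u phi0 [5, 4] = - u $ 1"
    "interior_prod u phi0 [5, 5] = 0"
    "interior_prod u phi0 [5, 6] = - u $ 3"
    "interior_prod u phi0 [5, 7] = - u $ 2"
    "interior_prod u phi0 [6, 1] = - u $ 7"
    "interior_prod u phi0 [6, 2] = u $ 4"
    "interior_prod u phi0 [6, 3] = - u $ 5"
    "interior_prod u phi0 [6, 4] = - u $ 2"
    "interior_prod u phi0 [6, 5] = u $ 3"
    "interior_prod u phi0 [6, 6] = 0"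
    "interior_prod u phi0 [6, 7] = u $ 1"
    "interior_prod u phi0 [7, 1] = u $ 6"
    "interior_prod u phi0 [7, 2] = - u $ 5"
    "interior_prod u phi0 [7, 3] = - u $ 4"
    "interior_prod u phi0 [7, 4] = u $ 3"
    "interior_prod u phi0 [7, 5] = u $ 2"
    "interior_prod u phi0 [7, 6] = - u $ 1"
    "interior_prod u phi0 [7, 7] = 0"
  by (simp_all add: interior_prod_phi0_sum phi0_rows if_distrib cong: if_cong)

text \<open>The dual of \<open>phi0\<close> for the standard metric and orientation, one monomial
  for the complement of each monomial of \<open>phi0\<close>; \<open>g2_psi_phi0\<close> identifies
  it with the Hodge dual.\<close>

definition psi0 :: "7 tensor"
  where "psi0 I = basis_form [4,5,6,7] I + basis_form [2,3,6,7] I + basis_form [2,3,4,5] I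
     + basis_form [1,3,5,7] I - basis_form [1,3,4,6] I - basis_form [1,2,5,6] I - basis_form [1,2,4,7] I"

lemma alternating_psi0: "alternating 4 psi0"
  unfolding psi0_def[abs_def]
  by (intro alternating_add alternating_diff alternating_basis_form) simp_all

lemma basis_form_4: "basis_form [i, j, k, l] [a, b, c, d] =
    alt_sum 4 (\<lambda>L. if [a, b, c, d] = L then 1 else 0) [i, j, k, l]"
proof -
  have "length [i, j, k, l] = 4" by simp
  then show ?thesis unfolding basis_form_alt_sum by (simp only:)
qed

lemma psi0_sorted:
    "psi0 [1, 2, 3, 4] = 0" "psi0 [1, 2, 3, 5] = 0" "psi0 [1, 2, 3, 6] = 0" "psi0 [1, 2, 3, 7] = 0"
    "psi0 [1, 2, 4, 5] = 0" "psi0 [1, 2, 4, 6] = 0" "psi0 [1, 2, 4, 7] = - 1" "psi0 [1, 2, 5, 6] = - 1"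
    "psi0 [1, 2, 5, 7] = 0" "psi0 [1, 2, 6, 7] = 0" "psi0 [1, 3, 4, 5] = 0" "psi0 [1, 3, 4, 6] = - 1"
    "psi0 [1, 3, 4, 7] = 0" "psi0 [1, 3, 5, 6] = 0" "psi0 [1, 3, 5, 7] = 1" "psi0 [1, 3, 6, 7] = 0"
    "psi0 [1, 4, 5, 6] = 0" "psi0 [1, 4, 5, 7] = 0" "psi0 [1, 4, 6, 7] = 0" "psi0 [1, 5, 6, 7] = 0"
    "psi0 [2, 3, 4, 5] = 1" "psi0 [2, 3, 4, 6] = 0" "psi0 [2, 3, 4, 7] = 0" "psi0 [2, 3, 5, 6] = 0"
    "psi0 [2, 3, 5, 7] = 0" "psi0 [2, 3, 6, 7] = 1" "psi0 [2, 4, 5, 6] = 0" "psi0 [2, 4, 5, 7] = 0"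
    "psi0 [2, 4, 6, 7] = 0" "psi0 [2, 5, 6, 7] = 0" "psi0 [3, 4, 5, 6] = 0" "psi0 [3, 4, 5, 7] = 0"
    "psi0 [3, 4, 6, 7] = 0" "psi0 [3, 5, 6, 7] = 0" "psi0 [4, 5, 6, 7] = 1"
  by (simp_all add: psi0_def basis_form_4 alt_sum_4)

lemma psi0_repeated:
  "psi0 [a, a, c, d] = 0" "psi0 [a, b, a, d] = 0" "psi0 [a, b, c, a] = 0"
  "psi0 [a, b, b, d] = 0" "psi0 [a, b, c, b] = 0" "psi0 [a, b, c, c] = 0"
  by (simp_all add: alternating_not_distinct[OF alternating_psi0])

section \<open>Metric and volume form of the model\<close>

lemma alt_sum_append:
  assumes "length I = n"
  shows "alt_sum n f (I @ K) = alt_sum n f I"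
proof -
  have "map (\<lambda>m. (I @ K) ! \<sigma> m) [0..<n] = map (\<lambda>m. I ! \<sigma> m) [0..<n]" if "\<sigma> permutes {..<n}" for \<sigma>
    using permutes_in_image[OF that] assms by (auto simp: nth_append)
  then show ?thesis unfolding alt_sum_def by (intro sum.cong refl) (simp only: mem_Collect_eq)
qed

text \<open>The recursion of \<open>alt_sum_Suc\<close> with the surplus entry cut off. Degrees 5, 6
  and 7 can thus be reduced to degree 4 and left there, without writing out the 24 terms of each
  antisymmetrisation in degree 4.\<close>

lemma alt_sum_snoc:
  assumes n: "length I = n"
  shows "alt_sum (Suc n) f (I @ [x]) = alt_sum n (\<lambda>L. f (L @ [x])) I
    - (\<Sum>b<n. alt_sum n (\<lambda>L. f (L @ [I ! b])) (I[b := x]))"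
proof -
  have "alt_sum n (\<lambda>L. f (L @ [(I @ [x]) ! b])) ((I @ [x])[b := (I @ [x]) ! n]) =
      alt_sum n (\<lambda>L. f (L @ [I ! b])) (I[b := x])" if "b < n" for b
    using that n by (simp add: list_update_append alt_sum_append nth_append)
  then show ?thesis
    using n by (subst alt_sum_Suc) (simp_all add: alt_sum_append nth_append)
qed

lemma alt_sum_5: "alt_sum 5 f [a, b, c, d, e] = alt_sum 4 (\<lambda>L. f (L @ [e])) [a, b, c, d]
    - (alt_sum 4 (\<lambda>L. f (L @ [a])) [e, b, c, d] + alt_sum 4 (\<lambda>L. f (L @ [b])) [a, e, c, d]
     + alt_sum 4 (\<lambda>L. f (L @ [c])) [a, b, e, d] + alt_sum 4 (\<lambda>L. f (L @ [d])) [a, b, c, e])"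
proof -
  have "{..<4::nat} = {0, 1, 2, 3}" by auto
  then show ?thesis using alt_sum_snoc[of "[a, b, c, d]" 4 f e] by (simp add: algebra_simps)
qed

lemma alt_sum_6: "alt_sum 6 f [a, b, c, d, e, g] = alt_sum 5 (\<lambda>L. f (L @ [g])) [a, b, c, d, e]
    - (alt_sum 5 (\<lambda>L. f (L @ [a])) [g, b, c, d, e] + alt_sum 5 (\<lambda>L. f (L @ [b])) [a, g, c, d, e]
     + alt_sum 5 (\<lambda>L. f (L @ [c])) [a, b, g, d, e] + alt_sum 5 (\<lambda>L. f (L @ [d])) [a, b, c, g, e]
     + alt_sum 5 (\<lambda>L. f (L @ [e])) [a, b, c, d, g])"
proof -
  have "{..<5::nat} = {0, 1, 2, 3, 4}" by auto
  then show ?thesis using alt_sum_snoc[of "[a, b, c, d, e]" 5 f g] by (simp add: algebra_simps)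
qed

lemma alt_sum_7: "alt_sum 7 f [a, b, c, d, e, g, h] = alt_sum 6 (\<lambda>L. f (L @ [h])) [a, b, c, d, e, g]
    - (alt_sum 6 (\<lambda>L. f (L @ [a])) [h, b, c, d, e, g] + alt_sum 6 (\<lambda>L. f (L @ [b])) [a, h, c, d, e, g]
     + alt_sum 6 (\<lambda>L. f (L @ [c])) [a, b, h, d, e, g] + alt_sum 6 (\<lambda>L. f (L @ [d])) [a, b, c, h, e, g]
     + alt_sum 6 (\<lambda>L. f (L @ [e])) [a, b, c, d, h, g] + alt_sum 6 (\<lambda>L. f (L @ [g])) [a, b, c, d, e, h])"
proof -
  have "{..<6::nat} = {0, 1, 2, 3, 4, 5}" by auto
  then show ?thesis using alt_sum_snoc[of "[a, b, c, d, e, g]" 6 f h] by (simp add: algebra_simps)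
qed

lemma alt_sum_alternating:
  assumes "alternating n F" "length I = n"
  shows "alt_sum n F I = fact n * F I"
proof -
  have *: "of_int (sign \<sigma>) * (of_int (sign \<sigma>) * z) = z" for \<sigma> :: "nat \<Rightarrow> nat" and z :: real
    by (metis mult.assoc mult_1 of_int_1 of_int_mult sign_idempotent)
  have "alt_sum n F I = (\<Sum>\<sigma> | \<sigma> permutes {..<n}. F I)"
    unfolding alt_sum_def using assms
    by (intro sum.cong refl) (simp add: map_nth_permute_list alternatingD *)
  then show ?thesis by (simp add: card_permutations)
qed

text \<open>Once the last entries \<open>K\<close> are fixed, antisymmetrising the four slots of an
  alternating \<open>A\<close> only multiplies by 4! = 24. Of the 5040 terms of a wedge product in
  degree 7 there remain 210.\<close>

lemma alt_sum_product:
  assumes "alternating 4 A"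
  shows "alt_sum 4 (\<lambda>L. A (take 4 (L @ K)) * f (drop 4 (L @ K))) [a, b, c, d] = 24 * (f K * A [a, b, c, d])"
    (is "alt_sum 4 _ ?J = _")
proof -
  have "alt_sum 4 (\<lambda>L. A (take 4 (L @ K)) * f (drop 4 (L @ K))) ?J = alt_sum 4 (\<lambda>L. f K * A L) ?J"
    by (rule alt_sum_cong) simp
  also have "\<dots> = fact 4 * (f K * A ?J)"
    by (rule alt_sum_alternating[OF alternating_scale]) (use assms in auto)
  finally show ?thesis by (simp add: fact_numeral)
qed

text \<open>Wedging with a monomial of \<open>phi0\<close> evaluates \<open>A\<close> on the
  complementary indices. Each of the seven triples occurs in 6 orders, each with the factor 24 from
  \<open>alt_sum_product\<close>; the product 144 cancels the normalisation 4! 3! of the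
  wedge.\<close>

lemma wedge_phi0:
  assumes A: "alternating 4 A"
  shows "wedge 4 3 A phi0 [1, 2, 3, 4, 5, 6, 7] =
    A [4,5,6,7] + A [2,3,6,7] + A [2,3,4,5] + A [1,3,5,7] - A [1,3,4,6] - A [1,2,5,6] - A [1,2,4,7]"
proof -
  have "wedge 4 3 A phi0 [1, 2, 3, 4, 5, 6, 7] =
      alt_sum 7 (\<lambda>L. A (take 4 L) * phi0 (drop 4 L)) [1, 2, 3, 4, 5, 6, 7] / 144"
    by (simp add: wedge_alt_sum fact_numeral)
  also have "alt_sum 7 (\<lambda>L. A (take 4 L) * phi0 (drop 4 L)) [1, 2, 3, 4, 5, 6, 7] =
      144 * (A [4,5,6,7] + A [2,3,6,7] + A [2,3,4,5] + A [1,3,5,7] - A [1,3,4,6] - A [1,2,5,6] - A [1,2,4,7])"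
    unfolding alt_sum_7 alt_sum_6 alt_sum_5 append_assoc append.simps alt_sum_product[OF A]
    by (simp add: phi0_rows alternating_sort_4[OF A])
  finally show ?thesis by simp
qed

lemma alternating_wedge: "alternating (k + l) (wedge k l \<alpha> \<beta>)"
  unfolding wedge_alt_sum[abs_def] by (intro alternating_divide alternating_alt_sum)

lemma wedge_2_2:
  assumes "\<And>a b. \<alpha> [b, a] = - \<alpha> [a, b]" "\<And>a b. \<beta> [b, a] = - \<beta> [a, b]"
  shows "wedge 2 2 \<alpha> \<beta> [a, b, c, d] = \<alpha> [a, b] * \<beta> [c, d] - \<alpha> [a, c] * \<beta> [b, d] + \<alpha> [a, d] * \<beta> [b, c]
    + \<alpha> [b, c] * \<beta> [a, d] - \<alpha> [b, d] * \<beta> [a, c] + \<alpha> [c, d] * \<beta> [a, b]"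
proof -
  have "wedge 2 2 \<alpha> \<beta> [a, b, c, d] = alt_sum 4 (\<lambda>L. \<alpha> (take 2 L) * \<beta> (drop 2 L)) [a, b, c, d] / 4"
    by (simp add: wedge_alt_sum fact_numeral)
  then show ?thesis
    unfolding alt_sum_4
    by (simp add: assms[of a b] assms[of a c] assms[of a d] assms[of b c] assms[of b d] assms[of c d])
qed

lemma alternating_interior_prod:
  assumes "alternating (Suc n) \<omega>"
  shows "alternating n (interior_prod u \<omega>)"
  unfolding interior_prod_def[abs_def]
proof (intro alternating_sum alternating_scale)
  fix i
  show "alternating n (\<lambda>I. \<omega> (i # I))"
    using alternating_append[of 1 n \<omega> "[i]"] assms by simp
qed

lemma metric_volume_phi0: "metric_volume phi0 (mat 1) 1"
proof -
  have "alternating 2 (interior_prod u phi0)" for u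
    using alternating_interior_prod[of 2 phi0 u] alternating_phi0 by simp
  then have anti: "interior_prod u phi0 [b, a] = - interior_prod u phi0 [a, b]" for u a b
    using alternating_swap[of 2 "interior_prod u phi0" "[]" a b "[]"] by simp
  have "wedge 4 3 (wedge 2 2 (interior_prod u phi0) (interior_prod w phi0)) phi0 [1,2,3,4,5,6,7]
      = 6 * (u \<bullet> w)" for u w
    using alternating_wedge[of 2 2 "interior_prod u phi0" "interior_prod w phi0"]
    by (simp add: wedge_phi0 wedge_2_2[of "interior_prod u phi0" "interior_prod w phi0", OF anti anti] interior_prod_phi0 inner_vec_def sum_7 algebra_simps)
  then show ?thesis
    by (simp add: metric_volume_def transpose_mat det_I)
qed

text \<open>For each of the 42 ordered pairs of distinct indices a, b, the form on the right is
  \<open>phi0\<close> contracted with the cross product of the two basis vectors. These are the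
  instances of \<open>psi0_identity\<close> for fixed a and b; as rewrite rules they reduce
  \<open>psi0\<close> to the table of \<open>phi0\<close>.\<close>

lemma psi0_rows_all:
    "\<forall>c d. psi0 [1, 2, c, d] = phi0 [3, c, d]
      - (if c = 1 \<and> d = 2 then 1 else 0) + (if c = 2 \<and> d = 1 then 1 else 0)"
    "\<forall>c d. psi0 [1, 3, c, d] = - phi0 [2, c, d]
      - (if c = 1 \<and> d = 3 then 1 else 0) + (if c = 3 \<and> d = 1 then 1 else 0)"
    "\<forall>c d. psi0 [1, 4, c, d] = phi0 [5, c, d]
      - (if c = 1 \<and> d = 4 then 1 else 0) + (if c = 4 \<and> d = 1 then 1 else 0)"
    "\<forall>c d. psi0 [1, 5, c, d] = - phi0 [4, c, d]
      - (if c = 1 \<and> d = 5 then 1 else 0) + (if c = 5 \<and> d = 1 then 1 else 0)"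
    "\<forall>c d. psi0 [1, 6, c, d] = phi0 [7, c, d]
      - (if c = 1 \<and> d = 6 then 1 else 0) + (if c = 6 \<and> d = 1 then 1 else 0)"
    "\<forall>c d. psi0 [1, 7, c, d] = - phi0 [6, c, d]
      - (if c = 1 \<and> d = 7 then 1 else 0) + (if c = 7 \<and> d = 1 then 1 else 0)"
    "\<forall>c d. psi0 [2, 1, c, d] = - phi0 [3, c, d]
      - (if c = 2 \<and> d = 1 then 1 else 0) + (if c = 1 \<and> d = 2 then 1 else 0)"
    "\<forall>c d. psi0 [2, 3, c, d] = phi0 [1, c, d]
      - (if c = 2 \<and> d = 3 then 1 else 0) + (if c = 3 \<and> d = 2 then 1 else 0)"
    "\<forall>c d. psi0 [2, 4, c, d] = phi0 [6, c, d]
      - (if c = 2 \<and> d = 4 then 1 else 0) + (if c = 4 \<and> d = 2 then 1 else 0)"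
    "\<forall>c d. psi0 [2, 5, c, d] = - phi0 [7, c, d]
      - (if c = 2 \<and> d = 5 then 1 else 0) + (if c = 5 \<and> d = 2 then 1 else 0)"
    "\<forall>c d. psi0 [2, 6, c, d] = - phi0 [4, c, d]
      - (if c = 2 \<and> d = 6 then 1 else 0) + (if c = 6 \<and> d = 2 then 1 else 0)"
    "\<forall>c d. psi0 [2, 7, c, d] = phi0 [5, c, d]
      - (if c = 2 \<and> d = 7 then 1 else 0) + (if c = 7 \<and> d = 2 then 1 else 0)"
    "\<forall>c d. psi0 [3, 1, c, d] = phi0 [2, c, d]
      - (if c = 3 \<and> d = 1 then 1 else 0) + (if c = 1 \<and> d = 3 then 1 else 0)"
    "\<forall>c d. psi0 [3, 2, c, d] = - phi0 [1, c, d]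
      - (if c = 3 \<and> d = 2 then 1 else 0) + (if c = 2 \<and> d = 3 then 1 else 0)"
    "\<forall>c d. psi0 [3, 4, c, d] = - phi0 [7, c, d]
      - (if c = 3 \<and> d = 4 then 1 else 0) + (if c = 4 \<and> d = 3 then 1 else 0)"
    "\<forall>c d. psi0 [3, 5, c, d] = - phi0 [6, c, d]
      - (if c = 3 \<and> d = 5 then 1 else 0) + (if c = 5 \<and> d = 3 then 1 else 0)"
    "\<forall>c d. psi0 [3, 6, c, d] = phi0 [5, c, d]
      - (if c = 3 \<and> d = 6 then 1 else 0) + (if c = 6 \<and> d = 3 then 1 else 0)"
    "\<forall>c d. psi0 [3, 7, c, d] = phi0 [4, c, d]
      - (if c = 3 \<and> d = 7 then 1 else 0) + (if c = 7 \<and> d = 3 then 1 else 0)"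
    "\<forall>c d. psi0 [4, 1, c, d] = - phi0 [5, c, d]
      - (if c = 4 \<and> d = 1 then 1 else 0) + (if c = 1 \<and> d = 4 then 1 else 0)"
    "\<forall>c d. psi0 [4, 2, c, d] = - phi0 [6, c, d]
      - (if c = 4 \<and> d = 2 then 1 else 0) + (if c = 2 \<and> d = 4 then 1 else 0)"
    "\<forall>c d. psi0 [4, 3, c, d] = phi0 [7, c, d]
      - (if c = 4 \<and> d = 3 then 1 else 0) + (if c = 3 \<and> d = 4 then 1 else 0)"
    "\<forall>c d. psi0 [4, 5, c, d] = phi0 [1, c, d]
      - (if c = 4 \<and> d = 5 then 1 else 0) + (if c = 5 \<and> d = 4 then 1 else 0)"
    "\<forall>c d. psi0 [4, 6, c, d] = phi0 [2, c, d]
      - (if c = 4 \<and> d = 6 then 1 else 0) + (if c = 6 \<and> d = 4 then 1 else 0)"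
    "\<forall>c d. psi0 [4, 7, c, d] = - phi0 [3, c, d]
      - (if c = 4 \<and> d = 7 then 1 else 0) + (if c = 7 \<and> d = 4 then 1 else 0)"
    "\<forall>c d. psi0 [5, 1, c, d] = phi0 [4, c, d]
      - (if c = 5 \<and> d = 1 then 1 else 0) + (if c = 1 \<and> d = 5 then 1 else 0)"
    "\<forall>c d. psi0 [5, 2, c, d] = phi0 [7, c, d]
      - (if c = 5 \<and> d = 2 then 1 else 0) + (if c = 2 \<and> d = 5 then 1 else 0)"
    "\<forall>c d. psi0 [5, 3, c, d] = phi0 [6, c, d]
      - (if c = 5 \<and> d = 3 then 1 else 0) + (if c = 3 \<and> d = 5 then 1 else 0)"
    "\<forall>c d. psi0 [5, 4, c, d] = - phi0 [1, c, d]
      - (if c = 5 \<and> d = 4 then 1 else 0) + (if c = 4 \<and> d = 5 then 1 else 0)"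
    "\<forall>c d. psi0 [5, 6, c, d] = - phi0 [3, c, d]
      - (if c = 5 \<and> d = 6 then 1 else 0) + (if c = 6 \<and> d = 5 then 1 else 0)"
    "\<forall>c d. psi0 [5, 7, c, d] = - phi0 [2, c, d]
      - (if c = 5 \<and> d = 7 then 1 else 0) + (if c = 7 \<and> d = 5 then 1 else 0)"
    "\<forall>c d. psi0 [6, 1, c, d] = - phi0 [7, c, d]
      - (if c = 6 \<and> d = 1 then 1 else 0) + (if c = 1 \<and> d = 6 then 1 else 0)"
    "\<forall>c d. psi0 [6, 2, c, d] = phi0 [4, c, d]
      - (if c = 6 \<and> d = 2 then 1 else 0) + (if c = 2 \<and> d = 6 then 1 else 0)"
    "\<forall>c d. psi0 [6, 3, c, d] = - phi0 [5, c, d]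
      - (if c = 6 \<and> d = 3 then 1 else 0) + (if c = 3 \<and> d = 6 then 1 else 0)"
    "\<forall>c d. psi0 [6, 4, c, d] = - phi0 [2, c, d]
      - (if c = 6 \<and> d = 4 then 1 else 0) + (if c = 4 \<and> d = 6 then 1 else 0)"
    "\<forall>c d. psi0 [6, 5, c, d] = phi0 [3, c, d]
      - (if c = 6 \<and> d = 5 then 1 else 0) + (if c = 5 \<and> d = 6 then 1 else 0)"
    "\<forall>c d. psi0 [6, 7, c, d] = phi0 [1, c, d]
      - (if c = 6 \<and> d = 7 then 1 else 0) + (if c = 7 \<and> d = 6 then 1 else 0)"
    "\<forall>c d. psi0 [7, 1, c, d] = phi0 [6, c, d]
      - (if c = 7 \<and> d = 1 then 1 else 0) + (if c = 1 \<and> d = 7 then 1 else 0)"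
    "\<forall>c d. psi0 [7, 2, c, d] = - phi0 [5, c, d]
      - (if c = 7 \<and> d = 2 then 1 else 0) + (if c = 2 \<and> d = 7 then 1 else 0)"
    "\<forall>c d. psi0 [7, 3, c, d] = - phi0 [4, c, d]
      - (if c = 7 \<and> d = 3 then 1 else 0) + (if c = 3 \<and> d = 7 then 1 else 0)"
    "\<forall>c d. psi0 [7, 4, c, d] = phi0 [3, c, d]
      - (if c = 7 \<and> d = 4 then 1 else 0) + (if c = 4 \<and> d = 7 then 1 else 0)"
    "\<forall>c d. psi0 [7, 5, c, d] = phi0 [2, c, d]
      - (if c = 7 \<and> d = 5 then 1 else 0) + (if c = 5 \<and> d = 7 then 1 else 0)"
    "\<forall>c d. psi0 [7, 6, c, d] = - phi0 [1, c, d]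
      - (if c = 7 \<and> d = 6 then 1 else 0) + (if c = 6 \<and> d = 7 then 1 else 0)"
  by (simp_all only: forall_7)
     (simp_all add: psi0_sorted psi0_repeated alternating_sort_4[OF alternating_psi0] phi0_rows)

lemmas psi0_rows = psi0_repeated(1) psi0_rows_all[THEN spec, THEN spec]

lemma psi0_identity:
  "psi0 [a, b, m, n] = (\<Sum>c\<in>UNIV. phi0 [a, b, c] * phi0 [m, n, c])
    - (if a = m \<and> b = n then 1 else 0) + (if a = n \<and> b = m then 1 else 0)"
proof -
  have cyc: "phi0 [m, n, c] = phi0 [c, m, n]" for c
    by (simp add: phi0_cyclic[of c])
  have "\<forall>a b. psi0 [a, b, m, n] = (\<Sum>c\<in>UNIV. phi0 [a, b, c] * phi0 [m, n, c])
    - (if m = a \<and> n = b then 1 else 0) + (if n = a \<and> m = b then 1 else 0)"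
    unfolding forall_7
    by (intro conjI) (simp_all add: psi0_rows phi0_rows cyc sum_7 conj_commute split del: if_split)
  then show ?thesis by (simp only: eq_commute[of m a] eq_commute[of n b] eq_commute[of n a] eq_commute[of m b])
qed

section \<open>The metric and the dual form of a positive form\<close>

lemma interior_prod_cong:
  assumes "\<And>J. length J = Suc (length I) \<Longrightarrow> \<omega> J = \<omega>' J"
  shows "interior_prod u \<omega> I = interior_prod u \<omega>' I"
  by (simp add: interior_prod_def assms)

lemma metric_volume_cong:
  assumes "\<And>I. length I = 3 \<Longrightarrow> \<omega> I = \<omega>' I"
  shows "metric_volume \<omega> g \<mu> \<longleftrightarrow> metric_volume \<omega>' g \<mu>"
proof -
  have "interior_prod u \<omega> L = interior_prod u \<omega>' L" if "length L = 2" for u L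
    by (rule interior_prod_cong) (simp add: assms that)
  then have "wedge 2 2 (interior_prod u \<omega>) (interior_prod w \<omega>) L
      = wedge 2 2 (interior_prod u \<omega>') (interior_prod w \<omega>') L" for u w L
    by (intro wedge_cong)
  note w = this
  have "wedge 4 3 (wedge 2 2 (interior_prod u \<omega>) (interior_prod w \<omega>)) \<omega> L
      = wedge 4 3 (wedge 2 2 (interior_prod u \<omega>') (interior_prod w \<omega>')) \<omega>' L" for u w L
    by (rule wedge_cong, rule w, rule assms)
  then show ?thesis by (simp add: metric_volume_def)
qed

lemma det_scale: "det (c *\<^sub>R A) = c ^ CARD('n) * det A" for A :: "real^'n^'n"
  using det_rows_mul[of "\<lambda>_. c" "\<lambda>i. A $ i"]
  by (simp add: scaleR_vec_def vector_scalar_mult_def)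

lemma matrix_inv_mult:
  fixes A :: "real^'n^'n"
  assumes "invertible A"
  shows "A ** matrix_inv A = mat 1" "matrix_inv A ** A = mat 1"
  using someI_ex[OF assms[unfolded invertible_def]] by (simp_all add: matrix_inv_def)

lemma matrix_inv_eqI:
  fixes A :: "real^'n^'n"
  assumes "A ** B = mat 1"
  shows "matrix_inv A = B"
proof -
  have "invertible A"
    using assms invertible_right_inverse by blast
  then have "matrix_inv A ** (A ** B) = B"
    by (simp add: matrix_mul_assoc matrix_inv_mult)
  then show ?thesis by (simp add: assms)
qed

lemma inner_vector_matrix: "u \<bullet> (w v* A) = (A *v u) \<bullet> w" for A :: "real^'n^'m"
  by (metis dot_lmul_matrix inner_commute)

lemma metric_volume_nonzero:
  assumes "metric_volume \<omega> g \<mu>"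
  shows "\<mu> \<noteq> 0" "invertible g" "det g > 0"
proof -
  have "\<forall>x. g *v x = 0 \<longrightarrow> x = 0"
    using assms unfolding metric_volume_def by (metis inner_zero_right less_irrefl)
  then obtain B where "B ** g = mat 1" using matrix_left_invertible_ker by metis
  then show inv: "invertible g" using invertible_left_inverse by blast
  then have "det g \<noteq> 0" using invertible_det_nz by blast
  moreover have "\<mu>\<^sup>2 = det g" using assms unfolding metric_volume_def by blast
  ultimately show "\<mu> \<noteq> 0" "det g > 0" by (metis zero_power2, metis zero_less_power2 zero_power2)
qed

definition form_matrix :: "7 tensor \<Rightarrow> real^7^7"
  where "form_matrix \<omega> = (\<chi> i j. wedge 4 3 (wedge 2 2 (interior_prod (axis i 1) \<omega>)
    (interior_prod (axis j 1) \<omega>)) \<omega> [1,2,3,4,5,6,7] / 6)"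

text \<open>In dimension 7, det (\<mu> g) = \<mu>^7 det g, and det g = \<mu>^2.\<close>

lemma metric_volume_form_matrix:
  assumes "metric_volume \<omega> g \<mu>"
  shows "\<mu> *\<^sub>R g = form_matrix \<omega>" "\<mu> ^ 9 = det (form_matrix \<omega>)"
proof -
  have "(axis i 1 \<bullet> (g *v axis j 1)) * \<mu> = form_matrix \<omega> $ i $ j" for i j
    using assms unfolding metric_volume_def form_matrix_def by simp
  then have "\<mu> * g $ i $ j = form_matrix \<omega> $ i $ j" for i j
    by (simp add: inner_axis' matrix_vector_mult_basis column_def mult.commute)
  then show *: "\<mu> *\<^sub>R g = form_matrix \<omega>" by (simp add: vec_eq_iff)
  have "\<mu>\<^sup>2 = det g" using assms unfolding metric_volume_def by blast
  then have "\<mu> ^ 9 = \<mu> ^ 7 * det g" using power_add[of \<mu> 7 2] by simp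
  then show "\<mu> ^ 9 = det (form_matrix \<omega>)" by (simp add: *[symmetric] det_scale)
qed

text \<open>The exponent 9 is odd, so \<mu> is determined together with its sign, which is the
  orientation; then g follows by division.\<close>

lemma metric_volume_unique:
  assumes "metric_volume \<omega> g \<mu>" "metric_volume \<omega> g' \<mu>'"
  shows "g = g'" "\<mu> = \<mu>'"
proof -
  have "\<mu> ^ 9 = \<mu>' ^ 9" using assms by (simp add: metric_volume_form_matrix)
  then have "root 9 (\<mu> ^ 9) = root 9 (\<mu>' ^ 9)" by simp
  then show "\<mu> = \<mu>'" by (simp add: odd_real_root_power_cancel)
  moreover have "\<mu> *\<^sub>R g = \<mu>' *\<^sub>R g'" using assms by (simp add: metric_volume_form_matrix(1))
  ultimately show "g = g'" using metric_volume_nonzero(1)[OF assms(1)] by simp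
qed

lemma g2_metric_eq: "metric_volume \<omega> g \<mu> \<Longrightarrow> g2_metric \<omega> = g"
  unfolding g2_metric_def using metric_volume_unique(1) by blast

lemma g2_vol_eq: "metric_volume \<omega> g \<mu> \<Longrightarrow> g2_vol \<omega> I = \<mu> * basis_form [1,2,3,4,5,6,7] I"
proof -
  assume *: "metric_volume \<omega> g \<mu>"
  have "(THE \<mu>. \<exists>g. metric_volume \<omega> g \<mu>) = \<mu>"
    using metric_volume_unique(2)[OF _ *] * by blast
  then show ?thesis by (simp add: g2_vol_def)
qed

text \<open>The defining relation compares 7-forms, and a pullback multiplies these by
  \<open>det P\<close>. Hence the volume factor becomes \<open>det P * \<mu>\<close>, sign included,
  while g transforms as a bilinear form.\<close>

lemma metric_volume_pullback:
  assumes mv: "metric_volume \<omega> g \<mu>" and P: "invertible P"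
  shows "metric_volume (pullback P \<omega>) (transpose P ** g ** P) (det P * \<mu>)"
proof -
  let ?L = "[1,2,3,4,5,6,7] :: 7 list"
  have inner: "u \<bullet> ((transpose P ** g ** P) *v w) = (P *v u) \<bullet> (g *v (P *v w))" for u w
    by (simp add: matrix_vector_mul_assoc[symmetric] inner_vector_matrix)
  have g: "transpose g = g" "u \<noteq> 0 \<Longrightarrow> u \<bullet> (g *v u) > 0" "\<mu>\<^sup>2 = det g"
    "(u \<bullet> (g *v w)) * \<mu> = wedge 4 3 (wedge 2 2 (interior_prod u \<omega>) (interior_prod w \<omega>)) \<omega> ?L / 6" for u w
    using mv unfolding metric_volume_def by blast+
  have "transpose (transpose P ** g ** P) = transpose P ** g ** P"
    by (simp add: matrix_transpose_mul g(1) matrix_mul_assoc)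
  moreover have "u \<bullet> ((transpose P ** g ** P) *v u) > 0" if "u \<noteq> 0" for u
  proof -
    have "P *v u \<noteq> 0"
      using P that matrix_left_invertible_ker[of P] unfolding invertible_def by blast
    then show ?thesis using g(2) inner by simp
  qed
  moreover have "(det P * \<mu>)\<^sup>2 = det (transpose P ** g ** P)"
    by (simp add: det_mul g(3)[symmetric] power2_eq_square)
  moreover have "(u \<bullet> ((transpose P ** g ** P) *v w)) * (det P * \<mu>) =
      wedge 4 3 (wedge 2 2 (interior_prod u (pullback P \<omega>)) (interior_prod w (pullback P \<omega>)))
        (pullback P \<omega>) ?L / 6" for u w
  proof -
    let ?A = "wedge 2 2 (interior_prod (P *v u) \<omega>) (interior_prod (P *v w) \<omega>)"
    have "wedge 4 3 (wedge 2 2 (interior_prod u (pullback P \<omega>)) (interior_prod w (pullback P \<omega>)))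
        (pullback P \<omega>) ?L = wedge 4 3 (pullback P ?A) (pullback P \<omega>) ?L"
      by (rule wedge_cong) (simp_all add: interior_prod_pullback[abs_def] pullback_wedge)
    also have "\<dots> = pullback P (wedge 4 3 ?A \<omega>) ?L" by (rule pullback_wedge) simp
    also have "\<dots> = det P * wedge 4 3 ?A \<omega> ?L"
    proof (rule pullback_top)
      show "alternating (length ?L) (wedge 4 3 ?A \<omega>)"
        unfolding list7(4) using alternating_wedge[of 4 3 ?A \<omega>] by simp
    qed (rule list7)+
    finally show ?thesis using g(4)[of "P *v u" "P *v w"] by (simp add: inner)
  qed
  ultimately show ?thesis by (simp add: metric_volume_def)
qed

lemma metric_volume_pullback_phi0:
  assumes "invertible P" "\<And>I. length I = 3 \<Longrightarrow> \<omega> I = pullback P phi0 I"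
  shows "metric_volume \<omega> (transpose P ** P) (det P)"
proof -
  have "metric_volume (pullback P phi0) (transpose P ** P) (det P)"
    using metric_volume_pullback[OF metric_volume_phi0 assms(1)] by simp
  then show ?thesis using metric_volume_cong[of \<omega> "pullback P phi0", OF assms(2)] by blast
qed

lemma g2_metric_pullback_phi0:
  assumes "invertible P" "\<And>I. length I = 3 \<Longrightarrow> \<omega> I = pullback P phi0 I"
  shows "g2_metric \<omega> = transpose P ** P"
  by (rule g2_metric_eq[OF metric_volume_pullback_phi0[OF assms]])

lemma g2_metric_phi0: "g2_metric phi0 = mat 1"
  by (rule g2_metric_eq[OF metric_volume_phi0])

section \<open>The Hodge dual under pullback\<close>

lemma list3_cases: "length J = 3 \<Longrightarrow> (\<And>a b c. J = [a, b, c] \<Longrightarrow> Q) \<Longrightarrow> Q"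
  by (auto simp: numeral_eq_Suc length_Suc_conv)

lemma list4_cases: "length J = 4 \<Longrightarrow> (\<And>a b c d. J = [a, b, c, d] \<Longrightarrow> Q) \<Longrightarrow> Q"
  by (auto simp: numeral_eq_Suc length_Suc_conv)

lemma sum_swap_3: "(\<Sum>x\<in>A. \<Sum>y\<in>B. \<Sum>z\<in>C. f x y z) = (\<Sum>z\<in>C. \<Sum>y\<in>B. \<Sum>x\<in>A. f x y z)"
  for f :: "'a \<Rightarrow> 'b \<Rightarrow> 'c \<Rightarrow> real"
proof -
  have "(\<Sum>x\<in>A. \<Sum>y\<in>B. \<Sum>z\<in>C. f x y z) = (\<Sum>y\<in>B. \<Sum>x\<in>A. \<Sum>z\<in>C. f x y z)"
    by (rule sum.swap)
  also have "\<dots> = (\<Sum>y\<in>B. \<Sum>z\<in>C. \<Sum>x\<in>A. f x y z)"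
    by (rule sum.cong[OF refl], rule sum.swap)
  also have "\<dots> = (\<Sum>z\<in>C. \<Sum>y\<in>B. \<Sum>x\<in>A. f x y z)"
    by (rule sum.swap)
  finally show ?thesis .
qed

text \<open>Raising all three indices is itself a pullback, along the transposed inverse metric. The
  transformation rule of the Hodge dual thereby reduces to composing pullbacks.\<close>

lemma fold_raise_3:
  assumes "length J = 3"
  shows "fold (raise g) [0..<3] \<alpha> J = pullback (transpose (matrix_inv g)) \<alpha> J"
proof (rule list3_cases[OF assms])
  fix a b c assume J: "J = [a, b, c]"
  have "[0..<3] = [0, 1, 2]" by (simp add: upt_rec numeral_eq_Suc)
  then show ?thesis
    by (simp add: J raise_def pullback_Cons transpose_def sum_distrib_left numeral_eq_Suc)
      (subst sum_swap_3, simp add: mult_ac)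
qed

lemma hodge_cong:
  assumes "\<And>I. length I = 3 \<Longrightarrow> \<alpha> I = \<beta> I"
  shows "hodge g vol 3 \<alpha> I = hodge g vol 3 \<beta> I"
  unfolding hodge_def
  by (rule arg_cong[where f = "\<lambda>x. x / fact 3"], rule sum.cong)
     (auto simp: fold_raise_3 assms intro!: pullback_cong)

lemma g2_psi_cong:
  assumes "\<And>I. length I = 3 \<Longrightarrow> \<omega> I = \<omega>' I"
  shows "g2_psi \<omega> I = g2_psi \<omega>' I"
proof -
  have "metric_volume \<omega> = metric_volume \<omega>'"
    by (intro ext metric_volume_cong assms)
  then show ?thesis
    by (simp add: g2_psi_def g2_metric_def g2_vol_def[abs_def] hodge_cong[OF assms])
qed

text \<open>The raised form transforms by the inverse transpose of \<open>P\<close> and the volume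
  form by \<open>P\<close>, so the contracted slots are invariant by
  \<open>pullback_contract\<close> and only the four free slots are pulled back.\<close>

lemma hodge_pullback:
  assumes P: "invertible P" and g: "invertible g" and I: "length I = 4"
    and vol': "\<And>K. length K = 7 \<Longrightarrow> vol' K = pullback P vol K"
  shows "hodge (transpose P ** g ** P) vol' 3 (pullback P \<alpha>) I = pullback P (hodge g vol 3 \<alpha>) I"
proof -
  let ?R = "pullback (transpose (matrix_inv g)) \<alpha>" and ?Q = "transpose (matrix_inv P)"
  have PQ: "P ** matrix_inv P = mat 1" "matrix_inv P ** P = mat 1" using P by (simp_all add: matrix_inv_mult)
  have gi: "matrix_inv (transpose P ** g ** P) = matrix_inv P ** matrix_inv g ** transpose (matrix_inv P)"
  proof (rule matrix_inv_eqI)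
    have "transpose P ** g ** P ** (matrix_inv P ** matrix_inv g ** transpose (matrix_inv P)) =
        transpose P ** (g ** ((P ** matrix_inv P) ** (matrix_inv g ** transpose (matrix_inv P))))"
      by (simp only: matrix_mul_assoc)
    also have "\<dots> = transpose P ** ((g ** matrix_inv g) ** transpose (matrix_inv P))"
      by (simp only: PQ matrix_mul_lid matrix_mul_assoc)
    also have "\<dots> = transpose (matrix_inv P ** P)"
      by (simp add: matrix_inv_mult(1)[OF g] matrix_transpose_mul)
    finally show "transpose P ** g ** P ** (matrix_inv P ** matrix_inv g ** transpose (matrix_inv P)) = mat 1"
      by (simp add: PQ transpose_mat)
  qed
  have R: "fold (raise (transpose P ** g ** P)) [0..<3] (pullback P \<alpha>) J = pullback ?Q ?R J"
    if "length J = 3" for J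
  proof -
    have "P ** transpose (matrix_inv P ** matrix_inv g ** transpose (matrix_inv P)) =
        P ** (matrix_inv P ** (transpose (matrix_inv g) ** ?Q))"
      by (simp add: matrix_transpose_mul)
    also have "\<dots> = transpose (matrix_inv g) ** ?Q"
      by (simp add: matrix_mul_assoc PQ)
    finally show ?thesis by (simp add: fold_raise_3 that gi pullback_pullback)
  qed
  have V: "vol' (J @ I) = pullback P (\<lambda>K. pullback P (\<lambda>L. vol (K @ L)) I) J" if "length J = 3" for J
    using that I by (simp add: vol' pullback_append)
  have "(\<Sum>J | length J = 3. pullback ?Q ?R J * pullback P (\<lambda>K. pullback P (\<lambda>L. vol (K @ L)) I) J) =
      (\<Sum>J | length J = 3. ?R J * pullback P (\<lambda>L. vol (J @ L)) I)"
    by (rule pullback_contract) (simp add: PQ)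
  also have "\<dots> = pullback P (\<lambda>L. \<Sum>J | length J = 3. ?R J * vol (J @ L)) I"
    by (simp add: pullback_sum pullback_scale)
  finally have "(\<Sum>J | length J = 3. fold (raise (transpose P ** g ** P)) [0..<3] (pullback P \<alpha>) J * vol' (J @ I))
      = pullback P (\<lambda>L. \<Sum>J | length J = 3. ?R J * vol (J @ L)) I"
    by (simp add: R V)
  moreover have "(\<lambda>L. \<Sum>J | length J = 3. fold (raise g) [0..<3] \<alpha> J * vol (J @ L)) =
      (\<lambda>L. \<Sum>J | length J = 3. ?R J * vol (J @ L))"
    by (intro ext sum.cong) (auto simp: fold_raise_3)
  ultimately show ?thesis unfolding hodge_def[abs_def] pullback_divide by simp
qed

lemma g2_psi_pullback:
  assumes mv: "metric_volume \<omega> g \<mu>" and P: "invertible P" and I: "length I = 4"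
  shows "g2_psi (pullback P \<omega>) I = pullback P (g2_psi \<omega>) I"
proof -
  note mv' = metric_volume_pullback[OF mv P]
  have vol: "g2_vol (pullback P \<omega>) K = pullback P (g2_vol \<omega>) K" if "length K = 7" for K
  proof -
    have "pullback P (\<lambda>I. \<mu> * basis_form [1,2,3,4,5,6,7] I) K = det P * \<mu> * basis_form [1,2,3,4,5,6,7] K"
      by (simp add: pullback_scale pullback_basis_form_top list7(1,2) that)
    then show ?thesis by (simp add: g2_vol_eq[OF mv'] g2_vol_eq[OF mv, abs_def])
  qed
  show ?thesis
    unfolding g2_psi_def g2_metric_eq[OF mv] g2_metric_eq[OF mv']
    by (rule hodge_pullback[OF P metric_volume_nonzero(2)[OF mv] I vol])
qed

lemma alternating_g2_psi_phi0: "alternating 4 (g2_psi phi0)"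
  unfolding g2_psi_def hodge_def[abs_def]
proof (intro alternating_divide alternating_sum alternating_scale)
  fix J :: "7 list" assume "J \<in> {J. length J = 3}"
  then show "alternating 4 (\<lambda>I. g2_vol phi0 (J @ I))"
    by (intro alternating_append[of 3]) (auto simp: g2_vol_eq[OF metric_volume_phi0, abs_def] alternating_basis_form)
qed

lemma g2_psi_phi0_sum:
  "g2_psi phi0 N = (\<Sum>a\<in>UNIV. \<Sum>b\<in>UNIV. \<Sum>c\<in>UNIV. phi0 [a, b, c] * basis_form [1,2,3,4,5,6,7] (a # b # c # N)) / 6"
proof -
  have "matrix_inv (mat 1 :: real^7^7) = mat 1"
    by (rule matrix_inv_eqI) simp
  then have "g2_psi phi0 N = (\<Sum>J | length J = 3. phi0 J * basis_form [1,2,3,4,5,6,7] (J @ N)) / 6"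
    unfolding g2_psi_def hodge_def g2_metric_phi0 g2_vol_eq[OF metric_volume_phi0]
    by (simp add: fold_raise_3 transpose_mat fact_numeral)
  also have "(\<Sum>J | length J = 3. phi0 J * basis_form [1,2,3,4,5,6,7] (J @ N)) =
      (\<Sum>a\<in>UNIV. \<Sum>b\<in>UNIV. \<Sum>c\<in>UNIV. phi0 [a, b, c] * basis_form [1,2,3,4,5,6,7] (a # b # c # N))"
  proof -
    have "{J::7 list. length J = 0} = {[]}" by auto
    then show ?thesis by (simp add: numeral_3_eq_3 sum_lists_Suc)
  qed
  finally show ?thesis .
qed

lemma alternating_basis_form_7: "alternating 7 (basis_form [1,2,3,4,5,6,7 :: 7])"
  by (rule alternating_basis_form) simp

text \<open>The six orders of a triple contribute equally, which cancels the 1/3! of the Hodge dual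
  and leaves one term for each monomial of \<open>phi0\<close>.\<close>

lemma g2_psi_phi0_terms:
  fixes p q r s :: 7
  defines "\<epsilon> \<equiv> basis_form [1,2,3,4,5,6,7 :: 7]"
  shows "g2_psi phi0 [p, q, r, s] = \<epsilon> [1,2,3,p,q,r,s] + \<epsilon> [1,4,5,p,q,r,s] + \<epsilon> [1,6,7,p,q,r,s]
    + \<epsilon> [2,4,6,p,q,r,s] - \<epsilon> [2,5,7,p,q,r,s] - \<epsilon> [3,4,7,p,q,r,s] - \<epsilon> [3,5,6,p,q,r,s]"
proof -
  have alt: "alternating 7 \<epsilon>" unfolding \<epsilon>_def by (rule alternating_basis_form_7)
  note sort = alternating_swap[OF alt, of "[]" _ _ "[_, p, q, r, s]", simplified]
    alternating_swap[OF alt, of "[_]" _ _ "[p, q, r, s]", simplified]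
  have perm: "\<epsilon> [b, a, c, p, q, r, s] = - \<epsilon> [a, b, c, p, q, r, s]"
    "\<epsilon> [a, c, b, p, q, r, s] = - \<epsilon> [a, b, c, p, q, r, s]"
    "\<epsilon> [c, a, b, p, q, r, s] = \<epsilon> [a, b, c, p, q, r, s]"
    "\<epsilon> [b, c, a, p, q, r, s] = \<epsilon> [a, b, c, p, q, r, s]"
    "\<epsilon> [c, b, a, p, q, r, s] = - \<epsilon> [a, b, c, p, q, r, s]" for a b c
    using sort(1)[of b a c] sort(2)[of a b c] sort(1)[of a c b] sort(2)[of c a b] sort(2)[of b a c]
      sort(1)[of c b a] sort(1)[of b c a] sort(1)[of c a b] sort(2)[of a c b] sort(2)[of b c a]
    by linarith+
  have "g2_psi phi0 [p, q, r, s] =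
      (\<Sum>a\<in>UNIV. \<Sum>b\<in>UNIV. \<Sum>c\<in>UNIV. phi0 [a, b, c] * \<epsilon> [a, b, c, p, q, r, s]) / 6"
    unfolding \<epsilon>_def by (rule g2_psi_phi0_sum)
  also have "\<dots> = \<epsilon> [1,2,3,p,q,r,s] + \<epsilon> [1,4,5,p,q,r,s] + \<epsilon> [1,6,7,p,q,r,s]
    + \<epsilon> [2,4,6,p,q,r,s] - \<epsilon> [2,5,7,p,q,r,s] - \<epsilon> [3,4,7,p,q,r,s] - \<epsilon> [3,5,6,p,q,r,s]"
    by (simp add: sum_7 phi0_rows perm[where a=1 and b=2 and c=3] perm[where a=1 and b=4 and c=5] perm[where a=1 and b=6 and c=7] perm[where a=2 and b=4 and c=6]
        perm[where a=2 and b=5 and c=7] perm[where a=3 and b=4 and c=7] perm[where a=3 and b=5 and c=6])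
  finally show ?thesis .
qed

lemma g2_psi_phi0:
  assumes "length I = 4"
  shows "g2_psi phi0 I = psi0 I"
proof (rule alternating_7_ext[OF alternating_g2_psi_phi0 alternating_psi0 _ assms])
  fix N :: "7 list"
  have self: "basis_form [1,2,3,4,5,6,7::7] [1,2,3,4,5,6,7] = 1"
    by (rule basis_form_self) simp
  have zero: "basis_form [1,2,3,4,5,6,7::7] K = 0" if "\<not> distinct K" "length K = 7" for K
    using alternating_not_distinct[OF alternating_basis_form_7 that(2,1)] .
  assume N: "N \<in> set (filter (\<lambda>N. length N = 4) (subseqs [1,2,3,4,5,6,7::7]))"
  have "\<forall>N\<in>set (filter (\<lambda>N. length N = 4) (subseqs [1,2,3,4,5,6,7::7])). g2_psi phi0 N = psi0 N"
    by (simp add: Let_def) (simp add: g2_psi_phi0_terms psi0_sorted zero alternating_sort_7[OF alternating_basis_form_7] self)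
  with N show "g2_psi phi0 N = psi0 N" by blast
qed

section \<open>Adapted frames\<close>

lemma alternating_pullback:
  assumes "alternating n F"
  shows "alternating n (pullback P F)"
  unfolding alternating_def
proof (intro allI impI)
  fix K :: "'a list" and \<sigma> assume K: "length K = n" and \<sigma>: "\<sigma> permutes {..<n}"
  have "pullback P F (permute_list \<sigma> K) = pullback P (\<lambda>J. of_int (sign \<sigma>) * F J) K"
    using \<sigma> K assms by (subst pullback_permute) (auto intro!: pullback_cong alternatingD)
  then show "pullback P F (map (\<lambda>m. K ! \<sigma> m) [0..<n]) = of_int (sign \<sigma>) * pullback P F K"
    by (simp add: pullback_scale map_nth_permute_list K)
qed

lemma pullback_phi0:
  "pullback P phi0 [a, b, c] =
    (\<Sum>i\<in>UNIV. P $ i $ a * (\<Sum>j\<in>UNIV. P $ j $ b * (\<Sum>k\<in>UNIV. P $ k $ c * phi0 [i, j, k])))"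
  by (simp add: pullback_Cons)

lemma sorted_triples_7:
  "set (filter (\<lambda>N. length N = 3) (subseqs [1,2,3,4,5,6,7::7])) =
   {[1,2,3], [1,2,4], [1,2,5], [1,2,6], [1,2,7], [1,3,4], [1,3,5], [1,3,6], [1,3,7], [1,4,5],
    [1,4,6], [1,4,7], [1,5,6], [1,5,7], [1,6,7], [2,3,4], [2,3,5], [2,3,6], [2,3,7], [2,4,5],
    [2,4,6], [2,4,7], [2,5,6], [2,5,7], [2,6,7], [3,4,5], [3,4,6], [3,4,7], [3,5,6], [3,5,7],
    [3,6,7], [4,5,6], [4,5,7], [4,6,7], [5,6,7]}"
  by (simp add: Let_def)

text \<open>Multiplication by the quaternion \<open>p + q i + s j + t k\<close> on the span of the basis vectors \<open>w, x, y, z\<close>,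
  which is a copy of the quaternions.\<close>
definition quat_block :: "7 \<Rightarrow> 7 \<Rightarrow> 7 \<Rightarrow> 7 \<Rightarrow> real \<Rightarrow> real \<Rightarrow> real \<Rightarrow> real \<Rightarrow> real^7^7"
  where "quat_block w x y z p q s t = (\<chi> i j.
    if i = w then (if j = w then p else if j = x then q else if j = y then s else if j = z then t else 0)
    else if i = x then (if j = w then - q else if j = x then p else if j = y then - t else if j = z then s else 0)
    else if i = y then (if j = w then - s else if j = x then t else if j = y then p else if j = z then - q else 0)
    else if i = z then (if j = w then - t else if j = x then - s else if j = y then q else if j = z then p else 0)
    else if i = j then 1 else 0)"

lemma quat_block_columns:
  assumes w: "(w, x, y, z) = (2, 3, 4, 5) \<or> (w, x, y, z) = (1, 2, 6, 5) \<or> (w, x, y, z) = (1, 3, 5, 7)"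
  shows "(\<Sum>i\<in>UNIV. quat_block w x y z p q s t $ i $ w * F i) = p * F w - q * F x - s * F y - t * F z"
    and "(\<Sum>i\<in>UNIV. quat_block w x y z p q s t $ i $ x * F i) = q * F w + p * F x + t * F y - s * F z"
    and "(\<Sum>i\<in>UNIV. quat_block w x y z p q s t $ i $ y * F i) = s * F w - t * F x + p * F y + q * F z"
    and "(\<Sum>i\<in>UNIV. quat_block w x y z p q s t $ i $ z * F i) = t * F w + s * F x - q * F y + p * F z"
    and "j \<noteq> w \<Longrightarrow> j \<noteq> x \<Longrightarrow> j \<noteq> y \<Longrightarrow> j \<noteq> z \<Longrightarrow>
      (\<Sum>i\<in>UNIV. quat_block w x y z p q s t $ i $ j * F i) = F j"
proof -
  have j: "(\<Sum>i\<in>UNIV. quat_block w x y z p q s t $ i $ j * F i) = F j"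
    if "j \<noteq> w" "j \<noteq> x" "j \<noteq> y" "j \<noteq> z" for j
  proof -
    have "(\<Sum>i\<in>UNIV. quat_block w x y z p q s t $ i $ j * F i) = (\<Sum>i\<in>UNIV. if i = j then F i else 0)"
      by (rule sum.cong) (auto simp: quat_block_def that)
    then show ?thesis by simp
  qed
  then show "j \<noteq> w \<Longrightarrow> j \<noteq> x \<Longrightarrow> j \<noteq> y \<Longrightarrow> j \<noteq> z \<Longrightarrow>
      (\<Sum>i\<in>UNIV. quat_block w x y z p q s t $ i $ j * F i) = F j" .
qed (use w in \<open>elim disjE; simp add: sum_7 quat_block_def\<close>)+

text \<open>The block is the complement of a triple occurring in \<open>phi0\<close> (167, 347 or
  246), ordered so that \<open>psi0 [w, x, y, z] = 1\<close>. Relative to this splitting the form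
  is, up to sign, the volume form of the triple plus a sum of wedges of its covectors with three
  2-forms on the block. These 2-forms are fixed by one of the two groups of unit quaternions inside
  SO(4).\<close>

lemma quat_block_phi0:
  assumes u: "p * p + q * q + s * s + t * t = 1" and I: "length I = 3"
    and w: "(w, x, y, z) = (2, 3, 4, 5) \<or> (w, x, y, z) = (1, 2, 6, 5) \<or> (w, x, y, z) = (1, 3, 5, 7)"
  shows "pullback (quat_block w x y z p q s t) phi0 I = phi0 I"
proof (rule alternating_7_ext[OF alternating_pullback[OF alternating_phi0] alternating_phi0 _ I])
  fix N :: "7 list"
  note cols = quat_block_columns(1-4)[of 2 3 4 5, simplified] quat_block_columns(5)[of 2 3 4 5 1, simplified]
    quat_block_columns(5)[of 2 3 4 5 6, simplified] quat_block_columns(5)[of 2 3 4 5 7, simplified]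
  have 1: "\<forall>N\<in>set (filter (\<lambda>N. length N = 3) (subseqs [1,2,3,4,5,6,7::7])).
      pullback (quat_block 2 3 4 5 p q s t) phi0 N = phi0 N"
    unfolding sorted_triples_7 ball_simps pullback_phi0 cols
    by (intro conjI TrueI) (simp_all add: phi0_rows, (use u in \<open>simp_all add: algebra_simps\<close>)?)
  note cols = quat_block_columns(1-4)[of 1 2 6 5, simplified] quat_block_columns(5)[of 1 2 6 5 3, simplified]
    quat_block_columns(5)[of 1 2 6 5 4, simplified] quat_block_columns(5)[of 1 2 6 5 7, simplified]
  have 2: "\<forall>N\<in>set (filter (\<lambda>N. length N = 3) (subseqs [1,2,3,4,5,6,7::7])).
      pullback (quat_block 1 2 6 5 p q s t) phi0 N = phi0 N"
    unfolding sorted_triples_7 ball_simps pullback_phi0 cols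
    by (intro conjI TrueI) (simp_all add: phi0_rows, (use u in \<open>simp_all add: algebra_simps\<close>)?)
  note cols = quat_block_columns(1-4)[of 1 3 5 7, simplified] quat_block_columns(5)[of 1 3 5 7 2, simplified]
    quat_block_columns(5)[of 1 3 5 7 4, simplified] quat_block_columns(5)[of 1 3 5 7 6, simplified]
  have 3: "\<forall>N\<in>set (filter (\<lambda>N. length N = 3) (subseqs [1,2,3,4,5,6,7::7])).
      pullback (quat_block 1 3 5 7 p q s t) phi0 N = phi0 N"
    unfolding sorted_triples_7 ball_simps pullback_phi0 cols
    by (intro conjI TrueI) (simp_all add: phi0_rows, (use u in \<open>simp_all add: algebra_simps\<close>)?)
  assume "N \<in> set (filter (\<lambda>N. length N = 3) (subseqs [1,2,3,4,5,6,7::7]))"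
  then show "pullback (quat_block w x y z p q s t) phi0 N = phi0 N"
    using w 1 2 3 by auto
qed

text \<open>The quaternion is (a, b, c, d) itself, normalised. Its block rotates the vector with
  these components onto the first axis of the block; the three equations say that the other
  components become 0.\<close>

lemma unit_quaternion:
  obtains p q s t :: real where "p * p + q * q + s * s + t * t = 1"
    "- q * a + p * b - t * c + s * d = 0" "- s * a + t * b + p * c - q * d = 0"
    "- t * a - s * b + q * c + p * d = 0"
proof (cases "a = 0 \<and> b = 0 \<and> c = 0 \<and> d = 0")
  case True
  then show ?thesis using that[of 1 0 0 0] by simp
next
  case False
  define m where "m = sqrt (a * a + b * b + c * c + d * d)"
  have pos: "a * a + b * b + c * c + d * d > 0"
    using False by (metis add_nonneg_eq_0_iff add_nonneg_nonneg less_eq_real_def mult_eq_0_iff zero_le_square)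
  then have m: "m > 0" "m * m = a * a + b * b + c * c + d * d" by (simp_all add: m_def)
  have "a / m * (a / m) + b / m * (b / m) + c / m * (c / m) + d / m * (d / m) =
      (a * a + b * b + c * c + d * d) / (m * m)"
    by (simp add: add_divide_distrib)
  also have "\<dots> = 1" using m pos by simp
  finally show ?thesis
    by (rule that) (simp_all add: mult.commute)
qed

lemma quat_block_mult:
  assumes w: "(w, x, y, z) = (2, 3, 4, 5) \<or> (w, x, y, z) = (1, 2, 6, 5) \<or> (w, x, y, z) = (1, 3, 5, 7)"
  shows "(quat_block w x y z p q s t *v u) $ x = - q * u $ w + p * u $ x - t * u $ y + s * u $ z"
    and "(quat_block w x y z p q s t *v u) $ y = - s * u $ w + t * u $ x + p * u $ y - q * u $ z"
    and "(quat_block w x y z p q s t *v u) $ z = - t * u $ w - s * u $ x + q * u $ y + p * u $ z"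
    and "j \<noteq> w \<Longrightarrow> j \<noteq> x \<Longrightarrow> j \<noteq> y \<Longrightarrow> j \<noteq> z \<Longrightarrow> (quat_block w x y z p q s t *v u) $ j = u $ j"
proof -
  have "(quat_block w x y z p q s t *v u) $ j = u $ j" if "j \<noteq> w" "j \<noteq> x" "j \<noteq> y" "j \<noteq> z"
  proof -
    have "(quat_block w x y z p q s t *v u) $ j = (\<Sum>i\<in>UNIV. if i = j then u $ i else 0)"
      unfolding matrix_vector_mult_def vec_lambda_beta
      by (rule sum.cong) (auto simp: quat_block_def that)
    then show ?thesis by simp
  qed
  then show "j \<noteq> w \<Longrightarrow> j \<noteq> x \<Longrightarrow> j \<noteq> y \<Longrightarrow> j \<noteq> z \<Longrightarrow>
      (quat_block w x y z p q s t *v u) $ j = u $ j" .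
qed (use w in \<open>elim disjE; simp add: matrix_vector_mult_def sum_7 quat_block_def\<close>)+

text \<open>Three rotations, each by a quaternion read off from the current vector, on the blocks
  2345, 1265 and 1357. The first clears components 3, 4, 5, the second 2, 6, 5 and the third 3, 5,
  7. Zeros already obtained lie outside the next block or are among the components that it clears,
  so only the first component survives.\<close>

lemma phi0_transitive:
  obtains R r where "\<And>I. length I = 3 \<Longrightarrow> pullback R phi0 I = phi0 I" "R *v u = r *s axis 1 1"
proof -
  obtain p q s t where 1: "p * p + q * q + s * s + t * t = 1"
      "- q * u $ 2 + p * u $ 3 - t * u $ 4 + s * u $ 5 = 0"
      "- s * u $ 2 + t * u $ 3 + p * u $ 4 - q * u $ 5 = 0"
      "- t * u $ 2 - s * u $ 3 + q * u $ 4 + p * u $ 5 = 0"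
    by (rule unit_quaternion)
  define A where "A = quat_block 2 3 4 5 p q s t"
  define x where "x = A *v u"
  have x: "x $ 3 = 0" "x $ 4 = 0" "x $ 5 = 0"
    by (simp_all only: x_def A_def simp_thms 1(2-4) quat_block_mult(1-3)[of 2 3 4 5 p q s t u])
  obtain p' q' s' t' where 2: "p' * p' + q' * q' + s' * s' + t' * t' = 1"
      "- q' * x $ 1 + p' * x $ 2 - t' * x $ 6 + s' * x $ 5 = 0"
      "- s' * x $ 1 + t' * x $ 2 + p' * x $ 6 - q' * x $ 5 = 0"
      "- t' * x $ 1 - s' * x $ 2 + q' * x $ 6 + p' * x $ 5 = 0"
    by (rule unit_quaternion)
  define B where "B = quat_block 1 2 6 5 p' q' s' t'"
  define y where "y = B *v x"
  have y: "y $ 2 = 0" "y $ 3 = 0" "y $ 4 = 0" "y $ 5 = 0" "y $ 6 = 0"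
  proof -
    show "y $ 2 = 0" "y $ 6 = 0" "y $ 5 = 0"
      by (simp_all only: y_def B_def simp_thms 2(2-4) quat_block_mult(1-3)[of 1 2 6 5 p' q' s' t' x])
    show "y $ 3 = 0" "y $ 4 = 0"
      unfolding y_def B_def by (simp_all add: quat_block_mult(4)[of 1 2 6 5] x)
  qed
  obtain p'' q'' s'' t'' where 3: "p'' * p'' + q'' * q'' + s'' * s'' + t'' * t'' = 1"
      "- q'' * y $ 1 + p'' * y $ 3 - t'' * y $ 5 + s'' * y $ 7 = 0"
      "- s'' * y $ 1 + t'' * y $ 3 + p'' * y $ 5 - q'' * y $ 7 = 0"
      "- t'' * y $ 1 - s'' * y $ 3 + q'' * y $ 5 + p'' * y $ 7 = 0"
    by (rule unit_quaternion)
  define C where "C = quat_block 1 3 5 7 p'' q'' s'' t''"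
  define w where "w = C *v y"
  have w: "w $ 2 = 0" "w $ 3 = 0" "w $ 4 = 0" "w $ 5 = 0" "w $ 6 = 0" "w $ 7 = 0"
  proof -
    show "w $ 3 = 0" "w $ 5 = 0" "w $ 7 = 0"
      by (simp_all only: w_def C_def simp_thms 3(2-4) quat_block_mult(1-3)[of 1 3 5 7 p'' q'' s'' t'' y])
    show "w $ 2 = 0" "w $ 4 = 0" "w $ 6 = 0"
      unfolding w_def C_def by (simp_all add: quat_block_mult(4)[of 1 3 5 7] y)
  qed
  have "\<forall>i. w $ i = (w $ 1 *s axis 1 1) $ i"
    unfolding forall_7 by (simp add: axis_def w)
  then have "(C ** B ** A) *v u = w $ 1 *s axis 1 1"
    unfolding vec_eq_iff[symmetric] by (simp only: w_def y_def x_def matrix_vector_mul_assoc matrix_mul_assoc)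
  moreover have "pullback (C ** B ** A) phi0 I = phi0 I" if "length I = 3" for I
  proof -
    have C: "pullback C phi0 J = phi0 J" if "length J = 3" for J
      unfolding C_def by (rule quat_block_phi0[OF 3(1) that]) simp
    have B: "pullback B phi0 J = phi0 J" if "length J = 3" for J
      unfolding B_def by (rule quat_block_phi0[OF 2(1) that]) simp
    have A: "pullback A phi0 J = phi0 J" if "length J = 3" for J
      unfolding A_def by (rule quat_block_phi0[OF 1(1) that]) simp
    have "pullback B (pullback C phi0) J = phi0 J" if "length J = 3" for J
      using pullback_cong[of J "pullback C phi0" phi0 B] B C that by simp
    then have "pullback A (pullback B (pullback C phi0)) I = phi0 I"
      using pullback_cong[of I "pullback B (pullback C phi0)" phi0 A] A that by simp
    then show ?thesis by (simp add: pullback_pullback matrix_mul_assoc)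
  qed
  ultimately show ?thesis using that by blast
qed

lemma interior_prod_phi0_zero:
  assumes "\<And>a b. interior_prod u phi0 [a, b] = 0"
  shows "u = 0"
proof -
  have "u $ 1 = 0" "u $ 2 = 0" "u $ 3 = 0" "u $ 4 = 0" "u $ 5 = 0" "u $ 6 = 0" "u $ 7 = 0"
    using assms[of 2 3] assms[of 3 1] assms[of 1 2] assms[of 1 5] assms[of 1 4] assms[of 1 7] assms[of 1 6]
    by (simp_all add: interior_prod_phi0)
  then have "\<forall>i. u $ i = 0" unfolding forall_7 by simp
  then show ?thesis by (simp add: vec_eq_iff)
qed

lemma invertible_ker: "invertible P \<longleftrightarrow> (\<forall>u. P *v u = 0 \<longrightarrow> u = 0)" for P :: "real^'n^'n"
  using matrix_left_invertible_ker[of P] invertible_left_inverse[of P] by blast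

lemma interior_prod_zero: "interior_prod 0 \<omega> = (\<lambda>I. 0)"
  by (simp add: interior_prod_def[abs_def])

text \<open>A vector in the kernel of \<open>J\<close> has interior product \<open>0\<close> with \<open>\<omega>\<close>, and positive forms are nondegenerate.\<close>
lemma invertible_if_pullback_positive:
  assumes \<omega>: "positive_form \<omega>" and eq: "\<And>I. length I = 3 \<Longrightarrow> \<omega> I = pullback J \<omega>' I"
  shows "invertible J"
  unfolding invertible_ker
proof (intro allI impI)
  fix u assume J: "J *v u = 0"
  obtain P where P: "invertible P" "\<And>I. length I = 3 \<Longrightarrow> \<omega> I = pullback P phi0 I"
    using \<omega> unfolding positive_form_def by blast
  have "interior_prod (P *v u) phi0 [a, b] = 0" for a b
  proof -
    have Q: "P ** matrix_inv P = mat 1" using P(1) by (simp add: matrix_inv_mult)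
    have 0: "pullback P (interior_prod (P *v u) phi0) K = 0" if "length K = 2" for K
    proof -
      have "pullback P (interior_prod (P *v u) phi0) K = interior_prod u \<omega> K"
        unfolding interior_prod_pullback[symmetric]
        by (rule interior_prod_cong) (simp add: P that)
      also have "\<dots> = interior_prod u (pullback J \<omega>') K"
        by (rule interior_prod_cong) (simp add: eq that)
      also have "\<dots> = 0" by (simp add: interior_prod_pullback J interior_prod_zero)
      finally show ?thesis .
    qed
    have "interior_prod (P *v u) phi0 [a, b] =
        pullback (matrix_inv P) (pullback P (interior_prod (P *v u) phi0)) [a, b]"
      by (simp add: pullback_pullback Q)
    also have "\<dots> = pullback (matrix_inv P) (\<lambda>K. 0) [a, b]"
      by (rule pullback_cong) (simp add: 0)
    finally show ?thesis by simp
  qed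
  then have "P *v u = 0" by (rule interior_prod_phi0_zero)
  then show "u = 0" using P(1) unfolding invertible_ker by blast
qed

lemma positive_phi0: "positive_form phi0"
  unfolding positive_form_def by (rule exI[of _ "mat 1"]) (auto simp: invertible_def intro: exI[of _ "mat 1"])

lemma adapted_frame:
  assumes "positive_form \<omega>"
  obtains P r where "invertible P" "\<And>I. length I = 3 \<Longrightarrow> \<omega> I = pullback P phi0 I"
    "P *v u = r *s axis 1 1"
proof -
  obtain P where P: "invertible P" "\<And>I. length I = 3 \<Longrightarrow> \<omega> I = pullback P phi0 I"
    using assms unfolding positive_form_def by blast
  obtain R r where R: "\<And>I. length I = 3 \<Longrightarrow> pullback R phi0 I = phi0 I" "R *v (P *v u) = r *s axis 1 1"
    using phi0_transitive[of "P *v u"] by metis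
  have "invertible R"
    by (rule invertible_if_pullback_positive[OF positive_phi0, of R phi0]) (simp add: R(1))
  then have "invertible (R ** P)" using P(1) by (rule invertible_mult)
  moreover have "\<omega> I = pullback (R ** P) phi0 I" if "length I = 3" for I
  proof -
    have "\<omega> I = pullback P (pullback R phi0) I"
      unfolding P(2)[OF that] by (rule pullback_cong) (simp add: R(1) that)
    then show ?thesis by (simp add: pullback_pullback)
  qed
  ultimately show ?thesis using that R(2) by (simp add: matrix_vector_mul_assoc)
qed

section \<open>The deformed form\<close>

text \<open>The formula lowers the index of \<open>u\<close> and raises the last index of \<psi>
  with the same symmetric metric, so the two operations cancel.\<close>

lemma deform_eq:
  assumes g: "invertible (g2_metric \<omega>)" "transpose (g2_metric \<omega>) = g2_metric \<omega>" and I: "length I = 3"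
  shows "deform \<omega> u I = \<omega> I + (\<Sum>j\<in>UNIV. u $ j * g2_psi \<omega> (I @ [j]))"
proof -
  let ?g = "g2_metric \<omega>"
  have "(\<Sum>e\<in>UNIV. flat ?g u [e] * raise ?g 3 (g2_psi \<omega>) (I @ [e])) =
      (\<Sum>e\<in>UNIV. \<Sum>j\<in>UNIV. (?g *v u) $ e * matrix_inv ?g $ e $ j * g2_psi \<omega> (I @ [j]))"
    using I by (simp add: flat_def raise_def nth_append list_update_append sum_distrib_left mult.assoc)
  also have "\<dots> = (\<Sum>j\<in>UNIV. ((?g *v u) v* matrix_inv ?g) $ j * g2_psi \<omega> (I @ [j]))"
    by (subst sum.swap) (simp add: vector_matrix_mult_def sum_distrib_left mult_ac)
  also have "(?g *v u) v* matrix_inv ?g = u"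
  proof -
    have "?g *v u = u v* ?g" using g(2) by (metis transpose_matrix_vector)
    then have "(?g *v u) v* matrix_inv ?g = u v* (?g ** matrix_inv ?g)"
      by (simp add: vector_matrix_mul_assoc)
    then show ?thesis by (simp add: matrix_inv_mult g(1))
  qed
  finally show ?thesis by (simp add: deform_def)
qed

lemma metric_volume_symmetric: "metric_volume \<omega> g \<mu> \<Longrightarrow> transpose g = g"
  by (simp add: metric_volume_def)

lemma g2_psi_pullback_phi0:
  assumes P: "invertible P" "\<And>I. length I = 3 \<Longrightarrow> \<omega> I = pullback P phi0 I" and I: "length I = 4"
  shows "g2_psi \<omega> I = pullback P psi0 I"
proof -
  have "g2_psi \<omega> I = g2_psi (pullback P phi0) I" by (rule g2_psi_cong) (rule P(2))
  also have "\<dots> = pullback P (g2_psi phi0) I" by (rule g2_psi_pullback[OF metric_volume_phi0 P(1) I])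
  also have "\<dots> = pullback P psi0 I" by (rule pullback_cong) (simp add: g2_psi_phi0 I)
  finally show ?thesis .
qed

lemma deform_eq_positive:
  assumes "positive_form \<omega>" and I: "length I = 3"
  shows "deform \<omega> u I = \<omega> I + (\<Sum>j\<in>UNIV. u $ j * g2_psi \<omega> (I @ [j]))"
proof -
  obtain P where P: "invertible P" "\<And>I. length I = 3 \<Longrightarrow> \<omega> I = pullback P phi0 I"
    using assms unfolding positive_form_def by blast
  have mv: "metric_volume \<omega> (transpose P ** P) (det P)"
    by (rule metric_volume_pullback_phi0) (use P in auto)
  show ?thesis
    by (rule deform_eq) (use metric_volume_nonzero(2)[OF mv] metric_volume_symmetric[OF mv] I
        in \<open>simp_all add: g2_metric_eq[OF mv]\<close>)
qed

definition deform0 :: "real^7 \<Rightarrow> 7 tensor"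
  where "deform0 u I = phi0 I + (\<Sum>j\<in>UNIV. u $ j * psi0 (I @ [j]))"

lemma deform_pullback_phi0:
  assumes P: "invertible P" "\<And>I. length I = 3 \<Longrightarrow> \<omega> I = pullback P phi0 I" and I: "length I = 3"
  shows "deform \<omega> u I = pullback P (deform0 (P *v u)) I"
proof -
  have pos: "positive_form \<omega>" using P unfolding positive_form_def by blast
  have "(\<Sum>j\<in>UNIV. u $ j * g2_psi \<omega> (I @ [j])) =
      (\<Sum>j\<in>UNIV. \<Sum>k\<in>UNIV. u $ j * (P $ k $ j * pullback P (\<lambda>J. psi0 (J @ [k])) I))"
    using I by (simp add: g2_psi_pullback_phi0[OF P] pullback_append pullback_Cons pullback_sum
        pullback_scale sum_distrib_left)
  also have "\<dots> = (\<Sum>k\<in>UNIV. (\<Sum>j\<in>UNIV. P $ k $ j * u $ j) * pullback P (\<lambda>J. psi0 (J @ [k])) I)"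
    by (subst sum.swap) (simp add: sum_distrib_left mult_ac)
  also have "\<dots> = pullback P (\<lambda>J. \<Sum>k\<in>UNIV. (P *v u) $ k * psi0 (J @ [k])) I"
    by (simp add: matrix_vector_mult_def pullback_sum pullback_scale)
  finally show ?thesis
    by (simp add: deform_eq_positive[OF pos I] deform0_def[abs_def] pullback_add P(2)[OF I])
qed

text \<open>Naturality of the deformation; with \<open>J\<close> a Jacobian it makes the deformed
  form a tensor field. The invertibility of \<open>J\<close> comes from the nondegeneracy of the
  positive form, not from a chain rule for transition maps.\<close>

lemma deform_transform:
  assumes pos: "positive_form \<omega>" "positive_form \<omega>'"
    and J: "\<And>I. length I = 3 \<Longrightarrow> \<omega>' I = pullback J \<omega> I" and I: "length I = 3"
  shows "deform \<omega>' u I = pullback J (deform \<omega> (J *v u)) I"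
proof -
  have inv: "invertible J" by (rule invertible_if_pullback_positive[OF pos(2)]) (rule J)
  obtain P where P: "invertible P" "\<And>I. length I = 3 \<Longrightarrow> \<omega> I = pullback P phi0 I"
    using pos(1) unfolding positive_form_def by blast
  have PJ: "\<omega>' I = pullback (P ** J) phi0 I" if "length I = 3" for I
    unfolding pullback_pullback[symmetric] J[OF that] by (rule pullback_cong) (simp add: P that)
  have "deform \<omega>' u I = pullback (P ** J) (deform0 ((P ** J) *v u)) I"
    by (rule deform_pullback_phi0[OF invertible_mult[OF P(1) inv] PJ I])
  also have "\<dots> = pullback J (pullback P (deform0 (P *v (J *v u)))) I"
    by (simp add: pullback_pullback matrix_vector_mul_assoc)
  also have "\<dots> = pullback J (deform \<omega> (J *v u)) I"
    by (rule pullback_cong) (simp add: deform_pullback_phi0[OF P] I)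
  finally show ?thesis .
qed

lemma alternating_psi0_last: "psi0 [b, c, d, a] = - psi0 [a, b, c, d]"
  using alternating_swap[OF alternating_psi0, of "[b, c]" d a "[]"]
    alternating_swap[OF alternating_psi0, of "[b]" c a "[d]"]
    alternating_swap[OF alternating_psi0, of "[]" b a "[c, d]"] by simp

text \<open>The contracted index moves from the last slot to the first, past three others. The
  resulting sign is the one in z^3 = 1 - i r.\<close>

lemma deform0_axis: "deform0 (r *s axis 1 1) [b, c, d] = phi0 [b, c, d] - r * psi0 [1, b, c, d]"
  by (simp add: deform0_def sum_7 axis_def alternating_psi0_last[of b c d 1])

text \<open>Real part, imaginary part and squared modulus of z^3 = 1 - i r, for z = x + i y.\<close>

lemma cube_root_components:
  obtains x y :: real where "x ^ 3 - 3 * x * y\<^sup>2 = 1" "3 * x\<^sup>2 * y - y ^ 3 = - r"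
    "(x\<^sup>2 + y\<^sup>2) ^ 3 = 1 + r\<^sup>2"
proof -
  obtain z :: complex where z: "z ^ 3 = Complex 1 (- r)"
  proof (cases "Complex 1 (- r) = 0")
    case True
    then show ?thesis using that[of 0] by (simp add: complex_eq_iff)
  next
    case False
    have "exp (Ln (Complex 1 (- r)) / 3) ^ 3 = exp (Ln (Complex 1 (- r)))"
      using exp_of_nat_mult[of 3 "Ln (Complex 1 (- r)) / 3"] by simp
    then show ?thesis using that False by (simp add: exp_Ln)
  qed
  let ?x = "Re z" and ?y = "Im z"
  have "z ^ 3 = Complex (?x ^ 3 - 3 * ?x * ?y\<^sup>2) (3 * ?x\<^sup>2 * ?y - ?y ^ 3)"
    by (simp add: complex_eq_iff power3_eq_cube power2_eq_square algebra_simps)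
  then have 1: "?x ^ 3 - 3 * ?x * ?y\<^sup>2 = 1" "3 * ?x\<^sup>2 * ?y - ?y ^ 3 = - r"
    using z by (simp_all add: complex_eq_iff)
  have "(?x\<^sup>2 + ?y\<^sup>2) ^ 3 = (?x ^ 3 - 3 * ?x * ?y\<^sup>2)\<^sup>2 + (3 * ?x\<^sup>2 * ?y - ?y ^ 3)\<^sup>2"
    by (simp add: power3_eq_cube power2_eq_square algebra_simps)
  then show ?thesis using that[OF 1] 1 by simp
qed

text \<open>Multiplication by \<open>h\<close> on the first axis and by \<open>z = x + iy\<close> on the three complex lines that
  the form singles out in its complement.  There \<open>phi0\<close> is \<open>e\<^sup>1 \<and> \<omega> + Re \<Omega>\<close>, and pulling back
  multiplies \<open>e\<^sup>1 \<and> \<omega>\<close> by \<open>h |z|\<^sup>2\<close> and \<open>\<Omega>\<close> by \<open>z^3\<close>; the deformed form is obtained for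
  \<open>z^3 = 1 - i r\<close> and \<open>h |z|\<^sup>2 = 1\<close>.\<close>
definition twist :: "real \<Rightarrow> real \<Rightarrow> real \<Rightarrow> real^7^7"
  where "twist h x y = (\<chi> i j. if i = 1 \<and> j = 1 then h else if i \<noteq> 1 \<and> i = j then x
    else if i = 2 \<and> j = 3 \<or> i = 4 \<and> j = 5 \<or> i = 6 \<and> j = 7 then - y
    else if i = 3 \<and> j = 2 \<or> i = 5 \<and> j = 4 \<or> i = 7 \<and> j = 6 then y else 0)"

lemma twist_columns:
  "(\<Sum>i\<in>UNIV. twist h x y $ i $ 1 * F i) = h * F 1"
  "(\<Sum>i\<in>UNIV. twist h x y $ i $ 2 * F i) = x * F 2 + y * F 3"
  "(\<Sum>i\<in>UNIV. twist h x y $ i $ 3 * F i) = x * F 3 - y * F 2"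
  "(\<Sum>i\<in>UNIV. twist h x y $ i $ 4 * F i) = x * F 4 + y * F 5"
  "(\<Sum>i\<in>UNIV. twist h x y $ i $ 5 * F i) = x * F 5 - y * F 4"
  "(\<Sum>i\<in>UNIV. twist h x y $ i $ 6 * F i) = x * F 6 + y * F 7"
  "(\<Sum>i\<in>UNIV. twist h x y $ i $ 7 * F i) = x * F 7 - y * F 6"
  by (simp_all add: sum_7 twist_def)

lemma alternating_deform0: "alternating 3 (deform0 u)"
proof -
  have "alternating 3 (\<lambda>I. psi0 (I @ [j]))" for j
  proof -
    have *: "psi0 (I @ [j]) = - psi0 (j # I)" if "length I = 3" for I
      using that by (elim list3_cases) (simp add: alternating_psi0_last[of _ _ _ j])
    have "alternating 3 (\<lambda>I. psi0 ([j] @ I))"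
      by (rule alternating_append[of 1]) (simp_all add: alternating_psi0)
    then show ?thesis unfolding alternating_def by (simp add: *)
  qed
  then show ?thesis unfolding deform0_def[abs_def]
    by (intro alternating_add alternating_sum alternating_scale alternating_phi0)
qed

lemma deform0_twist:
  assumes x: "x ^ 3 - 3 * x * y\<^sup>2 = 1" "3 * x\<^sup>2 * y - y ^ 3 = - r" and h: "h * (x\<^sup>2 + y\<^sup>2) = 1"
    and I: "length I = 3"
  shows "deform0 (r *s axis 1 1) I = pullback (twist h x y) phi0 I"
proof (rule alternating_7_ext[OF alternating_deform0 alternating_pullback[OF alternating_phi0] _ I])
  fix N :: "7 list"
  \<comment> \<open>The hypotheses are rewritten as linear relations between monomials. After
    multiplying out, each of the 35 components then follows by linear arithmetic with the monomials
    as atoms.\<close>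
  have c: "x * (x * x) = 1 + 3 * (x * (y * y))"
    using x(1) by (simp add: algebra_simps power3_eq_cube power2_eq_square)
  have c': "3 * (x * (x * y)) = y * (y * y) - r"
    using x(2) by (simp add: algebra_simps power3_eq_cube power2_eq_square)
  have c'': "h * (x * x) + h * (y * y) = 1"
    using h by (simp add: algebra_simps power2_eq_square)
  have "\<forall>N\<in>set (filter (\<lambda>N. length N = 3) (subseqs [1,2,3,4,5,6,7::7])).
      deform0 (r *s axis 1 1) N = pullback (twist h x y) phi0 N"
    unfolding sorted_triples_7 ball_simps pullback_phi0 twist_columns deform0_axis
    by (intro conjI TrueI; simp add: phi0_rows psi0_sorted psi0_repeated;
       (simp add: algebra_simps)?; (use c c' c'' in linarith)?)
  moreover assume "N \<in> set (filter (\<lambda>N. length N = 3) (subseqs [1,2,3,4,5,6,7::7]))"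
  ultimately show "deform0 (r *s axis 1 1) N = pullback (twist h x y) phi0 N" by blast
qed

lemma twist_gram:
  assumes "h * (x\<^sup>2 + y\<^sup>2) = 1"
  shows "transpose (twist h x y) ** twist h x y =
    (\<chi> i j. if i = j then if i = 1 then h\<^sup>2 else x\<^sup>2 + y\<^sup>2 else 0)"
proof -
  have "\<forall>i j. (transpose (twist h x y) ** twist h x y) $ i $ j =
      (if i = j then if i = 1 then h\<^sup>2 else x\<^sup>2 + y\<^sup>2 else 0)"
    unfolding forall_7 matrix_matrix_mult_def transpose_def vec_lambda_beta twist_columns
    by (intro conjI) (simp_all add: twist_def power2_eq_square)
  then show ?thesis by (simp add: vec_eq_iff)
qed

lemma invertible_twist:
  assumes "h * (x\<^sup>2 + y\<^sup>2) = 1"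
  shows "invertible (twist h x y)"
proof -
  have "det (transpose (twist h x y) ** twist h x y) \<noteq> 0"
    unfolding twist_gram[OF assms] using assms by (subst det_diagonal) (auto simp: prod_zero_iff)
  then show ?thesis by (simp add: det_mul invertible_det_nz)
qed

lemma alternating_cong:
  assumes "alternating n F" "\<And>I. length I = n \<Longrightarrow> F I = G I"
  shows "alternating n G"
  using assms unfolding alternating_def by (metis length_map length_upt diff_zero)

section \<open>Positivity and metric of the deformed form in an adapted frame\<close>

locale adapted =
  fixes \<omega> :: "7 tensor" and u :: "real^7" and P :: "real^7^7" and r k x y :: real
  assumes P: "invertible P" and form: "\<And>I. length I = 3 \<Longrightarrow> \<omega> I = pullback P phi0 I"
    and vec: "P *v u = r *s axis 1 1"
    and root: "x ^ 3 - 3 * x * y\<^sup>2 = 1" "3 * x\<^sup>2 * y - y ^ 3 = - r" and k: "k = x\<^sup>2 + y\<^sup>2"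
begin

text \<open>This is |z^3|^2 = |1 - i r|^2. It replaces the fractional powers of 1 + M by integer
  powers of \<open>k\<close>.\<close>

lemma k3: "k ^ 3 = 1 + r\<^sup>2"
proof -
  have "k ^ 3 = (x ^ 3 - 3 * x * y\<^sup>2)\<^sup>2 + (3 * x\<^sup>2 * y - y ^ 3)\<^sup>2"
    by (simp add: k power3_eq_cube power2_eq_square algebra_simps)
  then show ?thesis using root by simp
qed

lemma k_pos: "k > 0"
proof -
  have "k \<noteq> 0" using k3 sum_power2_gt_zero_iff[of 1 r] by auto
  then show ?thesis using k by (metis sum_power2_ge_zero less_eq_real_def)
qed

lemma hk: "(1 / k) * (x\<^sup>2 + y\<^sup>2) = 1"
  using k_pos by (simp add: k[symmetric])

lemma mv: "metric_volume \<omega> (transpose P ** P) (det P)"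
  by (rule metric_volume_pullback_phi0[OF P form])

lemma metric: "g2_metric \<omega> = transpose P ** P"
  by (rule g2_metric_eq[OF mv])

lemma deform_twist:
  assumes "length I = 3"
  shows "deform \<omega> u I = pullback (twist (1 / k) x y ** P) phi0 I"
proof -
  have "deform \<omega> u I = pullback P (deform0 (r *s axis 1 1)) I"
    using deform_pullback_phi0[OF P form assms] vec by simp
  also have "\<dots> = pullback P (pullback (twist (1 / k) x y) phi0) I"
    by (rule pullback_cong) (simp add: deform0_twist[OF root hk] assms)
  finally show ?thesis by (simp add: pullback_pullback)
qed

lemma invertible_twist_P: "invertible (twist (1 / k) x y ** P)"
  by (rule invertible_mult[OF invertible_twist[OF hk] P])

lemma deform_positive: "positive_form (deform \<omega> u)"
  unfolding positive_form_def using invertible_twist_P deform_twist by blast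

lemma deform_alternating: "alternating 3 (deform \<omega> u)"
  by (rule alternating_cong[OF alternating_pullback[OF alternating_phi0]]) (simp add: deform_twist)

lemma deform_metric_frame: "g2_metric (deform \<omega> u) =
    transpose P ** (\<chi> i j. if i = j then if i = 1 then (1 / k)\<^sup>2 else k else 0) ** P"
proof -
  have "g2_metric (deform \<omega> u) = transpose (twist (1 / k) x y ** P) ** (twist (1 / k) x y ** P)"
    by (rule g2_metric_pullback_phi0[OF invertible_twist_P deform_twist])
  also have "\<dots> = transpose P ** (transpose (twist (1 / k) x y) ** twist (1 / k) x y) ** P"
    by (simp add: matrix_transpose_mul matrix_mul_assoc)
  finally show ?thesis by (simp only: twist_gram[OF hk] k[symmetric])
qed

lemma norm_u: "u \<bullet> (g2_metric \<omega> *v u) = r\<^sup>2"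
proof -
  have "u \<bullet> (g2_metric \<omega> *v u) = (P *v u) \<bullet> (P *v u)"
    by (simp add: metric matrix_vector_mul_assoc[symmetric] inner_vector_matrix)
  then show ?thesis
    by (simp add: vec inner_vec_def axis_def sum_7 power2_eq_square)
qed

lemma flat_u: "(g2_metric \<omega> *v u) $ i = r * P $ 1 $ i"
proof -
  have "g2_metric \<omega> *v u = (r *s axis 1 1) v* P"
    by (simp add: metric matrix_vector_mul_assoc[symmetric] vec)
  then show ?thesis by (simp add: vector_matrix_mult_def axis_def sum_7)
qed

lemma powr_k: "(1 + r\<^sup>2) powr (- 2 / 3) = 1 / k\<^sup>2" "(1 + r\<^sup>2) powr (- 1 / 3) = 1 / k"
  "(1 + r\<^sup>2) powr (- 4 / 3) = 1 / k ^ 4"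
proof -
  have "1 + r\<^sup>2 = k powr 3" using k3 k_pos by (simp add: powr_numeral)
  then have e: "(1 + r\<^sup>2) powr a = k powr (3 * a)" for a by (simp only: powr_powr)
  show "(1 + r\<^sup>2) powr (- 2 / 3) = 1 / k\<^sup>2" "(1 + r\<^sup>2) powr (- 1 / 3) = 1 / k"
    "(1 + r\<^sup>2) powr (- 4 / 3) = 1 / k ^ 4"
    unfolding e using k_pos by (simp_all add: powr_minus_divide powr_numeral)
qed

lemma deform_metric: "g2_metric (deform \<omega> u) $ i $ j =
    (1 + u \<bullet> (g2_metric \<omega> *v u)) powr (- 2 / 3) * ((1 + u \<bullet> (g2_metric \<omega> *v u)) * g2_metric \<omega> $ i $ j
      - (g2_metric \<omega> *v u) $ i * (g2_metric \<omega> *v u) $ j)"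
proof -
  let ?d = "\<lambda>l::7. if l = 1 then (1 / k)\<^sup>2 else k"
  have "g2_metric (deform \<omega> u) $ i $ j = (\<Sum>l\<in>UNIV. ?d l * P $ l $ i * P $ l $ j)"
    by (simp add: deform_metric_frame matrix_matrix_mult_def transpose_def sum_7)
  also have "\<dots> = k * (\<Sum>l\<in>UNIV. P $ l $ i * P $ l $ j) + ((1 / k)\<^sup>2 - k) * P $ 1 $ i * P $ 1 $ j"
    by (simp add: sum_7 algebra_simps)
  also have "(\<Sum>l\<in>UNIV. P $ l $ i * P $ l $ j) = g2_metric \<omega> $ i $ j"
    by (simp add: metric matrix_matrix_mult_def transpose_def)
  \<comment> \<open>By k^3 = 1 + r^2 the left side is (1 - k^3) / k^2.\<close>
  also have "(1 / k)\<^sup>2 - k = - (1 / k\<^sup>2) * r\<^sup>2"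
    using k3 k_pos by (simp add: field_simps power2_eq_square power3_eq_cube)
  finally have 1: "g2_metric (deform \<omega> u) $ i $ j =
      k * g2_metric \<omega> $ i $ j + - (1 / k\<^sup>2) * r\<^sup>2 * P $ 1 $ i * P $ 1 $ j" .
  have 2: "1 / k\<^sup>2 * (1 + r\<^sup>2) = k"
    using k3 k_pos by (simp add: field_simps power2_eq_square power3_eq_cube)
  have "c * (R * G - r * p * (r * q)) = (c * R) * G + - c * r\<^sup>2 * p * q" for c R G p q :: real
    by (simp add: algebra_simps power2_eq_square)
  then have "1 / k\<^sup>2 * ((1 + r\<^sup>2) * g2_metric \<omega> $ i $ j - r * P $ 1 $ i * (r * P $ 1 $ j)) =
      (1 / k\<^sup>2 * (1 + r\<^sup>2)) * g2_metric \<omega> $ i $ j + - (1 / k\<^sup>2) * r\<^sup>2 * P $ 1 $ i * P $ 1 $ j"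
    .
  then show ?thesis
    unfolding norm_u flat_u powr_k 1 2 by simp
qed

end

section \<open>Frame-free consequences for positive forms\<close>

lemma adapted_exists:
  assumes "positive_form \<omega>"
  obtains P r k x y where "adapted \<omega> u P r k x y"
proof -
  obtain P r where P: "invertible P" "\<And>I. length I = 3 \<Longrightarrow> \<omega> I = pullback P phi0 I"
      "P *v u = r *s axis 1 1"
    using adapted_frame[OF assms, of u] by metis
  obtain x y :: real where "x ^ 3 - 3 * x * y\<^sup>2 = 1" "3 * x\<^sup>2 * y - y ^ 3 = - r"
    using cube_root_components[of r] by metis
  then have "adapted \<omega> u P r (x\<^sup>2 + y\<^sup>2) x y"
    using P by unfold_locales auto
  then show ?thesis by (rule that)
qed

lemma positive_deform: "positive_form \<omega> \<Longrightarrow> positive_form (deform \<omega> u)"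
  using adapted_exists[of \<omega> u] adapted.deform_positive by metis

lemma alternating_deform: "positive_form \<omega> \<Longrightarrow> alternating 3 (deform \<omega> u)"
  using adapted_exists[of \<omega> u] adapted.deform_alternating by metis

text \<open>The formula no longer mentions the adapted frame, so it can be differentiated along a
  curve on which that frame would vary.\<close>

lemma deform_metric:
  assumes "positive_form \<omega>"
  shows "g2_metric (deform \<omega> u) $ i $ j =
    (1 + u \<bullet> (g2_metric \<omega> *v u)) powr (- 2 / 3) * ((1 + u \<bullet> (g2_metric \<omega> *v u)) * g2_metric \<omega> $ i $ j
      - (g2_metric \<omega> *v u) $ i * (g2_metric \<omega> *v u) $ j)"
proof -
  obtain P r k x y where "adapted \<omega> u P r k x y" using adapted_exists[OF assms, of u] .
  then show ?thesis by (rule adapted.deform_metric)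
qed

lemma positive_metric_volume:
  assumes "positive_form \<omega>"
  obtains \<mu> where "metric_volume \<omega> (g2_metric \<omega>) \<mu>"
proof -
  obtain P where P: "invertible P" "\<And>I. length I = 3 \<Longrightarrow> \<omega> I = pullback P phi0 I"
    using assms unfolding positive_form_def by blast
  show ?thesis
    using that metric_volume_pullback_phi0[OF P] g2_metric_pullback_phi0[OF P] by simp
qed

lemma invertible_g2_metric: "positive_form \<omega> \<Longrightarrow> invertible (g2_metric \<omega>)"
  by (metis positive_metric_volume metric_volume_nonzero(2))

lemma g2_metric_symmetric: "positive_form \<omega> \<Longrightarrow> transpose (g2_metric \<omega>) = g2_metric \<omega>"
  by (metis positive_metric_volume metric_volume_symmetric)

lemma g2_psi_last:
  assumes "positive_form \<omega>"
  shows "g2_psi \<omega> [b, c, d, a] = - g2_psi \<omega> [a, b, c, d]"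
proof -
  obtain P where P: "invertible P" "\<And>I. length I = 3 \<Longrightarrow> \<omega> I = pullback P phi0 I"
    using assms unfolding positive_form_def by blast
  have alt: "alternating 4 (pullback P psi0)" by (rule alternating_pullback[OF alternating_psi0])
  show ?thesis
    using alternating_swap[OF alt, of "[b, c]" d a "[]"] alternating_swap[OF alt, of "[b]" c a "[d]"]
      alternating_swap[OF alt, of "[]" b a "[c, d]"]
    by (simp add: g2_psi_pullback_phi0[OF P])
qed

lemma deform_Lambda3_7:
  assumes "positive_form \<omega>"
  shows "(\<lambda>I. deform \<omega> u I - \<omega> I) \<in> Lambda3_7 \<omega>"
proof -
  let ?g = "g2_metric \<omega>"
  \<comment> \<open>The witness is the covector of -u: the deformation contracts the last slot of
    \<psi>, whereas \<open>Lambda3_7\<close> contracts the first.\<close>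
  have "sharp ?g (flat ?g (- u)) = matrix_inv ?g *v (?g *v (- u))"
    by (simp add: sharp_def raise_def flat_def matrix_vector_mult_def)
  also have "\<dots> = - u"
    by (simp only: matrix_vector_mul_assoc matrix_inv_mult(2)[OF invertible_g2_metric[OF assms]] matrix_vector_mul_lid)
  finally have "interior_prod (sharp ?g (flat ?g (- u))) (g2_psi \<omega>) [b, c, d] =
      (\<Sum>j\<in>UNIV. u $ j * g2_psi \<omega> [b, c, d, j])" for b c d
    by (simp add: interior_prod_def g2_psi_last[OF assms, of b c d])
  then show ?thesis
    unfolding Lambda3_7_def by (auto simp: deform_eq_positive[OF assms] intro!: exI[of _ "flat ?g (- u)"])
qed

lemma sum_swap_4: "(\<Sum>c\<in>C. \<Sum>d\<in>D. \<Sum>i\<in>A. \<Sum>j\<in>B. f c d i j) =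
    (\<Sum>i\<in>A. \<Sum>j\<in>B. \<Sum>d\<in>D. \<Sum>c\<in>C. f c d i j)"
  for f :: "'a \<Rightarrow> 'b \<Rightarrow> 'c \<Rightarrow> 'd \<Rightarrow> real"
proof -
  have "(\<Sum>c\<in>C. \<Sum>d\<in>D. \<Sum>i\<in>A. \<Sum>j\<in>B. f c d i j) = (\<Sum>i\<in>A. \<Sum>d\<in>D. \<Sum>c\<in>C. \<Sum>j\<in>B. f c d i j)"
    by (rule sum_swap_3)
  also have "\<dots> = (\<Sum>i\<in>A. \<Sum>j\<in>B. \<Sum>c\<in>C. \<Sum>d\<in>D. f c d i j)"
    by (rule sum.cong[OF refl], rule sum_swap_3)
  also have "\<dots> = (\<Sum>i\<in>A. \<Sum>j\<in>B. \<Sum>d\<in>D. \<Sum>c\<in>C. f c d i j)"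
    by (rule sum.cong[OF refl], rule sum.cong[OF refl], rule sum.swap)
  finally show ?thesis .
qed

text \<open>Pulling back \<open>psi0_identity\<close> expresses \<psi> by the form, the metric and
  its inverse. Smoothness and derivatives of \<psi> follow without treating the Hodge dual
  again.\<close>

lemma psi_identity:
  assumes "positive_form \<omega>"
  shows "g2_psi \<omega> [a, b, m, n] =
    (\<Sum>c\<in>UNIV. \<Sum>d\<in>UNIV. \<omega> [a, b, c] * matrix_inv (g2_metric \<omega>) $ c $ d * \<omega> [m, n, d])
    - g2_metric \<omega> $ a $ m * g2_metric \<omega> $ b $ n + g2_metric \<omega> $ a $ n * g2_metric \<omega> $ b $ m"
proof -
  obtain P where P: "invertible P" "\<And>I. length I = 3 \<Longrightarrow> \<omega> I = pullback P phi0 I"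
    using assms unfolding positive_form_def by blast
  let ?g = "g2_metric \<omega>"
  have g: "?g = transpose P ** P" by (rule g2_metric_pullback_phi0[OF P])
  have gc: "?g $ i $ j = (\<Sum>l\<in>UNIV. P $ l $ i * P $ l $ j)" for i j
    by (simp add: g matrix_matrix_mult_def transpose_def)
  have "?g ** (matrix_inv P ** transpose (matrix_inv P)) =
      transpose P ** (P ** matrix_inv P) ** transpose (matrix_inv P)"
    by (simp add: g matrix_mul_assoc)
  also have "\<dots> = mat 1"
    by (simp add: matrix_inv_mult[OF P(1)] matrix_transpose_mul[symmetric] transpose_mat)
  finally have "matrix_inv ?g = matrix_inv P ** transpose (matrix_inv P)" by (rule matrix_inv_eqI)
  \<comment> \<open>In the frame given by \<open>P\<close> the inverse metric is the identity
    matrix.\<close>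
  then have "P ** matrix_inv ?g ** transpose P =
      (P ** matrix_inv P) ** (transpose (matrix_inv P) ** transpose P)"
    by (simp add: matrix_mul_assoc)
  also have "\<dots> = mat 1"
    by (simp add: matrix_inv_mult[OF P(1)] matrix_transpose_mul[symmetric] transpose_mat)
  finally have "(P ** matrix_inv ?g ** transpose P) $ i $ j = (if i = j then 1 else 0)" for i j
    by (simp add: mat_def)
  then have inv: "(\<Sum>d\<in>UNIV. \<Sum>c\<in>UNIV. P $ i $ c * matrix_inv ?g $ c $ d * P $ j $ d) =
      (if i = j then 1 else 0)" for i j
    by (simp add: matrix_matrix_mult_def transpose_def sum_distrib_right)
  have ite: "(\<Sum>k\<in>UNIV. P $ k $ m * (\<Sum>l\<in>UNIV. P $ l $ n * (if i = k \<and> j = l then 1 else 0))) = P $ i $ m * P $ j $ n"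
    for i j m n
  proof -
    have 1: "(\<Sum>l\<in>UNIV. P $ l $ n * (if i = k \<and> j = l then 1 else 0)) = (if i = k then P $ j $ n else 0)" for k
      by (cases "i = k") (simp_all add: if_distrib cong: if_cong)
    show ?thesis unfolding 1 by (simp add: if_distrib cong: if_cong)
  qed
  have ite': "(\<Sum>k\<in>UNIV. P $ k $ m * (\<Sum>l\<in>UNIV. P $ l $ n * (if i = l \<and> j = k then 1 else 0))) = P $ j $ m * P $ i $ n"
    for i j m n
    using ite[of m n j i] by (simp only: conj_commute)
  \<comment> \<open>\<open>F k\<close> is the form with its last slot filled by the k-th frame
    vector, so the contraction through the inverse metric becomes a plain sum over k.\<close>
  define F where "F k I = pullback P (\<lambda>J. phi0 (J @ [k])) I" for k I
  have \<omega>: "\<omega> [a, b, c] = (\<Sum>k\<in>UNIV. F k [a, b] * P $ k $ c)" for a b c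
    using pullback_append[of P phi0 "[a, b]" "[c]"]
    by (simp add: P(2) F_def pullback_Cons[of _ _ c] pullback_sum pullback_scale mult.commute)
  have "(\<Sum>c\<in>UNIV. \<Sum>d\<in>UNIV. \<omega> [a, b, c] * matrix_inv ?g $ c $ d * \<omega> [m, n, d]) =
      (\<Sum>c\<in>UNIV. \<Sum>d\<in>UNIV. \<Sum>i\<in>UNIV. \<Sum>j\<in>UNIV. F i [a, b] * F j [m, n] *
        (P $ i $ c * matrix_inv ?g $ c $ d * P $ j $ d))"
    unfolding \<omega> by (simp add: sum_distrib_left sum_distrib_right mult_ac)
  also have "\<dots> = (\<Sum>i\<in>UNIV. \<Sum>j\<in>UNIV. \<Sum>d\<in>UNIV. \<Sum>c\<in>UNIV. F i [a, b] * F j [m, n] *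
        (P $ i $ c * matrix_inv ?g $ c $ d * P $ j $ d))"
    by (rule sum_swap_4)
  also have "\<dots> = (\<Sum>i\<in>UNIV. F i [a, b] * F i [m, n])"
    unfolding sum_distrib_left[symmetric] inv by (simp add: if_distrib cong: if_cong)
  finally have 1: "(\<Sum>c\<in>UNIV. \<Sum>d\<in>UNIV. \<omega> [a, b, c] * matrix_inv ?g $ c $ d * \<omega> [m, n, d]) =
      (\<Sum>i\<in>UNIV. F i [a, b] * F i [m, n])" .
  have "g2_psi \<omega> [a, b, m, n] = pullback P psi0 ([a, b] @ [m, n])"
    by (simp add: g2_psi_pullback_phi0[OF P])
  also have "\<dots> = pullback P (\<lambda>J. pullback P (\<lambda>K. (\<Sum>c\<in>UNIV. phi0 (J @ [c]) * phi0 (K @ [c]))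
      - (if J ! 0 = K ! 0 \<and> J ! 1 = K ! 1 then 1 else 0)
      + (if J ! 0 = K ! 1 \<and> J ! 1 = K ! 0 then 1 else 0)) [m, n]) [a, b]"
    unfolding pullback_append
  proof (intro pullback_cong)
    fix J K :: "7 list" assume "length J = length [a, b]" "length K = length [m, n]"
    then obtain i j l q where "J = [i, j]" "K = [l, q]" by (auto simp: length_Suc_conv)
    then show "psi0 (J @ K) = (\<Sum>c\<in>UNIV. phi0 (J @ [c]) * phi0 (K @ [c]))
        - (if J ! 0 = K ! 0 \<and> J ! 1 = K ! 1 then 1 else 0)
        + (if J ! 0 = K ! 1 \<and> J ! 1 = K ! 0 then 1 else 0)"
      by (simp add: psi0_identity)
  qed
  also have "\<dots> = (\<Sum>i\<in>UNIV. F i [a, b] * F i [m, n])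
      - pullback P (\<lambda>J. pullback P (\<lambda>K. if J ! 0 = K ! 0 \<and> J ! 1 = K ! 1 then 1 else 0) [m, n]) [a, b]
      + pullback P (\<lambda>J. pullback P (\<lambda>K. if J ! 0 = K ! 1 \<and> J ! 1 = K ! 0 then 1 else 0) [m, n]) [a, b]"
    by (simp add: pullback_add pullback_diff pullback_sum pullback_scale pullback_scale_right F_def)
  also have "pullback P (\<lambda>J. pullback P (\<lambda>K. if J ! 0 = K ! 0 \<and> J ! 1 = K ! 1 then 1 else 0) [m, n]) [a, b]
      = (\<Sum>i\<in>UNIV. P $ i $ a * (\<Sum>j\<in>UNIV. P $ j $ b * (P $ i $ m * P $ j $ n)))"
    by (simp add: pullback_Cons ite ite')
  also have "\<dots> = ?g $ a $ m * ?g $ b $ n"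
    unfolding gc sum_product by (simp add: sum_distrib_left mult_ac)
  also have "pullback P (\<lambda>J. pullback P (\<lambda>K. if J ! 0 = K ! 1 \<and> J ! 1 = K ! 0 then 1 else 0) [m, n]) [a, b]
      = (\<Sum>i\<in>UNIV. P $ i $ a * (\<Sum>j\<in>UNIV. P $ j $ b * (P $ j $ m * P $ i $ n)))"
    by (simp add: pullback_Cons ite ite')
  also have "\<dots> = ?g $ a $ n * ?g $ b $ m"
    unfolding gc sum_product by (simp add: sum_distrib_left mult_ac)
  finally show ?thesis unfolding 1 .
qed

section \<open>Smooth functions\<close>

lemma partial_deriv_eq: "(f has_derivative D) (at x) \<Longrightarrow> partial_deriv i f x = D (axis i 1)"
  unfolding partial_deriv_def by (metis frechet_derivative_at)

lemma differentiable_cong_open: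
  assumes "open S" "x \<in> S" "\<And>y. y \<in> S \<Longrightarrow> f y = g y" "(f has_derivative D) (at x)"
  shows "(g has_derivative D) (at x)"
  using has_derivative_transform_within_open[OF assms(4,1,2)] assms(3) by blast

lemma Ck_on_cong:
  assumes S: "open S" and "\<And>x. x \<in> S \<Longrightarrow> f x = g x" and "Ck_on k S f"
  shows "Ck_on k S g"
  using assms(2,3)
proof (induction k arbitrary: f g)
  case 0
  have "continuous_on S f \<longleftrightarrow> continuous_on S g"
    by (rule continuous_on_cong) (simp_all add: 0)
  then show ?case using 0 by simp
next
  case (Suc k)
  have D: "(g has_derivative frechet_derivative f (at x)) (at x)" if "x \<in> S" for x
    by (rule differentiable_cong_open[OF S that, of f])
       (use Suc.prems that in \<open>auto simp: frechet_derivative_works[symmetric]\<close>)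
  have "partial_deriv i f x = partial_deriv i g x" if "x \<in> S" for i x
    unfolding partial_deriv_eq[OF D[OF that]] by (simp only: partial_deriv_def)
  moreover have "Ck_on k S (partial_deriv i f)" for i using Suc.prems by simp
  ultimately have "Ck_on k S (partial_deriv i g)" for i using Suc.IH by blast
  then show ?case using D by (auto simp: differentiable_def)
qed

lemma Ck_on_SucD: "Ck_on (Suc k) S f \<Longrightarrow> Ck_on k S f"
proof (induction k arbitrary: f)
  case 0
  then show ?case
    by (auto intro!: continuous_at_imp_continuous_on differentiable_imp_continuous_within)
next
  case (Suc k)
  have "Ck_on k S (partial_deriv i f)" for i
    by (rule Suc.IH) (use Suc.prems in simp)
  then show ?case using Suc.prems by simp
qed

text \<open>Allows the derivative to be supplied as an explicit formula on \<open>S\<close>, whereas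
  \<open>Ck_on\<close> refers to the chosen Frechet derivative.\<close>

lemma Ck_on_SucI:
  assumes S: "open S" and D: "\<And>x. x \<in> S \<Longrightarrow> (f has_derivative D x) (at x)"
    and C: "\<And>i. Ck_on k S (\<lambda>x. D x (axis i 1))"
  shows "Ck_on (Suc k) S f"
proof -
  have "Ck_on k S (partial_deriv i f)" for i
    by (rule Ck_on_cong[OF S _ C[of i]]) (simp add: partial_deriv_eq[OF D])
  then show ?thesis using D by (auto simp: differentiable_def)
qed

lemma Ck_on_SucE:
  assumes "Ck_on (Suc k) S f" "x \<in> S"
  shows "(f has_derivative frechet_derivative f (at x)) (at x)"
  using assms by (simp add: frechet_derivative_works[symmetric])

lemma Ck_on_partial: "Ck_on (Suc k) S f \<Longrightarrow> Ck_on k S (\<lambda>x. frechet_derivative f (at x) (axis i 1))"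
  by (simp add: partial_deriv_def[abs_def])

lemma Ck_on_const: "open S \<Longrightarrow> Ck_on k S (\<lambda>x. c)"
proof (induction k arbitrary: c)
  case (Suc k)
  then show ?case by (intro Ck_on_SucI[where D = "\<lambda>x h. 0"]) auto
qed simp

lemma Ck_on_add:
  assumes S: "open S"
  shows "Ck_on k S f \<Longrightarrow> Ck_on k S g \<Longrightarrow> Ck_on k S (\<lambda>x. f x + g x)"
proof (induction k arbitrary: f g)
  case (Suc k)
  show ?case
    by (rule Ck_on_SucI[OF S has_derivative_add[OF Ck_on_SucE[OF Suc.prems(1)] Ck_on_SucE[OF Suc.prems(2)]]],
        assumption, assumption, rule Suc.IH[OF Ck_on_partial[OF Suc.prems(1)] Ck_on_partial[OF Suc.prems(2)]])
qed (simp add: continuous_on_add)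

lemma Ck_on_mult:
  assumes S: "open S"
  shows "Ck_on k S f \<Longrightarrow> Ck_on k S g \<Longrightarrow> Ck_on k S (\<lambda>x. f x * g x)"
proof (induction k arbitrary: f g)
  case (Suc k)
  show ?case
    by (rule Ck_on_SucI[OF S has_derivative_mult[OF Ck_on_SucE[OF Suc.prems(1)] Ck_on_SucE[OF Suc.prems(2)]]],
        assumption, assumption,
        rule Ck_on_add[OF S Suc.IH[OF Ck_on_SucD[OF Suc.prems(1)] Ck_on_partial[OF Suc.prems(2)]]
          Suc.IH[OF Ck_on_partial[OF Suc.prems(1)] Ck_on_SucD[OF Suc.prems(2)]]])
qed (simp add: continuous_on_mult)

text \<open>The derivative -f'/f^2 is built from 1/f itself, which has k continuous derivatives by
  induction; this gains one more order.\<close>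

lemma Ck_on_inverse:
  assumes S: "open S"
  shows "Ck_on k S f \<Longrightarrow> (\<And>x. x \<in> S \<Longrightarrow> f x \<noteq> 0) \<Longrightarrow> Ck_on k S (\<lambda>x. inverse (f x))"
proof (induction k arbitrary: f)
  case (Suc k)
  note I = Suc.IH[OF Ck_on_SucD[OF Suc.prems(1)] Suc.prems(2)]
  show ?case
  proof (rule Ck_on_SucI[OF S])
    fix x assume "x \<in> S"
    then show "((\<lambda>x. inverse (f x)) has_derivative
        (\<lambda>h. - (inverse (f x) * frechet_derivative f (at x) h * inverse (f x)))) (at x)"
      by (intro Deriv.has_derivative_inverse Suc.prems(2) Ck_on_SucE[OF Suc.prems(1)])
  next
    fix i
    have "Ck_on k S (\<lambda>x. (- 1) * (inverse (f x) * frechet_derivative f (at x) (axis i 1) * inverse (f x)))"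
      by (intro Ck_on_mult[OF S] Ck_on_const[OF S] I Ck_on_partial[OF Suc.prems(1)])
    then show "Ck_on k S (\<lambda>x. - (inverse (f x) * frechet_derivative f (at x) (axis i 1) * inverse (f x)))"
      by simp
  qed
qed (auto intro: continuous_on_inverse)

lemma Ck_on_power:
  assumes S: "open S"
  shows "Ck_on k S f \<Longrightarrow> Ck_on k S (\<lambda>x. f x ^ n)"
  by (induction n) (auto intro: Ck_on_const[OF S] Ck_on_mult[OF S])

lemma Ck_on_odd_root:
  assumes S: "open S" and n: "odd n"
  shows "Ck_on k S f \<Longrightarrow> (\<And>x. x \<in> S \<Longrightarrow> f x \<noteq> 0) \<Longrightarrow> Ck_on k S (\<lambda>x. root n (f x))"
proof (induction k arbitrary: f)
  case (Suc k)
  have n0: "n > 0" using n by (cases n) auto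
  note I = Suc.IH[OF Ck_on_SucD[OF Suc.prems(1)] Suc.prems(2)]
  show ?case
  proof (rule Ck_on_SucI[OF S])
    fix x assume x: "x \<in> S"
    show "((\<lambda>x. root n (f x)) has_derivative
        (\<lambda>h. inverse (real n * root n (f x) ^ (n - Suc 0)) * frechet_derivative f (at x) h)) (at x)"
      by (rule has_derivative_compose[OF Ck_on_SucE[OF Suc.prems(1) x]
            has_field_derivative_imp_has_derivative[OF DERIV_odd_real_root[OF n Suc.prems(2)[OF x]]]])
  next
    fix i
    show "Ck_on k S (\<lambda>x. inverse (real n * root n (f x) ^ (n - Suc 0)) * frechet_derivative f (at x) (axis i 1))"
      using Suc.prems(2) n0
      by (intro Ck_on_mult[OF S] Ck_on_inverse[OF S Ck_on_mult[OF S Ck_on_const[OF S] Ck_on_power[OF S I]]]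
            Ck_on_partial[OF Suc.prems(1)]) (auto simp: real_root_eq_0_iff)
  qed
next
  case 0
  then show ?case by (auto intro: continuous_on_real_root)
qed

lemma smooth_on_cong:
  "open S \<Longrightarrow> (\<And>x. x \<in> S \<Longrightarrow> f x = g x) \<Longrightarrow> smooth_on S f \<Longrightarrow> smooth_on S g"
  unfolding smooth_on_def using Ck_on_cong by blast

lemma smooth_on_differentiable: "smooth_on S f \<Longrightarrow> x \<in> S \<Longrightarrow> f differentiable (at x)"
  unfolding smooth_on_def by (metis Ck_on.simps(2))

lemma smooth_on_const: "open S \<Longrightarrow> smooth_on S (\<lambda>x. c)"
  by (simp add: smooth_on_def Ck_on_const)

lemma smooth_on_add: "open S \<Longrightarrow> smooth_on S f \<Longrightarrow> smooth_on S g \<Longrightarrow> smooth_on S (\<lambda>x. f x + g x)"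
  by (simp add: smooth_on_def Ck_on_add)

lemma smooth_on_mult: "open S \<Longrightarrow> smooth_on S f \<Longrightarrow> smooth_on S g \<Longrightarrow> smooth_on S (\<lambda>x. f x * g x)"
  by (simp add: smooth_on_def Ck_on_mult)

lemma smooth_on_minus: "open S \<Longrightarrow> smooth_on S f \<Longrightarrow> smooth_on S (\<lambda>x. - f x)"
  using smooth_on_mult[OF _ smooth_on_const, of S f "- 1"] by simp

lemma smooth_on_diff: "open S \<Longrightarrow> smooth_on S f \<Longrightarrow> smooth_on S g \<Longrightarrow> smooth_on S (\<lambda>x. f x - g x)"
  using smooth_on_add[of S f "\<lambda>x. - g x"] smooth_on_minus[of S g] by simp

lemma smooth_on_inverse:
  "open S \<Longrightarrow> smooth_on S f \<Longrightarrow> (\<And>x. x \<in> S \<Longrightarrow> f x \<noteq> 0) \<Longrightarrow> smooth_on S (\<lambda>x. inverse (f x))"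
  by (simp add: smooth_on_def Ck_on_inverse)

lemma smooth_on_divide:
  "open S \<Longrightarrow> smooth_on S f \<Longrightarrow> smooth_on S g \<Longrightarrow> (\<And>x. x \<in> S \<Longrightarrow> g x \<noteq> 0) \<Longrightarrow> smooth_on S (\<lambda>x. f x / g x)"
  unfolding divide_inverse by (intro smooth_on_mult smooth_on_inverse)

lemma smooth_on_odd_root:
  "open S \<Longrightarrow> odd n \<Longrightarrow> smooth_on S f \<Longrightarrow> (\<And>x. x \<in> S \<Longrightarrow> f x \<noteq> 0) \<Longrightarrow> smooth_on S (\<lambda>x. root n (f x))"
  by (simp add: smooth_on_def Ck_on_odd_root)

lemma smooth_on_sum:
  assumes "open S" "\<And>a. a \<in> A \<Longrightarrow> smooth_on S (f a)"
  shows "smooth_on S (\<lambda>x. \<Sum>a\<in>A. f a x)"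
  using assms(2)
  by (induction A rule: infinite_finite_induct) (auto intro: smooth_on_const smooth_on_add assms(1))

lemma smooth_on_prod:
  assumes "open S" "\<And>a. a \<in> A \<Longrightarrow> smooth_on S (f a)"
  shows "smooth_on S (\<lambda>x. \<Prod>a\<in>A. f a x)"
  using assms(2)
  by (induction A rule: infinite_finite_induct) (auto intro: smooth_on_const smooth_on_mult assms(1))

lemmas smooth_on_intros = smooth_on_const smooth_on_add smooth_on_mult smooth_on_minus
  smooth_on_diff smooth_on_sum smooth_on_prod

lemma smooth_on_det:
  assumes "open S" "\<And>i j. smooth_on S (\<lambda>x. A x $ i $ j)"
  shows "smooth_on S (\<lambda>x. det (A x))"
  unfolding det_def by (intro smooth_on_intros assms)

text \<open>As quotients of determinants, the entries of the inverse inherit smoothness and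
  vanishing first derivatives from the matrix.\<close>

lemma matrix_inv_cramer:
  fixes A :: "real^'n^'n"
  assumes "invertible A"
  shows "matrix_inv A $ i $ j = det (\<chi> p q. if q = i then axis j 1 $ p else A $ p $ q) / det A"
proof -
  have "A *v (matrix_inv A *v axis j 1) = axis j 1"
    by (simp add: matrix_vector_mul_assoc matrix_inv_mult[OF assms])
  then have "matrix_inv A *v axis j 1 = (\<chi> i. det (\<chi> p q. if q = i then axis j 1 $ p else A $ p $ q) / det A)"
    using cramer[of A] assms invertible_det_nz[of A] by blast
  then show ?thesis
    by (simp add: vec_eq_iff matrix_vector_mult_basis column_def)
qed

lemma smooth_on_matrix_inv:
  fixes A :: "real^'m \<Rightarrow> real^'n^'n"
  assumes S: "open S" and A: "\<And>i j. smooth_on S (\<lambda>x. A x $ i $ j)" and inv: "\<And>x. x \<in> S \<Longrightarrow> invertible (A x)"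
  shows "smooth_on S (\<lambda>x. matrix_inv (A x) $ i $ j)"
proof (rule smooth_on_cong[OF S])
  fix x assume "x \<in> S"
  then show "det (\<chi> p q. if q = i then axis j 1 $ p else A x $ p $ q) / det (A x) = matrix_inv (A x) $ i $ j"
    by (simp add: matrix_inv_cramer inv)
next
  have "smooth_on S (\<lambda>x. if q = i then c else A x $ p $ q)" for p q c
    by (cases "q = i") (simp_all add: smooth_on_const[OF S] A)
  note c = this
  show "smooth_on S (\<lambda>x. det (\<chi> p q. if q = i then axis j 1 $ p else A x $ p $ q) / det (A x))"
    by (intro smooth_on_divide smooth_on_det S A) (use inv invertible_det_nz in \<open>auto simp: c\<close>)
qed

section \<open>Smoothness of the metric, the dual and the deformed form\<close>

lemma smooth_on_interior_prod:
  assumes "open S" "\<And>J. length J = Suc (length I) \<Longrightarrow> smooth_on S (\<lambda>x. \<omega> x J)"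
  shows "smooth_on S (\<lambda>x. interior_prod u (\<omega> x) I)"
  unfolding interior_prod_def by (intro smooth_on_intros assms) (simp add: assms)

lemma smooth_on_wedge:
  assumes S: "open S" and "\<And>L. length L = k \<Longrightarrow> smooth_on S (\<lambda>x. \<alpha> x L)"
    "\<And>L. length L = l \<Longrightarrow> smooth_on S (\<lambda>x. \<beta> x L)"
  shows "smooth_on S (\<lambda>x. wedge k l (\<alpha> x) (\<beta> x) I)"
  unfolding wedge_def by (intro smooth_on_divide smooth_on_intros S assms) auto

lemma smooth_on_form_matrix:
  assumes S: "open S" and "\<And>I. length I = 3 \<Longrightarrow> smooth_on S (\<lambda>x. \<omega> x I)"
  shows "smooth_on S (\<lambda>x. form_matrix (\<omega> x) $ i $ j)"
  unfolding form_matrix_def vec_lambda_beta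
  by (intro smooth_on_divide smooth_on_const smooth_on_wedge smooth_on_interior_prod S assms) auto

text \<open>From \<mu> g = B and \<mu>^9 = det B. This turns the definite description of the metric
  into an explicit expression in the components of the form.\<close>

lemma g2_metric_root:
  assumes "positive_form \<omega>"
  shows "g2_metric \<omega> $ i $ j = form_matrix \<omega> $ i $ j / root 9 (det (form_matrix \<omega>))"
    and "det (form_matrix \<omega>) \<noteq> 0"
proof -
  obtain \<mu> where mv: "metric_volume \<omega> (g2_metric \<omega>) \<mu>" using positive_metric_volume[OF assms] .
  note \<mu> = metric_volume_form_matrix[OF mv] metric_volume_nonzero(1)[OF mv]
  show "det (form_matrix \<omega>) \<noteq> 0" using \<mu>(3) by (simp add: \<mu>(2)[symmetric])
  have "root 9 (det (form_matrix \<omega>)) = \<mu>" by (simp add: \<mu>(2)[symmetric] odd_real_root_power_cancel)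
  then show "g2_metric \<omega> $ i $ j = form_matrix \<omega> $ i $ j / root 9 (det (form_matrix \<omega>))"
    using \<mu>(3) by (simp add: \<mu>(1)[symmetric])
qed

lemma smooth_on_g2_metric:
  assumes S: "open S" and \<omega>: "\<And>I. length I = 3 \<Longrightarrow> smooth_on S (\<lambda>x. \<omega> x I)"
    and pos: "\<And>x. x \<in> S \<Longrightarrow> positive_form (\<omega> x)"
  shows "smooth_on S (\<lambda>x. g2_metric (\<omega> x) $ i $ j)"
proof (rule smooth_on_cong[OF S])
  note B = smooth_on_form_matrix[OF S \<omega>]
  show "smooth_on S (\<lambda>x. form_matrix (\<omega> x) $ i $ j / root 9 (det (form_matrix (\<omega> x))))"
    by (intro smooth_on_divide smooth_on_odd_root smooth_on_det B S)
       (use g2_metric_root(2)[OF pos] in \<open>auto simp: real_root_eq_0_iff\<close>)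
qed (simp add: g2_metric_root(1)[OF pos])

lemma smooth_on_g2_psi:
  assumes S: "open S" and \<omega>: "\<And>I. length I = 3 \<Longrightarrow> smooth_on S (\<lambda>x. \<omega> x I)"
    and pos: "\<And>x. x \<in> S \<Longrightarrow> positive_form (\<omega> x)"
  shows "smooth_on S (\<lambda>x. g2_psi (\<omega> x) [a, b, c, d])"
proof (rule smooth_on_cong[OF S])
  note g = smooth_on_g2_metric[OF S \<omega> pos]
  show "smooth_on S (\<lambda>x. (\<Sum>i\<in>UNIV. \<Sum>j\<in>UNIV. \<omega> x [a, b, i] * matrix_inv (g2_metric (\<omega> x)) $ i $ j * \<omega> x [c, d, j])
    - g2_metric (\<omega> x) $ a $ c * g2_metric (\<omega> x) $ b $ d + g2_metric (\<omega> x) $ a $ d * g2_metric (\<omega> x) $ b $ c)"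
    by (intro smooth_on_intros S g \<omega> smooth_on_matrix_inv invertible_g2_metric pos) simp_all
qed (simp add: psi_identity[OF pos])

lemma smooth_on_deform:
  assumes S: "open S" and \<omega>: "\<And>I. length I = 3 \<Longrightarrow> smooth_on S (\<lambda>x. \<omega> x I)"
    and pos: "\<And>x. x \<in> S \<Longrightarrow> positive_form (\<omega> x)" and u: "\<And>j. smooth_on S (\<lambda>x. u x $ j)"
    and I: "length I = 3"
  shows "smooth_on S (\<lambda>x. deform (\<omega> x) (u x) I)"
proof -
  obtain a b c where abc: "I = [a, b, c]" using I by (rule list3_cases)
  have eq: "\<omega> x I + (\<Sum>j\<in>UNIV. u x $ j * g2_psi (\<omega> x) [a, b, c, j]) = deform (\<omega> x) (u x) I" if "x \<in> S" for x
    using deform_eq_positive[OF pos[OF that] I] by (simp add: abc)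
  have "smooth_on S (\<lambda>x. \<omega> x I + (\<Sum>j\<in>UNIV. u x $ j * g2_psi (\<omega> x) [a, b, c, j]))"
    by (intro smooth_on_intros S \<omega> u I smooth_on_g2_psi pos)
  then show ?thesis by (rule smooth_on_cong[OF S eq, rotated]) assumption
qed

lemma chart_inv_in: "x \<in> snd c ` fst c \<Longrightarrow> chart_inv c x \<in> fst c"
  unfolding chart_inv_def by (rule inv_into_into)

lemma g2_structure_deform:
  assumes X: "smooth_manifold X \<A>" and g2: "g2_structure \<A> \<phi>" and v: "smooth_vector_field \<A> v"
  shows "g2_structure \<A> (\<lambda>c p. deform (\<phi> c p) (v c p))"
proof -
  have pos: "positive_form (\<phi> c p)" if "c \<in> \<A>" "p \<in> fst c" for c p
    using g2 that unfolding g2_structure_def by blast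
  have S: "open (snd c ` fst c)" if "c \<in> \<A>" for c
    using X that unfolding smooth_manifold_def by blast
  have "smooth_on (snd c ` fst c) (\<lambda>x. deform (\<phi> c (chart_inv c x)) (v c (chart_inv c x)) I)"
    if "c \<in> \<A>" "length I = 3" for c I
  proof (rule smooth_on_deform[OF S[OF that(1)]])
    show "smooth_on (snd c ` fst c) (\<lambda>x. \<phi> c (chart_inv c x) J)" if "length J = 3" for J
      using g2 \<open>c \<in> \<A>\<close> that unfolding g2_structure_def smooth_tensor_field_def by blast
    show "smooth_on (snd c ` fst c) (\<lambda>x. v c (chart_inv c x) $ j)" for j
      using v \<open>c \<in> \<A>\<close> unfolding smooth_vector_field_def by blast
    show "positive_form (\<phi> c (chart_inv c x))" if "x \<in> snd c ` fst c" for x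
      by (rule pos[OF \<open>c \<in> \<A>\<close> chart_inv_in[OF that]])
  qed (rule that(2))
  moreover have "deform (\<phi> c p) (v c p) I = pullback (jacobian c d p) (deform (\<phi> d p) (v d p)) I"
    if "c \<in> \<A>" "d \<in> \<A>" "p \<in> fst c \<inter> fst d" "length I = 3" for c d p I
  proof -
    have "v d p = jacobian c d p *v v c p"
      using v that unfolding smooth_vector_field_def by blast
    moreover have "\<phi> c p K = pullback (jacobian c d p) (\<phi> d p) K" if "length K = 3" for K
      using g2 \<open>c \<in> \<A>\<close> \<open>d \<in> \<A>\<close> \<open>p \<in> fst c \<inter> fst d\<close> that
      unfolding g2_structure_def smooth_tensor_field_def by blast
    ultimately show ?thesis
      using deform_transform[of "\<phi> d p" "\<phi> c p" "jacobian c d p" I "v c p"] pos that by auto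
  qed
  ultimately show ?thesis
    using alternating_deform positive_deform pos
    unfolding g2_structure_def smooth_tensor_field_def by blast
qed

section \<open>The torsion in an adapted frame\<close>

text \<open>In an adapted frame the vector field is \<open>r\<close> times the first basis vector, and \<open>S\<close> and \<open>T\<close> are the
  components of its covariant derivative and of the torsion.  \<open>torsion_v\<close> and \<open>torsion_t\<close> are the two
  brackets of the formula; \<open>torsion_S\<close> is \<open>12 torsion_v\<close>, written in terms of \<open>S\<close> itself instead of its
  components.\<close>

definition delta1 :: "7 \<Rightarrow> real" where "delta1 i = (if i = 1 then 1 else 0)"

definition torsion_v ::
    "real \<Rightarrow> real \<Rightarrow> (7 \<Rightarrow> real) \<Rightarrow> (7 \<Rightarrow> 7 \<Rightarrow> real) \<Rightarrow> (7 \<Rightarrow> 7 \<Rightarrow> real) \<Rightarrow> 7 \<Rightarrow> 7 \<Rightarrow> real"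
  where "torsion_v r s1 s7 s14 s27 a n =
    s1 * (r * delta1 a * (r * delta1 n) - (1 + r\<^sup>2) * (if a = n then 1 else 0))
    - 4 / 3 * (1 + r\<^sup>2) * s1 * (r * phi0 [a, n, 1])
    - (1 + 4 / 3 * r\<^sup>2) * (\<Sum>m\<in>UNIV. phi0 [a, n, m] * s7 m)
    - 1 / 3 * (\<Sum>p\<in>UNIV. r * psi0 [a, n, 1, p] * s7 p)
    + 5 / 3 * (r * delta1 a) * (\<Sum>p\<in>UNIV. r * phi0 [n, 1, p] * s7 p)
    + 4 / 3 * (r * delta1 n) * (\<Sum>p\<in>UNIV. r * phi0 [a, 1, p] * s7 p)
    + 1 / 3 * (r * s7 1) * (r * phi0 [1, a, n])
    + 1 / 3 * (r * delta1 n) * s7 a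
    + 8 / 3 * (r * delta1 a) * s7 n
    - (1 + r\<^sup>2) * s14 a n
    - 2 * ((r * s14 1 a * (r * delta1 n) - r * s14 1 n * (r * delta1 a)) / 2)
    - 1 / 3 * (\<Sum>m\<in>UNIV. phi0 [a, n, m] * (r * s14 m 1))
    + 1 / 3 * (\<Sum>p\<in>UNIV. r * psi0 [a, n, 1, p] * (r * s14 p 1))
    - (1 + r\<^sup>2) * s27 a n
    + r * s27 1 a * (r * delta1 n)
    - (1 + r\<^sup>2) * (\<Sum>p\<in>UNIV. r * phi0 [1, p, n] * s27 p a)
    - 1 / 3 * (\<Sum>m\<in>UNIV. phi0 [a, n, m] * (r * s27 m 1))
    + 1 / 3 * (\<Sum>p\<in>UNIV. r * psi0 [a, n, 1, p] * (r * s27 p 1))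
    + r * delta1 a * (\<Sum>p\<in>UNIV. r * phi0 [n, 1, p] * (r * s27 p 1))
    - 1 / 3 * (r * phi0 [a, n, 1]) * (r * (r * s27 1 1))"

definition torsion_t :: "real \<Rightarrow> (7 \<Rightarrow> 7 \<Rightarrow> real) \<Rightarrow> 7 \<Rightarrow> 7 \<Rightarrow> real"
  where "torsion_t r T a n = T a n + r * (\<Sum>p\<in>UNIV. phi0 [n, 1, p] * T a p)"

text \<open>The second bracket of the formula is T_an + \<phi>_nmp v^m T_a^p with T decomposed.
  Skewness of \<open>t14\<close> produces its minus sign, and the product of two forms in the
  \<open>t7\<close> part produces the \<psi> term and the two terms quadratic in v and
  \<open>t7\<close> without the form.\<close>

lemma torsion_t_components:
  assumes T: "\<And>a b. T a b = t1 * (if a = b then 1 else 0) + (\<Sum>c\<in>UNIV. t7 c * phi0 [c, a, b]) + t14 a b + t27 a b"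
    and t14: "\<And>a b. t14 a b = - t14 b a" and t27: "\<And>a b. t27 a b = t27 b a"
  shows "torsion_t r T a n = t1 * (if a = n then 1 else 0) + t1 * (r * phi0 [1, a, n])
    + (\<Sum>m\<in>UNIV. phi0 [a, n, m] * t7 m) + r * delta1 a * t7 n - (if a = n then 1 else 0) * (r * t7 1)
    + (\<Sum>m\<in>UNIV. r * psi0 [a, n, m, 1] * t7 m) + t14 a n - (\<Sum>p\<in>UNIV. r * phi0 [n, 1, p] * t14 p a)
    + t27 a n + (\<Sum>p\<in>UNIV. r * phi0 [n, 1, p] * t27 p a)"
proof -
  have cyc: "phi0 [c, a, b] = phi0 [a, b, c]" for a b c by (rule phi0_cyclic)
  have 14: "(\<Sum>p\<in>UNIV. r * phi0 [n, 1, p] * t14 p a) = - r * (\<Sum>p\<in>UNIV. phi0 [n, 1, p] * t14 a p)"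
    unfolding sum_distrib_left by (rule sum.cong) (simp_all add: t14[of _ a])
  have 27: "(\<Sum>p\<in>UNIV. r * phi0 [n, 1, p] * t27 p a) = r * (\<Sum>p\<in>UNIV. phi0 [n, 1, p] * t27 a p)"
    unfolding sum_distrib_left by (rule sum.cong) (simp_all add: t27[of _ a])
  have 7: "\<forall>a n. r * (\<Sum>p\<in>UNIV. phi0 [n, 1, p] * (t1 * (if a = p then 1 else 0) + (\<Sum>c\<in>UNIV. t7 c * phi0 [c, a, p])))
      = t1 * (r * phi0 [1, a, n]) + r * delta1 a * t7 n - (if a = n then 1 else 0) * (r * t7 1)
        + (\<Sum>m\<in>UNIV. r * psi0 [a, n, m, 1] * t7 m)"
    unfolding forall_7
    by (intro conjI; simp add: sum_7 phi0_rows psi0_rows delta1_def; (simp add: algebra_simps)?)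
  have "torsion_t r T a n = T a n + r * (\<Sum>p\<in>UNIV. phi0 [n, 1, p] *
      (t1 * (if a = p then 1 else 0) + (\<Sum>c\<in>UNIV. t7 c * phi0 [c, a, p])))
      + r * (\<Sum>p\<in>UNIV. phi0 [n, 1, p] * t14 a p) + r * (\<Sum>p\<in>UNIV. phi0 [n, 1, p] * t27 a p)"
    by (simp add: torsion_t_def T[of a] distrib_left sum.distrib)
  then show ?thesis
    unfolding 7[rule_format] 14 27 T[of a n]
    by (simp add: cyc[of _ a n] mult.commute[of "t7 _"])
qed

definition torsion_S :: "real \<Rightarrow> (7 \<Rightarrow> 7 \<Rightarrow> real) \<Rightarrow> 7 \<Rightarrow> 7 \<Rightarrow> real"
  where "torsion_S r S a n = - 12 * (1 + r * r) * S a n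
    - 6 * r * (1 + r * r) * (\<Sum>p\<in>UNIV. phi0 [1, p, n] * (S p a + S a p))
    - 4 * r * (\<Sum>m\<in>UNIV. phi0 [a, n, m] * S m 1)
    + 4 * r * r * (\<Sum>p\<in>UNIV. psi0 [a, n, 1, p] * S p 1)
    - 4 * r * r * r * phi0 [a, n, 1] * S 1 1
    + 12 * r * r * delta1 n * S a 1
    + delta1 a * (6 * r * (\<Sum>p\<in>UNIV. \<Sum>m\<in>UNIV. phi0 [n, p, m] * S p m)
      - 6 * r * r * (\<Sum>p\<in>UNIV. \<Sum>m\<in>UNIV. psi0 [1, n, p, m] * S p m)
      + 6 * r * r * r * (\<Sum>p\<in>UNIV. phi0 [1, p, n] * (S p 1 + S 1 p)))"

text \<open>Up to a common factor, \<open>nabla_metric r S\<close> is the covariant derivative of the deformed metric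
  \<open>(1 + M) powr (-2/3) ((1 + M) g - v \<otimes> v)\<close>, and \<open>difference r S\<close> is the difference of the two
  Levi-Civita connections, which the former determines.\<close>
definition nabla_metric :: "real \<Rightarrow> (7 \<Rightarrow> 7 \<Rightarrow> real) \<Rightarrow> 7 \<Rightarrow> 7 \<Rightarrow> 7 \<Rightarrow> real"
  where "nabla_metric r S a j l = 2 * (1 + r * r) * S a 1 * (if j = l then 1 else 0)
    - 3 * (1 + r * r) * (S a j * delta1 l + delta1 j * S a l) + 4 * r * r * S a 1 * delta1 j * delta1 l"

definition difference :: "real \<Rightarrow> (7 \<Rightarrow> 7 \<Rightarrow> real) \<Rightarrow> 7 \<Rightarrow> 7 \<Rightarrow> 7 \<Rightarrow> real"
  where "difference r S e i j = 2 * r * (if e = 1 then 1 + r * r else 1) *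
    (nabla_metric r S i j e + nabla_metric r S j i e - nabla_metric r S e i j)"

text \<open>The dual of the deformed form, multiplied by \<open>(1 + r\<^sup>2) powr (1/3)\<close> to make it polynomial in \<open>r\<close>.\<close>
definition deformed_psi :: "real \<Rightarrow> 7 tensor"
  where "deformed_psi r I = (1 + r * r) * (basis_form [4,5,6,7] I + basis_form [2,3,6,7] I + basis_form [2,3,4,5] I)
     + (basis_form [1,3,5,7] I - basis_form [1,3,4,6] I - basis_form [1,2,5,6] I - basis_form [1,2,4,7] I)
     + r * (basis_form [1,2,4,6] I - basis_form [1,2,5,7] I - basis_form [1,3,4,7] I - basis_form [1,3,5,6] I)"

lemma alternating_deformed_psi: "alternating 4 (deformed_psi r)"
  unfolding deformed_psi_def[abs_def]
  by (intro alternating_add alternating_diff alternating_scale alternating_basis_form) simp_all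

lemma deformed_psi_sorted:
    "deformed_psi r [1, 2, 3, 4] = 0" "deformed_psi r [1, 2, 3, 5] = 0" "deformed_psi r [1, 2, 3, 6] = 0"
    "deformed_psi r [1, 2, 3, 7] = 0" "deformed_psi r [1, 2, 4, 5] = 0" "deformed_psi r [1, 2, 4, 6] = r"
    "deformed_psi r [1, 2, 4, 7] = - 1" "deformed_psi r [1, 2, 5, 6] = - 1" "deformed_psi r [1, 2, 5, 7] = - r"
    "deformed_psi r [1, 2, 6, 7] = 0" "deformed_psi r [1, 3, 4, 5] = 0" "deformed_psi r [1, 3, 4, 6] = - 1"
    "deformed_psi r [1, 3, 4, 7] = - r" "deformed_psi r [1, 3, 5, 6] = - r" "deformed_psi r [1, 3, 5, 7] = 1"
    "deformed_psi r [1, 3, 6, 7] = 0" "deformed_psi r [1, 4, 5, 6] = 0" "deformed_psi r [1, 4, 5, 7] = 0"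
    "deformed_psi r [1, 4, 6, 7] = 0" "deformed_psi r [1, 5, 6, 7] = 0" "deformed_psi r [2, 3, 4, 5] = 1 + r * r"
    "deformed_psi r [2, 3, 4, 6] = 0" "deformed_psi r [2, 3, 4, 7] = 0" "deformed_psi r [2, 3, 5, 6] = 0"
    "deformed_psi r [2, 3, 5, 7] = 0" "deformed_psi r [2, 3, 6, 7] = 1 + r * r" "deformed_psi r [2, 4, 5, 6] = 0"
    "deformed_psi r [2, 4, 5, 7] = 0" "deformed_psi r [2, 4, 6, 7] = 0" "deformed_psi r [2, 5, 6, 7] = 0"
    "deformed_psi r [3, 4, 5, 6] = 0" "deformed_psi r [3, 4, 5, 7] = 0" "deformed_psi r [3, 4, 6, 7] = 0"
    "deformed_psi r [3, 5, 6, 7] = 0" "deformed_psi r [4, 5, 6, 7] = 1 + r * r"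
  by (simp_all add: deformed_psi_def basis_form_4 alt_sum_4)

lemma deformed_psi_repeated:
  "deformed_psi r [a, a, c, d] = 0" "deformed_psi r [a, b, a, d] = 0" "deformed_psi r [a, b, c, a] = 0"
  "deformed_psi r [a, b, b, d] = 0" "deformed_psi r [a, b, c, b] = 0" "deformed_psi r [a, b, c, c] = 0"
  by (simp_all add: alternating_not_distinct[OF alternating_deformed_psi])

text \<open>The sum is the action of an endomorphism as a derivation. It is needed for the
  difference of the two connections acting on the deformed form.\<close>

lemma alternating_derivation:
  assumes F: "alternating n F"
  shows "alternating n (\<lambda>I. \<Sum>m<n. \<Sum>e\<in>UNIV. A e (I ! m) * F (I[m := e]))"
  unfolding alternating_def
proof (intro allI impI)
  fix I :: "'a list" and \<sigma> assume I: "length I = n" and \<sigma>: "\<sigma> permutes {..<n}"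
  have *: "A e (permute_list \<sigma> I ! m) * F ((permute_list \<sigma> I)[m := e]) =
      of_int (sign \<sigma>) * (A e (I ! \<sigma> m) * F (I[\<sigma> m := e]))" if "m < n" for m e
  proof -
    have \<sigma>m: "\<sigma> i < n" if "i < n" for i using permutes_in_image[OF \<sigma>, of i] that by simp
    \<comment> \<open>Slot m of the permuted list is slot \<open>\<sigma> m\<close> of the original
      one, so permuting the slots only permutes the summands of the derivation.\<close>
    have "(permute_list \<sigma> I)[m := e] = permute_list \<sigma> (I[\<sigma> m := e])"
    proof (rule nth_equalityI)
      fix i assume "i < length ((permute_list \<sigma> I)[m := e])"
      then have i: "i < n" using I by simp
      have "\<sigma> i = \<sigma> m \<longleftrightarrow> i = m" "\<sigma> m = \<sigma> i \<longleftrightarrow> m = i"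
        using permutes_inj[OF \<sigma>] by (simp_all add: inj_eq)
      then show "(permute_list \<sigma> I)[m := e] ! i = permute_list \<sigma> (I[\<sigma> m := e]) ! i"
        using i that I \<sigma> \<sigma>m by (simp add: permute_list_nth nth_list_update)
    qed simp
    then have "F ((permute_list \<sigma> I)[m := e]) = of_int (sign \<sigma>) * F (I[\<sigma> m := e])"
      using alternatingD[OF F _ \<sigma>, of "I[\<sigma> m := e]"] I by simp
    then show ?thesis using that I \<sigma> by (simp add: permute_list_nth)
  qed
  have "(\<Sum>m<n. \<Sum>e\<in>UNIV. A e (permute_list \<sigma> I ! m) * F ((permute_list \<sigma> I)[m := e])) =
      of_int (sign \<sigma>) * (\<Sum>m<n. \<Sum>e\<in>UNIV. A e (I ! \<sigma> m) * F (I[\<sigma> m := e]))"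
    by (simp add: * sum_distrib_left)
  also have "(\<Sum>m<n. \<Sum>e\<in>UNIV. A e (I ! \<sigma> m) * F (I[\<sigma> m := e])) =
      (\<Sum>m<n. \<Sum>e\<in>UNIV. A e (I ! m) * F (I[m := e]))"
    using sum.permute[OF \<sigma>, of "\<lambda>m. \<Sum>e\<in>UNIV. A e (I ! m) * F (I[m := e])"] by (simp add: o_def)
  finally show "(\<Sum>m<n. \<Sum>e\<in>UNIV. A e (map (\<lambda>m. I ! \<sigma> m) [0..<n] ! m) * F ((map (\<lambda>m. I ! \<sigma> m) [0..<n])[m := e])) =
      of_int (sign \<sigma>) * (\<Sum>m<n. \<Sum>e\<in>UNIV. A e (I ! m) * F (I[m := e]))"
    by (simp only: map_nth_permute_list[OF I])
qed

lemma alternating_append_last: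
  assumes F: "alternating (Suc n) F"
  shows "alternating n (\<lambda>I. F (I @ [j]))"
  unfolding alternating_def
proof (intro allI impI)
  fix I :: "'a list" and \<sigma> assume I: "length I = n" and \<sigma>: "\<sigma> permutes {..<n}"
  have \<sigma>': "\<sigma> permutes {..<Suc n}" using \<sigma> by (rule permutes_subset) auto
  have "permute_list \<sigma> (I @ [j]) = permute_list \<sigma> I @ [j]"
  proof (rule nth_equalityI)
    fix i assume "i < length (permute_list \<sigma> (I @ [j]))"
    then have "i < n \<or> i = n" using I by auto
    then show "permute_list \<sigma> (I @ [j]) ! i = (permute_list \<sigma> I @ [j]) ! i"
      using I \<sigma> \<sigma>' permutes_in_image[OF \<sigma>, of i] permutes_not_in[OF \<sigma>, of n]
      by (auto simp: permute_list_nth nth_append)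
  qed simp
  then show "F (map (\<lambda>m. I ! \<sigma> m) [0..<n] @ [j]) = of_int (sign \<sigma>) * F (I @ [j])"
    using alternatingD[OF F _ \<sigma>', of "I @ [j]"] by (simp add: map_nth_permute_list I)
qed

text \<open>The part of \<open>\<nabla>\<^sub>a \<phi> - T\<^sub>a\<^sup>e \<psi>\<^sub>e\<close> for the deformed structure that depends on the
  covariant derivative of the vector field, with denominators cleared.  As an alternating form it vanishes
  once it does on the 35 increasing triples of indices.\<close>
definition frame_defect :: "real \<Rightarrow> (7 \<Rightarrow> 7 \<Rightarrow> real) \<Rightarrow> 7 \<Rightarrow> 7 tensor"
  where "frame_defect r S a I =
    12 * ((1 + r * r) * (1 + r * r)) * (\<Sum>e\<in>UNIV. S a e * psi0 (I @ [e]))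
    - (\<Sum>m<3. \<Sum>e\<in>UNIV. difference r S e a (I ! m) * deform0 (r *s axis 1 1) (I[m := e]))
    - (\<Sum>n\<in>UNIV. (if n = 1 then 1 + r * r else 1) * torsion_S r S a n * deformed_psi r (n # I))"

lemma alternating_frame_defect: "alternating 3 (frame_defect r S a)"
  unfolding frame_defect_def[abs_def]
proof (rule alternating_diff, rule alternating_diff)
  have 1: "alternating 3 (\<lambda>I. psi0 (I @ [e]))" for e
    by (rule alternating_append_last) (simp add: alternating_psi0)
  have 2: "alternating 3 (\<lambda>I. deformed_psi r (n # I))" for n
    using alternating_append[of 1 3 "deformed_psi r" "[n]"] alternating_deformed_psi by simp
  show "alternating 3 (\<lambda>I. 12 * ((1 + r * r) * (1 + r * r)) * (\<Sum>e\<in>UNIV. S a e * psi0 (I @ [e])))"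
    by (intro alternating_scale alternating_sum 1)
  show "alternating 3 (\<lambda>I. \<Sum>n\<in>UNIV. (if n = 1 then 1 + r * r else 1) * torsion_S r S a n * deformed_psi r (n # I))"
    by (intro alternating_scale alternating_sum 2)
qed (rule alternating_derivation[OF alternating_deform0])

lemma frame_defect_triple: "frame_defect r S a [b, c, d] =
    12 * ((1 + r * r) * (1 + r * r)) * (\<Sum>e\<in>UNIV. S a e * psi0 [b, c, d, e])
    - ((\<Sum>e\<in>UNIV. difference r S e a b * deform0 (r *s axis 1 1) [e, c, d])
      + (\<Sum>e\<in>UNIV. difference r S e a c * deform0 (r *s axis 1 1) [b, e, d])
      + (\<Sum>e\<in>UNIV. difference r S e a d * deform0 (r *s axis 1 1) [b, c, e]))
    - (\<Sum>n\<in>UNIV. (if n = 1 then 1 + r * r else 1) * torsion_S r S a n * deformed_psi r [n, b, c, d])"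
proof -
  have "{..<3::nat} = {0, 1, 2}" by auto
  then show ?thesis by (simp add: frame_defect_def)
qed

lemmas frame_expand = sum_7 deform0_axis phi0_rows psi0_sorted psi0_repeated alternating_sort_4[OF alternating_psi0]
  deformed_psi_sorted deformed_psi_repeated alternating_sort_4[OF alternating_deformed_psi]

text \<open>After the tables of \<open>phi0\<close>, \<open>psi0\<close> and
  \<open>deformed_psi\<close> are inserted, each component is a polynomial in r, linear in the
  entries of \<open>S\<close>, and vanishes on normalisation. The direction of differentiation takes
  the values 1 to 7, one lemma for each.\<close>

lemma frame_defect_1: "\<forall>N\<in>set (filter (\<lambda>N. length N = 3) (subseqs [1,2,3,4,5,6,7::7])). frame_defect r S 1 N = 0"
  unfolding sorted_triples_7 ball_simps frame_defect_triple
  by (intro conjI TrueI; simp add: frame_expand;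
      (simp add: difference_def nabla_metric_def torsion_S_def delta1_def sum_7 phi0_rows psi0_rows)?;
      (simp add: algebra_simps)?)

lemma frame_defect_2: "\<forall>N\<in>set (filter (\<lambda>N. length N = 3) (subseqs [1,2,3,4,5,6,7::7])). frame_defect r S 2 N = 0"
  unfolding sorted_triples_7 ball_simps frame_defect_triple
  by (intro conjI TrueI; simp add: frame_expand;
      (simp add: difference_def nabla_metric_def torsion_S_def delta1_def sum_7 phi0_rows psi0_rows)?;
      (simp add: algebra_simps)?)

lemma frame_defect_3: "\<forall>N\<in>set (filter (\<lambda>N. length N = 3) (subseqs [1,2,3,4,5,6,7::7])). frame_defect r S 3 N = 0"
  unfolding sorted_triples_7 ball_simps frame_defect_triple
  by (intro conjI TrueI; simp add: frame_expand;
      (simp add: difference_def nabla_metric_def torsion_S_def delta1_def sum_7 phi0_rows psi0_rows)?;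
      (simp add: algebra_simps)?)

lemma frame_defect_4: "\<forall>N\<in>set (filter (\<lambda>N. length N = 3) (subseqs [1,2,3,4,5,6,7::7])). frame_defect r S 4 N = 0"
  unfolding sorted_triples_7 ball_simps frame_defect_triple
  by (intro conjI TrueI; simp add: frame_expand;
      (simp add: difference_def nabla_metric_def torsion_S_def delta1_def sum_7 phi0_rows psi0_rows)?;
      (simp add: algebra_simps)?)

lemma frame_defect_5: "\<forall>N\<in>set (filter (\<lambda>N. length N = 3) (subseqs [1,2,3,4,5,6,7::7])). frame_defect r S 5 N = 0"
  unfolding sorted_triples_7 ball_simps frame_defect_triple
  by (intro conjI TrueI; simp add: frame_expand;
      (simp add: difference_def nabla_metric_def torsion_S_def delta1_def sum_7 phi0_rows psi0_rows)?;
      (simp add: algebra_simps)?)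

lemma frame_defect_6: "\<forall>N\<in>set (filter (\<lambda>N. length N = 3) (subseqs [1,2,3,4,5,6,7::7])). frame_defect r S 6 N = 0"
  unfolding sorted_triples_7 ball_simps frame_defect_triple
  by (intro conjI TrueI; simp add: frame_expand;
      (simp add: difference_def nabla_metric_def torsion_S_def delta1_def sum_7 phi0_rows psi0_rows)?;
      (simp add: algebra_simps)?)

lemma frame_defect_7: "\<forall>N\<in>set (filter (\<lambda>N. length N = 3) (subseqs [1,2,3,4,5,6,7::7])). frame_defect r S 7 N = 0"
  unfolding sorted_triples_7 ball_simps frame_defect_triple
  by (intro conjI TrueI; simp add: frame_expand;
      (simp add: difference_def nabla_metric_def torsion_S_def delta1_def sum_7 phi0_rows psi0_rows)?;
      (simp add: algebra_simps)?)

lemma frame_defect_zero: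
  assumes "length I = 3"
  shows "frame_defect r S a I = 0"
proof -
  have "\<forall>a. \<forall>N\<in>set (filter (\<lambda>N. length N = 3) (subseqs [1,2,3,4,5,6,7::7])). frame_defect r S a N = 0"
    unfolding forall_7
    by (intro conjI frame_defect_1 frame_defect_2 frame_defect_3 frame_defect_4 frame_defect_5
        frame_defect_6 frame_defect_7)
  then have "frame_defect r S a N = (\<lambda>I. 0) N"
    if "N \<in> set (filter (\<lambda>N. length N = 3) (subseqs [1,2,3,4,5,6,7::7]))" for N
    using that by blast
  then show ?thesis
    by (intro alternating_7_ext[OF alternating_frame_defect _ _ assms]) (auto simp: alternating_def)
qed

section \<open>Covariant derivatives along a moving frame\<close>

lemma DERIV_line:
  fixes f :: "real^'n \<Rightarrow> real"
  assumes "f differentiable (at x)"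
  shows "((\<lambda>t. f (x + t *\<^sub>R \<xi>)) has_real_derivative (\<Sum>i\<in>UNIV. \<xi> $ i * partial_deriv i f x)) (at 0)"
proof -
  let ?D = "frechet_derivative f (at x)"
  have D: "(f has_derivative ?D) (at (x + 0 *\<^sub>R \<xi>))"
    using assms by (simp add: frechet_derivative_works)
  have lin: "linear ?D" using D has_derivative_linear by blast
  have "((\<lambda>t. x + t *\<^sub>R \<xi>) has_derivative (\<lambda>t. t *\<^sub>R \<xi>)) (at 0)"
    by (auto intro!: derivative_eq_intros)
  from has_derivative_compose[OF this D]
  have "((\<lambda>t. f (x + t *\<^sub>R \<xi>)) has_derivative (\<lambda>t. ?D (t *\<^sub>R \<xi>))) (at 0)" .
  moreover have "?D \<xi> = (\<Sum>i\<in>UNIV. \<xi> $ i * partial_deriv i f x)"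
  proof -
    have "?D \<xi> = ?D (\<Sum>i\<in>UNIV. \<xi> $ i *\<^sub>R axis i 1)"
      using basis_expansion[of \<xi>] by (simp add: scalar_mult_eq_scaleR)
    then show ?thesis by (simp add: linear_sum[OF lin] linear_scale[OF lin] partial_deriv_def)
  qed
  moreover have "(\<lambda>t. ?D (t *\<^sub>R \<xi>)) = (*) (?D \<xi>)"
    by (rule ext) (simp add: linear_scale[OF lin])
  ultimately show ?thesis by (simp add: has_field_derivative_def)
qed

text \<open>The covariant derivative with the coordinate derivatives \<open>dT\<close> as a separate
  argument. Fixing the first slot of \<open>T\<close> then leaves an expression of the same kind,
  plus one Christoffel term, and the index list can be treated by induction.\<close>

definition covd :: "('n \<Rightarrow> 'n \<Rightarrow> 'n \<Rightarrow> real) \<Rightarrow> ('n \<Rightarrow> 'n::finite tensor) \<Rightarrow> 'n tensor \<Rightarrow> 'n \<Rightarrow> 'n tensor"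
  where "covd \<Gamma> dT T i J = dT i J - (\<Sum>m<length J. \<Sum>e\<in>UNIV. \<Gamma> e i (J ! m) * T (J[m := e]))"

lemma cov_deriv_covd:
  "cov_deriv c g T p (i # J) = covd (christoffel c g p) (\<lambda>i J. coord_deriv c i (\<lambda>q. T q J) p) (T p) i J"
  by (simp add: cov_deriv_def covd_def)

lemma covd_Nil: "covd \<Gamma> dT T i [] = dT i []"
  by (simp add: covd_def)

lemma covd_Cons: "covd \<Gamma> dT T i (j # J) =
    covd \<Gamma> (\<lambda>i J. dT i (j # J)) (\<lambda>J. T (j # J)) i J - (\<Sum>e\<in>UNIV. \<Gamma> e i j * T (e # J))"
  by (simp add: covd_def sum.lessThan_Suc_shift del: sum.lessThan_Suc)

text \<open>At time 0 the frame satisfies the equation of parallel transport in direction \<xi>. In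
  the product rule the derivatives of the frame supply exactly the Christoffel terms, one for each
  slot.\<close>

lemma pullback_covd:
  assumes A: "\<And>k a. ((\<lambda>t. A t $ k $ a) has_real_derivative
      - (\<Sum>i\<in>UNIV. \<xi> $ i * (\<Sum>j\<in>UNIV. \<Gamma> k i j * E $ j $ a))) (at 0)" and A0: "A 0 = E"
    and "\<And>J. length J = length I \<Longrightarrow> ((\<lambda>t. \<tau> t J) has_real_derivative (\<Sum>i\<in>UNIV. \<xi> $ i * dT i J)) (at 0)"
  shows "((\<lambda>t. pullback (A t) (\<tau> t) I) has_real_derivative
    (\<Sum>i\<in>UNIV. \<xi> $ i * pullback E (covd \<Gamma> dT (\<tau> 0) i) I)) (at 0)"
  using assms(3)
proof (induction I arbitrary: \<tau> dT)
  case Nil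
  then show ?case by (simp add: covd_Nil)
next
  case (Cons a I)
  let ?c = "\<lambda>j i. pullback E (covd \<Gamma> (\<lambda>i J. dT i (j # J)) (\<lambda>J. \<tau> 0 (j # J)) i) I"
  have IH: "((\<lambda>t. pullback (A t) (\<lambda>J. \<tau> t (j # J)) I) has_real_derivative (\<Sum>i\<in>UNIV. \<xi> $ i * ?c j i)) (at 0)" for j
    by (rule Cons.IH) (rule Cons.prems, simp)
  have "((\<lambda>t. \<Sum>j\<in>UNIV. A t $ j $ a * pullback (A t) (\<lambda>J. \<tau> t (j # J)) I) has_real_derivative
      (\<Sum>j\<in>UNIV. - (\<Sum>i\<in>UNIV. \<xi> $ i * (\<Sum>l\<in>UNIV. \<Gamma> j i l * E $ l $ a)) * pullback E (\<lambda>J. \<tau> 0 (j # J)) I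
        + (\<Sum>i\<in>UNIV. \<xi> $ i * ?c j i) * E $ j $ a)) (at 0)"
    by (rule DERIV_sum) (use DERIV_mult[OF A[of _ a] IH] in \<open>simp add: A0\<close>)
  also have "(\<Sum>j\<in>UNIV. - (\<Sum>i\<in>UNIV. \<xi> $ i * (\<Sum>l\<in>UNIV. \<Gamma> j i l * E $ l $ a)) * pullback E (\<lambda>J. \<tau> 0 (j # J)) I
        + (\<Sum>i\<in>UNIV. \<xi> $ i * ?c j i) * E $ j $ a) =
      (\<Sum>j\<in>UNIV. \<Sum>i\<in>UNIV. \<xi> $ i * (E $ j $ a * ?c j i))
      - (\<Sum>j\<in>UNIV. \<Sum>i\<in>UNIV. \<Sum>l\<in>UNIV. \<xi> $ i * (E $ l $ a * (\<Gamma> j i l * pullback E (\<lambda>J. \<tau> 0 (j # J)) I)))"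
    by (simp add: sum.distrib sum_negf sum_subtractf sum_distrib_left sum_distrib_right mult_ac)
  also have "(\<Sum>j\<in>UNIV. \<Sum>i\<in>UNIV. \<Sum>l\<in>UNIV. \<xi> $ i * (E $ l $ a * (\<Gamma> j i l * pullback E (\<lambda>J. \<tau> 0 (j # J)) I)))
      = (\<Sum>l\<in>UNIV. \<Sum>i\<in>UNIV. \<Sum>j\<in>UNIV. \<xi> $ i * (E $ l $ a * (\<Gamma> j i l * pullback E (\<lambda>J. \<tau> 0 (j # J)) I)))"
    by (rule sum_swap_3)
  also have "(\<Sum>j\<in>UNIV. \<Sum>i\<in>UNIV. \<xi> $ i * (E $ j $ a * ?c j i)) - \<dots> =
      (\<Sum>i\<in>UNIV. \<Sum>j\<in>UNIV. \<xi> $ i * (E $ j $ a * (?c j i - (\<Sum>e\<in>UNIV. \<Gamma> e i j * pullback E (\<lambda>J. \<tau> 0 (e # J)) I))))"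
    by (subst (1 3) sum.swap) (simp add: sum_subtractf right_diff_distrib sum_distrib_left)
  also have "\<dots> = (\<Sum>i\<in>UNIV. \<xi> $ i * pullback E (covd \<Gamma> dT (\<tau> 0) i) (a # I))"
    by (simp add: pullback_Cons covd_Cons[abs_def] pullback_diff pullback_sum pullback_scale sum_distrib_left)
  finally show ?case by (simp add: pullback_Cons)
qed

lemma DERIV_prod_zero:
  fixes f :: "'a \<Rightarrow> real \<Rightarrow> real"
  assumes "finite A" "\<And>i. i \<in> A \<Longrightarrow> (f i has_real_derivative 0) (at x)"
  shows "((\<lambda>t. \<Prod>i\<in>A. f i t) has_real_derivative 0) (at x)"
  using assms
proof (induction A rule: finite_induct)
  case (insert a A)
  from DERIV_mult[OF insert.prems[of a] insert.IH] insert show ?case by simp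
qed simp

lemma DERIV_det_zero:
  fixes A :: "real \<Rightarrow> real^'n^'n"
  assumes "\<And>i j. ((\<lambda>t. A t $ i $ j) has_real_derivative 0) (at x)"
  shows "((\<lambda>t. det (A t)) has_real_derivative 0) (at x)"
proof -
  have "((\<lambda>t. of_int (sign p) * (\<Prod>i\<in>UNIV. A t $ i $ p i)) has_real_derivative 0) (at x)" for p
  proof -
    have "((\<lambda>t. \<Prod>i\<in>UNIV. A t $ i $ p i) has_real_derivative 0) (at x)"
      by (rule DERIV_prod_zero) (simp_all add: assms)
    from DERIV_cmult[OF this, of "of_int (sign p)"] show ?thesis by simp
  qed
  from DERIV_sum[of "{p. p permutes UNIV}" _ "\<lambda>p. 0", OF this] show ?thesis
    by (simp add: det_def)
qed

lemma DERIV_eventually_eq: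
  fixes f g :: "real \<Rightarrow> real"
  assumes "(f has_real_derivative u) (at x)" "\<forall>\<^sub>F t in nhds x. f t = g t"
  shows "(g has_real_derivative u) (at x)"
  using DERIV_cong_ev[OF refl assms(2) refl] assms(1) by blast

text \<open>Numerator and denominator in Cramer's rule are both stationary when the entries of the
  matrix are.\<close>

lemma DERIV_matrix_inv_zero:
  fixes A :: "real \<Rightarrow> real^'n^'n"
  assumes A: "\<And>i j. ((\<lambda>t. A t $ i $ j) has_real_derivative 0) (at x)"
    and inv: "\<forall>\<^sub>F t in nhds x. invertible (A t)"
  shows "((\<lambda>t. matrix_inv (A t) $ i $ j) has_real_derivative 0) (at x)"
proof -
  let ?B = "\<lambda>t. (\<chi> p q. if q = i then axis j 1 $ p else A t $ p $ q) :: real^'n^'n"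
  have "((\<lambda>t. ?B t $ p $ q) has_real_derivative 0) (at x)" for p q
    by (cases "q = i") (simp_all add: A)
  then have B: "((\<lambda>t. det (?B t)) has_real_derivative 0) (at x)" by (rule DERIV_det_zero)
  have x: "det (A x) \<noteq> 0" using eventually_nhds_x_imp_x[OF inv] invertible_det_nz by blast
  have "((\<lambda>t. det (?B t) / det (A t)) has_real_derivative 0) (at x)"
    using DERIV_divide[OF B DERIV_det_zero[OF A] x] by simp
  moreover have "\<forall>\<^sub>F t in nhds x. det (?B t) / det (A t) = matrix_inv (A t) $ i $ j"
    using inv by eventually_elim (simp add: matrix_inv_cramer)
  ultimately show ?thesis by (rule DERIV_eventually_eq)
qed

lemma isCont_det:
  fixes A :: "real \<Rightarrow> real^'n^'n"
  assumes "\<And>i j. isCont (\<lambda>t. A t $ i $ j) x"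
  shows "isCont (\<lambda>t. det (A t)) x"
  unfolding det_def by (intro continuous_intros assms)

lemma eventually_invertible:
  fixes A :: "real \<Rightarrow> real^'n^'n"
  assumes "\<And>i j. isCont (\<lambda>t. A t $ i $ j) x" "invertible (A x)"
  shows "\<forall>\<^sub>F t in nhds x. invertible (A t)"
proof -
  have "det (A x) \<noteq> 0" using assms(2) invertible_det_nz by blast
  moreover have "(\<lambda>t. det (A t)) \<midarrow>x\<rightarrow> det (A x)"
    using isCont_det[OF assms(1)] by (simp add: isCont_def)
  ultimately have "\<forall>\<^sub>F t in at x. det (A t) \<noteq> 0"
    by (metis tendsto_imp_eventually_ne)
  then have "\<forall>\<^sub>F t in nhds x. det (A t) \<noteq> 0"
    using \<open>det (A x) \<noteq> 0\<close> by (auto simp: eventually_at_filter elim!: eventually_mono)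
  then show ?thesis by (simp add: invertible_det_nz)
qed

text \<open>The components of the form and of a covector in a frame along a curve that is parallel to first
  order; hence the components of the metric are stationary and no Christoffel symbols occur.\<close>
locale form_curve =
  fixes \<Phi> :: "real \<Rightarrow> 7 tensor" and F :: "7 tensor" and W :: "real \<Rightarrow> real^7" and s :: "7 \<Rightarrow> real" and r :: real
  assumes pos: "\<forall>\<^sub>F t in nhds 0. positive_form (\<Phi> t)"
    and \<Phi>0: "\<And>I. length I = 3 \<Longrightarrow> \<Phi> 0 I = phi0 I"
    and d\<Phi>: "\<And>I. length I = 3 \<Longrightarrow> ((\<lambda>t. \<Phi> t I) has_real_derivative F I) (at 0)"
    and dG: "\<And>i j. ((\<lambda>t. g2_metric (\<Phi> t) $ i $ j) has_real_derivative 0) (at 0)"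
    and W0: "W 0 = r *s axis 1 1" and dW: "\<And>i. ((\<lambda>t. W t $ i) has_real_derivative s i) (at 0)"
begin

abbreviation "G t \<equiv> g2_metric (\<Phi> t)"

text \<open>The given data concern the derivative of the covector of v, so the curve carries the
  covector \<open>W\<close> and the vector is recovered by raising its index. Because the metric is
  stationary at time 0, \<open>U\<close> and \<open>W\<close> have the same derivative
  \<open>s\<close> there.\<close>

definition "U t = matrix_inv (G t) *v W t"

lemma G0: "G 0 = mat 1"
proof -
  have "metric_volume (\<Phi> 0) (mat 1) 1"
    using metric_volume_cong[of "\<Phi> 0" phi0, OF \<Phi>0] metric_volume_phi0 by blast
  then show ?thesis by (rule g2_metric_eq)
qed

lemma G0': "G 0 $ i $ j = (if i = j then 1 else 0)"
  by (simp add: G0 mat_def)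

lemma invG0: "matrix_inv (G 0) $ i $ j = (if i = j then 1 else 0)"
proof -
  have "matrix_inv (G 0) = mat 1" unfolding G0 by (rule matrix_inv_eqI) simp
  then show ?thesis by (simp add: mat_def)
qed

lemma dInv: "((\<lambda>t. matrix_inv (G t) $ i $ j) has_real_derivative 0) (at 0)"
  by (rule DERIV_matrix_inv_zero[OF dG]) (use pos in \<open>auto elim!: eventually_mono intro: invertible_g2_metric\<close>)

lemma U0: "U 0 = r *s axis 1 1"
proof -
  have "matrix_inv (G 0) = mat 1" unfolding G0 by (rule matrix_inv_eqI) simp
  then show ?thesis by (simp add: U_def W0)
qed

lemma dU: "((\<lambda>t. U t $ i) has_real_derivative s i) (at 0)"
proof -
  have "((\<lambda>t. \<Sum>j\<in>UNIV. matrix_inv (G t) $ i $ j * W t $ j) has_real_derivative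
      (\<Sum>j\<in>UNIV. 0 * W 0 $ j + s j * matrix_inv (G 0) $ i $ j)) (at 0)"
    by (rule DERIV_sum, rule DERIV_mult[OF dInv dW])
  then show ?thesis by (simp add: U_def matrix_vector_mult_def invG0 if_distrib cong: if_cong)
qed

lemma GU: "positive_form (\<Phi> t) \<Longrightarrow> G t *v U t = W t"
  by (simp add: U_def matrix_vector_mul_assoc matrix_inv_mult(1)[OF invertible_g2_metric])

definition "dpsi b c d n = (\<Sum>k\<in>UNIV. F [b, c, k] * phi0 [d, n, k] + F [d, n, k] * phi0 [b, c, k])"

text \<open>In \<open>psi_identity\<close> the metric terms and the inverse metric are stationary;
  only the two factors of the form vary.\<close>

lemma deriv_psi: "((\<lambda>t. g2_psi (\<Phi> t) [b, c, d, n]) has_real_derivative dpsi b c d n) (at 0)"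
proof -
  let ?h = "\<lambda>t. (\<Sum>i\<in>UNIV. \<Sum>j\<in>UNIV. \<Phi> t [b, c, i] * matrix_inv (G t) $ i $ j * \<Phi> t [d, n, j])
    - G t $ b $ d * G t $ c $ n + G t $ b $ n * G t $ c $ d"
  have "(?h has_real_derivative (\<Sum>i\<in>UNIV. \<Sum>j\<in>UNIV.
      (F [b, c, i] * matrix_inv (G 0) $ i $ j + 0 * \<Phi> 0 [b, c, i]) * \<Phi> 0 [d, n, j]
        + F [d, n, j] * (\<Phi> 0 [b, c, i] * matrix_inv (G 0) $ i $ j))
      - (0 * G 0 $ c $ n + 0 * G 0 $ b $ d) + (0 * G 0 $ c $ d + 0 * G 0 $ b $ n)) (at 0)"
    by (rule DERIV_add, rule DERIV_diff, rule DERIV_sum, rule DERIV_sum,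
        rule DERIV_mult[OF DERIV_mult[OF d\<Phi> dInv] d\<Phi>], simp, simp,
        rule DERIV_mult[OF dG dG], rule DERIV_mult[OF dG dG])
  also have "(\<Sum>i\<in>UNIV. \<Sum>j\<in>UNIV.
      (F [b, c, i] * matrix_inv (G 0) $ i $ j + 0 * \<Phi> 0 [b, c, i]) * \<Phi> 0 [d, n, j]
        + F [d, n, j] * (\<Phi> 0 [b, c, i] * matrix_inv (G 0) $ i $ j))
      - (0 * G 0 $ c $ n + 0 * G 0 $ b $ d) + (0 * G 0 $ c $ d + 0 * G 0 $ b $ n) = dpsi b c d n"
  proof -
    have "(\<Sum>j\<in>UNIV. (F [b, c, i] * matrix_inv (G 0) $ i $ j + 0 * \<Phi> 0 [b, c, i]) * \<Phi> 0 [d, n, j]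
        + F [d, n, j] * (\<Phi> 0 [b, c, i] * matrix_inv (G 0) $ i $ j)) =
        F [b, c, i] * phi0 [d, n, i] + F [d, n, i] * phi0 [b, c, i]" for i
    proof -
      have "(F [b, c, i] * matrix_inv (G 0) $ i $ j + 0 * \<Phi> 0 [b, c, i]) * \<Phi> 0 [d, n, j]
        + F [d, n, j] * (\<Phi> 0 [b, c, i] * matrix_inv (G 0) $ i $ j) =
        (if i = j then F [b, c, i] * phi0 [d, n, i] + F [d, n, i] * phi0 [b, c, i] else 0)" for j
        by (simp add: invG0 \<Phi>0)
      then show ?thesis by simp
    qed
    then show ?thesis by (simp add: dpsi_def)
  qed
  finally have "(?h has_real_derivative dpsi b c d n) (at 0)" .
  moreover have "\<forall>\<^sub>F t in nhds 0. ?h t = g2_psi (\<Phi> t) [b, c, d, n]"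
    using pos by eventually_elim (simp add: psi_identity)
  ultimately show ?thesis by (rule DERIV_eventually_eq)
qed

lemma psi_at_0: "length I = 4 \<Longrightarrow> g2_psi (\<Phi> 0) I = psi0 I"
  using g2_psi_cong[of "\<Phi> 0" phi0, OF \<Phi>0] by (simp add: g2_psi_phi0)

lemma deriv_deform:
  "((\<lambda>t. deform (\<Phi> t) (U t) [b, c, d]) has_real_derivative
    F [b, c, d] + (\<Sum>e\<in>UNIV. s e * psi0 [b, c, d, e]) + r * dpsi b c d 1) (at 0)"
proof -
  let ?h = "\<lambda>t. \<Phi> t [b, c, d] + (\<Sum>e\<in>UNIV. U t $ e * g2_psi (\<Phi> t) [b, c, d, e])"
  have "(?h has_real_derivative F [b, c, d] + (\<Sum>e\<in>UNIV. s e * g2_psi (\<Phi> 0) [b, c, d, e] + dpsi b c d e * U 0 $ e)) (at 0)"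
    by (rule DERIV_add, rule d\<Phi>, simp, rule DERIV_sum, rule DERIV_mult[OF dU deriv_psi])
  also have "F [b, c, d] + (\<Sum>e\<in>UNIV. s e * g2_psi (\<Phi> 0) [b, c, d, e] + dpsi b c d e * U 0 $ e) =
      F [b, c, d] + (\<Sum>e\<in>UNIV. s e * psi0 [b, c, d, e]) + r * dpsi b c d 1"
    by (simp add: psi_at_0 sum.distrib U0) (simp add: sum_7 axis_def)
  finally have "(?h has_real_derivative F [b, c, d] + (\<Sum>e\<in>UNIV. s e * psi0 [b, c, d, e]) + r * dpsi b c d 1) (at 0)" .
  moreover have "\<forall>\<^sub>F t in nhds 0. ?h t = deform (\<Phi> t) (U t) [b, c, d]"
    using pos by eventually_elim (simp add: deform_eq_positive)
  ultimately show ?thesis by (rule DERIV_eventually_eq)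
qed

text \<open>The covector and the vector both start at r times the first axis with derivative
  \<open>s\<close>, so 1 + M has derivative 2 r s_1. Every surviving term carries a factor r, which
  is taken out together with the power 1/k^2 of 1 + M.\<close>

lemma deriv_deform_metric:
  assumes k: "k ^ 3 = 1 + r\<^sup>2" "k > 0"
  shows "((\<lambda>t. g2_metric (deform (\<Phi> t) (U t)) $ j $ l) has_real_derivative
    r / k\<^sup>2 * (2 / 3 * s 1 * (if j = l then 1 else 0) - s j * (if l = 1 then 1 else 0)
      - (if j = 1 then 1 else 0) * s l
      + 4 / 3 * r\<^sup>2 / (1 + r\<^sup>2) * s 1 * (if j = 1 then 1 else 0) * (if l = 1 then 1 else 0))) (at 0)"
proof -
  let ?M = "\<lambda>t. 1 + (\<Sum>i\<in>UNIV. U t $ i * W t $ i)"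
  let ?h = "\<lambda>t. ?M t powr (- 2 / 3) * (?M t * G t $ j $ l - W t $ j * W t $ l)"
  let ?e = "\<lambda>i::7. if i = 1 then 1 else 0 :: real"
  have M0: "?M 0 = 1 + r\<^sup>2" by (simp add: U0 W0 sum_7 axis_def power2_eq_square)
  have pos1: "1 + r\<^sup>2 > 0" by (simp add: add_pos_nonneg)
  have "(?M has_real_derivative 0 + (\<Sum>i\<in>UNIV. s i * W 0 $ i + s i * U 0 $ i)) (at 0)"
    by (rule DERIV_add, rule DERIV_const, rule DERIV_sum, rule DERIV_mult[OF dU dW])
  also have "0 + (\<Sum>i\<in>UNIV. s i * W 0 $ i + s i * U 0 $ i) = 2 * r * s 1"
    by (simp add: U0 W0 sum_7 axis_def)
  finally have dM: "(?M has_real_derivative 2 * r * s 1) (at 0)" .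
  have dP: "((\<lambda>t. ?M t powr (- 2 / 3)) has_real_derivative
      (- 2 / 3) * (1 + r\<^sup>2) powr (- 2 / 3 - 1) * (2 * r * s 1)) (at 0)"
    using DERIV_fun_powr[OF dM, of "- 2 / 3"] pos1 unfolding M0 by simp
  have e: "(1 + r\<^sup>2) powr a = k powr (3 * a)" for a
  proof -
    have "1 + r\<^sup>2 = k powr 3" using k by (simp add: powr_numeral)
    then show ?thesis by (simp only: powr_powr)
  qed
  have p1: "(1 + r\<^sup>2) powr (- 2 / 3) = 1 / k\<^sup>2" unfolding e using k(2) by (simp add: powr_minus_divide powr_numeral)
  have p2: "(1 + r\<^sup>2) powr (- 2 / 3 - 1) = 1 / (k\<^sup>2 * (1 + r\<^sup>2))"
    using pos1 by (simp only: powr_diff p1) simp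
  have "(?h has_real_derivative
      (- 2 / 3) * (1 + r\<^sup>2) powr (- 2 / 3 - 1) * (2 * r * s 1) * (?M 0 * G 0 $ j $ l - W 0 $ j * W 0 $ l)
      + ((2 * r * s 1 * G 0 $ j $ l + 0 * ?M 0) - (s j * W 0 $ l + s l * W 0 $ j)) * ?M 0 powr (- 2 / 3)) (at 0)"
    by (rule DERIV_mult[OF dP DERIV_diff[OF DERIV_mult[OF dM dG] DERIV_mult[OF dW dW]]])
  also have "(- 2 / 3) * (1 + r\<^sup>2) powr (- 2 / 3 - 1) * (2 * r * s 1) * (?M 0 * G 0 $ j $ l - W 0 $ j * W 0 $ l)
      + ((2 * r * s 1 * G 0 $ j $ l + 0 * ?M 0) - (s j * W 0 $ l + s l * W 0 $ j)) * ?M 0 powr (- 2 / 3) =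
      (- 2 / 3) * (1 / (k\<^sup>2 * (1 + r\<^sup>2))) * (2 * r * s 1) * ((1 + r\<^sup>2) * (if j = l then 1 else 0) - r * ?e j * (r * ?e l))
      + (2 * r * s 1 * (if j = l then 1 else 0) - (s j * (r * ?e l) + s l * (r * ?e j))) * (1 / k\<^sup>2)"
    unfolding M0 p1 p2 unfolding G0' W0 by (simp add: axis_def)
  also have "\<dots> = r / k\<^sup>2 * (2 / 3 * s 1 * (if j = l then 1 else 0) - s j * ?e l - ?e j * s l
      + 4 / 3 * r\<^sup>2 / (1 + r\<^sup>2) * s 1 * ?e j * ?e l)"
  proof -
    have "(- 2 / 3) * (1 / (K * R)) * (2 * r * x) * (R * D - r * A * (r * B)) + (2 * r * x * D - (y * (r * B) + z * (r * A))) * (1 / K)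
        = r / K * (2 / 3 * x * D - y * B - A * z + 4 / 3 * r\<^sup>2 / R * x * A * B)"
      if "K > 0" "R > 0" for K R D A B x y z :: real
      using that by (simp add: field_simps power2_eq_square)
    then show ?thesis using pos1 k(2) by simp
  qed
  finally have "(?h has_real_derivative r / k\<^sup>2 * (2 / 3 * s 1 * (if j = l then 1 else 0) - s j * ?e l - ?e j * s l
      + 4 / 3 * r\<^sup>2 / (1 + r\<^sup>2) * s 1 * ?e j * ?e l)) (at 0)" .
  moreover have "\<forall>\<^sub>F t in nhds 0. ?h t = g2_metric (deform (\<Phi> t) (U t)) $ j $ l"
    using pos by eventually_elim (simp add: deform_metric GU inner_vec_def)
  ultimately show ?thesis by (rule DERIV_eventually_eq)
qed

end

text \<open>The part of the covariant derivative of the deformed form that comes from the original torsion.\<close>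
definition torsion_part :: "real \<Rightarrow> (7 \<Rightarrow> real) \<Rightarrow> 7 \<Rightarrow> 7 \<Rightarrow> 7 \<Rightarrow> real"
  where "torsion_part r t b c d = (\<Sum>e\<in>UNIV. t e * psi0 [e, b, c, d])
    + r * (\<Sum>k\<in>UNIV. (\<Sum>e\<in>UNIV. t e * psi0 [e, b, c, k]) * phi0 [d, 1, k]
         + (\<Sum>e\<in>UNIV. t e * psi0 [e, d, 1, k]) * phi0 [b, c, k])"

text \<open>The weight, 1 + r^2 for n = 1 and 1 otherwise, is k times the inverse of the deformed
  metric diag(1/k^2, k, ..., k), since k^3 = 1 + r^2. The identity thus says that this part of the
  derivative has \<open>torsion_t\<close> as its torsion.\<close>

lemma torsion_part_sorted:
  "\<forall>N\<in>set (filter (\<lambda>N. length N = 3) (subseqs [1,2,3,4,5,6,7::7])).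
    (1 + r * r) * torsion_part r (T a) (N ! 0) (N ! 1) (N ! 2) =
    (\<Sum>n\<in>UNIV. (if n = 1 then 1 + r * r else 1) * torsion_t r T a n * deformed_psi r (n # N))"
  unfolding sorted_triples_7 ball_simps torsion_part_def torsion_t_def
  by (intro conjI TrueI; simp add: sum_7 phi0_rows psi0_rows deformed_psi_sorted deformed_psi_repeated
        alternating_sort_4[OF alternating_deformed_psi]; (simp add: algebra_simps)?)

lemma sorted_quadruples_7:
  "set (filter (\<lambda>N. length N = 4) (subseqs [1,2,3,4,5,6,7::7])) =
   {[1,2,3,4], [1,2,3,5], [1,2,3,6], [1,2,3,7], [1,2,4,5], [1,2,4,6], [1,2,4,7], [1,2,5,6],
    [1,2,5,7], [1,2,6,7], [1,3,4,5], [1,3,4,6], [1,3,4,7], [1,3,5,6], [1,3,5,7], [1,3,6,7],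
    [1,4,5,6], [1,4,5,7], [1,4,6,7], [1,5,6,7], [2,3,4,5], [2,3,4,6], [2,3,4,7], [2,3,5,6],
    [2,3,5,7], [2,3,6,7], [2,4,5,6], [2,4,5,7], [2,4,6,7], [2,5,6,7], [3,4,5,6], [3,4,5,7],
    [3,4,6,7], [3,5,6,7], [4,5,6,7]}"
  by (simp add: Let_def)

lemma pullback_twist_psi0:
  assumes k: "k = x\<^sup>2 + y\<^sup>2" "k \<noteq> 0" and x: "x ^ 3 - 3 * x * y\<^sup>2 = 1" "3 * x\<^sup>2 * y - y ^ 3 = - r"
    and k3: "k ^ 3 = 1 + r\<^sup>2" and I: "length I = 4"
  shows "pullback (twist (1 / k) x y) psi0 I = deformed_psi r I / k"
proof (rule alternating_7_ext[OF alternating_pullback[OF alternating_psi0]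
      alternating_divide[OF alternating_deformed_psi] _ I])
  fix N :: "7 list"
  \<comment> \<open>As for the form itself, the relations for x, y and k are stated between
    monomials so that linear arithmetic can use them.\<close>
  have c1: "x * (x * x) = 1 + 3 * (x * (y * y))"
    using x(1) by (simp add: algebra_simps power3_eq_cube power2_eq_square)
  have c2: "3 * (x * (x * y)) = y * (y * y) - r"
    using x(2) by (simp add: algebra_simps power3_eq_cube power2_eq_square)
  have "k * ((x * x + y * y) * (x * x + y * y)) = 1 + r * r"
    using k3 by (simp add: k(1)[unfolded power2_eq_square, symmetric] power3_eq_cube power2_eq_square)
  then have c3: "k * (x * (x * (x * x))) + (k * (y * (y * (y * y))) + 2 * (k * (x * (x * (y * y))))) = 1 + r * r"
    by (simp add: algebra_simps)
  have psi: "pullback P psi0 [a, b, c, d] = (\<Sum>i\<in>UNIV. P $ i $ a * (\<Sum>j\<in>UNIV. P $ j $ b *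
      (\<Sum>l\<in>UNIV. P $ l $ c * (\<Sum>m\<in>UNIV. P $ m $ d * psi0 [i, j, l, m]))))" for P a b c d
    by (simp add: pullback_Cons)
  have "\<forall>N\<in>set (filter (\<lambda>N. length N = 4) (subseqs [1,2,3,4,5,6,7::7])).
      k * pullback (twist (1 / k) x y) psi0 N = deformed_psi r N"
    unfolding sorted_quadruples_7 ball_simps psi twist_columns
    by (intro conjI TrueI; simp add: psi0_rows phi0_rows deformed_psi_sorted k(2);
        (simp add: algebra_simps)?; (use c1 c2 c3 in linarith)?)
  moreover assume "N \<in> set (filter (\<lambda>N. length N = 4) (subseqs [1,2,3,4,5,6,7::7]))"
  ultimately have "k * pullback (twist (1 / k) x y) psi0 N = deformed_psi r N" by blast
  then show "pullback (twist (1 / k) x y) psi0 N = deformed_psi r N / k"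
    using k(2) by (simp add: eq_divide_eq mult.commute)
qed

text \<open>The hypotheses are the projections onto the four components: the trace over 7, the
  contraction with the form over 6, and the remaining skew and symmetric parts. Inserted into the
  first bracket they leave an expression linear in \<open>S\<close>.\<close>

lemma torsion_v_eq_torsion_S:
  assumes s1: "s1 = (\<Sum>a\<in>UNIV. S a a) / 7"
    and s7: "\<And>c. s7 c = (\<Sum>a\<in>UNIV. \<Sum>b\<in>UNIV. phi0 [c, a, b] * S a b) / 6"
    and s14: "\<And>a b. s14 a b = (S a b - S b a) / 2 - (\<Sum>c\<in>UNIV. s7 c * phi0 [c, a, b])"
    and s27: "\<And>a b. s27 a b = (S a b + S b a) / 2 - s1 * (if a = b then 1 else 0)"
  shows "12 * torsion_v r s1 s7 s14 s27 a n = torsion_S r S a n"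
proof -
  have "\<forall>a n. 12 * torsion_v r s1 s7 s14 s27 a n = torsion_S r S a n"
    unfolding forall_7 torsion_v_def torsion_S_def
    by (intro conjI; simp add: sum_7 phi0_rows psi0_rows delta1_def power2_eq_square;
        simp add: s14 s27 sum_7 phi0_rows; simp add: s1 s7 sum_7 phi0_rows;
        simp add: algebra_simps add_divide_distrib diff_divide_distrib; (linarith)?)
  then show ?thesis by blast
qed

section \<open>The torsion formula in an adapted frame\<close>

context adapted
begin

abbreviation "E \<equiv> matrix_inv P"

lemma PE: "P ** E = mat 1" and EP: "E ** P = mat 1"
  by (simp_all add: matrix_inv_mult[OF P])

lemma PE_sum: "(\<Sum>m\<in>UNIV. P $ i $ m * E $ m $ j) = (if i = j then 1 else 0)"
  using arg_cong[OF PE, of "\<lambda>M. M $ i $ j"] by (simp add: matrix_matrix_mult_def mat_def)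

lemma inv_metric: "matrix_inv (g2_metric \<omega>) = E ** transpose E"
proof (rule matrix_inv_eqI)
  have "g2_metric \<omega> ** (E ** transpose E) = transpose P ** (P ** E) ** transpose E"
    by (simp add: metric matrix_mul_assoc)
  also have "\<dots> = transpose (E ** P)" by (simp add: PE matrix_transpose_mul)
  finally show "g2_metric \<omega> ** (E ** transpose E) = mat 1" by (simp add: EP transpose_mat)
qed

lemma inv_metric_sum: "matrix_inv (g2_metric \<omega>) $ a $ b = (\<Sum>i\<in>UNIV. E $ a $ i * E $ b $ i)"
  by (simp add: inv_metric matrix_matrix_mult_def transpose_def)

lemma metric_sum: "g2_metric \<omega> $ a $ b = (\<Sum>i\<in>UNIV. P $ i $ a * P $ i $ b)"
  by (simp add: metric matrix_matrix_mult_def transpose_def)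

text \<open>The components in coordinates of the covector, the vector and the bilinear form with
  given components in the frame.\<close>
definition co :: "(7 \<Rightarrow> real) \<Rightarrow> 7 \<Rightarrow> real" where "co \<beta> m = (\<Sum>i\<in>UNIV. P $ i $ m * \<beta> i)"
definition ve :: "(7 \<Rightarrow> real) \<Rightarrow> 7 \<Rightarrow> real" where "ve \<alpha> m = (\<Sum>i\<in>UNIV. E $ m $ i * \<alpha> i)"
definition bi :: "(7 \<Rightarrow> 7 \<Rightarrow> real) \<Rightarrow> 7 \<Rightarrow> 7 \<Rightarrow> real" where "bi f a n = co (\<lambda>i. co (\<lambda>j. f i j) n) a"

text \<open>\<open>P\<close> and \<open>E\<close> are inverse to each other, so a covector and a
  vector may be paired through their frame components.\<close>

lemma contract: "(\<Sum>m\<in>UNIV. co \<beta> m * ve \<alpha> m) = (\<Sum>i\<in>UNIV. \<beta> i * \<alpha> i)"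
proof -
  have "(\<Sum>m\<in>UNIV. co \<beta> m * ve \<alpha> m) = (\<Sum>m\<in>UNIV. \<Sum>i\<in>UNIV. \<Sum>j\<in>UNIV. \<beta> i * \<alpha> j * (P $ i $ m * E $ m $ j))"
    by (simp add: co_def ve_def sum_product mult_ac)
  also have "\<dots> = (\<Sum>j\<in>UNIV. \<Sum>i\<in>UNIV. \<Sum>m\<in>UNIV. \<beta> i * \<alpha> j * (P $ i $ m * E $ m $ j))"
    by (rule sum_swap_3)
  also have "\<dots> = (\<Sum>j\<in>UNIV. \<Sum>i\<in>UNIV. if i = j then \<beta> i * \<alpha> j else 0)"
    unfolding sum_distrib_left[symmetric] PE_sum by (intro sum.cong refl) simp
  finally show ?thesis by simp
qed

lemma contract': "(\<Sum>m\<in>UNIV. ve \<alpha> m * co \<beta> m) = (\<Sum>i\<in>UNIV. \<beta> i * \<alpha> i)"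
  using contract[of \<beta> \<alpha>] by (simp add: mult.commute)

lemma co_sum: "(\<Sum>k\<in>A. co (f k) m * c k) = co (\<lambda>i. \<Sum>k\<in>A. f k i * c k) m"
  unfolding co_def sum_distrib_right sum_distrib_left by (subst sum.swap) (simp add: mult_ac)

lemma bi_sum: "(\<Sum>k\<in>A. bi (f k) a n * c k) = bi (\<lambda>i j. \<Sum>k\<in>A. f k i j * c k) a n"
  unfolding bi_def by (simp add: co_sum)

lemma ve_sum: "(\<Sum>k\<in>A. ve (f k) m * c k) = ve (\<lambda>i. \<Sum>k\<in>A. f k i * c k) m"
  unfolding ve_def sum_distrib_right sum_distrib_left by (subst sum.swap) (simp add: mult_ac)

lemma co_add: "co (\<lambda>i. f i + g i) m = co f m + co g m"
  by (simp add: co_def distrib_left sum.distrib)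

lemma co_diff: "co (\<lambda>i. f i - g i) m = co f m - co g m"
  by (simp add: co_def right_diff_distrib sum_subtractf)

lemma co_scale: "co (\<lambda>i. c * f i) m = c * co f m"
  by (simp add: co_def sum_distrib_left mult_ac)

lemma co_scale': "co (\<lambda>i. f i * c) m = co f m * c"
  using co_scale[of c f] by (simp add: mult.commute)

lemma bi_add: "bi (\<lambda>i j. f i j + g i j) a n = bi f a n + bi g a n"
  by (simp add: bi_def co_add)

lemma bi_diff: "bi (\<lambda>i j. f i j - g i j) a n = bi f a n - bi g a n"
  by (simp add: bi_def co_diff)

lemma bi_scale: "bi (\<lambda>i j. c * f i j) a n = c * bi f a n"
  by (simp add: bi_def co_scale)

lemma bi_scale': "bi (\<lambda>i j. f i j * c) a n = bi f a n * c"
  using bi_scale[of c f] by (simp add: mult.commute)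

lemma bi_divide: "bi (\<lambda>i j. f i j / c) a n = bi f a n / c"
  using bi_scale[of "inverse c" f] by (simp add: divide_inverse mult.commute)

lemma bi_mult: "bi (\<lambda>i j. f i * g j) a n = co f a * co g n"
  by (simp add: bi_def co_scale co_scale')

lemma bi_mult': "bi (\<lambda>i j. g j * f i) a n = co g n * co f a"
  by (simp add: bi_def co_scale co_scale')

lemma bi_pullback: "pullback P X [a, n] = bi (\<lambda>i j. X [i, j]) a n"
  by (simp add: pullback_Cons bi_def co_def)

lemma bi_metric: "g2_metric \<omega> $ a $ n = bi (\<lambda>i j. if i = j then 1 else 0) a n"
  by (simp add: metric_sum bi_def co_def if_distrib cong: if_cong)

lemma form_first: "\<omega> [m, a, n] = co (\<lambda>k. bi (\<lambda>i j. phi0 [k, i, j]) a n) m"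
  by (simp add: form pullback_Cons bi_def co_def)

lemma form_last: "\<omega> [a, n, m] = co (\<lambda>k. bi (\<lambda>i j. phi0 [i, j, k]) a n) m"
proof -
  have alt: "alternating 3 (pullback P phi0)" by (rule alternating_pullback[OF alternating_phi0])
  have "pullback P phi0 [a, n, m] = pullback P phi0 [m, a, n]"
    using alternating_swap[OF alt, of "[a]" n m "[]"] alternating_swap[OF alt, of "[]" a m "[n]"] by simp
  then have "\<omega> [a, n, m] = co (\<lambda>k. bi (\<lambda>i j. phi0 [k, i, j]) a n) m"
    using form_first[of m a n] by (simp add: form)
  moreover have "(\<lambda>i j. phi0 [k, i, j]) = (\<lambda>i j. phi0 [i, j, k])" for k
    by (intro ext) (rule phi0_cyclic)
  ultimately show ?thesis by simp
qed

lemma form_triple: "\<omega> [n, m, p] = co (\<lambda>i. co (\<lambda>j. co (\<lambda>k. phi0 [i, j, k]) p) m) n"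
  by (simp add: form pullback_Cons co_def)

text \<open>Exchanging the two index pairs is an even permutation. It places the free indices a, n
  innermost, inside \<open>bi\<close>, and the contracted ones outermost, where
  \<open>contract\<close> applies.\<close>

lemma psi_last: "g2_psi \<omega> [a, n, m, p] = co (\<lambda>k. co (\<lambda>l. bi (\<lambda>i j. psi0 [i, j, k, l]) a n) p) m"
proof -
  have pairs: "F [a, n, m, p] = F [m, p, a, n]" if "alternating 4 F" for F :: "7 tensor" and a n m p
    using alternating_swap[OF that, of "[a]" n m "[p]"] alternating_swap[OF that, of "[]" a m "[n, p]"]
      alternating_swap[OF that, of "[m, a]" n p "[]"] alternating_swap[OF that, of "[m]" a p "[n]"] by simp
  have "g2_psi \<omega> [a, n, m, p] = pullback P psi0 [m, p, a, n]"
    using pairs[OF alternating_pullback[OF alternating_psi0]] by (simp add: g2_psi_pullback_phi0[OF P form])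
  also have "\<dots> = co (\<lambda>k. co (\<lambda>l. bi (\<lambda>i j. psi0 [k, l, i, j]) a n) p) m"
    by (simp add: pullback_Cons co_def bi_def)
  finally show ?thesis by (simp only: pairs[OF alternating_psi0])
qed

lemma vector_ve: "w $ m = ve (\<lambda>i. (P *v w) $ i) m"
proof -
  have "w = E *v (P *v w)" by (simp add: matrix_vector_mul_assoc EP)
  then show ?thesis by (metis (no_types) matrix_vector_mult_def ve_def vec_lambda_beta)
qed

lemma u_ve: "u $ m = ve (\<lambda>i. r * delta1 i) m"
proof -
  have "(\<lambda>i. (P *v u) $ i) = (\<lambda>i. r * delta1 i)" by (rule ext) (simp add: vec axis_def delta1_def)
  then show ?thesis using vector_ve[of u m] by simp
qed

lemma flat_co: "flat (g2_metric \<omega>) w [m] = co (\<lambda>i. (P *v w) $ i) m"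
  by (simp add: flat_def metric matrix_vector_mul_assoc[symmetric] co_def vector_matrix_mult_def mult.commute)

lemma flat_u_co: "flat (g2_metric \<omega>) u [m] = co (\<lambda>i. r * delta1 i) m"
proof -
  have "(\<lambda>i. (P *v u) $ i) = (\<lambda>i. r * delta1 i)" by (rule ext) (simp add: vec axis_def delta1_def)
  then show ?thesis by (simp add: flat_co)
qed

lemma sum_delta1: "(\<Sum>k\<in>UNIV. F k * (r * delta1 k)) = F 1 * r" "(\<Sum>k\<in>UNIV. r * delta1 k * F k) = r * F 1"
  by (simp_all add: sum_7 delta1_def)

lemma raise_co: "(\<Sum>l\<in>UNIV. matrix_inv (g2_metric \<omega>) $ p $ l * co \<beta> l) = ve \<beta> p"
proof -
  have "matrix_inv (g2_metric \<omega>) ** transpose P = E ** transpose (P ** E)"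
    by (simp add: inv_metric matrix_transpose_mul matrix_mul_assoc)
  then have "(matrix_inv (g2_metric \<omega>) ** transpose P) $ p $ i = E $ p $ i" for i
    by (simp add: PE transpose_mat)
  then have *: "(\<Sum>l\<in>UNIV. matrix_inv (g2_metric \<omega>) $ p $ l * P $ i $ l) = E $ p $ i" for i
    by (simp add: matrix_matrix_mult_def transpose_def)
  have "(\<Sum>l\<in>UNIV. matrix_inv (g2_metric \<omega>) $ p $ l * co \<beta> l) =
      (\<Sum>i\<in>UNIV. (\<Sum>l\<in>UNIV. matrix_inv (g2_metric \<omega>) $ p $ l * P $ i $ l) * \<beta> i)"
    unfolding co_def sum_distrib_left sum_distrib_right by (subst sum.swap) (simp add: mult_ac)
  then show ?thesis unfolding * by (simp add: ve_def)
qed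

lemma raise_0: "(\<And>j. X (j # I) = co h j) \<Longrightarrow> raise (g2_metric \<omega>) 0 X (m # I) = ve h m"
  by (simp add: raise_def raise_co)

lemma raise_2: "(\<And>j. X [a, n, j] = co h j) \<Longrightarrow> raise (g2_metric \<omega>) 2 X [a, n, m] = ve h m"
  by (simp add: raise_def raise_co)

lemma co_swap: "co (\<lambda>i. co (\<lambda>j. f i j) l) m = co (\<lambda>j. co (\<lambda>i. f i j) m) l"
  unfolding co_def sum_distrib_left by (subst sum.swap) (simp add: mult_ac)

lemma ve_co_swap: "ve (\<lambda>i. co (\<lambda>j. f i j) l) m = co (\<lambda>j. ve (\<lambda>i. f i j) m) l"
  unfolding co_def ve_def sum_distrib_left by (subst sum.swap) (simp add: mult_ac)

lemma raise_0_1: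
  assumes X: "\<And>j l. X (j # l # I) = co (\<lambda>i. co (\<lambda>i'. h i i') l) j"
  shows "raise (g2_metric \<omega>) 0 (raise (g2_metric \<omega>) 1 X) (m # p # I) = ve (\<lambda>i. ve (\<lambda>i'. h i i') p) m"
proof (rule raise_0)
  fix j
  have "raise (g2_metric \<omega>) 1 X (j # p # I) =
      (\<Sum>l\<in>UNIV. matrix_inv (g2_metric \<omega>) $ p $ l * co (\<lambda>i'. co (\<lambda>i. h i i') j) l)"
    by (simp add: raise_def X co_swap[of _ _ j])
  then show "raise (g2_metric \<omega>) 1 X (j # p # I) = co (\<lambda>i. ve (\<lambda>i'. h i i') p) j"
    by (simp add: raise_co ve_co_swap)
qed

lemma form_vector:
  assumes "\<And>m. w m = ve W m"
  shows "(\<Sum>m\<in>UNIV. \<omega> [a, n, m] * w m) = bi (\<lambda>i j. \<Sum>k\<in>UNIV. phi0 [i, j, k] * W k) a n"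
  unfolding assms form_last contract by (rule bi_sum)

lemma psi_vectors:
  assumes v: "\<And>m. v m = ve V m" and w: "\<And>m. w m = ve W m"
  shows "(\<Sum>m\<in>UNIV. \<Sum>p\<in>UNIV. g2_psi \<omega> [a, n, m, p] * v m * w p) =
    bi (\<lambda>i j. \<Sum>k\<in>UNIV. (\<Sum>l\<in>UNIV. psi0 [i, j, k, l] * W l) * V k) a n"
proof -
  have "(\<Sum>p\<in>UNIV. g2_psi \<omega> [a, n, m, p] * w p) =
      co (\<lambda>k. bi (\<lambda>i j. \<Sum>l\<in>UNIV. psi0 [i, j, k, l] * W l) a n) m" for m
    unfolding psi_last co_sum w contract bi_sum ..
  then have "(\<Sum>m\<in>UNIV. (\<Sum>p\<in>UNIV. g2_psi \<omega> [a, n, m, p] * w p) * v m) =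
      bi (\<lambda>i j. \<Sum>k\<in>UNIV. (\<Sum>l\<in>UNIV. psi0 [i, j, k, l] * W l) * V k) a n"
    by (simp only: v contract bi_sum)
  then show ?thesis by (simp add: sum_distrib_left mult_ac)
qed

lemma form_vectors:
  assumes v: "\<And>m. v m = ve V m" and w: "\<And>m. w m = ve W m"
  shows "(\<Sum>m\<in>UNIV. \<Sum>p\<in>UNIV. \<omega> [n, m, p] * v m * w p) =
    co (\<lambda>i. \<Sum>j\<in>UNIV. (\<Sum>k\<in>UNIV. phi0 [i, j, k] * W k) * V j) n"
proof -
  have "(\<Sum>p\<in>UNIV. \<omega> [n, m, p] * w p) = co (\<lambda>i. co (\<lambda>j. \<Sum>k\<in>UNIV. phi0 [i, j, k] * W k) m) n" for m
    unfolding form_triple co_sum w contract ..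
  then have "(\<Sum>m\<in>UNIV. (\<Sum>p\<in>UNIV. \<omega> [n, m, p] * w p) * v m) =
      co (\<lambda>i. \<Sum>j\<in>UNIV. (\<Sum>k\<in>UNIV. phi0 [i, j, k] * W k) * V j) n"
    by (simp only: v contract co_sum)
  then show ?thesis by (simp add: sum_distrib_left mult_ac)
qed

lemma double_raise_u:
  assumes X: "\<And>a b. X [a, b] = bi XF a b"
  shows "(\<Sum>p\<in>UNIV. raise (g2_metric \<omega>) 0 (raise (g2_metric \<omega>) 1 X) [m, p] * flat (g2_metric \<omega>) u [p]) =
    ve (\<lambda>i. r * XF i 1) m"
proof -
  have "raise (g2_metric \<omega>) 0 (raise (g2_metric \<omega>) 1 X) [m, p] = ve (\<lambda>i. ve (\<lambda>i'. XF i i') p) m" for p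
    by (rule raise_0_1) (simp add: X bi_def)
  then show ?thesis
    by (simp only: flat_u_co ve_sum contract' sum_delta1)
qed

lemma u_raise:
  assumes X: "\<And>a b. X [a, b] = bi XF a b"
  shows "(\<Sum>m\<in>UNIV. flat (g2_metric \<omega>) u [m] * raise (g2_metric \<omega>) 0 X [m, a]) = co (\<lambda>j. r * XF 1 j) a"
proof -
  have "raise (g2_metric \<omega>) 0 X [m, a] = ve (\<lambda>i. co (\<lambda>j. XF i j) a) m" for m
    by (rule raise_0) (simp add: X bi_def)
  then show ?thesis unfolding co_scale by (simp only: flat_u_co contract sum_delta1)
qed

lemma form_raise:
  assumes X: "\<And>a b. X [a, b] = bi XF a b"
  shows "(\<Sum>m\<in>UNIV. \<Sum>p\<in>UNIV. \<omega> [n, m, p] * u $ m * raise (g2_metric \<omega>) 0 X [p, a]) =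
    bi (\<lambda>i j. \<Sum>p\<in>UNIV. r * phi0 [j, 1, p] * XF p i) a n"
proof -
  have R: "raise (g2_metric \<omega>) 0 X [p, a] = ve (\<lambda>i. co (\<lambda>j. XF i j) a) p" for p
    by (rule raise_0) (simp add: X bi_def)
  have "(\<Sum>m\<in>UNIV. \<Sum>p\<in>UNIV. \<omega> [n, m, p] * u $ m * raise (g2_metric \<omega>) 0 X [p, a]) =
      co (\<lambda>i. (\<Sum>k\<in>UNIV. phi0 [i, 1, k] * co (\<lambda>j. XF k j) a) * r) n"
    by (subst form_vectors[OF u_ve R]) (simp only: sum_delta1)
  also have "\<dots> = co (\<lambda>i. co (\<lambda>j. \<Sum>p\<in>UNIV. r * phi0 [i, 1, p] * XF p j) a) n"
  proof (rule arg_cong[where f = "\<lambda>f. co f n"], rule ext)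
    fix i
    have "(\<Sum>k\<in>UNIV. co (\<lambda>j. XF k j) a * (phi0 [i, 1, k] * r)) = co (\<lambda>j. \<Sum>k\<in>UNIV. XF k j * (phi0 [i, 1, k] * r)) a"
      by (rule co_sum)
    then show "(\<Sum>k\<in>UNIV. phi0 [i, 1, k] * co (\<lambda>j. XF k j) a) * r =
        co (\<lambda>j. \<Sum>p\<in>UNIV. r * phi0 [i, 1, p] * XF p j) a"
      by (simp only: sum_distrib_left sum_distrib_right mult_ac)
  qed
  finally show ?thesis by (simp only: bi_def co_swap[of _ n a])
qed

lemma form_double_raise:
  assumes X: "\<And>a b. X [a, b] = bi XF a b"
  shows "(\<Sum>m\<in>UNIV. \<Sum>p\<in>UNIV. raise (g2_metric \<omega>) 0 (raise (g2_metric \<omega>) 1 \<omega>) [m, p, n] * X [p, a]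
      * flat (g2_metric \<omega>) u [m]) = bi (\<lambda>i j. \<Sum>p\<in>UNIV. r * phi0 [1, p, j] * XF p i) a n"
proof -
  have R: "raise (g2_metric \<omega>) 0 (raise (g2_metric \<omega>) 1 \<omega>) [m, p, n] =
      ve (\<lambda>k. ve (\<lambda>i. co (\<lambda>j. phi0 [k, i, j]) n) p) m" for m p
    by (rule raise_0_1) (simp add: form_triple)
  have 1: "(\<Sum>m\<in>UNIV. raise (g2_metric \<omega>) 0 (raise (g2_metric \<omega>) 1 \<omega>) [m, p, n] * flat (g2_metric \<omega>) u [m]) =
      r * ve (\<lambda>i. co (\<lambda>j. phi0 [1, i, j]) n) p" for p
    by (simp only: R flat_u_co contract' sum_delta1)
  have "(\<Sum>m\<in>UNIV. \<Sum>p\<in>UNIV. raise (g2_metric \<omega>) 0 (raise (g2_metric \<omega>) 1 \<omega>) [m, p, n] * X [p, a]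
      * flat (g2_metric \<omega>) u [m]) = (\<Sum>p\<in>UNIV. (\<Sum>m\<in>UNIV. raise (g2_metric \<omega>) 0 (raise (g2_metric \<omega>) 1 \<omega>) [m, p, n]
      * flat (g2_metric \<omega>) u [m]) * X [p, a])"
    unfolding sum_distrib_right by (subst sum.swap) (simp only: mult_ac)
  also have "\<dots> = r * (\<Sum>p\<in>UNIV. ve (\<lambda>i. co (\<lambda>j. phi0 [1, i, j]) n) p * co (\<lambda>i. co (\<lambda>j. XF i j) a) p)"
    unfolding 1 X bi_def by (simp only: sum_distrib_left mult_ac)
  also have "\<dots> = r * (\<Sum>p\<in>UNIV. bi (\<lambda>i j. XF p i * phi0 [1, p, j]) a n * 1)"
    unfolding contract' by (simp only: bi_mult mult_1_right)
  also have "\<dots> = bi (\<lambda>i j. \<Sum>p\<in>UNIV. r * phi0 [1, p, j] * XF p i) a n"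
    unfolding bi_sum bi_scale[symmetric] by (simp add: sum_distrib_left mult_ac)
  finally show ?thesis .
qed

lemma u_form:
  "(\<Sum>p\<in>UNIV. raise (g2_metric \<omega>) 0 \<omega> [p, a, n] * flat (g2_metric \<omega>) u [p]) = bi (\<lambda>i j. r * phi0 [1, i, j]) a n"
proof -
  have "raise (g2_metric \<omega>) 0 \<omega> [p, a, n] = ve (\<lambda>k. bi (\<lambda>i j. phi0 [k, i, j]) a n) p" for p
    by (rule raise_0) (rule form_first)
  then show ?thesis by (simp only: flat_u_co contract' sum_delta1 bi_scale)
qed

lemma form_u:
  "(\<Sum>m\<in>UNIV. raise (g2_metric \<omega>) 2 \<omega> [a, n, m] * flat (g2_metric \<omega>) u [m]) = bi (\<lambda>i j. r * phi0 [i, j, 1]) a n"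
proof -
  have "raise (g2_metric \<omega>) 2 \<omega> [a, n, m] = ve (\<lambda>k. bi (\<lambda>i j. phi0 [i, j, k]) a n) m" for m
    by (rule raise_2) (rule form_last)
  then show ?thesis by (simp only: flat_u_co contract' sum_delta1 bi_scale)
qed

text \<open>The vector field is r times the first axis, so each contraction with v selects the index
  1 and yields a factor r. Term by term the formula becomes \<open>bi\<close> of the summands of
  \<open>torsion_v\<close> and \<open>torsion_t\<close>, and the two powers of 1 + M become 1/k^4
  and 1/k.\<close>

lemma deformed_torsion_frame:
  assumes u14: "\<And>a b. u14 [a, b] = bi S14 a b" and u27: "\<And>a b. u27 [a, b] = bi S27 a b"
    and t7: "\<And>a. t7 [a] = co \<sigma>7 a"
    and t14: "\<And>a b. t14 [a, b] = bi T14 a b" and t27: "\<And>a b. t27 [a, b] = bi T27 a b"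
    and T: "\<And>a b. T a b = t1 * (if a = b then 1 else 0) + (\<Sum>c\<in>UNIV. \<sigma>7 c * phi0 [c, a, b]) + T14 a b + T27 a b"
    and T14: "\<And>a b. T14 a b = - T14 b a" and T27: "\<And>a b. T27 a b = T27 b a"
  shows "deformed_torsion \<omega> u u1 u7 u14 u27 t1 t7 t14 t27 a n =
    bi (\<lambda>i j. torsion_v r u1 (\<lambda>i. (P *v u7) $ i) S14 S27 i j / k ^ 4 + torsion_t r T i j / k) a n"
proof -
  let ?g = "g2_metric \<omega>" and ?w = "\<lambda>i. (P *v u7) $ i" and ?d = "\<lambda>i. r * delta1 i"
  let ?up = "raise ?g" and ?uf = "\<lambda>m. flat ?g u [m]"
  have t7s: "sharp ?g t7 $ m = ve \<sigma>7 m" for m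
    by (simp add: sharp_def raise_0[of t7 "[]", OF t7])
  note y14 = double_raise_u[of u14, OF u14] and y27 = double_raise_u[of u27, OF u27]
  have 1: "(\<Sum>m\<in>UNIV. \<omega> [a, n, m] * u $ m) = bi (\<lambda>i j. r * phi0 [i, j, 1]) a n"
    by (subst form_vector[OF u_ve]) (simp only: sum_delta1 mult.commute)
  have 2: "(\<Sum>m\<in>UNIV. \<omega> [a, n, m] * u7 $ m) = bi (\<lambda>i j. \<Sum>m\<in>UNIV. phi0 [i, j, m] * ?w m) a n"
    by (rule form_vector[OF vector_ve])
  have 3: "(\<Sum>m\<in>UNIV. \<Sum>p\<in>UNIV. g2_psi \<omega> [a, n, m, p] * u $ m * w p) =
      bi (\<lambda>i j. \<Sum>p\<in>UNIV. r * psi0 [i, j, 1, p] * W p) a n" if "\<And>m. w m = ve W m" for w W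
    by (subst psi_vectors[OF u_ve that]) (simp only: sum_delta1, simp only: sum_distrib_left sum_distrib_right mult_ac)
  have 4: "(\<Sum>m\<in>UNIV. \<Sum>p\<in>UNIV. \<omega> [b, m, p] * u $ m * w p) =
      co (\<lambda>i. \<Sum>p\<in>UNIV. r * phi0 [i, 1, p] * W p) b" if "\<And>m. w m = ve W m" for b w W
    by (subst form_vectors[OF u_ve that]) (simp only: sum_delta1, simp only: sum_distrib_left sum_distrib_right mult_ac)
  have 5: "(\<Sum>m\<in>UNIV. u7 $ m * ?uf m) = r * ?w 1"
    unfolding vector_ve[of u7] flat_u_co contract' sum_delta1 ..
  have 6: "flat ?g u7 [b] = co ?w b" for b by (rule flat_co)
  have 7: "(\<Sum>m\<in>UNIV. \<Sum>p\<in>UNIV. \<omega> [a, n, m] * ?up 0 (?up 1 X) [m, p] * ?uf p) =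
      bi (\<lambda>i j. \<Sum>m\<in>UNIV. phi0 [i, j, m] * (r * XF m 1)) a n" if "\<And>a b. X [a, b] = bi XF a b" for X XF
    unfolding mult.assoc sum_distrib_left[symmetric] double_raise_u[of X, OF that] by (rule form_vector) (rule refl)
  have 8: "(\<Sum>m\<in>UNIV. \<Sum>p\<in>UNIV. \<Sum>q\<in>UNIV. g2_psi \<omega> [a, n, m, p] * u $ m * ?up 0 (?up 1 X) [p, q] * ?uf q) =
      bi (\<lambda>i j. \<Sum>p\<in>UNIV. r * psi0 [i, j, 1, p] * (r * XF p 1)) a n" if "\<And>a b. X [a, b] = bi XF a b" for X XF
  proof -
    have "(\<Sum>q\<in>UNIV. g2_psi \<omega> [a, n, m, p] * u $ m * ?up 0 (?up 1 X) [p, q] * ?uf q) =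
        g2_psi \<omega> [a, n, m, p] * u $ m * ve (\<lambda>i. r * XF i 1) p" for m p
      unfolding mult.assoc sum_distrib_left[symmetric] double_raise_u[of X, OF that] ..
    then show ?thesis by (simp only: 3[OF refl])
  qed
  have e8: "(\<Sum>m\<in>UNIV. \<Sum>p\<in>UNIV. \<Sum>q\<in>UNIV. g2_psi \<omega> [a, n, m, p] * ?uf q * u $ m * ?up 0 (?up 1 u14) [p, q]) =
      bi (\<lambda>i j. \<Sum>p\<in>UNIV. r * psi0 [i, j, 1, p] * (r * S14 p 1)) a n"
    unfolding 8[OF u14, symmetric] by (simp only: mult_ac)
  have 9: "(\<Sum>m\<in>UNIV. \<Sum>p\<in>UNIV. \<Sum>q\<in>UNIV. \<omega> [b, m, p] * u $ m * ?up 0 (?up 1 u27) [p, q] * ?uf q) =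
      co (\<lambda>i. \<Sum>p\<in>UNIV. r * phi0 [i, 1, p] * (r * S27 p 1)) b" for b
  proof -
    have "(\<Sum>q\<in>UNIV. \<omega> [b, m, p] * u $ m * ?up 0 (?up 1 u27) [p, q] * ?uf q) =
        \<omega> [b, m, p] * u $ m * ve (\<lambda>i. r * S27 i 1) p" for m p
      unfolding mult.assoc sum_distrib_left[symmetric] y27 ..
    then show ?thesis by (simp only: 4[OF refl])
  qed
  have 10: "(\<Sum>p\<in>UNIV. \<Sum>q\<in>UNIV. ?up 0 (?up 1 u27) [p, q] * ?uf p * ?uf q) = r * (r * S27 1 1)"
  proof -
    have "(\<Sum>q\<in>UNIV. ?up 0 (?up 1 u27) [p, q] * ?uf p * ?uf q) = ve (\<lambda>i. r * S27 i 1) p * ?uf p" for p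
      unfolding y27[symmetric] sum_distrib_right by (simp only: mult_ac)
    then show ?thesis by (simp only: flat_u_co contract' sum_delta1)
  qed
  have 11: "(\<Sum>m\<in>UNIV. sharp ?g t7 $ m * ?uf m) = r * \<sigma>7 1"
    by (simp only: t7s flat_u_co contract' sum_delta1)
  have 12: "(\<Sum>m\<in>UNIV. \<Sum>p\<in>UNIV. g2_psi \<omega> [a, n, m, p] * sharp ?g t7 $ m * u $ p) =
      bi (\<lambda>i j. \<Sum>m\<in>UNIV. r * psi0 [i, j, m, 1] * \<sigma>7 m) a n"
    by (subst psi_vectors[OF t7s u_ve], simp only: sum_delta1, simp only: mult_ac)
  have 13: "(\<Sum>m\<in>UNIV. \<omega> [a, n, m] * sharp ?g t7 $ m) = bi (\<lambda>i j. \<Sum>m\<in>UNIV. phi0 [i, j, m] * \<sigma>7 m) a n"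
    by (rule form_vector[OF t7s])
  \<comment> \<open>Products such as v_n F_a separate into covectors, but the factor carrying the
    second index may be written first; these rules match both orders, with and without a
    constant.\<close>
  have rev: "bi (\<lambda>i j. r * delta1 j * F i) a n = co ?d n * co F a"
      "bi (\<lambda>i j. c * (r * delta1 j) * F i) a n = c * co ?d n * co F a" for F c
    unfolding bi_mult' using bi_mult'[of "\<lambda>j. c * (r * delta1 j)" F a n] by (simp_all only: co_scale)
  have fwd: "bi (\<lambda>i j. c * (r * delta1 i) * F j) a n = c * co ?d a * co F n" for F c
    using bi_mult[of "\<lambda>j. c * (r * delta1 j)" F a n] by (simp only: co_scale)
  have "bi (\<lambda>i j. torsion_v r u1 ?w S14 S27 i j / k ^ 4 + torsion_t r T i j / k) a n =
      bi (\<lambda>i j. torsion_v r u1 ?w S14 S27 i j) a n / k ^ 4 + bi (\<lambda>i j. torsion_t r T i j) a n / k"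
    by (simp only: bi_add bi_divide)
  also have "bi (\<lambda>i j. torsion_t r T i j) a n =
      t1 * ?g $ a $ n + t1 * (\<Sum>m\<in>UNIV. ?up 0 \<omega> [m, a, n] * ?uf m) + (\<Sum>m\<in>UNIV. \<omega> [a, n, m] * sharp ?g t7 $ m)
        + ?uf a * t7 [n] - ?g $ a $ n * (\<Sum>m\<in>UNIV. sharp ?g t7 $ m * ?uf m)
        + (\<Sum>m\<in>UNIV. \<Sum>p\<in>UNIV. g2_psi \<omega> [a, n, m, p] * sharp ?g t7 $ m * u $ p) + t14 [a, n]
        - (\<Sum>m\<in>UNIV. \<Sum>p\<in>UNIV. \<omega> [n, m, p] * u $ m * ?up 0 t14 [p, a])
        + t27 [a, n] + (\<Sum>m\<in>UNIV. \<Sum>p\<in>UNIV. \<omega> [n, m, p] * u $ m * ?up 0 t27 [p, a])"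
    unfolding torsion_t_components[OF T T14 T27] u_form 11 12 13 form_raise[OF t14] form_raise[OF t27]
      t7 t14 t27 bi_metric bi_add bi_diff
    unfolding flat_u_co bi_scale[of t1] bi_mult by (simp add: bi_scale bi_def co_scale')
  also have "bi (\<lambda>i j. torsion_v r u1 ?w S14 S27 i j) a n =
        u1 * (?uf a * ?uf n - (1 + r\<^sup>2) * ?g $ a $ n)
        - 4/3 * (1 + r\<^sup>2) * u1 * (\<Sum>m\<in>UNIV. \<omega> [a, n, m] * u $ m)
        - (1 + 4/3 * r\<^sup>2) * (\<Sum>m\<in>UNIV. \<omega> [a, n, m] * u7 $ m)
        - 1/3 * (\<Sum>m\<in>UNIV. \<Sum>p\<in>UNIV. g2_psi \<omega> [a, n, m, p] * u $ m * u7 $ p)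
        + 5/3 * ?uf a * (\<Sum>m\<in>UNIV. \<Sum>p\<in>UNIV. \<omega> [n, m, p] * u $ m * u7 $ p)
        + 4/3 * ?uf n * (\<Sum>m\<in>UNIV. \<Sum>p\<in>UNIV. \<omega> [a, m, p] * u $ m * u7 $ p)
        + 1/3 * (\<Sum>m\<in>UNIV. u7 $ m * ?uf m) * (\<Sum>p\<in>UNIV. ?up 0 \<omega> [p, a, n] * ?uf p)
        + 1/3 * ?uf n * flat ?g u7 [a]
        + 8/3 * ?uf a * flat ?g u7 [n]
        - (1 + r\<^sup>2) * u14 [a, n]
        - 2 * (((\<Sum>m\<in>UNIV. ?uf m * ?up 0 u14 [m, a]) * ?uf n
                - (\<Sum>m\<in>UNIV. ?uf m * ?up 0 u14 [m, n]) * ?uf a) / 2)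
        - 1/3 * (\<Sum>m\<in>UNIV. \<Sum>p\<in>UNIV. \<omega> [a, n, m] * ?up 0 (?up 1 u14) [m, p] * ?uf p)
        + 1/3 * (\<Sum>m\<in>UNIV. \<Sum>p\<in>UNIV. \<Sum>q\<in>UNIV. g2_psi \<omega> [a, n, m, p] * ?uf q * u $ m * ?up 0 (?up 1 u14) [p, q])
        - (1 + r\<^sup>2) * u27 [a, n]
        + (\<Sum>m\<in>UNIV. ?uf m * ?up 0 u27 [m, a]) * ?uf n
        - (1 + r\<^sup>2) * (\<Sum>m\<in>UNIV. \<Sum>p\<in>UNIV. ?up 0 (?up 1 \<omega>) [m, p, n] * u27 [p, a] * ?uf m)
        - 1/3 * (\<Sum>m\<in>UNIV. \<Sum>p\<in>UNIV. \<omega> [a, n, m] * ?up 0 (?up 1 u27) [m, p] * ?uf p)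
        + 1/3 * (\<Sum>m\<in>UNIV. \<Sum>p\<in>UNIV. \<Sum>q\<in>UNIV. g2_psi \<omega> [a, n, m, p] * u $ m * ?up 0 (?up 1 u27) [p, q] * ?uf q)
        + ?uf a * (\<Sum>m\<in>UNIV. \<Sum>p\<in>UNIV. \<Sum>q\<in>UNIV. \<omega> [n, m, p] * u $ m * ?up 0 (?up 1 u27) [p, q] * ?uf q)
        - 1/3 * (\<Sum>m\<in>UNIV. ?up 2 \<omega> [a, n, m] * ?uf m)
              * (\<Sum>p\<in>UNIV. \<Sum>q\<in>UNIV. ?up 0 (?up 1 u27) [p, q] * ?uf p * ?uf q)"
    unfolding torsion_v_def u_form form_u 1 2 3[OF vector_ve] 4[OF vector_ve] 5 6 7[OF u14] 7[OF u27] 8[OF u27] e8 9 10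
      u_raise[OF u14] u_raise[OF u27] form_double_raise[OF u27]
    unfolding flat_u_co u14 u27 bi_metric bi_add bi_diff
    by (simp add: bi_scale bi_scale' bi_divide bi_diff bi_mult bi_mult' rev fwd co_scale co_scale' mult_ac)
  finally show ?thesis
    unfolding deformed_torsion_def Let_def norm_u powr_k by simp
qed

end

section \<open>The four components in the frame\<close>

lemma form_contract_symmetric:
  assumes "\<And>a b. X a b = X b a"
  shows "(\<Sum>a\<in>UNIV. \<Sum>b\<in>UNIV. phi0 [c, a, b] * X a b) = 0"
proof -
  have anti: "phi0 [c, b, a] = - phi0 [c, a, b]" for a b
    using alternating_swap[OF alternating_phi0, of "[c]" b a "[]"] by simp
  have pt: "phi0 [c, b, a] * X b a = - (phi0 [c, a, b] * X a b)" for a b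
    using anti[of b a] assms[of b a] by simp
  have "(\<Sum>a\<in>UNIV. \<Sum>b\<in>UNIV. phi0 [c, a, b] * X a b) = (\<Sum>a\<in>UNIV. \<Sum>b\<in>UNIV. phi0 [c, b, a] * X b a)"
    by (rule sum.swap)
  also have "\<dots> = (\<Sum>a\<in>UNIV. \<Sum>b\<in>UNIV. - (phi0 [c, a, b] * X a b))"
    by (intro sum.cong refl, rule pt)
  finally show ?thesis by (simp add: sum_negf)
qed

text \<open>Each index lies in three of the seven triples, each counted in two orders. This 6 is the
  divisor by which the vector component is recovered.\<close>

lemma form_contract_form: "(\<Sum>a\<in>UNIV. \<Sum>b\<in>UNIV. phi0 [c, a, b] * phi0 [d, a, b]) = (if c = d then 6 else 0)"
proof -
  have "\<forall>c d. (\<Sum>a\<in>UNIV. \<Sum>b\<in>UNIV. phi0 [c, a, b] * phi0 [d, a, b]) = (if c = d then 6 else 0)"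
    unfolding forall_7 by (intro conjI; simp add: sum_7 phi0_rows)
  then show ?thesis by blast
qed

context adapted
begin

lemma co_zero: "(\<And>m. co \<beta> m = 0) \<Longrightarrow> \<beta> i = 0"
  using contract[of \<beta> "\<lambda>l. if l = i then 1 else 0"] by (simp add: if_distrib cong: if_cong)

lemma frame_components: "X [a, b] = bi (\<lambda>i j. pullback E X [i, j]) a b"
  unfolding bi_pullback[symmetric] by (simp add: pullback_pullback EP)

lemma frame_eqI:
  assumes "\<And>a b. X [a, b] = bi H a b"
  shows "pullback E X [i, j] = H i j"
proof -
  have "pullback E X [i, j] = pullback E (pullback P (\<lambda>J. H (J ! 0) (J ! 1))) [i, j]"
    by (rule pullback_cong) (auto simp: length_Suc_conv assms bi_pullback)
  then show ?thesis by (simp add: pullback_pullback PE)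
qed

text \<open>In an orthonormal frame the conditions on the components lose their raised indices:
  skewness and vanishing contraction with \<open>phi0\<close> for the 14-part, symmetry and
  vanishing trace for the 27-part.\<close>

lemma g2_components_frame:
  assumes "g2_components \<omega> S s1 s7 s14 s27"
  defines "w \<equiv> \<lambda>c. (P *v s7) $ c" and "SF \<equiv> \<lambda>i j. pullback E S [i, j]"
    and "F14 \<equiv> \<lambda>i j. pullback E s14 [i, j]" and "F27 \<equiv> \<lambda>i j. pullback E s27 [i, j]"
  shows "SF i j = s1 * (if i = j then 1 else 0) + (\<Sum>c\<in>UNIV. w c * phi0 [c, i, j]) + F14 i j + F27 i j"
    and "F14 i j = - F14 j i" and "F27 i j = F27 j i" and "(\<Sum>i\<in>UNIV. F27 i i) = 0"
    and "(\<Sum>i\<in>UNIV. \<Sum>j\<in>UNIV. phi0 [c, i, j] * F14 i j) = 0"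
proof -
  have c: "s14 \<in> Lambda2_14 \<omega>" "s27 \<in> traceless_symmetric \<omega>"
    "\<And>a b. S [a, b] = s1 * g2_metric \<omega> $ a $ b + (\<Sum>c\<in>UNIV. s7 $ c * \<omega> [c, a, b]) + s14 [a, b] + s27 [a, b]"
    using assms(1) unfolding g2_components_def by blast+
  note s14 = frame_components[of s14, folded F14_def] and s27 = frame_components[of s27, folded F27_def]
  have s14: "s14 [a, b] = bi F14 a b" and s27: "s27 [a, b] = bi F27 a b" for a b
    by (simp_all only: F14_def F27_def frame_components[symmetric])
  have "(\<Sum>c\<in>UNIV. s7 $ c * \<omega> [c, a, b]) = bi (\<lambda>i j. \<Sum>c\<in>UNIV. w c * phi0 [c, i, j]) a b" for a b
  proof -
    have "(\<Sum>c\<in>UNIV. s7 $ c * \<omega> [c, a, b]) = (\<Sum>k\<in>UNIV. bi (\<lambda>i j. phi0 [k, i, j]) a b * w k)"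
      unfolding form_first vector_ve[of s7] contract' w_def ..
    also have "\<dots> = bi (\<lambda>i j. \<Sum>k\<in>UNIV. phi0 [k, i, j] * w k) a b" by (rule bi_sum)
    finally show ?thesis by (simp only: mult.commute)
  qed
  then have "S [a, b] = bi (\<lambda>i j. s1 * (if i = j then 1 else 0) + (\<Sum>c\<in>UNIV. w c * phi0 [c, i, j]) + F14 i j + F27 i j) a b" for a b
    unfolding c(3) s14 s27 bi_metric bi_add bi_scale by simp
  from frame_eqI[OF this] show "SF i j = s1 * (if i = j then 1 else 0) + (\<Sum>c\<in>UNIV. w c * phi0 [c, i, j]) + F14 i j + F27 i j"
    by (simp add: SF_def)
  have "alternating 2 s14" using c(1) by (simp add: Lambda2_14_def)
  then have "alternating 2 (pullback E s14)" by (rule alternating_pullback)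
  from alternating_swap[OF this, of "[]" i j "[]"] show "F14 i j = - F14 j i" by (simp add: F14_def)
  have sym: "s27 [a, b] = s27 [b, a]" for a b using c(2) by (simp add: traceless_symmetric_def)
  show "F27 i j = F27 j i"
    unfolding F27_def
    by (simp add: pullback_Cons sum_distrib_left, subst sum.swap) (simp add: sym mult_ac)
  have "raise (g2_metric \<omega>) 0 s27 [a, a] = (\<Sum>i\<in>UNIV. co (F27 i) a * E $ a $ i)" for a
    by (subst raise_0[of s27 "[a]" "\<lambda>i. co (F27 i) a"]) (simp_all add: s27 bi_def ve_def mult.commute)
  then have "0 = (\<Sum>a\<in>UNIV. \<Sum>i\<in>UNIV. co (F27 i) a * E $ a $ i)"
    using c(2) by (simp add: traceless_symmetric_def)
  also have "\<dots> = (\<Sum>i\<in>UNIV. \<Sum>a\<in>UNIV. co (F27 i) a * ve (\<lambda>l. if l = i then 1 else 0) a)"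
    by (subst sum.swap) (simp add: ve_def if_distrib cong: if_cong)
  also have "\<dots> = (\<Sum>i\<in>UNIV. F27 i i)"
    unfolding contract by (simp add: if_distrib cong: if_cong)
  finally show "(\<Sum>i\<in>UNIV. F27 i i) = 0" by simp
  have 0: "co (\<lambda>k. \<Sum>i\<in>UNIV. \<Sum>j\<in>UNIV. phi0 [i, j, k] * F14 i j) c = 0" for c
  proof -
    have R: "raise (g2_metric \<omega>) 0 (raise (g2_metric \<omega>) 1 s14) [a, b] = ve (\<lambda>i. ve (\<lambda>j. F14 i j) b) a" for a b
      by (rule raise_0_1) (simp add: s14 bi_def)
    have "0 = (\<Sum>a\<in>UNIV. \<Sum>b\<in>UNIV. raise (g2_metric \<omega>) 0 (raise (g2_metric \<omega>) 1 s14) [a, b] * \<omega> [a, b, c])"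
      using c(1) by (simp add: Lambda2_14_def)
    also have "\<dots> = (\<Sum>b\<in>UNIV. \<Sum>a\<in>UNIV. ve (\<lambda>i. ve (\<lambda>j. F14 i j) b) a * co (\<lambda>i. co (\<lambda>j. co (\<lambda>k. phi0 [i, j, k]) c) b) a)"
      by (subst sum.swap) (simp only: R form_triple)
    also have "\<dots> = (\<Sum>i\<in>UNIV. \<Sum>b\<in>UNIV. co (\<lambda>j. co (\<lambda>k. phi0 [i, j, k]) c) b * ve (\<lambda>j. F14 i j) b)"
      unfolding contract' by (rule sum.swap)
    also have "\<dots> = (\<Sum>i\<in>UNIV. \<Sum>j\<in>UNIV. co (\<lambda>k. phi0 [i, j, k]) c * F14 i j)"
      unfolding contract ..
    also have "\<dots> = (\<Sum>i\<in>UNIV. co (\<lambda>k. \<Sum>j\<in>UNIV. phi0 [i, j, k] * F14 i j) c * 1)"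
      by (simp only: co_sum mult_1_right)
    also have "\<dots> = co (\<lambda>k. \<Sum>i\<in>UNIV. (\<Sum>j\<in>UNIV. phi0 [i, j, k] * F14 i j) * 1) c"
      by (rule co_sum)
    finally show ?thesis by simp
  qed
  from co_zero[OF 0] show "(\<Sum>i\<in>UNIV. \<Sum>j\<in>UNIV. phi0 [c, i, j] * F14 i j) = 0"
    by (simp add: phi0_cyclic[of c])
qed

text \<open>The decomposition is inverted to supply the projections required by
  \<open>torsion_v_eq_torsion_S\<close>. The trace sees only the scalar part, and the contraction
  with \<open>phi0\<close> sees only the vector part.\<close>

lemma g2_components_torsion_S:
  assumes comp: "g2_components \<omega> S s1 s7 s14 s27"
  shows "12 * torsion_v r s1 (\<lambda>c. (P *v s7) $ c) (\<lambda>i j. pullback E s14 [i, j]) (\<lambda>i j. pullback E s27 [i, j]) a n =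
    torsion_S r (\<lambda>i j. pullback E S [i, j]) a n"
proof (rule torsion_v_eq_torsion_S)
  let ?w = "\<lambda>c. (P *v s7) $ c" and ?S = "\<lambda>i j. pullback E S [i, j]"
    and ?A = "\<lambda>i j. pullback E s14 [i, j]" and ?H = "\<lambda>i j. pullback E s27 [i, j]"
  note f = g2_components_frame[OF comp]
  have anti: "phi0 [c, b, a] = - phi0 [c, a, b]" for a b c
    using alternating_swap[OF alternating_phi0, of "[c]" b a "[]"] by simp
  have d0: "phi0 [c, a, a] = 0" for a c
    by (rule alternating_not_distinct[OF alternating_phi0]) simp_all
  have A0: "?A i i = 0" for i using f(2)[of i i] by simp
  show "s1 = (\<Sum>i\<in>UNIV. ?S i i) / 7"
    unfolding f(1) by (simp add: sum.distrib f(4) A0 d0)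
  show w: "?w c = (\<Sum>i\<in>UNIV. \<Sum>j\<in>UNIV. phi0 [c, i, j] * ?S i j) / 6" for c
  proof -
    have "(\<Sum>i\<in>UNIV. \<Sum>j\<in>UNIV. phi0 [c, i, j] * ?S i j) =
        (\<Sum>i\<in>UNIV. \<Sum>j\<in>UNIV. phi0 [c, i, j] * (s1 * (if i = j then 1 else 0)))
        + (\<Sum>i\<in>UNIV. \<Sum>j\<in>UNIV. \<Sum>d\<in>UNIV. ?w d * (phi0 [c, i, j] * phi0 [d, i, j]))
        + (\<Sum>i\<in>UNIV. \<Sum>j\<in>UNIV. phi0 [c, i, j] * ?A i j) + (\<Sum>i\<in>UNIV. \<Sum>j\<in>UNIV. phi0 [c, i, j] * ?H i j)"
      unfolding f(1) distrib_left sum.distrib by (simp only: sum_distrib_left mult_ac)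
    also have "(\<Sum>i\<in>UNIV. \<Sum>j\<in>UNIV. phi0 [c, i, j] * (s1 * (if i = j then 1 else 0))) = 0"
      by (rule form_contract_symmetric) auto
    also have "(\<Sum>i\<in>UNIV. \<Sum>j\<in>UNIV. \<Sum>d\<in>UNIV. ?w d * (phi0 [c, i, j] * phi0 [d, i, j])) = 6 * ?w c"
    proof -
      have "(\<Sum>i\<in>UNIV. \<Sum>j\<in>UNIV. \<Sum>d\<in>UNIV. ?w d * (phi0 [c, i, j] * phi0 [d, i, j])) =
          (\<Sum>d\<in>UNIV. ?w d * (\<Sum>j\<in>UNIV. \<Sum>i\<in>UNIV. phi0 [c, i, j] * phi0 [d, i, j]))"
        by (subst sum_swap_3) (simp only: sum_distrib_left)
      also have "\<dots> = (\<Sum>d\<in>UNIV. if c = d then 6 * ?w c else 0)"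
        by (subst sum.swap) (intro sum.cong refl, simp add: form_contract_form)
      finally show ?thesis by simp
    qed
    also have "(\<Sum>i\<in>UNIV. \<Sum>j\<in>UNIV. phi0 [c, i, j] * ?A i j) = 0" by (rule f(5))
    also have "(\<Sum>i\<in>UNIV. \<Sum>j\<in>UNIV. phi0 [c, i, j] * ?H i j) = 0"
      by (rule form_contract_symmetric) (rule f(3))
    finally show ?thesis by simp
  qed
  \<comment> \<open>Transposition changes the sign of the vector and 14-parts and keeps the other
    two, so half the sum and half the difference isolate the remaining components.\<close>
  have SS: "?S j i = s1 * (if i = j then 1 else 0) - (\<Sum>c\<in>UNIV. ?w c * phi0 [c, i, j]) - ?A i j + ?H i j" for i j
    unfolding f(1)[of j i] f(2)[of j i] f(3)[of j i] anti[of _ i j] by (simp add: sum_negf eq_commute)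
  show "?A i j = (?S i j - ?S j i) / 2 - (\<Sum>c\<in>UNIV. ?w c * phi0 [c, i, j])" for i j
    unfolding SS[where i = i and j = j] f(1)[of i j] by (simp add: add_divide_distrib)
  show "?H i j = (?S i j + ?S j i) / 2 - s1 * (if i = j then 1 else 0)" for i j
    unfolding SS[where i = i and j = j] f(1)[of i j] by (simp add: add_divide_distrib)
qed

end

section \<open>The difference of two Levi-Civita connections\<close>

lemma partial_deriv_cong:
  assumes "open U" "x \<in> U" "\<And>y. y \<in> U \<Longrightarrow> f y = g y" "f differentiable (at x)"
  shows "partial_deriv i f x = partial_deriv i g x"
proof -
  have "(f has_derivative frechet_derivative f (at x)) (at x)"
    using assms(4) by (simp add: frechet_derivative_works)
  then have "(g has_derivative frechet_derivative f (at x)) (at x)"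
    using differentiable_cong_open[OF assms(1,2), of f g] assms(3) by blast
  from partial_deriv_eq[OF this] show ?thesis by (simp only: partial_deriv_def)
qed

lemma christoffel_lower:
  fixes g :: "'a \<Rightarrow> real^'n^'n"
  assumes "invertible (g p)" "transpose (g p) = g p"
  shows "(\<Sum>e\<in>UNIV. christoffel c g p e i j * g p $ e $ l) =
    (coord_deriv c i (\<lambda>q. g q $ j $ l) p + coord_deriv c j (\<lambda>q. g q $ i $ l) p
     - coord_deriv c l (\<lambda>q. g q $ i $ j) p) / 2"
proof -
  let ?Y = "\<lambda>l. coord_deriv c i (\<lambda>q. g q $ j $ l) p + coord_deriv c j (\<lambda>q. g q $ i $ l) p
     - coord_deriv c l (\<lambda>q. g q $ i $ j) p"
  have sym: "g p $ e $ l = g p $ l $ e" for e l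
    using arg_cong[OF assms(2), of "\<lambda>M. M $ l $ e"] by (simp add: transpose_def)
  have inv: "(\<Sum>e\<in>UNIV. g p $ l $ e * matrix_inv (g p) $ e $ m) = (if l = m then 1 else 0)" for m
    using arg_cong[OF matrix_inv_mult(1)[OF assms(1)], of "\<lambda>M. M $ l $ m"]
    by (simp add: matrix_matrix_mult_def mat_def)
  have "(\<Sum>e\<in>UNIV. christoffel c g p e i j * g p $ e $ l) =
      (\<Sum>e\<in>UNIV. \<Sum>m\<in>UNIV. g p $ l $ e * matrix_inv (g p) $ e $ m * ?Y m) / 2"
    by (simp add: christoffel_def sum_divide_distrib[symmetric] sum_distrib_right sum_distrib_left sym[of _ l] mult_ac)
  also have "\<dots> = (\<Sum>m\<in>UNIV. (if l = m then 1 else 0) * ?Y m) / 2"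
    by (subst sum.swap) (simp only: sum_distrib_right[symmetric] inv)
  finally show ?thesis by (simp add: if_distrib if_distribR cong: if_cong)
qed

lemma cov_deriv_metric:
  "cov_deriv c g (\<lambda>q I. h q $ (I ! 0) $ (I ! 1)) p [i, j, l] = coord_deriv c i (\<lambda>q. h q $ j $ l) p
    - (\<Sum>e\<in>UNIV. christoffel c g p e i j * h p $ e $ l) - (\<Sum>e\<in>UNIV. christoffel c g p e i l * h p $ j $ e)"
  by (simp add: cov_deriv_def numeral_2_eq_2)

text \<open>The derivatives of h are written as covariant derivatives for g plus Christoffel terms
  of g. Because the latter are symmetric in the lower indices, the cyclic combination in the formula
  for the Christoffel symbols of h leaves twice one of them, which is the connection of g.\<close>

lemma christoffel_difference:
  fixes g h :: "'a \<Rightarrow> real^'n^'n"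
  assumes g: "\<And>i j l. coord_deriv c i (\<lambda>q. g q $ j $ l) p = coord_deriv c i (\<lambda>q. g q $ l $ j) p"
    and h: "invertible (h p)" "transpose (h p) = h p"
  defines "Y \<equiv> \<lambda>i j l. cov_deriv c g (\<lambda>q I. h q $ (I ! 0) $ (I ! 1)) p [i, j, l]"
  shows "christoffel c h p k i j = christoffel c g p k i j +
    (\<Sum>l\<in>UNIV. matrix_inv (h p) $ k $ l * (Y i j l + Y j i l - Y l i j)) / 2"
proof -
  let ?L = "\<lambda>i j l. \<Sum>e\<in>UNIV. christoffel c g p e i j * h p $ e $ l"
  have sym: "h p $ e $ l = h p $ l $ e" for e l
    using arg_cong[OF h(2), of "\<lambda>M. M $ l $ e"] by (simp add: transpose_def)
  have csym: "christoffel c g p e i j = christoffel c g p e j i" for e i j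
    unfolding christoffel_def using g[of _ i j] by (simp add: add.commute)
  have Lsym: "?L i j l = ?L j i l" for i j l by (simp only: csym[of _ i j])
  have Y: "Y i j l = coord_deriv c i (\<lambda>q. h q $ j $ l) p - ?L i j l - ?L i l j" for i j l
    unfolding Y_def cov_deriv_metric by (simp add: sym[of j])
  have comb: "coord_deriv c i (\<lambda>q. h q $ j $ l) p + coord_deriv c j (\<lambda>q. h q $ i $ l) p
     - coord_deriv c l (\<lambda>q. h q $ i $ j) p = Y i j l + Y j i l - Y l i j + 2 * ?L i j l" for l
    unfolding Y using Lsym[of j i l] Lsym[of l i j] Lsym[of l j i] by linarith
  have inv: "(\<Sum>l\<in>UNIV. matrix_inv (h p) $ k $ l * h p $ l $ e) = (if k = e then 1 else 0)" for e
    using arg_cong[OF matrix_inv_mult(2)[OF h(1)], of "\<lambda>M. M $ k $ e"]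
    by (simp add: matrix_matrix_mult_def mat_def)
  have "(\<Sum>l\<in>UNIV. matrix_inv (h p) $ k $ l * ?L i j l) =
      (\<Sum>e\<in>UNIV. (\<Sum>l\<in>UNIV. matrix_inv (h p) $ k $ l * h p $ l $ e) * christoffel c g p e i j)"
    unfolding sum_distrib_left sum_distrib_right by (subst sum.swap) (simp add: sym[of _ "_::'n"] mult_ac)
  also have "\<dots> = christoffel c g p k i j"
    unfolding inv by (simp add: if_distrib if_distribR cong: if_cong)
  finally have L: "(\<Sum>l\<in>UNIV. matrix_inv (h p) $ k $ l * ?L i j l) = christoffel c g p k i j" .
  show ?thesis
    unfolding christoffel_def[of c h] comb distrib_left sum.distrib mult.left_commute[of _ 2] sum_distrib_left[symmetric] L
    by (simp add: add_divide_distrib)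
qed

lemma cov_deriv_difference:
  "cov_deriv c h T p (i # I) = cov_deriv c g T p (i # I) -
    (\<Sum>m<length I. \<Sum>e\<in>UNIV. (christoffel c h p e i (I ! m) - christoffel c g p e i (I ! m)) * T p (I[m := e]))"
  by (simp add: cov_deriv_def left_diff_distrib sum_subtractf)

text \<open>The hypothesis says that \<open>M'\<close> is the endomorphism \<open>M\<close> in the
  basis \<open>E\<close>; the derivation it induces commutes with passing to that basis.\<close>

lemma pullback_derivation:
  assumes M: "\<And>e b. (\<Sum>j\<in>UNIV. M e j * E $ j $ b) = (\<Sum>l\<in>UNIV. E $ e $ l * M' l b)"
  shows "pullback E (\<lambda>J. \<Sum>m<length J. \<Sum>e\<in>UNIV. M e (J ! m) * T (J[m := e])) I =
    (\<Sum>m<length I. \<Sum>e\<in>UNIV. M' e (I ! m) * pullback E T (I[m := e]))"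
proof (induction I arbitrary: T)
  case (Cons b I)
  let ?p = "\<lambda>e. pullback E (\<lambda>J. T (e # J)) I"
  have "pullback E (\<lambda>J. \<Sum>m<length J. \<Sum>e\<in>UNIV. M e (J ! m) * T (J[m := e])) (b # I) =
      (\<Sum>j\<in>UNIV. E $ j $ b * ((\<Sum>e\<in>UNIV. M e j * ?p e)
        + (\<Sum>m<length I. \<Sum>e\<in>UNIV. M' e (I ! m) * pullback E (\<lambda>J. T (j # J)) (I[m := e]))))"
    by (simp add: pullback_Cons sum.lessThan_Suc_shift pullback_add pullback_sum pullback_scale Cons[symmetric]
        del: sum.lessThan_Suc)
  also have "\<dots> = (\<Sum>j\<in>UNIV. \<Sum>e\<in>UNIV. E $ j $ b * (M e j * ?p e))
      + (\<Sum>j\<in>UNIV. \<Sum>m<length I. \<Sum>e\<in>UNIV. M' e (I ! m) * (E $ j $ b * pullback E (\<lambda>J. T (j # J)) (I[m := e])))"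
    by (simp add: distrib_left sum.distrib sum_distrib_left mult_ac)
  also have "(\<Sum>j\<in>UNIV. \<Sum>e\<in>UNIV. E $ j $ b * (M e j * ?p e)) = (\<Sum>e\<in>UNIV. (\<Sum>j\<in>UNIV. M e j * E $ j $ b) * ?p e)"
    by (subst sum.swap) (simp add: sum_distrib_left sum_distrib_right mult_ac)
  also have "\<dots> = (\<Sum>l\<in>UNIV. M' l b * pullback E T (l # I))"
    unfolding M by (simp add: sum_distrib_right pullback_Cons sum_distrib_left, subst sum.swap) (simp add: mult_ac)
  also have "(\<Sum>j\<in>UNIV. \<Sum>m<length I. \<Sum>e\<in>UNIV. M' e (I ! m) * (E $ j $ b * pullback E (\<lambda>J. T (j # J)) (I[m := e])))
      = (\<Sum>m<length I. \<Sum>e\<in>UNIV. M' e (I ! m) * pullback E T (b # I[m := e]))"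
  proof -
    have "(\<Sum>j\<in>UNIV. \<Sum>m<length I. \<Sum>e\<in>UNIV. M' e (I ! m) * (E $ j $ b * pullback E (\<lambda>J. T (j # J)) (I[m := e])))
      = (\<Sum>m<length I. \<Sum>j\<in>UNIV. \<Sum>e\<in>UNIV. M' e (I ! m) * (E $ j $ b * pullback E (\<lambda>J. T (j # J)) (I[m := e])))"
      by (rule sum.swap)
    also have "\<dots> = (\<Sum>m<length I. \<Sum>e\<in>UNIV. \<Sum>j\<in>UNIV. M' e (I ! m) * (E $ j $ b * pullback E (\<lambda>J. T (j # J)) (I[m := e])))"
      by (rule sum.cong[OF refl], rule sum.swap)
    finally show ?thesis by (simp add: pullback_Cons sum_distrib_left)
  qed
  finally show ?case by (simp add: sum.lessThan_Suc_shift del: sum.lessThan_Suc)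
qed simp

lemma g2_metric_pullback:
  assumes "positive_form \<omega>" "invertible A"
  shows "g2_metric (pullback A \<omega>) = transpose A ** g2_metric \<omega> ** A"
  using positive_metric_volume[OF assms(1)] g2_metric_eq metric_volume_pullback[OF _ assms(2)] by metis

lemma positive_pullback:
  assumes "positive_form \<omega>" "invertible A"
  shows "positive_form (pullback A \<omega>)"
proof -
  obtain P where P: "invertible P" "\<And>I. length I = 3 \<Longrightarrow> \<omega> I = pullback P phi0 I"
    using assms(1) unfolding positive_form_def by blast
  have "pullback A \<omega> I = pullback (P ** A) phi0 I" if "length I = 3" for I
    unfolding pullback_pullback[symmetric] by (rule pullback_cong) (simp add: P that)
  then show ?thesis
    unfolding positive_form_def using invertible_mult[OF P(1) assms(2)] by blast
qed

lemma g2_metric_cong: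
  assumes "\<And>I. length I = 3 \<Longrightarrow> \<omega> I = \<omega>' I"
  shows "g2_metric \<omega> = g2_metric \<omega>'"
proof -
  have "metric_volume \<omega> = metric_volume \<omega>'"
    by (intro ext metric_volume_cong assms)
  then show ?thesis by (simp add: g2_metric_def)
qed

text \<open>Reads a matrix as a tensor on index lists, so that \<open>pullback\<close> and
  \<open>cov_deriv\<close> apply to metrics.\<close>

definition metric_tensor :: "real^'n^'n \<Rightarrow> 'n tensor"
  where "metric_tensor g I = g $ (I ! 0) $ (I ! 1)"

lemma pullback_metric_tensor:
  "pullback A (metric_tensor g) [i, j] = (transpose A ** g ** A) $ i $ j"
  by (simp add: pullback_Cons metric_tensor_def matrix_matrix_mult_def transpose_def
      sum_distrib_left sum_distrib_right, subst sum.swap) (simp add: mult_ac)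

lemma pullback_flat: "pullback A (flat g w) [j] = ((g *v w) v* A) $ j"
  by (simp add: pullback_Cons flat_def vector_matrix_mult_def mult.commute)

section \<open>Derivatives of the deformed form and metric at a point\<close>

locale deformation_point =
  adapted "\<phi> p" "v p" P r k x y
  for c :: "('a, 7) chart" and \<phi> :: "'a \<Rightarrow> 7 tensor" and v :: "'a \<Rightarrow> real^7" and p :: 'a
    and P :: "real^7^7" and r k x y :: real +
  assumes dom: "open (snd c ` fst c)" "p \<in> fst c" "\<And>q. q \<in> fst c \<Longrightarrow> chart_inv c (snd c q) = q"
    and smooth_form: "\<And>I. length I = 3 \<Longrightarrow> smooth_on (snd c ` fst c) (\<lambda>x. \<phi> (chart_inv c x) I)"
    and smooth_vector: "\<And>i. smooth_on (snd c ` fst c) (\<lambda>x. v (chart_inv c x) $ i)"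
    and pos: "\<And>q. q \<in> fst c \<Longrightarrow> positive_form (\<phi> q)"
begin

abbreviation "D \<equiv> snd c ` fst c"
abbreviation "x0 \<equiv> snd c p"
abbreviation "g q \<equiv> g2_metric (\<phi> q)"
abbreviation "\<phi>' q \<equiv> deform (\<phi> q) (v q)"
abbreviation "h q \<equiv> g2_metric (\<phi>' q)"
abbreviation "w q \<equiv> flat (g q) (v q)"

lemma x0: "x0 \<in> D" "chart_inv c x0 = p"
  using dom by auto

lemma inv_pos: "z \<in> D \<Longrightarrow> positive_form (\<phi> (chart_inv c z))"
  by (rule pos[OF chart_inv_in])

lemma smooth_g: "smooth_on D (\<lambda>z. g (chart_inv c z) $ i $ j)"
  by (rule smooth_on_g2_metric[OF dom(1) smooth_form inv_pos])

lemma smooth_deform: "length I = 3 \<Longrightarrow> smooth_on D (\<lambda>z. \<phi>' (chart_inv c z) I)"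
  by (rule smooth_on_deform[OF dom(1) smooth_form inv_pos smooth_vector])

lemma smooth_h: "smooth_on D (\<lambda>z. h (chart_inv c z) $ i $ j)"
  by (rule smooth_on_g2_metric[OF dom(1) smooth_deform positive_deform[OF inv_pos]])

lemma smooth_w: "smooth_on D (\<lambda>z. w (chart_inv c z) [i])"
proof -
  have "smooth_on D (\<lambda>z. \<Sum>j\<in>UNIV. g (chart_inv c z) $ i $ j * v (chart_inv c z) $ j)"
    by (intro smooth_on_sum smooth_on_mult dom(1) smooth_g smooth_vector)
  then show ?thesis by (simp add: flat_def matrix_vector_mult_def)
qed

text \<open>The frame \<open>frame a\<close> along \<open>curve a\<close> is parallel to first order at \<open>0\<close>, so that ordinary
  derivatives of components in it are components of covariant derivatives.\<close>
definition curve :: "7 \<Rightarrow> real \<Rightarrow> 'a"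
  where "curve a t = chart_inv c (x0 + t *\<^sub>R column a E)"

definition frame :: "7 \<Rightarrow> real \<Rightarrow> real^7^7"
  where "frame a t = (\<chi> l b. E $ l $ b - t * (\<Sum>i\<in>UNIV. column a E $ i *
    (\<Sum>j\<in>UNIV. christoffel c g p l i j * E $ j $ b)))"

lemma curve_0: "curve a 0 = p" by (simp add: curve_def x0)

lemma frame_0: "frame a 0 = E" by (simp add: frame_def vec_eq_iff)

lemma invertible_E: "invertible E"
  using PE EP unfolding invertible_def by blast

lemma frame_deriv: "((\<lambda>t. frame a t $ l $ b) has_real_derivative
    - (\<Sum>i\<in>UNIV. column a E $ i * (\<Sum>j\<in>UNIV. christoffel c g p l i j * E $ j $ b))) (at 0)"
  unfolding frame_def vec_lambda_beta by (auto intro!: derivative_eq_intros)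

lemma near: "\<forall>\<^sub>F t in nhds 0. curve a t \<in> fst c \<and> invertible (frame a t)"
proof -
  have "\<forall>\<^sub>F t in nhds 0. invertible (frame a t)"
  proof (rule eventually_invertible)
    show "isCont (\<lambda>t. frame a t $ i $ j) 0" for i j
      using frame_deriv by (rule DERIV_isCont)
    show "invertible (frame a 0)" by (simp add: frame_0 invertible_E)
  qed
  moreover have "\<forall>\<^sub>F t in nhds 0. curve a t \<in> fst c"
  proof -
    have "open ((\<lambda>t. x0 + t *\<^sub>R column a E) -` D)"
      by (rule open_vimage[OF dom(1)]) (intro continuous_intros)
    moreover have "0 \<in> (\<lambda>t. x0 + t *\<^sub>R column a E) -` D" using x0 by simp
    ultimately have "\<forall>\<^sub>F t in nhds 0. t \<in> (\<lambda>t. x0 + t *\<^sub>R column a E) -` D"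
      by (rule eventually_nhds_in_open)
    then show ?thesis by (rule eventually_mono) (auto simp: curve_def intro: chart_inv_in)
  qed
  ultimately show ?thesis by (simp add: eventually_conj_iff)
qed

text \<open>The curve leaves the point in the direction of the frame vector a, and the frame has the
  derivative required by \<open>pullback_covd\<close>.\<close>

lemma deriv_cov:
  assumes T: "\<And>J. length J = length I \<Longrightarrow> smooth_on D (\<lambda>z. T (chart_inv c z) J)"
  shows "((\<lambda>t. pullback (frame a t) (T (curve a t)) I) has_real_derivative
    pullback E (cov_deriv c g T p) (a # I)) (at 0)"
proof -
  let ?\<xi> = "column a E"
  have d: "((\<lambda>t. T (curve a t) J) has_real_derivative (\<Sum>i\<in>UNIV. ?\<xi> $ i * coord_deriv c i (\<lambda>q. T q J) p)) (at 0)"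
    if "length J = length I" for J
    unfolding curve_def coord_deriv_def
    by (rule DERIV_line) (rule smooth_on_differentiable[OF T[OF that] x0(1)])
  have "((\<lambda>t. pullback (frame a t) (T (curve a t)) I) has_real_derivative
      (\<Sum>i\<in>UNIV. ?\<xi> $ i * pullback E (covd (christoffel c g p) (\<lambda>i J. coord_deriv c i (\<lambda>q. T q J) p) (T (curve a 0)) i) I)) (at 0)"
    by (rule pullback_covd[OF frame_deriv frame_0 d])
  also have "(\<Sum>i\<in>UNIV. ?\<xi> $ i * pullback E (covd (christoffel c g p) (\<lambda>i J. coord_deriv c i (\<lambda>q. T q J) p) (T (curve a 0)) i) I)
      = pullback E (cov_deriv c g T p) (a # I)"
    by (simp add: pullback_Cons column_def curve_0 cov_deriv_covd)
  finally show ?thesis .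
qed

lemma metric_tensor_smooth: "smooth_on D (\<lambda>z. metric_tensor (g (chart_inv c z)) J)"
  "smooth_on D (\<lambda>z. metric_tensor (h (chart_inv c z)) J)"
  unfolding metric_tensor_def by (rule smooth_g smooth_h)+

lemma symmetric_g: "q \<in> fst c \<Longrightarrow> g q $ i $ j = g q $ j $ i"
  using arg_cong[OF g2_metric_symmetric[OF pos], of q "\<lambda>M. M $ j $ i"] by (simp add: transpose_def)

lemma coord_deriv_g: "coord_deriv c l (\<lambda>q. g q $ i $ j) p = coord_deriv c l (\<lambda>q. g q $ j $ i) p"
  unfolding coord_deriv_def
  by (rule partial_deriv_cong[OF dom(1) x0(1) symmetric_g[OF chart_inv_in] smooth_on_differentiable[OF smooth_g x0(1)]])

text \<open>Metric compatibility of the Levi-Civita connection; it makes the metric components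
  stationary along the curve.\<close>

lemma cov_deriv_g_zero: "cov_deriv c g (\<lambda>q. metric_tensor (g q)) p [i, j, l] = 0"
proof -
  have inv: "invertible (g p)" "transpose (g p) = g p"
    using invertible_g2_metric g2_metric_symmetric pos dom(2) by blast+
  have sym: "g p $ j $ e = g p $ e $ j" for e by (rule symmetric_g[OF dom(2)])
  show ?thesis
    unfolding metric_tensor_def[abs_def] cov_deriv_metric sym christoffel_lower[where g = g and p = p, OF inv]
    using coord_deriv_g[of i j l] coord_deriv_g[of l i j] coord_deriv_g[of j i l] by (simp add: field_simps)
qed

lemma form_curve:
  "form_curve (\<lambda>t. pullback (frame a t) (\<phi> (curve a t))) (\<lambda>I. pullback E (cov_deriv c g \<phi> p) (a # I))
    (\<lambda>t. \<chi> j. pullback (frame a t) (w (curve a t)) [j]) (\<lambda>j. pullback E (cov_deriv c g w p) [a, j]) r"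
proof
  show "\<forall>\<^sub>F t in nhds 0. positive_form (pullback (frame a t) (\<phi> (curve a t)))"
    using near[of a] by eventually_elim (simp add: positive_pullback pos)
  show "pullback (frame a 0) (\<phi> (curve a 0)) I = phi0 I" if "length I = 3" for I
  proof -
    have "pullback E (\<phi> p) I = pullback E (pullback P phi0) I"
      by (rule pullback_cong) (simp add: form that)
    then show ?thesis by (simp add: frame_0 curve_0 pullback_pullback PE)
  qed
  show "((\<lambda>t. pullback (frame a t) (\<phi> (curve a t)) I) has_real_derivative pullback E (cov_deriv c g \<phi> p) (a # I)) (at 0)"
    if "length I = 3" for I
    by (rule deriv_cov) (simp add: smooth_form that)
  show "((\<lambda>t. g2_metric (pullback (frame a t) (\<phi> (curve a t))) $ i $ j) has_real_derivative 0) (at 0)" for i j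
  proof -
    have "((\<lambda>t. pullback (frame a t) (metric_tensor (g (curve a t))) [i, j]) has_real_derivative
        pullback E (cov_deriv c g (\<lambda>q. metric_tensor (g q)) p) [a, i, j]) (at 0)"
      by (rule deriv_cov) (rule metric_tensor_smooth)
    also have "pullback E (cov_deriv c g (\<lambda>q. metric_tensor (g q)) p) [a, i, j] = pullback E (\<lambda>I. 0) [a, i, j]"
      by (rule pullback_cong) (auto simp: length_Suc_conv cov_deriv_g_zero)
    finally have d: "((\<lambda>t. pullback (frame a t) (metric_tensor (g (curve a t))) [i, j]) has_real_derivative 0) (at 0)"
      by simp
    show ?thesis
    proof (rule DERIV_eventually_eq[OF d])
      show "\<forall>\<^sub>F t in nhds 0. pullback (frame a t) (metric_tensor (g (curve a t))) [i, j] =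
          g2_metric (pullback (frame a t) (\<phi> (curve a t))) $ i $ j"
        using near[of a] by eventually_elim (simp add: g2_metric_pullback pos pullback_metric_tensor)
    qed
  qed
  show "(\<chi> j. pullback (frame a 0) (w (curve a 0)) [j]) = r *s axis 1 1"
  proof -
    have "pullback E (w p) [j] = (r *s axis 1 1) $ j" for j
    proof -
      have "pullback E (w p) [j] = pullback E (pullback P (\<lambda>J. r * delta1 (hd J))) [j]"
        by (rule pullback_cong) (auto simp: length_Suc_conv flat_u_co pullback_Cons co_def)
      then show ?thesis by (simp add: pullback_pullback PE delta1_def axis_def)
    qed
    then show ?thesis by (simp add: vec_eq_iff frame_0 curve_0)
  qed
  show "((\<lambda>t. (\<chi> j. pullback (frame a t) (w (curve a t)) [j]) $ i) has_real_derivative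
      pullback E (cov_deriv c g w p) [a, i]) (at 0)" for i
    unfolding vec_lambda_beta
    by (rule deriv_cov) (auto simp: length_Suc_conv smooth_w)
qed

text \<open>Deforming commutes with passing to the frame at time t: the vector raised from the frame
  components of the covector is the frame representation of v, and \<open>deform_transform\<close>
  applies.\<close>

lemma curve_deform:
  assumes "curve a t \<in> fst c" "invertible (frame a t)"
  defines "\<Phi> \<equiv> pullback (frame a t) (\<phi> (curve a t))"
    and "W \<equiv> (\<chi> j. pullback (frame a t) (w (curve a t)) [j])"
  shows "length I = 3 \<Longrightarrow> deform \<Phi> (matrix_inv (g2_metric \<Phi>) *v W) I = pullback (frame a t) (\<phi>' (curve a t)) I"
    and "g2_metric (deform \<Phi> (matrix_inv (g2_metric \<Phi>) *v W)) $ i $ j =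
      pullback (frame a t) (metric_tensor (h (curve a t))) [i, j]"
proof -
  let ?A = "frame a t" and ?\<omega> = "\<phi> (curve a t)" and ?v = "v (curve a t)"
  let ?u = "matrix_inv (g2_metric \<Phi>) *v W"
  have pos1: "positive_form ?\<omega>" by (rule pos[OF assms(1)])
  have pos2: "positive_form \<Phi>" unfolding \<Phi>_def by (rule positive_pullback[OF pos1 assms(2)])
  have G: "g2_metric \<Phi> = transpose ?A ** g2_metric ?\<omega> ** ?A"
    unfolding \<Phi>_def by (rule g2_metric_pullback[OF pos1 assms(2)])
  have Av: "?A *v (matrix_inv ?A *v ?v) = ?v"
    by (simp add: matrix_vector_mul_assoc matrix_inv_mult[OF assms(2)])
  have "W = transpose ?A *v (g2_metric ?\<omega> *v ?v)"
    by (simp add: W_def vec_eq_iff pullback_flat)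
  also have "\<dots> = g2_metric \<Phi> *v (matrix_inv ?A *v ?v)"
    unfolding G matrix_vector_mul_assoc[symmetric] Av ..
  finally have u: "?u = matrix_inv ?A *v ?v"
    by (simp only: matrix_vector_mul_assoc matrix_mul_assoc matrix_inv_mult[OF invertible_g2_metric[OF pos2]] matrix_mul_lid)
  show 1: "deform \<Phi> ?u I = pullback ?A (\<phi>' (curve a t)) I" if "length I = 3" for I
    using deform_transform[OF pos1 pos2, of ?A I ?u] that by (simp add: \<Phi>_def[symmetric] u Av)
  have "g2_metric (deform \<Phi> ?u) = g2_metric (pullback ?A (\<phi>' (curve a t)))"
    by (rule g2_metric_cong[OF 1])
  then show "g2_metric (deform \<Phi> ?u) $ i $ j = pullback ?A (metric_tensor (h (curve a t))) [i, j]"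
    by (simp add: g2_metric_pullback positive_deform pos1 assms(2) pullback_metric_tensor)
qed

text \<open>The derivative at 0 of one function is computed twice: as a component of the covariant
  derivative of the deformed form, and through \<open>deriv_deform\<close> from the derivatives of
  the form and the covector. Derivatives are unique.\<close>

lemma cov_deriv_deform: "pullback E (cov_deriv c g \<phi>' p) [a, b, c', d] =
    pullback E (cov_deriv c g \<phi> p) [a, b, c', d]
    + (\<Sum>e\<in>UNIV. pullback E (cov_deriv c g w p) [a, e] * psi0 [b, c', d, e])
    + r * (\<Sum>l\<in>UNIV. pullback E (cov_deriv c g \<phi> p) [a, b, c', l] * phi0 [d, 1, l]
        + pullback E (cov_deriv c g \<phi> p) [a, d, 1, l] * phi0 [b, c', l])"
proof -
  interpret form_curve "\<lambda>t. pullback (frame a t) (\<phi> (curve a t))" "\<lambda>I. pullback E (cov_deriv c g \<phi> p) (a # I)"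
    "\<lambda>t. \<chi> j. pullback (frame a t) (w (curve a t)) [j]" "\<lambda>j. pullback E (cov_deriv c g w p) [a, j]" r
    by (rule form_curve)
  have "((\<lambda>t. pullback (frame a t) (\<phi>' (curve a t)) [b, c', d]) has_real_derivative
      pullback E (cov_deriv c g \<phi>' p) [a, b, c', d]) (at 0)"
    by (rule deriv_cov) (simp add: smooth_deform)
  moreover have "((\<lambda>t. pullback (frame a t) (\<phi>' (curve a t)) [b, c', d]) has_real_derivative
      pullback E (cov_deriv c g \<phi> p) (a # [b, c', d]) + (\<Sum>e\<in>UNIV. pullback E (cov_deriv c g w p) [a, e] * psi0 [b, c', d, e])
      + r * dpsi b c' d 1) (at 0)"
  proof (rule DERIV_eventually_eq[OF deriv_deform])
    show "\<forall>\<^sub>F t in nhds 0. deform (pullback (frame a t) (\<phi> (curve a t))) (U t) [b, c', d] =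
        pullback (frame a t) (\<phi>' (curve a t)) [b, c', d]"
      using near[of a] by eventually_elim (simp add: U_def curve_deform(1))
  qed
  ultimately show ?thesis by (simp add: DERIV_unique[of _ _ 0] dpsi_def)
qed

text \<open>The same comparison for the deformed metric. The factor in front is the one left out of
  \<open>nabla_metric\<close> to keep that polynomial.\<close>

lemma cov_deriv_deform_metric: "pullback E (cov_deriv c g (\<lambda>q. metric_tensor (h q)) p) [a, j, l] =
    r / k\<^sup>2 / (3 * (1 + r\<^sup>2)) * nabla_metric r (\<lambda>a b. pullback E (cov_deriv c g w p) [a, b]) a j l"
proof -
  interpret form_curve "\<lambda>t. pullback (frame a t) (\<phi> (curve a t))" "\<lambda>I. pullback E (cov_deriv c g \<phi> p) (a # I)"
    "\<lambda>t. \<chi> j. pullback (frame a t) (w (curve a t)) [j]" "\<lambda>j. pullback E (cov_deriv c g w p) [a, j]" r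
    by (rule form_curve)
  let ?s = "\<lambda>j. pullback E (cov_deriv c g w p) [a, j]"
  have "((\<lambda>t. pullback (frame a t) (metric_tensor (h (curve a t))) [j, l]) has_real_derivative
      pullback E (cov_deriv c g (\<lambda>q. metric_tensor (h q)) p) [a, j, l]) (at 0)"
    by (rule deriv_cov) (rule metric_tensor_smooth)
  moreover have "((\<lambda>t. pullback (frame a t) (metric_tensor (h (curve a t))) [j, l]) has_real_derivative
    r / k\<^sup>2 * (2 / 3 * ?s 1 * (if j = l then 1 else 0) - ?s j * (if l = 1 then 1 else 0)
      - (if j = 1 then 1 else 0) * ?s l
      + 4 / 3 * r\<^sup>2 / (1 + r\<^sup>2) * ?s 1 * (if j = 1 then 1 else 0) * (if l = 1 then 1 else 0))) (at 0)"
  proof (rule DERIV_eventually_eq[OF deriv_deform_metric[OF k3 k_pos]])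
    show "\<forall>\<^sub>F t in nhds 0. g2_metric (deform (pullback (frame a t) (\<phi> (curve a t))) (U t)) $ j $ l =
        pullback (frame a t) (metric_tensor (h (curve a t))) [j, l]"
      using near[of a] by eventually_elim (simp add: U_def curve_deform(2))
  qed
  ultimately have "pullback E (cov_deriv c g (\<lambda>q. metric_tensor (h q)) p) [a, j, l] =
    r / k\<^sup>2 * (2 / 3 * ?s 1 * (if j = l then 1 else 0) - ?s j * (if l = 1 then 1 else 0)
      - (if j = 1 then 1 else 0) * ?s l
      + 4 / 3 * r\<^sup>2 / (1 + r\<^sup>2) * ?s 1 * (if j = 1 then 1 else 0) * (if l = 1 then 1 else 0))"
    by (rule DERIV_unique)
  also have "\<dots> = r / k\<^sup>2 * (nabla_metric r (\<lambda>a b. pullback E (cov_deriv c g w p) [a, b]) a j l / (3 * (1 + r\<^sup>2)))"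
  proof -
    have "1 + r * r > 0" by (simp add: add_pos_nonneg)
    then have "2 / 3 * z1 * D - zj * B - A * zl + 4 / 3 * (r * r) / (1 + r * r) * z1 * A * B =
        (2 * (1 + r * r) * z1 * D - 3 * (1 + r * r) * (zj * B + A * zl) + 4 * r * r * z1 * A * B) / (3 * (1 + r * r))"
      for z1 zj zl A B D :: real
      by (simp add: field_simps)
    then show ?thesis by (simp only: nabla_metric_def delta1_def power2_eq_square)
  qed
  finally show ?thesis by simp
qed

end

section \<open>The deformed torsion\<close>

lemma psi_nondegenerate:
  assumes pos: "positive_form \<omega>" and z: "\<And>b c d. (\<Sum>e\<in>UNIV. z $ e * g2_psi \<omega> [e, b, c, d]) = 0"
  shows "z = 0"
proof -
  obtain P where P: "invertible P" "\<And>I. length I = 3 \<Longrightarrow> \<omega> I = pullback P phi0 I"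
    using pos unfolding positive_form_def by blast
  let ?u = "P *v z"
  have 0: "interior_prod ?u psi0 I = 0" if "length I = 3" for I
  proof -
    have "pullback P (interior_prod ?u psi0) J = 0" if J: "length J = 3" for J
    proof -
      obtain b c d where "J = [b, c, d]" using J by (rule list3_cases)
      then show ?thesis
        using z[of b c d] by (simp add: interior_prod_pullback[symmetric] interior_prod_def g2_psi_pullback_phi0[OF P])
    qed
    then have "pullback (matrix_inv P) (pullback P (interior_prod ?u psi0)) I = pullback (matrix_inv P) (\<lambda>J. 0) I"
      using that by (intro pullback_cong) simp
    then show ?thesis by (simp add: pullback_pullback matrix_inv_mult[OF P(1)])
  qed
  have "\<forall>i. ?u $ i = 0"
    unfolding forall_7
    \<comment> \<open>Each of these triples is completed to a monomial of \<open>psi0\<close> by a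
      single index, so the seven equations give the components of the vector one at a time, in the
      order 1 to 7.\<close>
    using 0[of "[3,5,7]"] 0[of "[3,6,7]"] 0[of "[2,6,7]"] 0[of "[5,6,7]"] 0[of "[4,6,7]"] 0[of "[4,5,7]"] 0[of "[4,5,6]"]
    by (simp add: interior_prod_def sum_7 psi0_rows phi0_rows)
  then have "?u = 0" by (simp add: vec_eq_iff)
  then show ?thesis using P(1) unfolding invertible_ker by blast
qed

context adapted
begin

lemma co_E: "(\<Sum>i\<in>UNIV. E $ i $ a * co \<beta> i) = \<beta> a"
proof -
  have "(\<Sum>i\<in>UNIV. E $ i $ a * co \<beta> i) = (\<Sum>i\<in>UNIV. co \<beta> i * ve (\<lambda>l. if l = a then 1 else 0) i)"
    by (simp add: ve_def mult.commute if_distrib cong: if_cong)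
  also have "\<dots> = \<beta> a" unfolding contract by (simp add: if_distrib cong: if_cong)
  finally show ?thesis .
qed

lemma contract_diagonal:
  assumes hinv: "\<And>e l. matrix_inv h $ e $ l = (\<Sum>m\<in>UNIV. E $ e $ m * (d m * E $ l $ m))"
  shows "(\<Sum>l\<in>UNIV. matrix_inv h $ e $ l * co \<beta> l) = ve (\<lambda>m. d m * \<beta> m) e"
proof -
  have "(\<Sum>l\<in>UNIV. matrix_inv h $ e $ l * co \<beta> l) =
      (\<Sum>m\<in>UNIV. E $ e $ m * (d m * (\<Sum>l\<in>UNIV. E $ l $ m * co \<beta> l)))"
    unfolding hinv sum_distrib_left sum_distrib_right by (subst sum.swap) (simp only: mult_ac)
  then show ?thesis by (simp only: co_E ve_def)
qed

text \<open>Covers both structures: the inverse metric is diagonal in the frame with weights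
  \<open>d\<close>, equal to 1 for the original metric and to \<open>dual_weight\<close> for the
  deformed one.\<close>

lemma raise_contract:
  assumes hinv: "\<And>e l. matrix_inv h $ e $ l = (\<Sum>m\<in>UNIV. E $ e $ m * (d m * E $ l $ m))"
    and X: "\<And>a b. X [a, b] = bi XF a b" and \<Psi>: "\<And>e. \<Psi> (e # I) = pullback P \<Psi>F (e # I)"
  shows "(\<Sum>e\<in>UNIV. raise h 1 X [i, e] * \<Psi> (e # I)) =
    pullback P (\<lambda>K. \<Sum>m\<in>UNIV. d m * XF (hd K) m * \<Psi>F (m # tl K)) (i # I)"
proof -
  have "raise h 1 X [i, e] = ve (\<lambda>m. d m * co (\<lambda>a. XF a m) i) e" for e
  proof -
    have "raise h 1 X [i, e] = (\<Sum>l\<in>UNIV. matrix_inv h $ e $ l * co (\<lambda>n. co (\<lambda>a. XF a n) i) l)"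
      by (simp add: raise_def X bi_def co_swap[of _ _ i])
    then show ?thesis by (simp only: contract_diagonal[OF hinv])
  qed
  then have "(\<Sum>e\<in>UNIV. raise h 1 X [i, e] * \<Psi> (e # I)) =
      (\<Sum>m\<in>UNIV. pullback P (\<lambda>J. \<Psi>F (m # J)) I * (d m * co (\<lambda>a. XF a m) i))"
    unfolding \<Psi> pullback_Cons co_def[symmetric] by (simp only: contract')
  also have "\<dots> = (\<Sum>m\<in>UNIV. co (\<lambda>a. XF a m) i * (d m * pullback P (\<lambda>J. \<Psi>F (m # J)) I))"
    by (simp only: mult_ac)
  also have "\<dots> = co (\<lambda>a. \<Sum>m\<in>UNIV. XF a m * (d m * pullback P (\<lambda>J. \<Psi>F (m # J)) I)) i"
    by (rule co_sum)
  finally show ?thesis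
    unfolding pullback_Cons[of P _ i] list.sel co_def by (simp only: pullback_sum pullback_scale mult_ac)
qed

end

context deformation_point
begin

abbreviation "S \<equiv> \<lambda>a b. pullback E (cov_deriv c g w p) [a, b]"
abbreviation "DD \<equiv> \<lambda>a I. pullback E (cov_deriv c g \<phi>' p) (a # I)"

text \<open>The diagonal of the inverse deformed metric in the frame, whose metric is diag(1/k^2, k,
  ..., k).\<close>

definition "dual_weight m = (if m = (1::7) then k\<^sup>2 else 1 / k)"

lemma inv_h: "matrix_inv (h p) $ e $ l = (\<Sum>m\<in>UNIV. E $ e $ m * (dual_weight m * E $ l $ m))"
proof -
  let ?G = "(\<chi> i j. if i = j then if i = 1 then (1 / k)\<^sup>2 else k else 0) :: real^7^7"
  let ?H = "(\<chi> i j. if i = j then dual_weight i else 0) :: real^7^7"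
  have "(\<Sum>j\<in>UNIV. (if i = j then if i = 1 then (1 / k)\<^sup>2 else k else 0) * (if j = l then dual_weight j else 0)) =
      (if i = l then 1 else 0)" for i l :: 7
  proof -
    have "(if i = j then if i = 1 then (1 / k)\<^sup>2 else k else 0) * (if j = l then dual_weight j else 0) =
        (if i = j then if i = l then 1 else 0 else 0)" for j
      using k_pos by (simp add: dual_weight_def power_divide)
    then show ?thesis by simp
  qed
  then have GH: "?G ** ?H = mat 1"
    by (simp add: matrix_matrix_mult_def mat_def vec_eq_iff)
  have "h p ** (E ** ?H ** transpose E) = transpose P ** ?G ** (P ** E) ** ?H ** transpose E"
    by (simp add: deform_metric_frame matrix_mul_assoc)
  also have "\<dots> = transpose P ** (?G ** ?H) ** transpose E"
    by (simp only: PE matrix_mul_rid matrix_mul_assoc)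
  also have "\<dots> = transpose (E ** P)" by (simp add: GH matrix_transpose_mul)
  finally have "matrix_inv (h p) = E ** ?H ** transpose E"
    by (intro matrix_inv_eqI) (simp add: EP transpose_mat)
  moreover have "(E ** ?H) $ e $ m = E $ e $ m * dual_weight m" for m
  proof -
    have "(E ** ?H) $ e $ m = (\<Sum>j\<in>UNIV. if j = m then E $ e $ m * dual_weight m else 0)"
      unfolding matrix_matrix_mult_def vec_lambda_beta by (intro sum.cong refl) simp
    then show ?thesis by simp
  qed
  ultimately show ?thesis
    by (simp add: matrix_matrix_mult_def[of "E ** ?H"] transpose_def mult.assoc)
qed

lemma deform_frame: "length I = 3 \<Longrightarrow> pullback E (\<phi>' p) I = deform0 (r *s axis 1 1) I"
proof -
  assume I: "length I = 3"
  have "pullback E (\<phi>' p) I = pullback E (pullback P (deform0 (r *s axis 1 1))) I"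
    by (rule pullback_cong) (simp add: deform_pullback_phi0[OF P form] vec I)
  then show ?thesis by (simp add: pullback_pullback PE)
qed

lemma psi_frame: "length I = 4 \<Longrightarrow> g2_psi (\<phi>' p) I = pullback P (\<lambda>J. deformed_psi r J / k) I"
proof -
  assume I: "length I = 4"
  have "g2_psi (\<phi>' p) I = pullback P (pullback (twist (1 / k) x y) psi0) I"
    by (simp add: g2_psi_pullback_phi0[OF invertible_twist_P deform_twist I] pullback_pullback)
  also have "\<dots> = pullback P (\<lambda>J. deformed_psi r J / k) I"
    by (rule pullback_cong, rule pullback_twist_psi0[OF k _ root k3]) (use k_pos I in auto)
  finally show ?thesis .
qed

text \<open>The components along the curve are alternating at every time near 0, and differentiation
  preserves this linear relation.\<close>

lemma alternating_DD: "alternating 3 (DD a)"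
  unfolding alternating_def
proof (intro allI impI)
  fix I :: "7 list" and \<sigma> :: "nat \<Rightarrow> nat" assume I: "length I = 3" and \<sigma>: "\<sigma> permutes {..<3}"
  let ?f = "\<lambda>I t. pullback (frame a t) (\<phi>' (curve a t)) I"
  have d: "(?f J has_real_derivative DD a J) (at 0)" if "length J = 3" for J
    by (rule deriv_cov) (simp add: smooth_deform that)
  have "((\<lambda>t. of_int (sign \<sigma>) * ?f I t) has_real_derivative of_int (sign \<sigma>) * DD a I) (at 0)"
    by (rule DERIV_cmult[OF d[OF I]])
  moreover have "\<forall>\<^sub>F t in nhds 0. of_int (sign \<sigma>) * ?f I t = ?f (permute_list \<sigma> I) t"
    using near[of a]
  proof eventually_elim
    case (elim t)
    have "alternating 3 (pullback (frame a t) (\<phi>' (curve a t)))"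
      by (rule alternating_pullback[OF alternating_deform]) (use elim pos in blast)
    from alternatingD[OF this I \<sigma>] show ?case by simp
  qed
  ultimately have "(?f (permute_list \<sigma> I) has_real_derivative of_int (sign \<sigma>) * DD a I) (at 0)"
    by (rule DERIV_eventually_eq)
  from DERIV_unique[OF d this] show "DD a (map (\<lambda>m. I ! \<sigma> m) [0..<3]) = of_int (sign \<sigma>) * DD a I"
    by (simp add: map_nth_permute_list I)
qed

text \<open>The derivative splits into a part from nabla v and a part from the original torsion. The
  first, together with the change of connection, is \<open>frame_defect_zero\<close>. The second is
  \<open>torsion_part_sorted\<close>, which uses up one of the two factors 1 + r^2 and leaves 12 (1
  + r^2) before \<open>torsion_t\<close>.\<close>

lemma frame_identity:
  assumes T: "\<And>b c' d. pullback E (cov_deriv c g \<phi> p) [a, b, c', d] = (\<Sum>e\<in>UNIV. TF a e * psi0 [e, b, c', d])"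
    and I: "length I = 3"
  shows "12 * ((1 + r * r) * (1 + r * r)) * DD a I
      - (\<Sum>m<3. \<Sum>e\<in>UNIV. difference r S e a (I ! m) * deform0 (r *s axis 1 1) (I[m := e])) =
    (\<Sum>n\<in>UNIV. (torsion_S r S a n + 12 * (1 + r * r) * torsion_t r TF a n) *
      ((if n = 1 then 1 + r * r else 1) * deformed_psi r (n # I)))"
proof (rule alternating_7_ext[OF _ _ _ I])
  show "alternating 3 (\<lambda>I. 12 * ((1 + r * r) * (1 + r * r)) * DD a I
      - (\<Sum>m<3. \<Sum>e\<in>UNIV. difference r S e a (I ! m) * deform0 (r *s axis 1 1) (I[m := e])))"
    by (intro alternating_diff alternating_scale alternating_DD) (rule alternating_derivation[OF alternating_deform0])
  have "alternating 3 (\<lambda>I. deformed_psi r (n # I))" for n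
    using alternating_append[of 1 3 "deformed_psi r" "[n]"] alternating_deformed_psi by simp
  then show "alternating 3 (\<lambda>I. \<Sum>n\<in>UNIV. (torsion_S r S a n + 12 * (1 + r * r) * torsion_t r TF a n) *
      ((if n = 1 then 1 + r * r else 1) * deformed_psi r (n # I)))"
    by (intro alternating_sum alternating_scale)
next
  fix N :: "7 list"
  assume N: "N \<in> set (filter (\<lambda>N. length N = 3) (subseqs [1,2,3,4,5,6,7]))"
  then have len: "length N = 3" by (simp only: set_filter mem_Collect_eq)
  then obtain b c' d where bcd: "N = [b, c', d]" by (rule list3_cases)
  let ?R = "1 + r * r" and ?w = "\<lambda>n::7. if n = 1 then 1 + r * r else 1"
  have DN: "DD a N = torsion_part r (TF a) b c' d + (\<Sum>e\<in>UNIV. S a e * psi0 (N @ [e]))"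
    unfolding bcd cov_deriv_deform T torsion_part_def by simp
  have S: "12 * (?R * ?R) * (\<Sum>e\<in>UNIV. S a e * psi0 (N @ [e]))
      - (\<Sum>m<3. \<Sum>e\<in>UNIV. difference r S e a (N ! m) * deform0 (r *s axis 1 1) (N[m := e])) =
      (\<Sum>n\<in>UNIV. ?w n * torsion_S r S a n * deformed_psi r (n # N))"
    using frame_defect_zero[OF len, of r S a] by (simp add: frame_defect_def)
  have T: "?R * torsion_part r (TF a) b c' d = (\<Sum>n\<in>UNIV. ?w n * torsion_t r TF a n * deformed_psi r (n # N))"
    using torsion_part_sorted[of r TF a] N bcd by fastforce
  have "12 * (?R * ?R) * DD a N
      - (\<Sum>m<3. \<Sum>e\<in>UNIV. difference r S e a (N ! m) * deform0 (r *s axis 1 1) (N[m := e])) =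
      (\<Sum>n\<in>UNIV. ?w n * torsion_S r S a n * deformed_psi r (n # N))
      + 12 * ?R * (?R * torsion_part r (TF a) b c' d)"
    unfolding DN S[symmetric] by (simp add: algebra_simps)
  also have "\<dots> = (\<Sum>n\<in>UNIV. (torsion_S r S a n + 12 * ?R * torsion_t r TF a n) * (?w n * deformed_psi r (n # N)))"
    unfolding T sum_distrib_left sum.distrib[symmetric] by (intro sum.cong refl) (simp add: algebra_simps)
  finally show "12 * (?R * ?R) * DD a N
      - (\<Sum>m<3. \<Sum>e\<in>UNIV. difference r S e a (N ! m) * deform0 (r *s axis 1 1) (N[m := e])) =
    (\<Sum>n\<in>UNIV. (torsion_S r S a n + 12 * ?R * torsion_t r TF a n) * (?w n * deformed_psi r (n # N)))" .
qed

text \<open>The lower indices of the difference tensor are taken in the frame and the upper one is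
  left in coordinates, which is the form of the hypothesis of
  \<open>pullback_derivation\<close>.\<close>

lemma difference_frame:
  "(\<Sum>j\<in>UNIV. (\<Sum>i\<in>UNIV. E $ i $ a * (christoffel c h p e i j - christoffel c g p e i j)) * E $ j $ b) =
    (\<Sum>m\<in>UNIV. E $ e $ m * (difference r S m a b / (12 * ((1 + r * r) * (1 + r * r)))))"
proof -
  define Y where "Y = cov_deriv c g (\<lambda>q. metric_tensor (h q)) p"
  define N where "N a j l = pullback E Y [a, j, l]" for a j l
  have Y: "Y [i, j, l] = co (\<lambda>a. co (\<lambda>b. co (\<lambda>m. N a b m) l) j) i" for i j l
  proof -
    have "Y [i, j, l] = pullback P (pullback E Y) [i, j, l]" by (simp add: pullback_pullback EP)
    then show ?thesis by (simp add: pullback_Cons co_def N_def)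
  qed
  have hp: "positive_form (\<phi>' p)" by (rule positive_deform[OF pos[OF dom(2)]])
  have diff: "christoffel c h p e i j - christoffel c g p e i j =
      (\<Sum>l\<in>UNIV. matrix_inv (h p) $ e $ l * (Y [i, j, l] + Y [j, i, l] - Y [l, i, j])) / 2" for i j
    using christoffel_difference[of c g p h e i j, OF coord_deriv_g invertible_g2_metric[OF hp] g2_metric_symmetric[OF hp]]
    by (simp add: Y_def metric_tensor_def[abs_def])
  have c1: "(\<Sum>j\<in>UNIV. \<Sum>i\<in>UNIV. E $ i $ a * Y [i, j, l] * E $ j $ b) = co (\<lambda>m. N a b m) l" for l
  proof -
    have "(\<Sum>j\<in>UNIV. \<Sum>i\<in>UNIV. E $ i $ a * Y [i, j, l] * E $ j $ b) =
        (\<Sum>j\<in>UNIV. E $ j $ b * (\<Sum>i\<in>UNIV. E $ i $ a * Y [i, j, l]))"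
      by (simp only: sum_distrib_left mult_ac)
    then show ?thesis by (simp only: Y co_E)
  qed
  have c2: "(\<Sum>j\<in>UNIV. \<Sum>i\<in>UNIV. E $ i $ a * Y [j, i, l] * E $ j $ b) = co (\<lambda>m. N b a m) l" for l
  proof -
    have "(\<Sum>j\<in>UNIV. \<Sum>i\<in>UNIV. E $ i $ a * Y [j, i, l] * E $ j $ b) =
        (\<Sum>i\<in>UNIV. E $ i $ a * (\<Sum>j\<in>UNIV. E $ j $ b * Y [j, i, l]))"
      by (subst sum.swap) (simp only: sum_distrib_left mult_ac)
    then show ?thesis by (simp only: Y co_E)
  qed
  have c3: "(\<Sum>j\<in>UNIV. \<Sum>i\<in>UNIV. E $ i $ a * Y [l, i, j] * E $ j $ b) = co (\<lambda>m. N m a b) l" for l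
  proof -
    have y: "Y [l, i, j] = co (\<lambda>a. co (\<lambda>b. co (\<lambda>m. N m a b) l) j) i" for i j
      unfolding Y by (subst co_swap, rule arg_cong[where f = "\<lambda>f. co f i"], rule ext, rule co_swap)
    have "(\<Sum>j\<in>UNIV. \<Sum>i\<in>UNIV. E $ i $ a * Y [l, i, j] * E $ j $ b) =
        (\<Sum>j\<in>UNIV. E $ j $ b * (\<Sum>i\<in>UNIV. E $ i $ a * Y [l, i, j]))"
      by (simp only: sum_distrib_left mult_ac)
    then show ?thesis by (simp only: y co_E)
  qed
  have "(\<Sum>j\<in>UNIV. (\<Sum>i\<in>UNIV. E $ i $ a * (christoffel c h p e i j - christoffel c g p e i j)) * E $ j $ b) =
      (\<Sum>j\<in>UNIV. \<Sum>i\<in>UNIV. \<Sum>l\<in>UNIV. matrix_inv (h p) $ e $ l * (E $ i $ a * Y [i, j, l] * E $ j $ b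
        + E $ i $ a * Y [j, i, l] * E $ j $ b - E $ i $ a * Y [l, i, j] * E $ j $ b) / 2)"
    unfolding diff sum_distrib_right sum_distrib_left sum_divide_distrib
    by (intro sum.cong refl) (simp add: algebra_simps)
  also have "\<dots> = (\<Sum>l\<in>UNIV. \<Sum>i\<in>UNIV. \<Sum>j\<in>UNIV. matrix_inv (h p) $ e $ l * (E $ i $ a * Y [i, j, l] * E $ j $ b
        + E $ i $ a * Y [j, i, l] * E $ j $ b - E $ i $ a * Y [l, i, j] * E $ j $ b) / 2)"
    by (rule sum_swap_3)
  also have "\<dots> = (\<Sum>l\<in>UNIV. matrix_inv (h p) $ e $ l * (co (\<lambda>m. N a b m) l + co (\<lambda>m. N b a m) l - co (\<lambda>m. N m a b) l) / 2)"
  proof (rule sum.cong[OF refl])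
    fix l
    show "(\<Sum>i\<in>UNIV. \<Sum>j\<in>UNIV. matrix_inv (h p) $ e $ l * (E $ i $ a * Y [i, j, l] * E $ j $ b
        + E $ i $ a * Y [j, i, l] * E $ j $ b - E $ i $ a * Y [l, i, j] * E $ j $ b) / 2) =
      matrix_inv (h p) $ e $ l * (co (\<lambda>m. N a b m) l + co (\<lambda>m. N b a m) l - co (\<lambda>m. N m a b) l) / 2"
      unfolding c1[symmetric] c2[symmetric] c3[symmetric]
      by (subst sum.swap) (simp add: sum_distrib_left sum.distrib sum_subtractf sum_divide_distrib right_diff_distrib
          distrib_left add_divide_distrib diff_divide_distrib)
  qed
  also have "\<dots> = (\<Sum>l\<in>UNIV. matrix_inv (h p) $ e $ l * co (\<lambda>m. N a b m + N b a m - N m a b) l) / 2"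
    by (simp only: co_add co_diff sum_divide_distrib)
  also have "\<dots> = (\<Sum>m\<in>UNIV. E $ e $ m * (dual_weight m * (N a b m + N b a m - N m a b) / 2))"
    unfolding contract_diagonal[OF inv_h] ve_def by (simp add: sum_divide_distrib)
  also have "\<dots> = (\<Sum>m\<in>UNIV. E $ e $ m * (difference r S m a b / (12 * ((1 + r * r) * (1 + r * r)))))"
  proof (intro sum.cong refl arg_cong2[where f = "(*)"])
    fix m
    let ?R = "1 + r * r"
    have R: "?R > 0" by (simp add: add_pos_nonneg)
    have k3': "k ^ 3 = ?R" using k3 by (simp add: power2_eq_square)
    have N: "N a b l = r / k\<^sup>2 / (3 * ?R) * nabla_metric r S a b l" for a b l
      using cov_deriv_deform_metric by (simp add: N_def Y_def power2_eq_square)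
    let ?n = "nabla_metric r S a b m + nabla_metric r S b a m - nabla_metric r S m a b"
    have "N a b m + N b a m - N m a b = r / k\<^sup>2 / (3 * ?R) * ?n"
      unfolding N by (simp add: algebra_simps)
    \<comment> \<open>Both cases follow from k^3 = 1 + r^2: the weight k^2 of the first axis cancels
      1/k^2, and the weight 1/k of the others completes it to 1/k^3.\<close>
    moreover have "dual_weight m * (r / k\<^sup>2 / (3 * ?R) * z) / 2 = 2 * r * (if m = 1 then ?R else 1) * z / (12 * (?R * ?R))" for z
    proof (cases "m = 1")
      case True
      have "k\<^sup>2 * (r / k\<^sup>2 / (3 * A) * z) / 2 = 2 * r * A * z / (12 * (A * A))" if "A > 0" for A
        using that k_pos by (simp add: field_simps)
      from this[OF R] show ?thesis
        unfolding True dual_weight_def by (simp only: simp_thms if_True)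
    next
      case False
      have "1 / k * (r / k\<^sup>2 / (3 * ?R) * z) = r / (3 * k ^ 3 * ?R) * z"
        by (simp add: power2_eq_square power3_eq_cube)
      moreover have "r / (3 * A * A) * z / 2 = 2 * r * 1 * z / (12 * (A * A))" if "A > 0" for A
        using that by (simp add: field_simps)
      ultimately show ?thesis
        unfolding k3' using False R by (simp only: dual_weight_def if_False)
    qed
    ultimately show "dual_weight m * (N a b m + N b a m - N m a b) / 2 = difference r S m a b / (12 * (?R * ?R))"
      by (simp only: difference_def)
  qed
  finally show ?thesis .
qed

text \<open>\<open>frame_identity\<close> divided by 12 (1 + r^2)^2. The constants then regroup into
  the inverse deformed metric, the proposed torsion and the deformed dual form, whose factor 1/k
  undoes the scaling in \<open>deformed_psi\<close>.\<close>

lemma deformed_cov_deriv_frame: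
  assumes T: "\<And>b c' d. pullback E (cov_deriv c g \<phi> p) [a, b, c', d] = (\<Sum>e\<in>UNIV. TF a e * psi0 [e, b, c', d])"
    and tv: "\<And>n. 12 * tv n = torsion_S r S a n" and I: "length I = 3"
  shows "pullback E (cov_deriv c h \<phi>' p) (a # I) =
    (\<Sum>m\<in>UNIV. dual_weight m * (tv m / k ^ 4 + torsion_t r TF a m / k) * (deformed_psi r (m # I) / k))"
proof -
  let ?R = "1 + r * r"
  have R: "?R > 0" by (simp add: add_pos_nonneg)
  have k3': "k ^ 3 = ?R" using k3 by (simp add: power2_eq_square)
  let ?M = "\<lambda>e j. \<Sum>i\<in>UNIV. E $ i $ a * (christoffel c h p e i j - christoffel c g p e i j)"
  have "pullback E (cov_deriv c h \<phi>' p) (a # I) = DD a I - (\<Sum>i\<in>UNIV. E $ i $ a * pullback E (\<lambda>J. \<Sum>m<length J. \<Sum>e\<in>UNIV.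
      (christoffel c h p e i (J ! m) - christoffel c g p e i (J ! m)) * \<phi>' p (J[m := e])) I)"
    unfolding pullback_Cons cov_deriv_difference[of c h \<phi>' p _ _ g] pullback_diff
    by (simp add: right_diff_distrib sum_subtractf)
  also have "(\<Sum>i\<in>UNIV. E $ i $ a * pullback E (\<lambda>J. \<Sum>m<length J. \<Sum>e\<in>UNIV.
      (christoffel c h p e i (J ! m) - christoffel c g p e i (J ! m)) * \<phi>' p (J[m := e])) I) =
      pullback E (\<lambda>J. \<Sum>m<length J. \<Sum>e\<in>UNIV. ?M e (J ! m) * \<phi>' p (J[m := e])) I"
    unfolding pullback_scale[symmetric] pullback_sum[symmetric]
  proof (rule pullback_cong)
    fix J :: "7 list"
    have "(\<Sum>i\<in>UNIV. E $ i $ a * (\<Sum>m<length J. \<Sum>e\<in>UNIV.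
      (christoffel c h p e i (J ! m) - christoffel c g p e i (J ! m)) * \<phi>' p (J[m := e]))) =
      (\<Sum>i\<in>UNIV. \<Sum>m<length J. \<Sum>e\<in>UNIV.
      E $ i $ a * (christoffel c h p e i (J ! m) - christoffel c g p e i (J ! m)) * \<phi>' p (J[m := e]))"
      by (simp only: sum_distrib_left mult.assoc)
    also have "\<dots> = (\<Sum>m<length J. \<Sum>i\<in>UNIV. \<Sum>e\<in>UNIV.
      E $ i $ a * (christoffel c h p e i (J ! m) - christoffel c g p e i (J ! m)) * \<phi>' p (J[m := e]))"
      by (rule sum.swap)
    also have "\<dots> = (\<Sum>m<length J. \<Sum>e\<in>UNIV. \<Sum>i\<in>UNIV.
      E $ i $ a * (christoffel c h p e i (J ! m) - christoffel c g p e i (J ! m)) * \<phi>' p (J[m := e]))"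
      by (rule sum.cong[OF refl], rule sum.swap)
    finally show "(\<Sum>i\<in>UNIV. E $ i $ a * (\<Sum>m<length J. \<Sum>e\<in>UNIV.
      (christoffel c h p e i (J ! m) - christoffel c g p e i (J ! m)) * \<phi>' p (J[m := e]))) =
      (\<Sum>m<length J. \<Sum>e\<in>UNIV. ?M e (J ! m) * \<phi>' p (J[m := e]))"
      by (simp only: sum_distrib_right)
  qed
  also have "\<dots> = (\<Sum>m<3. \<Sum>e\<in>UNIV. difference r S e a (I ! m) / (12 * (?R * ?R)) * deform0 (r *s axis 1 1) (I[m := e]))"
    unfolding pullback_derivation[of ?M E "\<lambda>m b. difference r S m a b / (12 * (?R * ?R))", OF difference_frame]
    by (simp add: I deform_frame)
  also have "DD a I - \<dots> = (12 * (?R * ?R) * DD a I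
      - (\<Sum>m<3. \<Sum>e\<in>UNIV. difference r S e a (I ! m) * deform0 (r *s axis 1 1) (I[m := e]))) / (12 * (?R * ?R))"
    using R by (simp add: diff_divide_distrib sum_divide_distrib)
  also have "\<dots> = (\<Sum>n\<in>UNIV. (torsion_S r S a n + 12 * ?R * torsion_t r TF a n) *
      ((if n = 1 then ?R else 1) * deformed_psi r (n # I)) / (12 * (?R * ?R)))"
    unfolding frame_identity[where TF = TF and a = a, OF T I] by (rule sum_divide_distrib)
  also have "\<dots> = (\<Sum>m\<in>UNIV. dual_weight m * (tv m / k ^ 4 + torsion_t r TF a m / k) * (deformed_psi r (m # I) / k))"
  proof (intro sum.cong refl)
    fix m
    \<comment> \<open>With k^3 = 1 + r^2 all powers of \<open>k\<close> reduce to the first, and the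
      equality of coefficients becomes one of rational functions.\<close>
    have k4: "k ^ 4 = ?R * k" unfolding k3'[symmetric] by (simp add: power4_eq_xxxx power3_eq_cube)
    have kk: "k * (k * k) = ?R" using k3' by (simp add: power3_eq_cube)
    have "(12 * A + 12 * ?R * B) * ((if m = 1 then ?R else 1) * C) / (12 * (?R * ?R)) =
        dual_weight m * (A / (?R * k) + B / k) * (C / k)" for A B C :: real
    proof (cases "m = 1")
      case True
      have "(12 * A + 12 * X * B) * (X * C) / (12 * (X * X)) = k\<^sup>2 * (A / (X * k) + B / k) * (C / k)" if "X > 0" for X
        using that k_pos by (simp add: field_simps power2_eq_square)
      from this[OF R] show ?thesis
        unfolding True dual_weight_def by (simp only: simp_thms if_True)
    next
      case False
      have "1 / k * (A / (X * k) + B / k) * (C / k) = (A / X + B) * C / (k * (k * k))" for X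
        using k_pos by (simp add: field_simps)
      from this[of ?R] have "1 / k * (A / (?R * k) + B / k) * (C / k) = (A / ?R + B) * C / ?R"
        unfolding kk .
      moreover have "(A / X + B) * C / X = (12 * A + 12 * X * B) * (1 * C) / (12 * (X * X))" if "X > 0" for X
        using that by (simp add: field_simps)
      from this[OF R] calculation show ?thesis using False by (simp only: dual_weight_def if_False)
    qed
    then show "(torsion_S r S a m + 12 * ?R * torsion_t r TF a m) *
      ((if m = 1 then ?R else 1) * deformed_psi r (m # I)) / (12 * (?R * ?R)) =
      dual_weight m * (tv m / k ^ 4 + torsion_t r TF a m / k) * (deformed_psi r (m # I) / k)"
      unfolding tv[symmetric] k4 .
  qed
  finally show ?thesis .
qed

text \<open>The proposed tensor solves the torsion equation because both sides have equal components
  in the adapted frame; any other solution agrees with it by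
  \<open>psi_nondegenerate\<close>.\<close>

lemma full_torsion_deform:
  assumes torsion: "\<And>a b c' d. cov_deriv c g \<phi> p [a, b, c', d] =
      (\<Sum>e\<in>UNIV. raise (g p) 1 T [a, e] * g2_psi (\<phi> p) [e, b, c', d])"
    and T: "g2_components (\<phi> p) T t1 (sharp (g p) t7) t14 t27"
    and nabla: "g2_components (\<phi> p) (cov_deriv c g w p) v1 v7 v14 v27"
  shows "(\<forall>a b c' d. cov_deriv c h \<phi>' p [a, b, c', d] =
      (\<Sum>e\<in>UNIV. raise (h p) 1 T' [a, e] * g2_psi (\<phi>' p) [e, b, c', d])) \<longleftrightarrow>
    (\<forall>a n. T' [a, n] = deformed_torsion (\<phi> p) (v p) v1 v7 v14 v27 t1 t7 t14 t27 a n)"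
proof -
  define TF where "TF i j = pullback E T [i, j]" for i j
  define \<sigma> where "\<sigma> i = pullback E t7 [i]" for i
  define tv where "tv a n = torsion_v r v1 (\<lambda>c. (P *v v7) $ c) (\<lambda>i j. pullback E v14 [i, j])
    (\<lambda>i j. pullback E v27 [i, j]) a n" for a n
  define \<tau> where "\<tau> a n = tv a n / k ^ 4 + torsion_t r TF a n / k" for a n
  let ?F = "deformed_torsion (\<phi> p) (v p) v1 v7 v14 v27 t1 t7 t14 t27"
  have t7: "t7 [a] = co \<sigma> a" for a
  proof -
    have "t7 [a] = pullback P (pullback E t7) [a]" by (simp add: pullback_pullback EP)
    then show ?thesis by (simp add: pullback_Cons[of P] co_def \<sigma>_def)
  qed
  have "(P *v sharp (g p) t7) $ c = \<sigma> c" for c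
  proof -
    have "sharp (g p) t7 $ m = ve \<sigma> m" for m by (simp add: sharp_def raise_0[of t7 "[]", OF t7])
    then have "sharp (g p) t7 = E *v (\<chi> i. \<sigma> i)" by (simp add: vec_eq_iff ve_def matrix_vector_mult_def)
    then show ?thesis by (simp add: matrix_vector_mul_assoc PE)
  qed
  note Tc = g2_components_frame[OF T, unfolded this, folded TF_def]
  have F: "?F a n = bi \<tau> a n" for a n
    unfolding \<tau>_def tv_def
    by (rule deformed_torsion_frame[OF frame_components frame_components t7 frame_components frame_components
          Tc(1) Tc(2) Tc(3)])
  have one: "matrix_inv (g p) $ e $ l = (\<Sum>m\<in>UNIV. E $ e $ m * (1 * E $ l $ m))" for e l
    by (simp add: inv_metric_sum)
  have TE: "pullback E (cov_deriv c g \<phi> p) [a, b, c', d] = (\<Sum>e\<in>UNIV. TF a e * psi0 [e, b, c', d])" for a b c' d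
  proof -
    have "pullback E (cov_deriv c g \<phi> p) [a, b, c', d] =
        pullback E (pullback P (\<lambda>K. \<Sum>m\<in>UNIV. 1 * TF (hd K) m * psi0 (m # tl K))) [a, b, c', d]"
    proof (rule pullback_cong)
      fix J :: "7 list" assume "length J = length [a, b, c', d]"
      then have "length J = 4" by simp
      then obtain i i1 i2 i3 where J: "J = [i, i1, i2, i3]" by (rule list4_cases)
      show "cov_deriv c g \<phi> p J = pullback P (\<lambda>K. \<Sum>m\<in>UNIV. 1 * TF (hd K) m * psi0 (m # tl K)) J"
        unfolding J torsion
        by (rule raise_contract[OF one]) (simp_all add: TF_def frame_components[symmetric] g2_psi_pullback_phi0[OF P form])
    qed
    then show ?thesis by (simp add: pullback_pullback PE)
  qed
  have sol: "cov_deriv c h \<phi>' p [a, b, c', d] = (\<Sum>e\<in>UNIV. raise (h p) 1 X [a, e] * g2_psi (\<phi>' p) [e, b, c', d])"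
    if X: "\<And>a n. X [a, n] = ?F a n" for X a b c' d
  proof -
    have "(\<Sum>e\<in>UNIV. raise (h p) 1 X [a, e] * g2_psi (\<phi>' p) [e, b, c', d]) =
        pullback P (\<lambda>K. \<Sum>m\<in>UNIV. dual_weight m * \<tau> (hd K) m * (deformed_psi r (m # tl K) / k)) [a, b, c', d]"
      by (rule raise_contract[OF inv_h]) (simp_all add: X F psi_frame)
    also have "\<dots> = pullback P (pullback E (cov_deriv c h \<phi>' p)) [a, b, c', d]"
    proof (rule pullback_cong)
      fix J :: "7 list" assume "length J = length [a, b, c', d]"
      then obtain i I where J: "J = i # I" "length I = 3" by (auto simp: length_Suc_conv)
      have "12 * tv i n = torsion_S r S i n" for n
        unfolding tv_def by (rule g2_components_torsion_S[OF nabla])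
      from deformed_cov_deriv_frame[where TF = TF and tv = "tv i", OF TE this J(2)]
      show "(\<Sum>m\<in>UNIV. dual_weight m * \<tau> (hd J) m * (deformed_psi r (m # tl J) / k)) =
          pullback E (cov_deriv c h \<phi>' p) J"
        by (simp add: J \<tau>_def)
    qed
    finally show ?thesis by (simp add: pullback_pullback EP)
  qed
  have hp: "positive_form (\<phi>' p)" by (rule positive_deform[OF pos[OF dom(2)]])
  show ?thesis
  proof
    assume eq: "\<forall>a b c' d. cov_deriv c h \<phi>' p [a, b, c', d] =
      (\<Sum>e\<in>UNIV. raise (h p) 1 T' [a, e] * g2_psi (\<phi>' p) [e, b, c', d])"
    let ?X = "\<lambda>I. ?F (I ! 0) (I ! 1)"
    show "\<forall>a n. T' [a, n] = ?F a n"
    proof (intro allI)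
      fix a n
      \<comment> \<open>The difference of two solutions, with its second index raised by the
        deformed metric, contracts to 0 with the deformed dual form. It vanishes by nondegeneracy,
        and lowering the index again gives equality of the tensors.\<close>
      let ?z = "\<chi> e. raise (h p) 1 T' [a, e] - raise (h p) 1 ?X [a, e]"
      have "(\<Sum>e\<in>UNIV. ?z $ e * g2_psi (\<phi>' p) [e, b, c', d]) = 0" for b c' d
        using eq sol[of ?X a b c' d] by (simp add: left_diff_distrib sum_subtractf)
      then have "?z = 0" by (rule psi_nondegenerate[OF hp])
      moreover have "?z = matrix_inv (h p) *v (\<chi> l. T' [a, l] - ?F a l)"
        by (simp add: vec_eq_iff raise_def matrix_vector_mult_def right_diff_distrib sum_subtractf)
      ultimately have "h p *v (matrix_inv (h p) *v (\<chi> l. T' [a, l] - ?F a l)) = 0" by simp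
      then have "(\<chi> l. T' [a, l] - ?F a l) = 0"
        by (simp only: matrix_vector_mul_assoc matrix_inv_mult[OF invertible_g2_metric[OF hp]] matrix_vector_mul_lid)
      then show "T' [a, n] = ?F a n" by (simp add: vec_eq_iff)
    qed
  qed (use sol in blast)
qed

end

lemma smooth_manifold_chart:
  assumes "smooth_manifold X \<A>" "c \<in> \<A>"
  shows "open (snd c ` fst c)" and "p \<in> fst c \<Longrightarrow> chart_inv c (snd c p) = p"
proof -
  have o: "openin X (fst c)" "open (snd c ` fst c)"
    and h: "homeomorphic_map (subtopology X (fst c)) (top_of_set (snd c ` fst c)) (snd c)"
    using assms unfolding smooth_manifold_def by blast+
  show "open (snd c ` fst c)" by (rule o)
  have "inj_on (snd c) (topspace (subtopology X (fst c)))"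
    using homeomorphic_imp_injective_map[OF h] .
  moreover have "topspace (subtopology X (fst c)) = fst c"
    using openin_subset[OF o(1)] by auto
  ultimately show "p \<in> fst c \<Longrightarrow> chart_inv c (snd c p) = p"
    unfolding chart_inv_def by (simp add: inv_into_f_f)
qed

text \<open>The equivalence for all \<open>T'\<close> states two things at once: the tensor of the
  formula is a torsion of the deformed structure, and no other tensor is.\<close>

theorem theorem20:
  fixes X :: "'a topology" and \<A> :: "('a, 7) chart set"
    and \<phi> T \<tau>7 \<tau>14 \<tau>27 v14 v27 :: "('a, 7) tensor_field"
    and v v7 :: "('a, 7) vector_field"
    and \<tau>1 v1 :: "'a \<Rightarrow> real"
  assumes manifold: "smooth_manifold X \<A>"
    and g2: "g2_structure \<A> \<phi>"
    and torsion: "full_torsion \<A> \<phi> T"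
    and torsion_components: "\<forall>c\<in>\<A>. \<forall>p\<in>fst c.
      g2_components (\<phi> c p) (T c p)
        (\<tau>1 p) (sharp (g2_metric (\<phi> c p)) (\<tau>7 c p)) (\<tau>14 c p) (\<tau>27 c p)"
    and vector_field: "smooth_vector_field \<A> v"
    and nabla_v_components: "\<forall>c\<in>\<A>. \<forall>p\<in>fst c.
      g2_components (\<phi> c p) (g2_nabla \<phi> c (\<lambda>q. flat (g2_metric (\<phi> c q)) (v c q)) p)
        (v1 p) (v7 c p) (v14 c p) (v27 c p)"
  shows "g2_structure \<A> (\<lambda>c p. deform (\<phi> c p) (v c p))
    \<and> (\<forall>c\<in>\<A>. \<forall>p\<in>fst c.
         (\<lambda>I. deform (\<phi> c p) (v c p) I - \<phi> c p I) \<in> Lambda3_7 (\<phi> c p))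
    \<and> (\<forall>T'. full_torsion \<A> (\<lambda>c p. deform (\<phi> c p) (v c p)) T' \<longleftrightarrow>
         (\<forall>c\<in>\<A>. \<forall>p\<in>fst c. \<forall>a n. T' c p [a, n] =
            deformed_torsion (\<phi> c p) (v c p) (v1 p) (v7 c p) (v14 c p) (v27 c p)
              (\<tau>1 p) (\<tau>7 c p) (\<tau>14 c p) (\<tau>27 c p) a n))"
proof (intro conjI ballI allI)
  have pos: "positive_form (\<phi> c p)" if "c \<in> \<A>" "p \<in> fst c" for c p
    using g2 that unfolding g2_structure_def by blast
  show "g2_structure \<A> (\<lambda>c p. deform (\<phi> c p) (v c p))"
    by (rule g2_structure_deform[OF manifold g2 vector_field])
  show "(\<lambda>I. deform (\<phi> c p) (v c p) I - \<phi> c p I) \<in> Lambda3_7 (\<phi> c p)" if "c \<in> \<A>" "p \<in> fst c" for c p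
    by (rule deform_Lambda3_7[OF pos[OF that]])
  have pointwise: "(\<forall>a b c' d. g2_nabla (\<lambda>c p. deform (\<phi> c p) (v c p)) c (\<lambda>p. deform (\<phi> c p) (v c p)) p [a, b, c', d] =
        (\<Sum>e\<in>UNIV. raise (g2_metric (deform (\<phi> c p) (v c p))) 1 (T' c p) [a, e] *
          g2_psi (deform (\<phi> c p) (v c p)) [e, b, c', d])) \<longleftrightarrow>
      (\<forall>a n. T' c p [a, n] =
        deformed_torsion (\<phi> c p) (v c p) (v1 p) (v7 c p) (v14 c p) (v27 c p)
          (\<tau>1 p) (\<tau>7 c p) (\<tau>14 c p) (\<tau>27 c p) a n)"
    if c: "c \<in> \<A>" and p: "p \<in> fst c" for T' c p
  proof -
    obtain P r k x y where "adapted (\<phi> c p) (v c p) P r k x y"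
      using adapted_exists[OF pos[OF c p]] by blast
    moreover have "smooth_on (snd c ` fst c) (\<lambda>x. \<phi> c (chart_inv c x) I)" if "length I = 3" for I
      using g2 c that unfolding g2_structure_def smooth_tensor_field_def by blast
    moreover have "smooth_on (snd c ` fst c) (\<lambda>x. v c (chart_inv c x) $ i)" for i
      using vector_field c unfolding smooth_vector_field_def by blast
    ultimately interpret deformation_point c "\<phi> c" "v c" p P r k x y
      unfolding deformation_point_def deformation_point_axioms_def
      using smooth_manifold_chart[OF manifold c] p pos[OF c] by blast
    show ?thesis
      unfolding g2_nabla_def
    proof (rule full_torsion_deform)
      show "cov_deriv c (\<lambda>q. g2_metric (\<phi> c q)) (\<phi> c) p [a, b, c', d] =
          (\<Sum>e\<in>UNIV. raise (g2_metric (\<phi> c p)) 1 (T c p) [a, e] * g2_psi (\<phi> c p) [e, b, c', d])" for a b c' d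
        using torsion c p unfolding full_torsion_def g2_nabla_def by blast
      show "g2_components (\<phi> c p) (T c p) (\<tau>1 p) (sharp (g2_metric (\<phi> c p)) (\<tau>7 c p)) (\<tau>14 c p) (\<tau>27 c p)"
        using torsion_components c p by blast
      show "g2_components (\<phi> c p) (cov_deriv c (\<lambda>q. g2_metric (\<phi> c q)) (\<lambda>q. flat (g2_metric (\<phi> c q)) (v c q)) p)
          (v1 p) (v7 c p) (v14 c p) (v27 c p)"
        using nabla_v_components c p unfolding g2_nabla_def by blast
    qed
  qed
  show "full_torsion \<A> (\<lambda>c p. deform (\<phi> c p) (v c p)) T' \<longleftrightarrow>
         (\<forall>c\<in>\<A>. \<forall>p\<in>fst c. \<forall>a n. T' c p [a, n] =
            deformed_torsion (\<phi> c p) (v c p) (v1 p) (v7 c p) (v14 c p) (v27 c p)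
              (\<tau>1 p) (\<tau>7 c p) (\<tau>14 c p) (\<tau>27 c p) a n)" for T'
    unfolding full_torsion_def by (intro ball_cong refl pointwise)
qed

end
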